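(* Let $D\subset\mathbb{R}^n$, $n\in\{1,2,3\}$, be a bounded Lipschitz domain, $d\ge1$, $\Gamma=[-1,1]^d$, $V(D)=H_0^1(D)$ with norm $\|v\|_{V(D)}=\|\nabla v\|_{L^2(D)}$, $V^*(D)$ its dual, and $f\in V^*(D)$ fixed. Consider the parameterized elliptic problem $$-\nabla\cdot(a(x,\mathbf{y})\nabla u(x,\mathbf{y}))=f(x)\ \text{ for }(x,\mathbf{y})\in D\times\Gamma,\qquad u(x,\mathbf{y})=0\ \text{ for }(x,\mathbf{y})\in\partial D\times\Gamma,$$ where $\nabla$ acts in $x$. Assume: (i) there are constants $0<a_{\min}<a_{\max}<\infty$ with $a_{\min}\le a(x,\mathbf{y})\le a_{\max}$ for all $x\in\overline{D}$, $\mathbf{y}\in\Gamma$; (ii) the complex continuation $a(x,\mathbf{z})$ of $a(x,\mathbf{y})$ is an $L^\infty(D)$-valued holomorphic function on $\mathbb{C}^d$; (iii) for some $0<\delta<a_{\min}$ and some $\boldsymbol{\rho}=(\rho_1,\dots,\rho_d)$ with all $\rho_j>1$, $\Re(a(x,\mathbf{z}))\ge\delta$ for all $x\in\overline{D}$ and $\mathbf{z}\in\mathcal{E}_{\boldsymbol{\rho}}$. Then the coefficients of the tensorized Legendre expansions $$u(x,\mathbf{y})=\sum_{\mathbf{k}\in\mathbb{N}_0^d}u_{\mathbf{k}}(x)P_{\mathbf{k}}(\mathbf{y})=\sum_{\mathbf{k}\in\mathbb{N}_0^d}v_{\mathbf{k}}(x)\overline{P}_{\mathbf{k}}(\mathbf{y})$$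 of the solution $u$ satisfy, for all $\mathbf{k}\in\mathbb{N}_0^d$, $$\|u_{\mathbf{k}}\|_{V(D)}\le\widehat{C}_{\boldsymbol{\rho},\delta}\,\boldsymbol{\rho}^{-\mathbf{k}}\prod_{k_j\ne0}\sqrt{k_j},\qquad\|v_{\mathbf{k}}\|_{V(D)}\le\widehat{C}_{\boldsymbol{\rho},\delta}\,2^{\aleph(\mathbf{k})/2}\,\boldsymbol{\rho}^{-\mathbf{k}},$$ where $$\widehat{C}_{\boldsymbol{\rho},\delta}=\frac{\|f\|_{V^*(D)}}{\delta}\left(\prod_{j=1}^d\frac{L(\mathcal{E}_{\rho_j})}{\pi}\right)\prod_{k_i=0}\overline{D}_{\rho_i}^{(1/2)}\prod_{k_j\ne0}D_{\rho_j}^{(1/2)}.$$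
   Context: For each $\mathbf{y}$, $u(\cdot,\mathbf{y})\in V(D)$ denotes the weak solution. $P_k$ is the Legendre polynomial with $P_k(1)=1$, $\overline{P}_k=\sqrt{\frac{2k+1}{2}}P_k$, $P_{\mathbf{k}}(\mathbf{y})=\prod_jP_{k_j}(y_j)$, $\overline{P}_{\mathbf{k}}(\mathbf{y})=\prod_j\overline{P}_{k_j}(y_j)$; thus $u_{\mathbf{k}}(x)=\prod_{j}(k_j+\tfrac12)\int_\Gamma u(x,\mathbf{y})P_{\mathbf{k}}(\mathbf{y})\,d\mathbf{y}$ and $v_{\mathbf{k}}(x)=\int_\Gamma u(x,\mathbf{y})\overline{P}_{\mathbf{k}}(\mathbf{y})\,d\mathbf{y}$. $\boldsymbol{\rho}^{-\mathbf{k}}=\prod_j\rho_j^{-k_j}$ and $\aleph(\mathbf{k})=\#\{i:k_i=0\}$. For $\rho>1$, $\mathcal{E}_\rho=\{z\in\mathbb{C}:z=\frac12(u+u^{-1}),\ |u|=\rho\}$ (Bernstein ellipse), $L(\mathcal{E}_\rho)$ is its arc length, and $\mathcal{E}_{\boldsymbol{\rho}}=\bigotimes_{j=1}^d\mathcal{E}_{\rho_j}$. $\overline{D}_\rho^{(1/2)}=\frac1\rho(1-\rho^{-2})^{-1/2}$ and $D_\rho^{(1/2)}=\frac{\Gamma(1/2)}{\rho}\exp\!\left(\frac1{12}+\frac12\right)(1-\rho^{-2})^{-1/2}$. Empty products equal $1$. *)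

theory Defs
  imports "HOL-Analysis.Analysis" "HOL-Computational_Algebra.Polynomial"
begin

section \<open>Bounded Lipschitz domains\<close>

text \<open>Near each boundary point, \<open>D\<close> is the part above the graph of a Lipschitz function in a
  rotated coordinate system: \<open>e\<close> is the vertical direction and \<open>x - (x \<bullet> e) *\<^sub>R e\<close> the
  horizontal part of \<open>x\<close>.  In dimension one this leaves the bounded open intervals.\<close>

definition lipschitz_boundary :: "'a::euclidean_space set \<Rightarrow> bool" where
  "lipschitz_boundary D \<longleftrightarrow>
     (\<forall>p\<in>frontier D. \<exists>r>0. \<exists>e. \<exists>L. \<exists>\<phi>::'a \<Rightarrow> real.
        norm e = 1 \<and> L-lipschitz_on UNIV \<phi> \<and>
        D \<inter> ball p r = {x \<in> ball p r. \<phi> (x - (x \<bullet> e) *\<^sub>R e) < x \<bullet> e})"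

definition bounded_lipschitz_domain :: "'a::euclidean_space set \<Rightarrow> bool" where
  "bounded_lipschitz_domain D \<longleftrightarrow>
     open D \<and> connected D \<and> D \<noteq> {} \<and> bounded D \<and> lipschitz_boundary D"


section \<open>Test functions, weak gradients and $H^1_0(D)$\<close>

text \<open>As usual, elements of the function spaces below are represented by functions on the whole
  space, of which only the values almost everywhere on \<open>D\<close> matter; the norms are therefore
  seminorms on functions.\<close>

definition pderivative :: "'n \<Rightarrow> (real^'n \<Rightarrow> real) \<Rightarrow> real^'n \<Rightarrow> real" where
  "pderivative i \<phi> = (\<lambda>x. frechet_derivative \<phi> (at x) (axis i 1))"

definition smooth_fun :: "(real^'n \<Rightarrow> real) \<Rightarrow> bool" where
  "smooth_fun \<phi> \<longleftrightarrow> (\<forall>is x. foldr pderivative is \<phi> differentiable (at x))"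

definition test_funs :: "(real^'n) set \<Rightarrow> (real^'n \<Rightarrow> real) set" where
  "test_funs D = {\<phi>. smooth_fun \<phi> \<and> compact (closure {x. \<phi> x \<noteq> 0}) \<and> closure {x. \<phi> x \<noteq> 0} \<subseteq> D}"

definition L2 :: "'a::euclidean_space set \<Rightarrow> ('a \<Rightarrow> 'b::euclidean_space) set" where
  "L2 D = {v \<in> borel_measurable (lebesgue_on D). integrable (lebesgue_on D) (\<lambda>x. (norm (v x))\<^sup>2)}"

definition L2_norm :: "'a::euclidean_space set \<Rightarrow> ('a \<Rightarrow> 'b::euclidean_space) \<Rightarrow> real" where
  "L2_norm D v = sqrt (integral\<^sup>L (lebesgue_on D) (\<lambda>x. (norm (v x))\<^sup>2))"

definition is_weak_grad :: "(real^'n) set \<Rightarrow> (real^'n \<Rightarrow> real) \<Rightarrow> (real^'n \<Rightarrow> real^'n) \<Rightarrow> bool" where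
  "is_weak_grad D v g \<longleftrightarrow>
     (\<forall>\<phi>\<in>test_funs D. \<forall>i.
        integral\<^sup>L (lebesgue_on D) (\<lambda>x. v x * pderivative i \<phi> x) =
        - integral\<^sup>L (lebesgue_on D) (\<lambda>x. g x $ i * \<phi> x))"

definition H1 :: "(real^'n) set \<Rightarrow> (real^'n \<Rightarrow> real) set" where
  "H1 D = {v \<in> L2 D. \<exists>g\<in>L2 D. is_weak_grad D v g}"

text \<open>For \<open>v \<in> H1 D\<close> the weak gradient is unique up to a null set.\<close>

definition weak_grad :: "(real^'n) set \<Rightarrow> (real^'n \<Rightarrow> real) \<Rightarrow> real^'n \<Rightarrow> real^'n" where
  "weak_grad D v = (SOME g. g \<in> L2 D \<and> is_weak_grad D v g)"

definition H1_norm :: "(real^'n) set \<Rightarrow> (real^'n \<Rightarrow> real) \<Rightarrow> real" where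
  "H1_norm D v = sqrt ((L2_norm D v)\<^sup>2 + (L2_norm D (weak_grad D v))\<^sup>2)"

definition H10 :: "(real^'n) set \<Rightarrow> (real^'n \<Rightarrow> real) set" where
  "H10 D = {v \<in> H1 D. \<exists>\<phi>::nat \<Rightarrow> real^'n \<Rightarrow> real.
     (\<forall>m. \<phi> m \<in> test_funs D) \<and> (\<lambda>m. H1_norm D (\<lambda>x. v x - \<phi> m x)) \<longlonglongrightarrow> 0}"

definition V_norm :: "(real^'n) set \<Rightarrow> (real^'n \<Rightarrow> real) \<Rightarrow> real" where
  "V_norm D v = L2_norm D (weak_grad D v)"

text \<open>Bounded linear functionals on \<open>H10 D\<close>.  Linearity and boundedness force such a functional
  to agree on functions that are equal almost everywhere on \<open>D\<close>.\<close>

definition V_dual :: "(real^'n) set \<Rightarrow> ((real^'n \<Rightarrow> real) \<Rightarrow> real) set" where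
  "V_dual D = {f.
     (\<forall>v\<in>H10 D. \<forall>w\<in>H10 D. f (\<lambda>x. v x + w x) = f v + f w) \<and>
     (\<forall>c. \<forall>v\<in>H10 D. f (\<lambda>x. c * v x) = c * f v) \<and>
     (\<exists>C. \<forall>v\<in>H10 D. \<bar>f v\<bar> \<le> C * V_norm D v)}"

definition V_dual_norm :: "(real^'n) set \<Rightarrow> ((real^'n \<Rightarrow> real) \<Rightarrow> real) \<Rightarrow> real" where
  "V_dual_norm D f = (SUP v\<in>{v \<in> H10 D. V_norm D v \<le> 1}. \<bar>f v\<bar>)"


section \<open>$L^\infty(D)$-valued holomorphic functions on $C^d$\<close>

definition Linf :: "'a::euclidean_space set \<Rightarrow> ('a \<Rightarrow> complex) set" where
  "Linf D = {g \<in> borel_measurable (lebesgue_on D). \<exists>C. AE x in lebesgue_on D. norm (g x) \<le> C}"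

definition Linf_norm :: "'a::euclidean_space set \<Rightarrow> ('a \<Rightarrow> complex) \<Rightarrow> real" where
  "Linf_norm D g = Inf {C. 0 \<le> C \<and> (AE x in lebesgue_on D. norm (g x) \<le> C)}"

text \<open>Complex Frechet differentiability at every point: a complex-linear map from
  $C^d$ to $L^\infty(D)$ is given by \<open>d\<close> elements of $L^\infty(D)$.\<close>

definition Linf_holomorphic :: "'a::euclidean_space set \<Rightarrow> ('a \<Rightarrow> complex^'d \<Rightarrow> complex) \<Rightarrow> bool" where
  "Linf_holomorphic D b \<longleftrightarrow>
     (\<forall>z. (\<lambda>x. b x z) \<in> Linf D) \<and>
     (\<forall>z. \<exists>A. (\<forall>j. A j \<in> Linf D) \<and>
        ((\<lambda>w. Linf_norm D (\<lambda>x. b x w - b x z - (\<Sum>j\<in>UNIV. A j x * (w $ j - z $ j)))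
               / norm (w - z)) \<longlongrightarrow> 0) (at z))"


section \<open>The parametric elliptic problem\<close>

definition Gam :: "(real^'d) set" where
  "Gam = {y. \<forall>j. y $ j \<in> {-1..1}}"

definition weak_solution ::
  "(real^'n) set \<Rightarrow> (real^'n \<Rightarrow> real) \<Rightarrow> ((real^'n \<Rightarrow> real) \<Rightarrow> real) \<Rightarrow> (real^'n \<Rightarrow> real) \<Rightarrow> bool" where
  "weak_solution D \<alpha> f w \<longleftrightarrow> w \<in> H10 D \<and>
     (\<forall>v\<in>H10 D. integral\<^sup>L (lebesgue_on D) (\<lambda>x. \<alpha> x * (weak_grad D w x \<bullet> weak_grad D v x)) = f v)"

text \<open>The weak solution for a single parameter is determined only up to a null set depending
  on the parameter.  For the integrals over the parameter at fixed \<open>x\<close> to be meaningful,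
  the representatives have to be chosen so that \<open>u\<close> is a measurable function on \<open>D \<times> Gam\<close>.\<close>

definition parametric_solution ::
  "(real^'n) set \<Rightarrow> (real^'n \<Rightarrow> real^'d \<Rightarrow> real) \<Rightarrow> ((real^'n \<Rightarrow> real) \<Rightarrow> real)
     \<Rightarrow> (real^'n \<Rightarrow> real^'d \<Rightarrow> real) \<Rightarrow> bool" where
  "parametric_solution D a f u \<longleftrightarrow>
     (\<lambda>(x, y). u x y) \<in> borel_measurable (lebesgue_on (D \<times> Gam)) \<and>
     (\<forall>y\<in>Gam. weak_solution D (\<lambda>x. a x y) f (\<lambda>x. u x y))"


section \<open>Tensorized Legendre polynomials and coefficients\<close>

text \<open>Rodrigues' formula; this is the normalization with value \<open>1\<close> at \<open>1\<close>.\<close>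

definition legendre :: "nat \<Rightarrow> real \<Rightarrow> real" where
  "legendre k t = poly ((pderiv ^^ k) ([:-1, 0, 1:] ^ k)) t / (2 ^ k * fact k)"

definition legendre_on :: "nat \<Rightarrow> real \<Rightarrow> real" where
  "legendre_on k t = sqrt ((2 * real k + 1) / 2) * legendre k t"

definition legendre_tensor :: "('d::finite \<Rightarrow> nat) \<Rightarrow> real^'d \<Rightarrow> real" where
  "legendre_tensor k y = (\<Prod>j\<in>UNIV. legendre (k j) (y $ j))"

definition legendre_on_tensor :: "('d::finite \<Rightarrow> nat) \<Rightarrow> real^'d \<Rightarrow> real" where
  "legendre_on_tensor k y = (\<Prod>j\<in>UNIV. legendre_on (k j) (y $ j))"

definition legendre_coeff ::
  "(real^'n \<Rightarrow> real^'d \<Rightarrow> real) \<Rightarrow> ('d::finite \<Rightarrow> nat) \<Rightarrow> real^'n \<Rightarrow> real" where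
  "legendre_coeff u k x =
     (\<Prod>j\<in>UNIV. real (k j) + 1/2) * integral\<^sup>L (lebesgue_on Gam) (\<lambda>y. u x y * legendre_tensor k y)"

definition legendre_on_coeff ::
  "(real^'n \<Rightarrow> real^'d \<Rightarrow> real) \<Rightarrow> ('d::finite \<Rightarrow> nat) \<Rightarrow> real^'n \<Rightarrow> real" where
  "legendre_on_coeff u k x = integral\<^sup>L (lebesgue_on Gam) (\<lambda>y. u x y * legendre_on_tensor k y)"


section \<open>Bernstein ellipses and constants\<close>

definition bernstein_ellipse :: "real \<Rightarrow> complex set" where
  "bernstein_ellipse \<rho> = {z. \<exists>u. norm u = \<rho> \<and> z = (u + inverse u) / 2}"

definition bernstein_polyellipse :: "real^'d \<Rightarrow> (complex^'d) set" where
  "bernstein_polyellipse \<rho> = {z. \<forall>j. z $ j \<in> bernstein_ellipse (\<rho> $ j)}"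

text \<open>For \<open>\<rho> > 1\<close> the map below runs through the ellipse exactly once.\<close>

definition bernstein_curve :: "real \<Rightarrow> real \<Rightarrow> complex" where
  "bernstein_curve \<rho> t = (of_real \<rho> * cis t + inverse (of_real \<rho> * cis t)) / 2"

definition bernstein_length :: "real \<Rightarrow> real" where
  "bernstein_length \<rho> = integral {0..2*pi} (\<lambda>t. norm (vector_derivative (bernstein_curve \<rho>) (at t)))"

definition D_bar :: "real \<Rightarrow> real" where
  "D_bar \<rho> = 1 / \<rho> * (1 - \<rho> powi (-2)) powr (-1/2)"

definition D_half :: "real \<Rightarrow> real" where
  "D_half \<rho> = Gamma (1/2) / \<rho> * exp (1/12 + 1/2) * (1 - \<rho> powi (-2)) powr (-1/2)"

definition C_hat ::
  "(real^'n) set \<Rightarrow> ((real^'n \<Rightarrow> real) \<Rightarrow> real) \<Rightarrow> real \<Rightarrow> real^'d \<Rightarrow> ('d::finite \<Rightarrow> nat) \<Rightarrow> real" where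
  "C_hat D f \<delta> \<rho> k =
     V_dual_norm D f / \<delta> * (\<Prod>j\<in>UNIV. bernstein_length (\<rho> $ j) / pi)
       * (\<Prod>i\<in>{i. k i = 0}. D_bar (\<rho> $ i)) * (\<Prod>j\<in>{j. k j \<noteq> 0}. D_half (\<rho> $ j))"

definition rho_pow :: "real^'d \<Rightarrow> ('d::finite \<Rightarrow> nat) \<Rightarrow> real" where
  "rho_pow \<rho> k = (\<Prod>j\<in>UNIV. (\<rho> $ j) powi (- int (k j)))"

definition zero_count :: "('d::finite \<Rightarrow> nat) \<Rightarrow> nat" where
  "zero_count k = card {i. k i = 0}"

end

theory Submission
  imports Defs "HOL-Complex_Analysis.Complex_Analysis"
begin

text \<open>
  By the minimum principle, coercivity on the product of the ellipses propagates to the product of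
  the filled ellipses, so \<open>u\<close> should extend holomorphically there with norm at most
  \<open>\<parallel>f\<parallel> / \<delta>\<close>.  Cauchy's formula in each variable then turns the Legendre functional into integration
  against the Legendre function of the second kind \<open>Q\<^sub>k\<close>, and the bound on \<open>Q\<^sub>k\<close> comes from its expansion
  in powers of \<open>1/u\<close>, where \<open>z = (u + 1/u)/2\<close>: the coefficients are the sine coefficients of
  \<open>P\<^sub>k(cos \<theta>)\<close>, which satisfy a two-term recurrence.

  The complex problem is never solved in \<open>H\<^sup>1\<^sub>0\<close>.  Since \<open>y \<mapsto> u(\<cdot>,y)\<close> is continuous on a compact set, it
  is uniformly approximated by Galerkin solutions in spaces spanned by finitely many test functions,
  whose coefficients are holomorphic by elimination and inherit the bound \<open>\<parallel>f\<parallel> / \<delta>\<close>.  The Legendre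
  coefficients of the approximants are test functions, form a Cauchy sequence in the energy norm, and
  converge in \<open>L\<^sup>2\<close> to those of \<open>u\<close> by Fubini and Poincare.
\<close>

no_notation fps_nth (infixl "$" 75)

section \<open>Legendre functions of the second kind\<close>

text \<open>The constant has one factor per variable. Cauchy's 1/(2 pi) and the arc length give
  \<open>bernstein_length / pi\<close>. The series of Q_k starts with \<rho>^(-k-1), whence the
  extra 1/\<rho> in \<open>D_bar\<close> and \<open>D_half\<close>, and is dominated by the binomial
  series of (1 - x) powr (-1/2) at x = \<rho>^(-2). Its leading coefficient is controlled by (k +
  1/2) J_k <= 2 sqrt k for k > 0, and 2 <= sqrt pi * exp (7/12) reaches the constant in
  \<open>D_half\<close>. The treatment of u is shaped by the fact that a coefficient is an integral
  over y at fixed x and that the norms are seminorms on functions, so there is no V-valued integral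
  to estimate. For a finite sum of test functions with scalar coefficients, pairing with a fixed g
  leaves a scalar holomorphic function of z, and taking g to be the coefficient itself recovers its
  norm. The trial functions come from a finite cover of the parameter box and may be linearly
  dependent, hence a regularization, tied to the square of the accuracy so that the error keeps its
  order.\<close>

definition rodrigues_poly :: "nat \<Rightarrow> real poly" where
  "rodrigues_poly k = [:-1, 0, 1:] ^ k"

definition legendre_poly :: "nat \<Rightarrow> real poly" where
  "legendre_poly k = smult (1 / (2 ^ k * fact k)) ((pderiv ^^ k) (rodrigues_poly k))"

lemma legendre_eq_poly: "legendre k t = poly (legendre_poly k) t"
  by (simp add: legendre_def legendre_poly_def rodrigues_poly_def)

section \<open>Legendre's differential equation\<close>

lemma rodrigues_pderiv:
  "(t\<^sup>2 - 1) * poly (pderiv (rodrigues_poly k)) t = 2 * real k * t * poly (rodrigues_poly k) t"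
proof (cases k)
  case (Suc n)
  show ?thesis
    by (simp add: Suc rodrigues_poly_def pderiv_power_Suc pderiv_pCons poly_power del: power_Suc)
       (simp add: power2_eq_square algebra_simps)
qed (simp add: rodrigues_poly_def)

text \<open>Leibniz' rule, one order at a time: each step differentiates the previous identity and
  compares, starting from (t^2 - 1) y' = 2 k t y for y = (t^2 - 1)^k. At m = k it becomes Legendre's
  equation for the k-th derivative of y.\<close>

lemma rodrigues_higher_pderiv:
  fixes t :: real and k m :: nat
  defines "y \<equiv> rodrigues_poly k"
  shows "(t\<^sup>2 - 1) * poly ((pderiv ^^ Suc (Suc m)) y) t
    = 2 * (real k - real m - 1) * t * poly ((pderiv ^^ Suc m) y) t
      + (real m + 1) * (2 * real k - real m) * poly ((pderiv ^^ m) y) t"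
proof (induction m arbitrary: t)
  case 0
  have eq: "(\<lambda>t. (t\<^sup>2 - 1) * poly (pderiv y) t) = (\<lambda>t. 2 * real k * t * poly y t)"
    unfolding y_def by (intro ext rodrigues_pderiv)
  have "((\<lambda>t. (t\<^sup>2 - 1) * poly (pderiv y) t) has_real_derivative
      2 * t * poly (pderiv y) t + (t\<^sup>2 - 1) * poly (pderiv (pderiv y)) t) (at t)"
    by (auto intro!: derivative_eq_intros simp: algebra_simps)
  moreover have "((\<lambda>t. 2 * real k * t * poly y t) has_real_derivative
      2 * real k * poly y t + 2 * real k * t * poly (pderiv y) t) (at t)"
    by (auto intro!: derivative_eq_intros simp: algebra_simps)
  ultimately have "2 * t * poly (pderiv y) t + (t\<^sup>2 - 1) * poly (pderiv (pderiv y)) t =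
      2 * real k * poly y t + 2 * real k * t * poly (pderiv y) t"
    unfolding eq by (rule DERIV_unique)
  then show ?case by (simp add: algebra_simps)
next
  case (Suc m)
  define f where "f i = poly ((pderiv ^^ i) y)" for i
  have df: "(f i has_real_derivative f (Suc i) t) (at t)" for i t
    unfolding f_def by simp
  have eq: "(\<lambda>t. (t\<^sup>2 - 1) * f (Suc (Suc m)) t) =
    (\<lambda>t. 2 * (real k - real m - 1) * t * f (Suc m) t + (real m + 1) * (2 * real k - real m) * f m t)"
    using Suc.IH unfolding f_def by blast
  have 1: "((\<lambda>t. (t\<^sup>2 - 1) * f (Suc (Suc m)) t) has_real_derivative
      2 * t * f (Suc (Suc m)) t + (t\<^sup>2 - 1) * f (Suc (Suc (Suc m))) t) (at t)"
    by (auto intro!: derivative_eq_intros df simp: algebra_simps)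
  have 2: "((\<lambda>t. 2 * (real k - real m - 1) * t * f (Suc m) t + (real m + 1) * (2 * real k - real m) * f m t)
      has_real_derivative
      2 * (real k - real m - 1) * (f (Suc m) t + t * f (Suc (Suc m)) t)
      + (real m + 1) * (2 * real k - real m) * f (Suc m) t) (at t)"
    by (auto intro!: derivative_eq_intros df simp: algebra_simps)
  have "2 * t * f (Suc (Suc m)) t + (t\<^sup>2 - 1) * f (Suc (Suc (Suc m))) t =
      2 * (real k - real m - 1) * (f (Suc m) t + t * f (Suc (Suc m)) t)
      + (real m + 1) * (2 * real k - real m) * f (Suc m) t"
    using DERIV_unique[OF 1[unfolded eq] 2] .
  then have "(t\<^sup>2 - 1) * f (Suc (Suc (Suc m))) t = 2 * (real k - real (Suc m) - 1) * t * f (Suc (Suc m)) t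
      + (real (Suc m) + 1) * (2 * real k - real (Suc m)) * f (Suc m) t"
    by (simp add: algebra_simps)
  then show ?case unfolding f_def .
qed

lemma legendre_ode:
  "(1 - t\<^sup>2) * poly (pderiv (pderiv (legendre_poly k))) t
    = 2 * t * poly (pderiv (legendre_poly k)) t - real k * (real k + 1) * poly (legendre_poly k) t"
  using rodrigues_higher_pderiv[of t k k]
  by (simp add: legendre_poly_def pderiv_smult field_simps)

text \<open>Up to the factor 2 these are the coefficients of u^(-n) in the expansion of the
  second-kind function, see \<open>legendre_Q_kernel_sums\<close>.\<close>

definition legendre_sine_coeff :: "nat \<Rightarrow> nat \<Rightarrow> real" where
  "legendre_sine_coeff k n = integral {0..pi} (\<lambda>\<theta>. sin (real n * \<theta>) * legendre k (cos \<theta>))"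

lemma continuous_on_legendre [continuous_intros]:
  "continuous_on S f \<Longrightarrow> continuous_on S (\<lambda>x. legendre k (f x))"
  unfolding legendre_eq_poly by (intro continuous_intros)

text \<open>The integrand is the derivative of \<open>cos (\<nu>\<theta>) sin \<theta> p'(\<theta>) + \<nu> sin (\<nu>\<theta>) sin \<theta> p(\<theta>)\<close>
  with \<open>p(\<theta>) = P\<^sub>k(cos \<theta>)\<close>, by Legendre's equation.\<close>

lemma legendre_sine_identity:
  "((\<lambda>\<theta>. (\<nu>\<^sup>2 - real k * (real k + 1)) * (cos (\<nu> * \<theta>) * sin \<theta> * legendre k (cos \<theta>))
      + \<nu> * (sin (\<nu> * \<theta>) * cos \<theta> * legendre k (cos \<theta>))) has_integral 0) {0..pi}"
proof -
  define P where "P = poly (legendre_poly k)"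
  define P1 where "P1 = poly (pderiv (legendre_poly k))"
  define P2 where "P2 = poly (pderiv (pderiv (legendre_poly k)))"
  have dP: "(P has_real_derivative P1 t) (at t)" "(P1 has_real_derivative P2 t) (at t)" for t
    unfolding P_def P1_def P2_def by simp_all
  define G where "G \<theta> = - cos (\<nu> * \<theta>) * (sin \<theta>)\<^sup>2 * P1 (cos \<theta>) + \<nu> * sin (\<nu> * \<theta>) * sin \<theta> * P (cos \<theta>)" for \<theta>
  have "(G has_real_derivative (\<nu>\<^sup>2 - real k * (real k + 1)) * (cos (\<nu> * \<theta>) * sin \<theta> * legendre k (cos \<theta>))
      + \<nu> * (sin (\<nu> * \<theta>) * cos \<theta> * legendre k (cos \<theta>))) (at \<theta>)" for \<theta>
  proof -
    have d1: "((\<lambda>\<theta>. P (cos \<theta>)) has_real_derivative - sin \<theta> * P1 (cos \<theta>)) (at \<theta>)"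
      using DERIV_chain2[OF dP(1) DERIV_cos] by (simp add: mult.commute)
    have d2: "((\<lambda>\<theta>. P1 (cos \<theta>)) has_real_derivative - sin \<theta> * P2 (cos \<theta>)) (at \<theta>)"
      using DERIV_chain2[OF dP(2) DERIV_cos] by (simp add: mult.commute)
    have ode: "(sin \<theta>)\<^sup>2 * P2 (cos \<theta>) = 2 * cos \<theta> * P1 (cos \<theta>) - real k * (real k + 1) * P (cos \<theta>)"
      using legendre_ode[of "cos \<theta>" k] unfolding P_def P1_def P2_def sin_squared_eq .
    have "(G has_real_derivative
        \<nu> * sin (\<nu> * \<theta>) * (sin \<theta>)\<^sup>2 * P1 (cos \<theta>) - cos (\<nu> * \<theta>) * (2 * sin \<theta> * cos \<theta>) * P1 (cos \<theta>)
        + cos (\<nu> * \<theta>) * sin \<theta> * ((sin \<theta>)\<^sup>2 * P2 (cos \<theta>))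
        + \<nu>\<^sup>2 * cos (\<nu> * \<theta>) * sin \<theta> * P (cos \<theta>) + \<nu> * sin (\<nu> * \<theta>) * cos \<theta> * P (cos \<theta>)
        - \<nu> * sin (\<nu> * \<theta>) * (sin \<theta>)\<^sup>2 * P1 (cos \<theta>)) (at \<theta>)"
      unfolding G_def
      by (rule derivative_eq_intros d1 d2 refl)+ (simp add: algebra_simps power2_eq_square)
    then show ?thesis
      unfolding ode by (simp add: legendre_eq_poly P_def algebra_simps)
  qed
  then have "((\<lambda>\<theta>. (\<nu>\<^sup>2 - real k * (real k + 1)) * (cos (\<nu> * \<theta>) * sin \<theta> * legendre k (cos \<theta>))
      + \<nu> * (sin (\<nu> * \<theta>) * cos \<theta> * legendre k (cos \<theta>))) has_integral G pi - G 0) {0..pi}"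
    by (intro fundamental_theorem_of_calculus)
       (auto simp: has_real_derivative_iff_has_vector_derivative[symmetric] intro: has_field_derivative_at_within)
  then show ?thesis by (simp add: G_def)
qed

lemma legendre_sine_integral:
  "((\<lambda>\<theta>. sin (real n * \<theta>) * legendre k (cos \<theta>)) has_integral legendre_sine_coeff k n) {0..pi}"
  unfolding legendre_sine_coeff_def
  by (intro integrable_integral integrable_continuous_interval continuous_intros)

text \<open>The identity at frequency n + 1, with both products of sine and cosine rewritten through
  sin ((n + 2) \<theta>) and sin (n \<theta>). The left factor vanishes only at n + 1 = k and the
  right one only at n = k, so the coefficient of index k + 1 is left undetermined and has to be
  computed separately.\<close>

lemma legendre_sine_recurrence:
  "(real (n + 1) * real (n + 2) - real k * (real k + 1)) * legendre_sine_coeff k (n + 2)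
    = (real n * real (n + 1) - real k * (real k + 1)) * legendre_sine_coeff k n"
proof -
  define c where "c = real k * (real k + 1)"
  define A where "A = (real (n + 1) * real (n + 2) - c) / 2"
  define B where "B = (real n * real (n + 1) - c) / 2"
  have eq: "((real (n + 1))\<^sup>2 - c) * (cos (real (n + 1) * \<theta>) * sin \<theta> * legendre k (cos \<theta>))
      + real (n + 1) * (sin (real (n + 1) * \<theta>) * cos \<theta> * legendre k (cos \<theta>))
     = A * (sin (real (n + 2) * \<theta>) * legendre k (cos \<theta>)) - B * (sin (real n * \<theta>) * legendre k (cos \<theta>))" for \<theta>
  proof -
    have s1: "sin (real (n + 2) * \<theta>) = sin (real (n + 1) * \<theta>) * cos \<theta> + cos (real (n + 1) * \<theta>) * sin \<theta>"
      by (simp flip: sin_add) (simp add: algebra_simps)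
    have s2: "sin (real n * \<theta>) = sin (real (n + 1) * \<theta>) * cos \<theta> - cos (real (n + 1) * \<theta>) * sin \<theta>"
      by (simp flip: sin_diff) (simp add: algebra_simps)
    show ?thesis
      unfolding s1 s2 A_def B_def by (simp add: field_simps power2_eq_square)
  qed
  have "((\<lambda>\<theta>. A * (sin (real (n + 2) * \<theta>) * legendre k (cos \<theta>)) - B * (sin (real n * \<theta>) * legendre k (cos \<theta>)))
     has_integral A * legendre_sine_coeff k (n + 2) - B * legendre_sine_coeff k n) {0..pi}"
    by (intro has_integral_diff has_integral_mult_right legendre_sine_integral)
  moreover have "((\<lambda>\<theta>. A * (sin (real (n + 2) * \<theta>) * legendre k (cos \<theta>)) - B * (sin (real n * \<theta>) * legendre k (cos \<theta>)))
     has_integral 0) {0..pi}"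
    using legendre_sine_identity[of "real (n + 1)" k] unfolding c_def[symmetric] eq .
  ultimately have "A * legendre_sine_coeff k (n + 2) - B * legendre_sine_coeff k n = 0"
    by (rule has_integral_unique)
  then show ?thesis by (simp add: A_def B_def c_def field_simps)
qed

text \<open>Zero propagates upwards in steps of two from the indices 0 and 1, because the left
  factor of the recurrence is nonzero as long as m + 2 <= k.\<close>

lemma legendre_sine_coeff_eq_0:
  assumes "n \<le> k"
  shows "legendre_sine_coeff k n = 0"
  using assms
proof (induction n rule: less_induct)
  case (less n)
  consider "n = 0" | "n = 1" | m where "n = m + 2"
    by (metis One_nat_def Suc_1 add_2_eq_Suc' not0_implies_Suc)
  then show ?case
  proof cases
    case 1
    then show ?thesis by (simp add: legendre_sine_coeff_def)
  next
    case 2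
    then have k: "k > 0" using less.prems by simp
    \<comment> \<open>Frequency 0 in the sine identity: its second term drops out and the first is a
      multiple of the coefficient of index 1, with a nonzero factor since k > 0.\<close>
    have "((\<lambda>\<theta>. (- (real k * (real k + 1))) * (sin (real n * \<theta>) * legendre k (cos \<theta>))) has_integral 0) {0..pi}"
      using legendre_sine_identity[of 0 k] by (simp add: 2)
    moreover have "((\<lambda>\<theta>. (- (real k * (real k + 1))) * (sin (real n * \<theta>) * legendre k (cos \<theta>))) has_integral
        (- (real k * (real k + 1))) * legendre_sine_coeff k n) {0..pi}"
      by (intro has_integral_mult_right legendre_sine_integral)
    ultimately have "(- (real k * (real k + 1))) * legendre_sine_coeff k n = 0"
      by (meson has_integral_unique)
    with k show ?thesis by simp
  next
    case 3
    have "real (m + 1) * real (m + 2) < real k * (real k + 1)"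
      by (rule mult_strict_mono) (use 3 less.prems in auto)
    moreover have "legendre_sine_coeff k m = 0"
      using less 3 by simp
    ultimately show ?thesis
      using legendre_sine_recurrence[of m k] 3 by auto
  qed
qed

text \<open>At n = k the right factor of the recurrence is zero and the left one is 2k + 2; from
  there on the left factor stays positive.\<close>

lemma legendre_sine_coeff_even_eq_0: "legendre_sine_coeff k (k + 2 + 2 * m) = 0"
proof (induction m)
  case 0
  have "(2 * real k + 2) * legendre_sine_coeff k (k + 2) = 0"
    using legendre_sine_recurrence[of k k] by (simp add: algebra_simps)
  then show ?case by (simp add: add_eq_0_iff)
next
  case (Suc m)
  have "real k * (real k + 1) < real (k + 2 + 2 * m + 1) * real (k + 2 + 2 * m + 2)"
    by (rule mult_strict_mono) auto
  moreover have "k + 2 + 2 * Suc m = (k + 2 + 2 * m) + 2" by simp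
  ultimately show ?case
    using legendre_sine_recurrence[of "k + 2 + 2 * m" k] Suc.IH by (metis diff_gt_0_iff_gt less_irrefl mult_eq_0_iff)
qed

text \<open>The ratio of consecutive surviving coefficients is (2m+1)(2k+2m+2) / ((2m+2)(2k+2m+3)).
  Dropping the quotient (2k+2m+2) / (2k+2m+3) <= 1 leaves (m + 1/2) / (m + 1), the ratio of
  consecutive coefficients of (1 - x) powr (-1/2), uniformly in k.\<close>

lemma legendre_sine_coeff_bound:
  "\<bar>legendre_sine_coeff k (k + 1 + 2 * m)\<bar>
    \<le> \<bar>legendre_sine_coeff k (k + 1)\<bar> * (pochhammer (1/2) m / fact m)"
proof (induction m)
  case (Suc m)
  define n where "n = k + 1 + 2 * m"
  define a where "a = (real n * real (n + 1) - real k * (real k + 1))"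
  define b where "b = (real (n + 1) * real (n + 2) - real k * (real k + 1))"
  have a: "a = (2 * real m + 1) * (2 * real k + 2 * real m + 2)"
    by (simp add: a_def n_def algebra_simps)
  have b: "b = (2 * real m + 2) * (2 * real k + 2 * real m + 3)"
    by (simp add: b_def n_def algebra_simps)
  have bpos: "b > 0" and apos: "a \<ge> 0" unfolding a b by auto
  have "legendre_sine_coeff k (n + 2) = a / b * legendre_sine_coeff k n"
    using legendre_sine_recurrence[of n k] bpos unfolding a_def[symmetric] b_def[symmetric]
    by (simp add: field_simps)
  then have "\<bar>legendre_sine_coeff k (n + 2)\<bar> = a / b * \<bar>legendre_sine_coeff k n\<bar>"
    using apos bpos by (simp add: abs_mult)
  also have "\<dots> \<le> (1/2 + real m) / (real m + 1) * \<bar>legendre_sine_coeff k n\<bar>"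
  proof (rule mult_right_mono)
    have "(2 * real m + 1) * (2 * real k + 2 * real m + 2) \<le> (2 * real m + 1) * (2 * real k + 2 * real m + 3)"
      by (rule mult_left_mono) auto
    then show "a / b \<le> (1/2 + real m) / (real m + 1)"
      unfolding a b by (simp add: divide_simps) (simp add: algebra_simps)
  qed auto
  also have "\<dots> \<le> (1/2 + real m) / (real m + 1) *
      (\<bar>legendre_sine_coeff k (k + 1)\<bar> * (pochhammer (1/2) m / fact m))"
    by (rule mult_left_mono[OF Suc.IH[folded n_def]]) auto
  finally show ?case
    by (simp add: n_def pochhammer_Suc field_simps)
qed simp

section \<open>The leading sine coefficient\<close>

lemma rodrigues_higher_pderiv_boundary:
  "poly ((pderiv ^^ i) (rodrigues_poly k)) 1 = 0 \<and> poly ((pderiv ^^ i) (rodrigues_poly k)) (-1) = 0" if "i < k"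
proof -
  define W :: "real poly" where "W = [:-1, 0, 1:]"
  have "\<exists>q. (pderiv ^^ i) (rodrigues_poly k) = W ^ (k - i) * q" if "i \<le> k" for i
    using that
  proof (induction i)
    case 0
    then show ?case by (intro exI[of _ 1]) (simp add: rodrigues_poly_def W_def)
  next
    case (Suc i)
    then obtain q where q: "(pderiv ^^ i) (rodrigues_poly k) = W ^ (k - i) * q" by auto
    obtain m where m: "k - i = Suc m" using Suc.prems by (metis Suc_diff_Suc Suc_le_lessD)
    then have m': "k - Suc i = m" by simp
    have "(pderiv ^^ Suc i) (rodrigues_poly k) =
        W ^ m * (smult (real (Suc m)) (pderiv W) * q + W * pderiv q)"
      unfolding funpow.simps o_apply q m pderiv_mult pderiv_power_Suc
      by (simp add: algebra_simps smult_add_left)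
    then show ?case unfolding m' by blast
  qed
  from this[of i] that obtain q where "(pderiv ^^ i) (rodrigues_poly k) = W ^ (k - i) * q"
    by auto
  then show ?thesis using that by (simp add: W_def poly_power power_0_left)
qed

lemma integral_poly_by_parts:
  fixes p r :: "real poly"
  assumes "poly r 1 = 0" "poly r (-1) = 0"
  shows "integral {-1..1} (\<lambda>t. poly p t * poly (pderiv r) t) = - integral {-1..1} (\<lambda>t. poly (pderiv p) t * poly r t)"
proof -
  have "((\<lambda>t. poly p t * poly (pderiv r) t + poly (pderiv p) t * poly r t) has_integral
      (poly p 1 * poly r 1 - poly p (-1) * poly r (-1))) {-1..1}"
    by (intro fundamental_theorem_of_calculus)
       (auto simp: has_real_derivative_iff_has_vector_derivative[symmetric] algebra_simps intro!: derivative_eq_intros)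
  moreover have "((\<lambda>t. poly p t * poly (pderiv r) t + poly (pderiv p) t * poly r t) has_integral
      (integral {-1..1} (\<lambda>t. poly p t * poly (pderiv r) t) + integral {-1..1} (\<lambda>t. poly (pderiv p) t * poly r t))) {-1..1}"
    by (intro has_integral_add integrable_integral integrable_continuous_interval continuous_intros)
  ultimately have "poly p 1 * poly r 1 - poly p (-1) * poly r (-1) =
      integral {-1..1} (\<lambda>t. poly p t * poly (pderiv r) t) + integral {-1..1} (\<lambda>t. poly (pderiv p) t * poly r t)"
    by (rule has_integral_unique)
  with assms show ?thesis by simp
qed

text \<open>k integrations by parts: each lowers the order of the derivative of (t^2 - 1)^k, and
  every order below k still has a factor t^2 - 1, so no boundary term survives.\<close>

lemma integral_poly_rodrigues:
  "integral {-1..1} (\<lambda>t. poly q t * poly ((pderiv ^^ k) (rodrigues_poly k)) t)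
    = (-1) ^ k * integral {-1..1} (\<lambda>t. poly ((pderiv ^^ k) q) t * poly (rodrigues_poly k) t)"
proof -
  have "integral {-1..1} (\<lambda>t. poly q t * poly ((pderiv ^^ k) (rodrigues_poly k)) t)
    = (-1) ^ i * integral {-1..1} (\<lambda>t. poly ((pderiv ^^ i) q) t * poly ((pderiv ^^ (k - i)) (rodrigues_poly k)) t)"
    if "i \<le> k" for i
    using that
  proof (induction i)
    case (Suc i)
    obtain m where m: "k - i = Suc m" using Suc.prems by (metis Suc_diff_Suc Suc_le_lessD)
    then have m': "k - Suc i = m" "m < k" using Suc.prems by auto
    show ?case
      using Suc integral_poly_by_parts[of "(pderiv ^^ m) (rodrigues_poly k)" "(pderiv ^^ i) q"]
        rodrigues_higher_pderiv_boundary[OF m'(2)]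
      by (simp add: m m')
  qed simp
  from this[of k] show ?thesis by simp
qed

text \<open>Chebyshev polynomials of the second kind: they turn sin ((k + 1) \<theta>) into sin
  \<theta> times a polynomial of degree k in cos \<theta>, so the leading coefficient becomes a
  polynomial integral over [-1, 1].\<close>

fun chebyshev_U :: "nat \<Rightarrow> real poly" where
  "chebyshev_U 0 = 1"
| "chebyshev_U (Suc 0) = [:0, 2:]"
| "chebyshev_U (Suc (Suc n)) = [:0, 2:] * chebyshev_U (Suc n) - chebyshev_U n"

lemma chebyshev_U_sine: "sin (real (n + 1) * \<theta>) = sin \<theta> * poly (chebyshev_U n) (cos \<theta>)"
proof (induction n rule: chebyshev_U.induct)
  case (3 n)
  have "sin (real (Suc (Suc n) + 1) * \<theta>) = sin (real (Suc n + 1) * \<theta> + \<theta>)"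
       "sin (real (n + 1) * \<theta>) = sin (real (Suc n + 1) * \<theta> - \<theta>)"
    by (simp_all add: algebra_simps)
  then have "sin (real (Suc (Suc n) + 1) * \<theta>) = 2 * cos \<theta> * sin (real (Suc n + 1) * \<theta>) - sin (real (n + 1) * \<theta>)"
    unfolding sin_add sin_diff by simp
  then show ?case using 3 by (simp add: algebra_simps)
qed (simp_all add: sin_double)

lemma degree_chebyshev_U: "degree (chebyshev_U n) \<le> n"
proof (induction n rule: chebyshev_U.induct)
  case (3 n)
  have "degree ([:0, 2:] * chebyshev_U (Suc n)) \<le> Suc (Suc n)"
    using degree_mult_le[of "[:0, 2:]" "chebyshev_U (Suc n)"] 3 by simp
  then show ?case
    using 3 by (auto intro!: degree_diff_le simp del: mult_pCons_left)
qed simp_all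

lemma coeff_chebyshev_U: "coeff (chebyshev_U n) n = 2 ^ n"
proof (induction n rule: chebyshev_U.induct)
  case (3 n)
  have "coeff (chebyshev_U n) (Suc (Suc n)) = 0"
    using degree_chebyshev_U[of n] by (intro coeff_eq_0) simp
  then show ?case using 3 by simp
qed simp_all

text \<open>The degree is at most n and the coefficient of degree n is 2^n, so n differentiations
  leave only the constant.\<close>

lemma higher_pderiv_chebyshev_U: "(pderiv ^^ n) (chebyshev_U n) = [:2 ^ n * fact n:]"
proof (rule poly_eqI)
  fix i
  show "coeff ((pderiv ^^ n) (chebyshev_U n)) i = coeff [:2 ^ n * fact n:] i"
  proof (cases i)
    case 0
    then show ?thesis
      by (simp add: coeff_higher_pderiv coeff_chebyshev_U pochhammer_fact)
  next
    case (Suc j)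
    have "coeff (chebyshev_U n) (i + n) = 0"
      using degree_chebyshev_U[of n] Suc by (intro coeff_eq_0) simp
    then show ?thesis by (simp add: coeff_higher_pderiv Suc)
  qed
qed

text \<open>The substitution runs through -cos, which increases on [0, pi] and has derivative sin;
  reflecting the interval undoes the sign.\<close>

lemma integral_cos_substitution:
  fixes g :: "real \<Rightarrow> 'a::euclidean_space"
  assumes "continuous_on {-1..1} g"
  shows "((\<lambda>\<theta>. sin \<theta> *\<^sub>R g (cos \<theta>)) has_integral integral {-1..1} g) {0..pi}"
proof -
  have cont: "continuous_on {-1..1} (\<lambda>s. g (- s))"
    by (rule continuous_on_compose2[OF assms]) (auto intro!: continuous_intros)
  have "((\<lambda>\<theta>. sin \<theta> *\<^sub>R g (- (- cos \<theta>))) has_integral integral {- cos 0..- cos pi} (\<lambda>s. g (- s))) {0..pi}"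
    by (rule has_integral_substitution[where c = "-1" and d = 1 and g = "\<lambda>\<theta>. - cos \<theta>"])
       (auto intro!: derivative_eq_intros cont simp: has_real_derivative_iff_has_vector_derivative[symmetric])
  moreover have "integral {-1..1} (\<lambda>s. g (- s)) = integral {-1..1} g"
    using Henstock_Kurzweil_Integration.integral_reflect_real[of 1 "-1" g] by simp
  ultimately show ?thesis by simp
qed

text \<open>The Beta integral 2^(2k+1) (k!)^2 / (2k+1)!, kept in integral form, from which its
  recurrence follows directly.\<close>

definition legendre_J :: "nat \<Rightarrow> real" where
  "legendre_J k = integral {-1..1} (\<lambda>t. (1 - t\<^sup>2) ^ k)"

text \<open>The factor 2^k k! produced by differentiating the Chebyshev polynomial cancels the
  normalization in Rodrigues' formula, and the sign (-1)^k turns (t^2 - 1)^k into (1 -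
  t^2)^k.\<close>

lemma legendre_sine_coeff_first: "legendre_sine_coeff k (k + 1) = legendre_J k"
proof -
  have "legendre_sine_coeff k (k + 1) = integral {0..pi} (\<lambda>\<theta>. sin \<theta> *\<^sub>R (poly (chebyshev_U k) (cos \<theta>) * legendre k (cos \<theta>)))"
    unfolding legendre_sine_coeff_def chebyshev_U_sine by (simp add: mult.assoc)
  also have "\<dots> = integral {-1..1} (\<lambda>t. poly (chebyshev_U k) t * legendre k t)"
    by (intro integral_unique integral_cos_substitution continuous_intros)
  also have "\<dots> = integral {-1..1} (\<lambda>t. (1 / (2 ^ k * fact k)) * (poly (chebyshev_U k) t * poly ((pderiv ^^ k) (rodrigues_poly k)) t))"
    by (simp add: legendre_eq_poly legendre_poly_def mult_ac)
  also have "\<dots> = (1 / (2 ^ k * fact k)) * ((-1) ^ k * integral {-1..1} (\<lambda>t. 2 ^ k * fact k * poly (rodrigues_poly k) t))"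
    unfolding integral_mult_right integral_poly_rodrigues higher_pderiv_chebyshev_U by simp
  also have "\<dots> = integral {-1..1} (\<lambda>t. (-1) ^ k * poly (rodrigues_poly k) t)"
    by simp
  also have "(\<lambda>t. (-1) ^ k * poly (rodrigues_poly k) t) = (\<lambda>t. (1 - t\<^sup>2) ^ k)"
    by (auto simp: rodrigues_poly_def poly_power power2_eq_square simp flip: power_mult_distrib)
  finally show ?thesis unfolding legendre_J_def .
qed

text \<open>The derivative of t (1 - t^2)^(k+1), rewritten with t^2 = 1 - (1 - t^2), integrates to
  zero over [-1, 1].\<close>

lemma legendre_J_Suc: "(2 * real k + 3) * legendre_J (Suc k) = (2 * real k + 2) * legendre_J k"
proof -
  have "((\<lambda>t. (2 * real k + 3) * (1 - t\<^sup>2) ^ Suc k - (2 * real k + 2) * (1 - t\<^sup>2) ^ k) has_integral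
      (1 * (1 - 1\<^sup>2) ^ Suc k - (-1) * (1 - (-1)\<^sup>2) ^ Suc k)) {-1..1::real}"
  proof (intro fundamental_theorem_of_calculus)
    fix t :: real
    have "((\<lambda>t. t * (1 - t\<^sup>2) ^ Suc k) has_real_derivative
        (1 - t\<^sup>2) ^ Suc k + t * (real (Suc k) * (1 - t\<^sup>2) ^ k * (- 2 * t))) (at t within {-1..1})"
      by (auto intro!: derivative_eq_intros simp: algebra_simps simp del: power_Suc)
    moreover have "(1 - t\<^sup>2) ^ Suc k + t * (real (Suc k) * (1 - t\<^sup>2) ^ k * (- 2 * t)) =
       (2 * real k + 3) * (1 - t\<^sup>2) ^ Suc k - (2 * real k + 2) * (1 - t\<^sup>2) ^ k"
      by (simp add: algebra_simps power2_eq_square)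
    ultimately show "((\<lambda>t. t * (1 - t\<^sup>2) ^ Suc k) has_vector_derivative
        (2 * real k + 3) * (1 - t\<^sup>2) ^ Suc k - (2 * real k + 2) * (1 - t\<^sup>2) ^ k) (at t within {-1..1})"
      by (simp add: has_real_derivative_iff_has_vector_derivative)
  qed simp
  moreover have "((\<lambda>t. (2 * real k + 3) * (1 - t\<^sup>2) ^ Suc k - (2 * real k + 2) * (1 - t\<^sup>2) ^ k) has_integral
      ((2 * real k + 3) * legendre_J (Suc k) - (2 * real k + 2) * legendre_J k)) {-1..1::real}"
    unfolding legendre_J_def
    by (intro has_integral_diff has_integral_mult_right integrable_integral integrable_continuous_interval continuous_intros)
  ultimately have "(2 * real k + 3) * legendre_J (Suc k) - (2 * real k + 2) * legendre_J k =
      1 * (1 - 1\<^sup>2) ^ Suc k - (-1) * (1 - (-1)\<^sup>2) ^ Suc k"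
    by (meson has_integral_unique)
  then show ?thesis by simp
qed

lemma legendre_J_0: "legendre_J 0 = 2"
  by (simp add: legendre_J_def)

lemma legendre_J_nonneg: "0 \<le> legendre_J k"
  unfolding legendre_J_def
  by (intro integral_nonneg integrable_continuous_interval continuous_intros)
     (auto simp: power2_le_iff_abs_le abs_square_le_1)

text \<open>A Wallis-type estimate, with equality for J_1; the induction step amounts to 4x(x + 1)
  <= (2x + 1)^2. The shifted index leaves out J_0, for which the right-hand side would be 0.\<close>

lemma legendre_J_bound: "((real (Suc k) + 1/2) * legendre_J (Suc k))\<^sup>2 \<le> 4 * real (Suc k)"
proof (induction k)
  case 0
  have "3 * legendre_J 1 = 4" using legendre_J_Suc[of 0] by (simp add: legendre_J_0)
  then have J1: "legendre_J (Suc 0) = 4/3" by simp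
  show ?case unfolding J1 by (simp add: power2_eq_square)
next
  case (Suc k)
  define x where "x = real (Suc k)"
  have x: "x \<ge> 1" by (simp add: x_def)
  define a where "a = (x + 1/2) * legendre_J (Suc k)"
  have rec: "(x + 1 + 1/2) * legendre_J (Suc (Suc k)) = a * ((2 * x + 2) / (2 * x + 1))"
    using legendre_J_Suc[of "Suc k"] x unfolding a_def x_def[symmetric] by (simp add: field_simps)
  have "(a * ((2 * x + 2) / (2 * x + 1)))\<^sup>2 = a\<^sup>2 * ((2 * x + 2) / (2 * x + 1))\<^sup>2"
    by (rule power_mult_distrib)
  also have "\<dots> \<le> (4 * x) * ((2 * x + 2) / (2 * x + 1))\<^sup>2"
    by (rule mult_right_mono) (use Suc.IH in \<open>simp_all add: a_def x_def\<close>)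
  also have "\<dots> \<le> 4 * (x + 1)"
  proof -
    have "(4 * x) * (2 * x + 2)\<^sup>2 \<le> 4 * (x + 1) * (2 * x + 1)\<^sup>2"
      using x by (simp add: power2_eq_square algebra_simps)
    then show ?thesis using x by (simp add: power_divide divide_simps)
  qed
  finally have "((x + 1 + 1/2) * legendre_J (Suc (Suc k)))\<^sup>2 \<le> 4 * (x + 1)" unfolding rec .
  then show ?case by (simp add: x_def algebra_simps)
qed

section \<open>Expansion of the second-kind function in powers of 1/u\<close>

lemma sums_sine_kernel:
  fixes u :: complex
  assumes u: "cmod u > 1"
  shows "(\<lambda>n. 2 * of_real (sin (real n * \<theta>)) / u ^ n) sums
    (of_real (sin \<theta>) / ((u + inverse u) / 2 - of_real (cos \<theta>)))"
proof -
  define w where "w = inverse u"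
  have w: "cmod w < 1" using u by (simp add: w_def norm_inverse inverse_less_1_iff)
  have u0: "u \<noteq> 0" using u by auto
  have wu: "w * u = 1" using u0 by (simp add: w_def)
  have less: "cmod (w * cis \<theta>) < 1" "cmod (w * cis (- \<theta>)) < 1"
    using w by (simp_all add: norm_mult)
  \<comment> \<open>The sine is split into exponentials, giving two geometric series with ratios w
    e^(i \<theta>) and w e^(-i \<theta>), where w = 1/u.\<close>
  have "(\<lambda>n. - \<i> * ((w * cis \<theta>) ^ n - (w * cis (- \<theta>)) ^ n)) sums
      (- \<i> * (1 / (1 - w * cis \<theta>) - 1 / (1 - w * cis (- \<theta>))))"
    by (intro sums_mult sums_diff geometric_sums less)
  moreover have "- \<i> * ((w * cis \<theta>) ^ n - (w * cis (- \<theta>)) ^ n) = 2 * of_real (sin (real n * \<theta>)) / u ^ n" for n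
  proof -
    have "cis (real n * \<theta>) - cis (- (real n * \<theta>)) = 2 * \<i> * of_real (sin (real n * \<theta>))"
      by (simp add: complex_eq_iff)
    then have "- \<i> * ((w * cis \<theta>) ^ n - (w * cis (- \<theta>)) ^ n) = - \<i> * (w ^ n * (2 * \<i> * of_real (sin (real n * \<theta>))))"
      by (simp add: power_mult_distrib Complex.DeMoivre right_diff_distrib[symmetric])
    then show ?thesis by (simp add: w_def field_simps power_inverse)
  qed
  moreover have "- \<i> * (1 / (1 - w * cis \<theta>) - 1 / (1 - w * cis (- \<theta>)))
      = of_real (sin \<theta>) / ((u + inverse u) / 2 - of_real (cos \<theta>))"
  proof -
    have nz: "1 - w * cis \<theta> \<noteq> 0" "1 - w * cis (- \<theta>) \<noteq> 0"
      using less by auto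
    have cc: "cis \<theta> + cis (- \<theta>) = 2 * of_real (cos \<theta>)" "cis \<theta> - cis (- \<theta>) = 2 * \<i> * of_real (sin \<theta>)"
      "cis \<theta> * cis (- \<theta>) = 1"
      by (simp_all add: complex_eq_iff cis_mult)
    have prod: "(1 - w * cis \<theta>) * (1 - w * cis (- \<theta>)) = 1 - w * (cis \<theta> + cis (- \<theta>)) + w * w * (cis \<theta> * cis (- \<theta>))"
      by (simp add: algebra_simps)
    \<comment> \<open>The product of the two denominators is 1 - 2 w cos \<theta> + w^2; since w u =
      1 this equals 2w (z - cos \<theta>) with z = (u + w) / 2.\<close>
    have den: "(1 - w * cis \<theta>) * (1 - w * cis (- \<theta>)) = 2 * w * ((u + w) / 2 - of_real (cos \<theta>))"
      unfolding prod cc using wu by (simp add: algebra_simps)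
    have "1 / (1 - w * cis \<theta>) - 1 / (1 - w * cis (- \<theta>)) =
        w * (cis \<theta> - cis (- \<theta>)) / ((1 - w * cis \<theta>) * (1 - w * cis (- \<theta>)))"
      using nz by (simp add: field_simps)
    also have "\<dots> = w * (2 * \<i> * of_real (sin \<theta>)) / (2 * w * ((u + w) / 2 - of_real (cos \<theta>)))"
      unfolding den cc ..
    also have "\<dots> = \<i> * (of_real (sin \<theta>) / ((u + w) / 2 - of_real (cos \<theta>)))"
    proof -
      have "w * (2 * \<i> * S) / (2 * w * X) = \<i> * (S / X)" for S X :: complex
        using u0 by (cases "X = 0") (simp_all add: w_def field_simps)
      then show ?thesis .
    qed
    finally show ?thesis unfolding w_def[symmetric] by simp
  qed
  ultimately show ?thesis by simp
qed

text \<open>Twice the Legendre function of the second kind, by Neumann's integral.\<close>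

definition legendre_Q_kernel :: "nat \<Rightarrow> complex \<Rightarrow> complex" where
  "legendre_Q_kernel k z = integral {-1..1} (\<lambda>t. of_real (legendre k t) / (z - of_real t))"

text \<open>For t = cos \<theta> the equation is quadratic in u with roots e^(i \<theta>) and e^(-i
  \<theta>), both of modulus one.\<close>

lemma joukowski_not_in_interval:
  assumes u: "cmod u > 1" and t: "t \<in> {-1..1}"
  shows "(u + inverse u) / 2 \<noteq> of_real t"
proof
  define \<theta> where "\<theta> = arccos t"
  have t': "t = cos \<theta>" using t by (simp add: \<theta>_def)
  assume "(u + inverse u) / 2 = of_real t"
  moreover have u0: "u \<noteq> 0" using u by auto
  ultimately have "u * (u + inverse u) = u * (2 * of_real t)" by (simp add: field_simps)
  then have "u * u - u * (2 * of_real t) + 1 = 0" using u0 by (simp add: algebra_simps)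
  moreover have "(u - cis \<theta>) * (u - cis (- \<theta>)) = u * u - u * (cis \<theta> + cis (- \<theta>)) + cis \<theta> * cis (- \<theta>)"
    by (simp add: algebra_simps)
  moreover have "cis \<theta> + cis (- \<theta>) = 2 * of_real (cos \<theta>)" "cis \<theta> * cis (- \<theta>) = 1"
    by (simp_all add: complex_eq_iff cis_mult)
  ultimately have "(u - cis \<theta>) * (u - cis (- \<theta>)) = 0" by (simp add: t')
  then have "u = cis \<theta> \<or> u = cis (- \<theta>)" by simp
  then show False using u by auto
qed

text \<open>Substituting t = cos \<theta> brings in the kernel sin \<theta> / (z - cos \<theta>),
  whose sine series converges uniformly in \<theta>, geometrically in 1/|u|, and may be integrated
  term by term against P_k(cos \<theta>).\<close>

lemma legendre_Q_kernel_sums: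
  assumes u: "cmod u > 1"
  shows "(\<lambda>n. 2 * of_real (legendre_sine_coeff k n) / u ^ n) sums legendre_Q_kernel k ((u + inverse u) / 2)"
proof -
  define z where "z = (u + inverse u) / 2"
  have z: "z - of_real t \<noteq> 0" if "t \<in> {-1..1}" for t
    using joukowski_not_in_interval[OF u that] by (simp add: z_def)
  define g :: "real \<Rightarrow> complex" where "g t = of_real (legendre k t) / (z - of_real t)" for t
  have cont: "continuous_on {-1..1} g"
    unfolding g_def by (intro continuous_intros) (use z in auto)
  define h where "h n \<theta> = 2 * of_real (sin (real n * \<theta>)) / u ^ n * of_real (legendre k (cos \<theta>))" for n and \<theta> :: real
  have "compact ((\<lambda>t. legendre k t) ` {-1..1})"
    by (intro compact_continuous_image continuous_intros) auto
  then obtain B where "\<forall>t\<in>{-1..1}. \<bar>legendre k t\<bar> \<le> B"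
    by (auto dest!: compact_imp_bounded simp: bounded_iff)
  then have B: "\<And>t. t \<in> {-1..1} \<Longrightarrow> \<bar>legendre k t\<bar> \<le> B" by blast
  have B0: "B \<ge> 0" using B[of 0] by simp
  have hb: "norm (h n \<theta>) \<le> 2 * B * (1 / cmod u) ^ n" for n \<theta>
  proof -
    have "norm (h n \<theta>) = 2 * \<bar>sin (real n * \<theta>)\<bar> * \<bar>legendre k (cos \<theta>)\<bar> / cmod u ^ n"
      by (simp add: h_def norm_mult norm_divide norm_power)
    also have "\<dots> \<le> 2 * 1 * B / cmod u ^ n"
      by (intro divide_right_mono mult_mono B) (use B0 in auto)
    finally show ?thesis by (simp add: power_divide)
  qed
  have "uniform_limit {0..pi} (\<lambda>n \<theta>. \<Sum>i<n. h i \<theta>) (\<lambda>\<theta>. suminf (\<lambda>i. h i \<theta>)) sequentially"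
    by (rule Weierstrass_m_test[OF hb]) (use u less_trans[OF zero_less_one u] in \<open>auto intro!: summable_mult summable_geometric simp: norm_divide\<close>)
  moreover have "suminf (\<lambda>i. h i \<theta>) = sin \<theta> *\<^sub>R g (cos \<theta>)" for \<theta>
  proof -
    have "(\<lambda>n. h n \<theta>) sums (of_real (sin \<theta>) / (z - of_real (cos \<theta>)) * of_real (legendre k (cos \<theta>)))"
      unfolding h_def z_def by (intro sums_mult2 sums_sine_kernel u)
    then show ?thesis by (simp add: sums_iff g_def scaleR_conv_of_real)
  qed
  ultimately have "uniform_limit (cbox 0 pi) (\<lambda>n \<theta>. \<Sum>i<n. h i \<theta>) (\<lambda>\<theta>. sin \<theta> *\<^sub>R g (cos \<theta>)) sequentially"
    by simp
  moreover have "continuous_on (cbox 0 pi) (\<lambda>\<theta>. \<Sum>i<n. h i \<theta>)" for n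
    unfolding h_def by (intro continuous_intros) (use u in auto)
  ultimately obtain I J where IJ: "\<And>n. ((\<lambda>\<theta>. \<Sum>i<n. h i \<theta>) has_integral I n) (cbox 0 pi)"
    "((\<lambda>\<theta>. sin \<theta> *\<^sub>R g (cos \<theta>)) has_integral J) (cbox 0 pi)" "I \<longlonglongrightarrow> J"
    by (rule uniform_limit_integral_cbox) auto
  have "I = (\<lambda>n. integral {0..pi} (\<lambda>\<theta>. \<Sum>i<n. h i \<theta>))" "J = integral {0..pi} (\<lambda>\<theta>. sin \<theta> *\<^sub>R g (cos \<theta>))"
    using integral_unique[OF IJ(1)] integral_unique[OF IJ(2)] by auto
  with IJ(3) have "(\<lambda>n. integral {0..pi} (\<lambda>\<theta>. \<Sum>i<n. h i \<theta>)) \<longlonglongrightarrow> integral {0..pi} (\<lambda>\<theta>. sin \<theta> *\<^sub>R g (cos \<theta>))"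
    by simp
  moreover have "integral {0..pi} (\<lambda>\<theta>. sin \<theta> *\<^sub>R g (cos \<theta>)) = legendre_Q_kernel k z"
    unfolding legendre_Q_kernel_def g_def[symmetric]
    by (rule integral_unique[OF integral_cos_substitution[OF cont]])
  moreover have "integral {0..pi} (\<lambda>\<theta>. \<Sum>i<n. h i \<theta>) = (\<Sum>i<n. 2 * of_real (legendre_sine_coeff k i) / u ^ i)" for n
  proof -
    have "(h i has_integral 2 / u ^ i * of_real (legendre_sine_coeff k i)) {0..pi}" for i
    proof -
      have "((\<lambda>\<theta>. 2 / u ^ i * of_real (sin (real i * \<theta>) * legendre k (cos \<theta>))) has_integral
          2 / u ^ i * of_real (legendre_sine_coeff k i)) {0..pi}"
        by (intro has_integral_mult_right has_integral_of_real legendre_sine_integral)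
      then show ?thesis by (simp add: h_def[abs_def] mult_ac)
    qed
    then have "((\<lambda>\<theta>. \<Sum>i<n. h i \<theta>) has_integral (\<Sum>i<n. 2 / u ^ i * of_real (legendre_sine_coeff k i))) {0..pi}"
      by (intro has_integral_sum) auto
    then show ?thesis by (simp add: integral_unique)
  qed
  ultimately show ?thesis by (simp add: sums_def z_def)
qed

text \<open>Only the indices k + 1 + 2m contribute; together they are dominated by the leading term
  times the binomial series of (1 - r^2) powr (-1/2), r = 1/|u|.\<close>

lemma norm_legendre_Q_kernel_le:
  assumes u: "cmod u > 1"
  shows "cmod (legendre_Q_kernel k ((u + inverse u) / 2))
    \<le> 2 * legendre_J k * (1 / cmod u) ^ (k + 1) * (1 - 1 / (cmod u)\<^sup>2) powr (-1/2)"
proof -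
  define r where "r = 1 / cmod u"
  have r: "0 < r" "r < 1" using u less_trans[OF zero_less_one u] by (auto simp: r_def)
  have r2: "\<bar>- (r\<^sup>2)\<bar> < 1" using r by (simp add: power_less_one_iff)
  define p where "p m = pochhammer (1/2 :: real) m / fact m * (r\<^sup>2) ^ m" for m
  have p0: "p m \<ge> 0" for m
    unfolding p_def using r by (auto intro!: mult_nonneg_nonneg divide_nonneg_nonneg pochhammer_nonneg)
  \<comment> \<open>The generalized binomial coefficients at -1/2 alternate in sign; the signs are
    absorbed by the argument -r^2.\<close>
  have "((-1/2 :: real) gchoose m) * (- (r\<^sup>2)) ^ m = p m" for m
  proof -
    have "(- 1 :: real) ^ m * (- (r\<^sup>2)) ^ m = (r\<^sup>2) ^ m"
      by (simp flip: power_mult_distrib)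
    then show ?thesis by (simp add: gbinomial_pochhammer p_def algebra_simps)
  qed
  then have psum: "p sums (1 - r\<^sup>2) powr (-1/2)"
    using gen_binomial_real[OF r2, of "-1/2"] by simp
  define s where "s n = 2 * of_real (legendre_sine_coeff k n) / u ^ n" for n
  define C where "C = 2 * legendre_J k * r ^ (k + 1)"
  have C0: "C \<ge> 0" unfolding C_def using legendre_J_nonneg r by auto
  \<comment> \<open>Partial sums are cut off just below a contributing index, so each enlargement by
    two adds one surviving and one vanishing term.\<close>
  have bound: "cmod (\<Sum>n<k + 1 + 2 * M. s n) \<le> C * (\<Sum>m<M. p m)" for M
  proof (induction M)
    case 0
    have "(\<Sum>n<k + 1. s n) = 0"
      by (rule sum.neutral) (auto simp: s_def legendre_sine_coeff_eq_0)
    then show ?case by simp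
  next
    case (Suc M)
    have "s (k + 2 + 2 * M) = 0" by (simp only: s_def legendre_sine_coeff_even_eq_0) simp
    then have eq: "(\<Sum>n<k + 1 + 2 * Suc M. s n) = (\<Sum>n<k + 1 + 2 * M. s n) + s (k + 1 + 2 * M)"
      by simp
    have "cmod (s (k + 1 + 2 * M)) = 2 * \<bar>legendre_sine_coeff k (k + 1 + 2 * M)\<bar> * r ^ (k + 1 + 2 * M)"
      by (simp add: s_def norm_divide norm_mult norm_power r_def power_divide)
    also have "\<dots> \<le> 2 * (\<bar>legendre_sine_coeff k (k + 1)\<bar> * (pochhammer (1/2) M / fact M)) * r ^ (k + 1 + 2 * M)"
      by (intro mult_right_mono mult_left_mono legendre_sine_coeff_bound) (use r in auto)
    also have "\<dots> = C * p M"
      unfolding legendre_sine_coeff_first C_def p_def using legendre_J_nonneg[of k]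
      by (simp add: power_add power_mult)
    finally have "cmod (s (k + 1 + 2 * M)) \<le> C * p M" .
    then have "cmod (\<Sum>n<k + 1 + 2 * Suc M. s n) \<le> C * (\<Sum>m<M. p m) + C * p M"
      unfolding eq by (rule norm_triangle_le[OF add_mono[OF Suc.IH]])
    then show ?case by (simp add: algebra_simps)
  qed
  have "(\<lambda>M. \<Sum>n<k + 1 + 2 * M. s n) \<longlonglongrightarrow> legendre_Q_kernel k ((u + inverse u) / 2)"
  proof -
    have "(\<lambda>N. \<Sum>n<N. s n) \<longlonglongrightarrow> legendre_Q_kernel k ((u + inverse u) / 2)"
      using legendre_Q_kernel_sums[OF u, of k] by (simp add: sums_def s_def[abs_def])
    moreover have "strict_mono (\<lambda>M. k + 1 + 2 * M)" by (simp add: strict_mono_def)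
    ultimately show ?thesis by (rule LIMSEQ_subseq_LIMSEQ[unfolded o_def])
  qed
  moreover have "cmod (\<Sum>n<k + 1 + 2 * M. s n) \<le> C * (1 - r\<^sup>2) powr (-1/2)" for M
  proof -
    have "(\<Sum>m<M. p m) \<le> suminf p"
      using psum p0 by (intro sum_le_suminf) (auto simp: sums_iff)
    then have "C * (\<Sum>m<M. p m) \<le> C * (1 - r\<^sup>2) powr (-1/2)"
      using psum C0 by (intro mult_left_mono) (auto simp: sums_iff)
    with bound[of M] show ?thesis by linarith
  qed
  ultimately have "cmod (legendre_Q_kernel k ((u + inverse u) / 2)) \<le> C * (1 - r\<^sup>2) powr (-1/2)"
    by (intro LIMSEQ_le_const2[OF tendsto_norm]) auto
  then show ?thesis by (simp add: C_def r_def power_divide)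
qed

text \<open>The contribution of one variable to the final bound, apart from the arc length:
  \<open>C_hat_eq\<close> multiplies these factors up to the constants, the powers of \<rho> and the
  square roots of the claim.\<close>

definition legendre_const :: "nat \<Rightarrow> real \<Rightarrow> real" where
  "legendre_const k \<rho> = (if k = 0 then D_bar \<rho> else D_half \<rho> * sqrt (real k)) * \<rho> powi (- int k)"

text \<open>Relates the elementary factor 2 of the estimate of \<open>legendre_J\<close> to the
  constant Gamma(1/2) exp (1/12 + 1/2) inside \<open>D_half\<close>.\<close>

lemma sqrt_pi_exp_ge_2: "2 \<le> sqrt pi * exp (1/12 + 1/2)"
proof -
  have "1.7 \<le> sqrt pi"
    by (rule real_le_rsqrt) (use pi_gt3 in \<open>simp add: power2_eq_square\<close>)
  moreover have "1.5 \<le> exp (1/12 + 1/2 :: real)"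
    using exp_ge_add_one_self[of "1/12 + 1/2 :: real"] by simp
  ultimately have "1.7 * 1.5 \<le> sqrt pi * exp (1/12 + 1/2)"
    by (intro mult_mono) auto
  then show ?thesis by simp
qed

text \<open>The exponent k + 1 in the kernel estimate splits into \<rho>^(-k) and the 1/\<rho> in
  \<open>D_bar\<close> and \<open>D_half\<close>. At k = 0 the factor (1/2) J_0 is exactly 1, which
  is why \<open>D_bar\<close> has no further constant.\<close>

lemma legendre_Q_kernel_bound:
  assumes u: "cmod u = \<rho>" and \<rho>: "1 < \<rho>"
  shows "(real k + 1/2) * cmod (legendre_Q_kernel k ((u + inverse u) / 2)) \<le> 2 * legendre_const k \<rho>"
proof -
  define E where "E = (1 - \<rho> powi (-2)) powr (-1/2)"
  have E0: "E \<ge> 0" by (simp add: E_def)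
  have pm2: "\<rho> powi (-2) = 1 / \<rho>\<^sup>2" by (simp add: power_int_minus inverse_eq_divide)
  have pk: "\<rho> powi (- int k) = (1 / \<rho>) ^ k" by (simp add: power_int_minus inverse_eq_divide power_divide)
  have J: "(real k + 1/2) * legendre_J k \<le> (if k = 0 then 1 else sqrt pi * exp (1/12 + 1/2) * sqrt (real k))"
  proof (cases k)
    case 0
    then show ?thesis by (simp add: legendre_J_0)
  next
    case (Suc n)
    have "(real k + 1/2) * legendre_J k \<le> sqrt (4 * real k)"
      unfolding Suc by (rule real_le_rsqrt[OF legendre_J_bound])
    also have "\<dots> = 2 * sqrt (real k)" by (simp add: real_sqrt_mult)
    also have "\<dots> \<le> sqrt pi * exp (1/12 + 1/2) * sqrt (real k)"
      by (rule mult_right_mono[OF sqrt_pi_exp_ge_2]) simp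
    finally show ?thesis using Suc by simp
  qed
  have "cmod (legendre_Q_kernel k ((u + inverse u) / 2)) \<le> 2 * legendre_J k * (1 / \<rho>) ^ (k + 1) * E"
    using norm_legendre_Q_kernel_le[of u k] u \<rho> by (simp add: E_def pm2)
  then have "(real k + 1/2) * cmod (legendre_Q_kernel k ((u + inverse u) / 2))
      \<le> (real k + 1/2) * (2 * legendre_J k * (1 / \<rho>) ^ (k + 1) * E)"
    by (rule mult_left_mono) simp
  also have "\<dots> = ((real k + 1/2) * legendre_J k) * (2 * (1 / \<rho>) ^ (k + 1) * E)" by (simp add: mult_ac)
  also have "\<dots> \<le> (if k = 0 then 1 else sqrt pi * exp (1/12 + 1/2) * sqrt (real k)) * (2 * (1 / \<rho>) ^ (k + 1) * E)"
    by (rule mult_right_mono[OF J]) (use E0 \<rho> in auto)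
  also have "\<dots> = 2 * legendre_const k \<rho>"
    unfolding legendre_const_def D_bar_def D_half_def E_def[symmetric] pk
    by (simp add: Gamma_one_half_real)
  finally show ?thesis .
qed

section \<open>Bernstein ellipses and the Cauchy integral formula\<close>

text \<open>The region enclosed by the ellipse, described by its foci 1 and -1 and the focal sum
  \<rho> + 1/\<rho>. Closedness, boundedness and convexity can be read off from this form, unlike
  from the Joukowski parametrization.\<close>

definition filled_ellipse :: "real \<Rightarrow> complex set" where
  "filled_ellipse \<rho> = {z. cmod (z - 1) + cmod (z + 1) \<le> \<rho> + 1 / \<rho>}"

text \<open>Subtracting and adding 1 gives (u - 1)^2 / (2u) and (u + 1)^2 / (2u), so the
  parallelogram law yields the focal sum.\<close>

lemma joukowski_norm_sum:
  assumes "u \<noteq> 0"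
  shows "cmod ((u + inverse u) / 2 - 1) + cmod ((u + inverse u) / 2 + 1) = cmod u + 1 / cmod u"
proof -
  have "(u + inverse u) / 2 - 1 = (u - 1)\<^sup>2 / (2 * u)" "(u + inverse u) / 2 + 1 = (u + 1)\<^sup>2 / (2 * u)"
    using assms by (simp_all add: field_simps power2_eq_square)
  then have "cmod ((u + inverse u) / 2 - 1) + cmod ((u + inverse u) / 2 + 1) =
      ((cmod (u - 1))\<^sup>2 + (cmod (u + 1))\<^sup>2) / (2 * cmod u)"
    by (simp add: norm_divide norm_mult norm_power add_divide_distrib)
  also have "(cmod (u - 1))\<^sup>2 + (cmod (u + 1))\<^sup>2 = 2 * (cmod u)\<^sup>2 + 2"
    unfolding cmod_power2 by (simp add: power2_eq_square algebra_simps)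
  also have "(2 * (cmod u)\<^sup>2 + 2) / (2 * cmod u) = cmod u + 1 / cmod u"
    using assms by (simp add: field_simps power2_eq_square)
  finally show ?thesis .
qed

text \<open>The two solutions z + s and z - s, with s a square root of z^2 - 1, have product 1, so
  one of them has modulus at least 1.\<close>

lemma joukowski_surj: "\<exists>u. u \<noteq> 0 \<and> cmod u \<ge> 1 \<and> z = (u + inverse u) / 2"
proof -
  define v where "v = z + csqrt (z\<^sup>2 - 1)"
  define v' where "v' = z - csqrt (z\<^sup>2 - 1)"
  have prod: "v * v' = 1"
    unfolding v_def v'_def by (simp add: algebra_simps) (simp add: power2_eq_square[symmetric])
  have sum: "v + v' = 2 * z" by (simp add: v_def v'_def)
  have nz: "v \<noteq> 0" "v' \<noteq> 0" using prod by auto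
  have inv: "inverse v = v'" "inverse v' = v" using prod nz by (simp_all add: field_simps)
  have np: "cmod v * cmod v' = 1" using prod by (metis norm_mult norm_one)
  show ?thesis
  proof (cases "cmod v \<ge> 1")
    case True
    then show ?thesis using nz sum inv by (intro exI[of _ v]) auto
  next
    case False
    have "cmod v' \<ge> 1"
    proof (rule ccontr)
      assume "\<not> cmod v' \<ge> 1"
      with False have "cmod v * cmod v' < 1 * 1" by (intro mult_strict_mono) auto
      with np show False by simp
    qed
    then show ?thesis using nz sum inv by (intro exI[of _ v']) (auto simp: add.commute)
  qed
qed

lemma add_inverse_mono:
  fixes x y :: real
  assumes "1 \<le> x" "x < y"
  shows "x + 1 / x < y + 1 / y"
proof -
  have "1 < x * y" using assms by (smt (verit) mult_le_cancel_left1 mult_strict_left_mono)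
  then have "(y - x) * (x * y - 1) > 0" using assms by simp
  then show ?thesis using assms by (simp add: field_simps power2_eq_square)
qed

lemma joukowski_in_filled_ellipse:
  assumes "1 < \<rho>" "u \<noteq> 0" "1 \<le> cmod u"
  shows "(u + inverse u) / 2 \<in> filled_ellipse \<rho> \<longleftrightarrow> cmod u \<le> \<rho>"
  unfolding filled_ellipse_def mem_Collect_eq joukowski_norm_sum[OF assms(2)]
  using add_inverse_mono[of "cmod u" \<rho>] add_inverse_mono[of \<rho> "cmod u"] assms
  by (smt (verit))

lemma bernstein_ellipse_subset: "1 < \<rho> \<Longrightarrow> bernstein_ellipse \<rho> \<subseteq> filled_ellipse \<rho>"
proof
  fix z assume "1 < \<rho>" "z \<in> bernstein_ellipse \<rho>"
  then obtain u where "cmod u = \<rho>" "z = (u + inverse u) / 2" by (auto simp: bernstein_ellipse_def)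
  moreover have "u \<noteq> 0" "1 \<le> cmod u" "cmod u \<le> \<rho>" using \<open>cmod u = \<rho>\<close> \<open>1 < \<rho>\<close> by auto
  ultimately show "z \<in> filled_ellipse \<rho>" using joukowski_in_filled_ellipse[of \<rho> u] \<open>1 < \<rho>\<close> by blast
qed

lemma closed_filled_ellipse: "closed (filled_ellipse \<rho>)"
  unfolding filled_ellipse_def by (intro closed_Collect_le continuous_intros)

lemma bounded_filled_ellipse: "bounded (filled_ellipse \<rho>)"
proof (rule boundedI)
  fix z assume "z \<in> filled_ellipse \<rho>"
  then have "cmod (z - 1) + cmod (z + 1) \<le> \<rho> + 1 / \<rho>" by (simp add: filled_ellipse_def)
  moreover have "cmod z \<le> cmod (z - 1) + 1" using norm_triangle_ineq[of "z - 1" 1] by simp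
  ultimately show "cmod z \<le> \<rho> + 1 / \<rho> + 1" using norm_ge_zero[of "z + 1"] by linarith
qed

text \<open>The distances to the two foci are convex functions.\<close>

lemma convex_filled_ellipse: "convex (filled_ellipse \<rho>)"
proof (rule convexI)
  fix x y :: complex and s t :: real
  assume xy: "x \<in> filled_ellipse \<rho>" "y \<in> filled_ellipse \<rho>" and st: "0 \<le> s" "0 \<le> t" "s + t = 1"
  have tri: "cmod (s *\<^sub>R x + t *\<^sub>R y - c) \<le> s * cmod (x - c) + t * cmod (y - c)" for c
  proof -
    have "s *\<^sub>R x + t *\<^sub>R y - c = s *\<^sub>R (x - c) + t *\<^sub>R (y - c)"
      using st(3) by (simp add: algebra_simps flip: scaleR_add_left)
    then show ?thesis using norm_triangle_ineq[of "s *\<^sub>R (x - c)" "t *\<^sub>R (y - c)"] st by simp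
  qed
  have "cmod (s *\<^sub>R x + t *\<^sub>R y - 1) + cmod (s *\<^sub>R x + t *\<^sub>R y + 1)
      \<le> s * (cmod (x - 1) + cmod (x + 1)) + t * (cmod (y - 1) + cmod (y + 1))"
    using tri[of 1] tri[of "-1"] by (simp add: algebra_simps)
  also have "\<dots> \<le> s * (\<rho> + 1 / \<rho>) + t * (\<rho> + 1 / \<rho>)"
    using xy st by (intro add_mono[OF mult_left_mono mult_left_mono]) (auto simp: filled_ellipse_def)
  also have "\<dots> = \<rho> + 1 / \<rho>" using st by (simp flip: distrib_right)
  finally show "s *\<^sub>R x + t *\<^sub>R y \<in> filled_ellipse \<rho>" by (simp add: filled_ellipse_def)
qed

text \<open>Between the foci the focal sum is 2, which is strictly less than \<rho> +
  1/\<rho>.\<close>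

lemma interval_in_interior_filled_ellipse:
  assumes "1 < \<rho>" "t \<in> {-1..1}"
  shows "complex_of_real t \<in> interior (filled_ellipse \<rho>)"
proof -
  define U where "U = {z. cmod (z - 1) + cmod (z + 1) < \<rho> + 1 / \<rho>}"
  have "open U" unfolding U_def by (intro open_Collect_less continuous_intros)
  moreover have "U \<subseteq> filled_ellipse \<rho>" by (auto simp: U_def filled_ellipse_def)
  moreover have "cmod (of_real t - 1) = 1 - t" "cmod (of_real t + 1) = 1 + t"
    using assms(2) norm_of_real[of "t - 1", where 'a = complex] norm_of_real[of "t + 1", where 'a = complex] by auto
  then have "complex_of_real t \<in> U"
    using add_inverse_mono[of 1 \<rho>] assms by (simp add: U_def)
  ultimately show ?thesis by (meson interior_maximal subsetD)
qed

text \<open>A point with strictly smaller focal sum is interior, so the frontier lies on the level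
  set; there strict monotonicity of x + 1/x on x >= 1 forces |u| = \<rho>.\<close>

lemma frontier_filled_ellipse:
  assumes \<rho>: "1 < \<rho>"
  shows "frontier (filled_ellipse \<rho>) \<subseteq> bernstein_ellipse \<rho>"
proof
  fix z assume z: "z \<in> frontier (filled_ellipse \<rho>)"
  define U where "U = {z. cmod (z - 1) + cmod (z + 1) < \<rho> + 1 / \<rho>}"
  have "open U" unfolding U_def by (intro open_Collect_less continuous_intros)
  moreover have "U \<subseteq> filled_ellipse \<rho>" by (auto simp: U_def filled_ellipse_def)
  ultimately have "U \<subseteq> interior (filled_ellipse \<rho>)" by (rule interior_maximal[rotated])
  with z have "z \<notin> U" "z \<in> filled_ellipse \<rho>"
    using closed_filled_ellipse[of \<rho>] by (auto simp: frontier_def)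
  then have eq: "cmod (z - 1) + cmod (z + 1) = \<rho> + 1 / \<rho>" by (auto simp: U_def filled_ellipse_def)
  obtain u where u: "u \<noteq> 0" "cmod u \<ge> 1" "z = (u + inverse u) / 2" using joukowski_surj[of z] by blast
  have "cmod u + 1 / cmod u = \<rho> + 1 / \<rho>" using eq joukowski_norm_sum[OF u(1)] u(3) by simp
  then have "cmod u = \<rho>"
    using add_inverse_mono[of "cmod u" \<rho>] add_inverse_mono[of \<rho> "cmod u"] u(2) \<rho> by (cases "cmod u < \<rho>"; cases "\<rho> < cmod u") auto
  with u show "z \<in> bernstein_ellipse \<rho>" unfolding bernstein_ellipse_def by blast
qed

section \<open>The ellipse as a closed path, and Cauchy's formula on it\<close>

lemma bernstein_curve_in_ellipse:
  assumes "1 < \<rho>"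
  shows "bernstein_curve \<rho> t \<in> bernstein_ellipse \<rho>"
  unfolding bernstein_ellipse_def bernstein_curve_def mem_Collect_eq
  by (rule exI[of _ "of_real \<rho> * cis t"]) (use assms in \<open>simp add: norm_mult\<close>)

definition bernstein_deriv :: "real \<Rightarrow> real \<Rightarrow> complex" where
  "bernstein_deriv \<rho> t = (of_real \<rho> * (\<i> * cis t) - \<i> * cis (- t) / of_real \<rho>) / 2"

lemma bernstein_curve_alt: "bernstein_curve \<rho> t = (of_real \<rho> * cis t + cis (- t) / of_real \<rho>) / 2"
  unfolding bernstein_curve_def by (simp only: inverse_mult_distrib cis_inverse divide_inverse mult.commute)

lemma bernstein_curve_has_vector_derivative:
  "(bernstein_curve \<rho> has_vector_derivative bernstein_deriv \<rho> t) (at t within S)"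
proof -
  have "(cis has_vector_derivative \<i> * cis t) (at t within S)"
    unfolding cis_conv_exp by (auto intro!: derivative_eq_intros has_vector_derivative_real_field simp: scaleR_conv_of_real)
  moreover have "((\<lambda>t. cis (- t)) has_vector_derivative - \<i> * cis (- t)) (at t within S)"
    unfolding cis_conv_exp by (auto intro!: derivative_eq_intros has_vector_derivative_real_field simp: scaleR_conv_of_real)
  ultimately have "((\<lambda>t. (of_real \<rho> * cis t + cis (- t) / of_real \<rho>) / 2) has_vector_derivative
      (of_real \<rho> * (\<i> * cis t) + (- \<i> * cis (- t)) / of_real \<rho>) / 2) (at t within S)"
    by (intro has_vector_derivative_divide has_vector_derivative_add has_vector_derivative_mult_right)
  then show ?thesis by (simp add: bernstein_curve_alt[abs_def] bernstein_deriv_def)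
qed

lemma bernstein_length_alt: "bernstein_length \<rho> = integral {0..2*pi} (\<lambda>t. cmod (bernstein_deriv \<rho> t))"
  unfolding bernstein_length_def
  using vector_derivative_at[OF bernstein_curve_has_vector_derivative] by simp

lemma continuous_on_bernstein [continuous_intros]:
  "continuous_on S f \<Longrightarrow> continuous_on S (\<lambda>x. bernstein_curve \<rho> (f x))"
  "continuous_on S f \<Longrightarrow> continuous_on S (\<lambda>x. bernstein_deriv \<rho> (f x))"
  unfolding bernstein_curve_alt bernstein_deriv_def divide_inverse by (intro continuous_intros; assumption?)+

text \<open>The same curve over [0, 1], as contour integrals require;
  \<open>bernstein_length\<close> integrates over [0, 2 pi].\<close>

definition bernstein_path :: "real \<Rightarrow> real \<Rightarrow> complex" where
  "bernstein_path \<rho> s = bernstein_curve \<rho> (2 * pi * s)"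

lemma bernstein_path_has_vector_derivative:
  "(bernstein_path \<rho> has_vector_derivative (2 * pi) *\<^sub>R bernstein_deriv \<rho> (2 * pi * s)) (at s within S)"
proof -
  have "((\<lambda>s. 2 * pi * s) has_vector_derivative 2 * pi) (at s within S)"
    by (auto intro!: derivative_eq_intros simp: has_real_derivative_iff_has_vector_derivative[symmetric])
  then have "((bernstein_curve \<rho> \<circ> (\<lambda>s. 2 * pi * s)) has_vector_derivative (2 * pi) *\<^sub>R bernstein_deriv \<rho> (2 * pi * s)) (at s within S)"
    by (rule vector_diff_chain_within) (rule bernstein_curve_has_vector_derivative)
  then show ?thesis by (simp add: bernstein_path_def[abs_def] o_def)
qed

lemma valid_path_bernstein_path: "valid_path (bernstein_path \<rho>)"
proof -
  have "bernstein_path \<rho> C1_differentiable_on {0..1}"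
    unfolding C1_differentiable_on_def
    by (rule exI[of _ "\<lambda>s. (2 * pi) *\<^sub>R bernstein_deriv \<rho> (2 * pi * s)"])
       (auto intro!: continuous_intros bernstein_path_has_vector_derivative)
  then show ?thesis by (simp add: valid_path_def C1_differentiable_imp_piecewise)
qed

lemma bernstein_path_closed: "pathfinish (bernstein_path \<rho>) = pathstart (bernstein_path \<rho>)"
  by (simp add: bernstein_path_def pathfinish_def pathstart_def bernstein_curve_def)

lemma path_image_bernstein_path:
  assumes "1 < \<rho>"
  shows "path_image (bernstein_path \<rho>) \<subseteq> filled_ellipse \<rho>"
    and "t \<in> {-1..1} \<Longrightarrow> of_real t \<notin> path_image (bernstein_path \<rho>)"
proof -
  show "path_image (bernstein_path \<rho>) \<subseteq> filled_ellipse \<rho>"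
    using bernstein_curve_in_ellipse[OF assms] bernstein_ellipse_subset[OF assms]
    by (auto simp: path_image_def bernstein_path_def)
  show "of_real t \<notin> path_image (bernstein_path \<rho>)" if "t \<in> {-1..1}"
  proof
    assume "of_real t \<in> path_image (bernstein_path \<rho>)"
    then obtain s where "of_real t = bernstein_curve \<rho> s" by (auto simp: path_image_def bernstein_path_def)
    moreover have "cmod (of_real \<rho> * cis s) > 1" using assms by (simp add: norm_mult)
    ultimately show False using joukowski_not_in_interval[OF _ that] by (metis bernstein_curve_def)
  qed
qed

text \<open>The point can be moved to 0 inside the segment [-1, 1], which the path does not meet,
  and a linear homotopy avoiding 0 deforms the ellipse into the circle of radius \<rho>.\<close>

lemma winding_number_bernstein_path:
  assumes \<rho>: "1 < \<rho>" and t: "t \<in> {-1..1}"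
  shows "winding_number (bernstein_path \<rho>) (of_real t) = 1"
proof -
  have p: "path (bernstein_path \<rho>)" by (rule valid_path_imp_path[OF valid_path_bernstein_path])
  have "winding_number (bernstein_path \<rho>) (of_real t) = winding_number (bernstein_path \<rho>) 0"
  proof (rule winding_number_eq[OF p bernstein_path_closed])
    show "of_real t \<in> complex_of_real ` {-1..1}" "0 \<in> complex_of_real ` {-1..1}" using t by auto
    show "connected (complex_of_real ` {-1..1})"
      by (intro connected_continuous_image continuous_intros) auto
    show "complex_of_real ` {- 1..1} \<inter> path_image (bernstein_path \<rho>) = {}"
      using path_image_bernstein_path(2)[OF \<rho>] by auto
  qed
  also have "\<dots> = winding_number (circlepath 0 \<rho>) 0"
  proof (rule winding_number_loops_linear_eq)
    show "0 \<notin> closed_segment (circlepath 0 \<rho> s) (bernstein_path \<rho> s)" for s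
    proof
      assume "0 \<in> closed_segment (circlepath 0 \<rho> s) (bernstein_path \<rho> s)"
      then obtain v where v: "0 \<le> v" "v \<le> 1"
        and eq: "0 = (1 - v) *\<^sub>R circlepath 0 \<rho> s + v *\<^sub>R bernstein_path \<rho> s"
        by (auto simp: in_segment)
      \<comment> \<open>A point of the connecting segment is (1 - v/2) \<rho> c + (v / (2 \<rho>)) /
        c with |c| = 1. It cannot vanish: the first summand has modulus at least \<rho>/2, the
        second at most 1/(2 \<rho>).\<close>
      define c where "c = cis (2 * pi * s)"
      have c: "circlepath 0 \<rho> s = of_real \<rho> * c" "bernstein_path \<rho> s = (of_real \<rho> * c + cis (- (2 * pi * s)) / of_real \<rho>) / 2"
        by (simp_all add: circlepath c_def cis_conv_exp bernstein_path_def bernstein_curve_alt mult_ac)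
      have "(1 - V) * (R * c) + V * ((R * c + k / R) / 2) = (1 - V / 2) * R * c + V / (2 * R) * k" for V R k :: complex
        by (simp add: algebra_simps add_divide_distrib)
      from this[of "of_real v" "of_real \<rho>"]
      have "of_real ((1 - v / 2) * \<rho>) * c + (of_real (v / (2 * \<rho>)) * cis (- (2 * pi * s))) = 0"
        using eq unfolding c by (simp add: scaleR_conv_of_real)
      then have "of_real ((1 - v / 2) * \<rho>) * c = - (of_real (v / (2 * \<rho>)) * cis (- (2 * pi * s)))"
        by (simp add: eq_neg_iff_add_eq_0)
      then have "cmod (of_real ((1 - v / 2) * \<rho>) * c) = cmod (of_real (v / (2 * \<rho>)) * cis (- (2 * pi * s)))"
        by simp
      then have "\<bar>(1 - v / 2) * \<rho>\<bar> = \<bar>v / (2 * \<rho>)\<bar>"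
        unfolding norm_mult c_def norm_cis norm_of_real by simp
      moreover have "(1 - v / 2) * \<rho> \<ge> (1/2) * \<rho>" using v \<rho> by (intro mult_right_mono) auto
      moreover have "v / (2 * \<rho>) \<le> 1 / (2 * \<rho>)" using v \<rho> by (intro divide_right_mono) auto
      moreover have "1 / (2 * \<rho>) < (1/2) * \<rho>"
        using add_inverse_mono[of 1 \<rho>] \<rho> less_1_mult[of \<rho> \<rho>] by (simp add: field_simps)
      moreover have "v / (2 * \<rho>) \<ge> 0" using v \<rho> by simp
      ultimately show False by linarith
    qed
  qed (use p bernstein_path_closed in auto)
  also have "\<dots> = 1" by (rule winding_number_circlepath) (use \<rho> in simp)
  finally show ?thesis .
qed

text \<open>The path runs on the boundary of the region, where F is merely continuous; Cauchy's
  formula on a convex set for functions differentiable in the interior covers this case.\<close>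

lemma bernstein_cauchy_formula:
  assumes \<rho>: "1 < \<rho>" and t: "t \<in> {-1..1}"
    and cont: "continuous_on (filled_ellipse \<rho>) F"
    and hol: "F holomorphic_on interior (filled_ellipse \<rho>)"
  shows "((\<lambda>s. F (bernstein_curve \<rho> s) / (bernstein_curve \<rho> s - of_real t) * bernstein_deriv \<rho> s)
    has_integral (2 * pi * \<i> * F (of_real t))) {0..2*pi}"
proof -
  have ti: "complex_of_real t \<in> interior (filled_ellipse \<rho>)"
    by (rule interval_in_interior_filled_ellipse[OF \<rho> t])
  have "((\<lambda>w. F w / (w - of_real t)) has_contour_integral
      (2 * pi * \<i> * winding_number (bernstein_path \<rho>) (of_real t) * F (of_real t))) (bernstein_path \<rho>)"
  proof (rule Cauchy_integral_formula_weak[where S = "filled_ellipse \<rho>" and k = "{}"])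
    show "F field_differentiable at x" if "x \<in> interior (filled_ellipse \<rho>) - {}" for x
      using hol that by (simp add: holomorphic_on_imp_differentiable_at)
    show "path_image (bernstein_path \<rho>) \<subseteq> filled_ellipse \<rho> - {of_real t}"
      using path_image_bernstein_path[OF \<rho>] t by blast
  qed (use ti cont in \<open>simp_all add: convex_filled_ellipse valid_path_bernstein_path bernstein_path_closed\<close>)
  then have "((\<lambda>s. F (bernstein_path \<rho> s) / (bernstein_path \<rho> s - of_real t) *
      vector_derivative (bernstein_path \<rho>) (at s within {0..1})) has_integral (2 * pi * \<i> * F (of_real t))) {0..1}"
    unfolding has_contour_integral_def winding_number_bernstein_path[OF \<rho> t] by simp
  then have "((\<lambda>s. F (bernstein_path \<rho> s) / (bernstein_path \<rho> s - of_real t) *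
      ((2 * pi) *\<^sub>R bernstein_deriv \<rho> (2 * pi * s))) has_integral (2 * pi * \<i> * F (of_real t))) {0..1}"
    by (rule has_integral_eq[rotated])
       (simp add: vector_derivative_within_cbox[OF _ _ bernstein_path_has_vector_derivative, of 0 1, simplified])
  then have "((\<lambda>s. (2 * pi) *\<^sub>R (F (bernstein_curve \<rho> (2 * pi * s)) / (bernstein_curve \<rho> (2 * pi * s) - of_real t) *
      bernstein_deriv \<rho> (2 * pi * s))) has_integral (2 * pi * \<i> * F (of_real t))) (cbox 0 1)"
    by (simp add: bernstein_path_def)
  then have "((\<lambda>s. (1 / (2 * pi)) *\<^sub>R (2 * pi) *\<^sub>R (F (bernstein_curve \<rho> (2 * pi * s)) / (bernstein_curve \<rho> (2 * pi * s) - of_real t) *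
      bernstein_deriv \<rho> (2 * pi * s))) has_integral (1 / (2 * pi)) *\<^sub>R (2 * pi * \<i> * F (of_real t))) (cbox 0 1)"
    by (rule has_integral_cmul)
  then have *: "((\<lambda>s. F (bernstein_curve \<rho> (2 * pi * s + 0)) / (bernstein_curve \<rho> (2 * pi * s + 0) - of_real t) *
      bernstein_deriv \<rho> (2 * pi * s + 0)) has_integral (1 / (2 * pi)) *\<^sub>R (2 * pi * \<i> * F (of_real t))) {0..1}"
    by simp
  show ?thesis
    using has_integral_affinity'[of _ _ 0 1 "1 / (2 * pi)" 0, OF *[folded box_real]] by simp
qed

section \<open>Coercive linear systems\<close>

text \<open>Elimination by Schur complements: the Schur complement inherits the coercivity constant,
  because the form of the complement at \<open>c\<close> is the full form at the minimizing extension of \<open>c\<close>.\<close>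

lemma coercive_system_solution:
  fixes A :: "nat \<Rightarrow> nat \<Rightarrow> 'z \<Rightarrow> complex" and b :: "nat \<Rightarrow> 'z \<Rightarrow> complex"
  assumes R_add: "\<And>f g. f \<in> R \<Longrightarrow> g \<in> R \<Longrightarrow> (\<lambda>z. f z + g z) \<in> R"
    and R_mult: "\<And>f g. f \<in> R \<Longrightarrow> g \<in> R \<Longrightarrow> (\<lambda>z. f z * g z) \<in> R"
    and R_const: "\<And>c. (\<lambda>z. c) \<in> R"
    and R_inverse: "\<And>f. f \<in> R \<Longrightarrow> (\<And>z. z \<in> Z \<Longrightarrow> f z \<noteq> 0) \<Longrightarrow> (\<lambda>z. inverse (f z)) \<in> R"
    and A: "\<And>i j. i < N \<Longrightarrow> j < N \<Longrightarrow> A i j \<in> R"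
    and b: "\<And>i. i < N \<Longrightarrow> b i \<in> R"
    and eps: "\<epsilon> > 0"
    and coercive: "\<And>z c. z \<in> Z \<Longrightarrow>
      \<epsilon> * (\<Sum>i<N. (cmod (c i))\<^sup>2) \<le> Re (\<Sum>i<N. \<Sum>j<N. cnj (c i) * A i j z * c j)"
  shows "\<exists>c. (\<forall>i<N. c i \<in> R) \<and> (\<forall>z\<in>Z. \<forall>i<N. (\<Sum>j<N. A i j z * c j z) = b i z)"
  using A b coercive
proof (induction N arbitrary: A b)
  case 0
  then show ?case by simp
next
  case (Suc N)
  define p where "p z = inverse (A N N z)" for z
  \<comment> \<open>Coercivity tested on the last unit vector: a zero pivot would contradict
    \<epsilon> > 0.\<close>
  have ANN: "A N N z \<noteq> 0" if "z \<in> Z" for z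
  proof
    assume 0: "A N N z = 0"
    have "\<epsilon> * (\<Sum>i<Suc N. (cmod (if i = N then 1 else 0))\<^sup>2)
      \<le> Re (\<Sum>i<Suc N. \<Sum>j<Suc N. cnj (if i = N then 1 else 0) * A i j z * (if j = N then 1 else 0))"
      by (rule Suc.prems(3)[OF that])
    also have "(\<Sum>i<Suc N. \<Sum>j<Suc N. cnj (if i = N then 1 else 0) * A i j z * (if j = N then 1 else 0)) = 0"
      by (simp add: 0)
    finally show False using eps by simp
  qed
  have pR: "p \<in> R" unfolding p_def by (intro R_inverse ANN Suc.prems(1)) auto
  define S where "S i j z = A i j z + (-1) * (A i N z * (p z * A N j z))" for i j z
  define b' where "b' i z = b i z + (-1) * (A i N z * (p z * b N z))" for i z
  have "\<exists>c. (\<forall>i<N. c i \<in> R) \<and> (\<forall>z\<in>Z. \<forall>i<N. (\<Sum>j<N. S i j z * c j z) = b' i z)"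
  proof (rule Suc.IH)
    show "S i j \<in> R" if "i < N" "j < N" for i j
      unfolding S_def by (intro R_add R_mult R_const pR Suc.prems(1)) (use that in auto)
    show "b' i \<in> R" if "i < N" for i
      unfolding b'_def by (intro R_add R_mult R_const pR Suc.prems(1,2)) (use that in auto)
    fix z and c :: "nat \<Rightarrow> complex"
    assume z: "z \<in> Z"
    define s where "s = (\<Sum>j<N. A N j z * c j)"
    \<comment> \<open>The last entry is chosen so that the last row annihilates \<open>d\<close>;
      the remaining rows then act on it as the Schur complement acts on \<open>c\<close>.\<close>
    define d where "d i = (if i = N then - p z * s else c i)" for i
    have row: "(\<Sum>j<Suc N. A i j z * d j) = (\<Sum>j<N. S i j z * c j)" for i
    proof -
      have "(\<Sum>j<Suc N. A i j z * d j) = (\<Sum>j<N. A i j z * c j) + A i N z * (- p z * s)"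
        by (simp add: d_def)
      also have "\<dots> = (\<Sum>j<N. S i j z * c j)"
        unfolding s_def S_def by (simp add: sum_distrib_left sum_subtractf algebra_simps sum_negf)
      finally show ?thesis .
    qed
    have rowN: "(\<Sum>j<Suc N. A N j z * d j) = 0"
      using ANN[OF z] by (simp add: d_def s_def p_def)
    have "\<epsilon> * (\<Sum>i<N. (cmod (c i))\<^sup>2) \<le> \<epsilon> * (\<Sum>i<Suc N. (cmod (d i))\<^sup>2)"
      using eps by (simp add: d_def)
    also have "\<dots> \<le> Re (\<Sum>i<Suc N. \<Sum>j<Suc N. cnj (d i) * A i j z * d j)"
      by (rule Suc.prems(3)[OF z])
    also have "(\<Sum>i<Suc N. \<Sum>j<Suc N. cnj (d i) * A i j z * d j) = (\<Sum>i<Suc N. cnj (d i) * (\<Sum>j<Suc N. A i j z * d j))"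
      by (simp only: sum_distrib_left mult.assoc)
    also have "\<dots> = (\<Sum>i<N. cnj (d i) * (\<Sum>j<Suc N. A i j z * d j))"
      unfolding sum.lessThan_Suc[of _ N] rowN[unfolded sum.lessThan_Suc] by simp
    also have "\<dots> = (\<Sum>i<N. \<Sum>j<N. cnj (c i) * S i j z * c j)"
      unfolding row by (simp add: d_def sum_distrib_left mult.assoc)
    finally show "\<epsilon> * (\<Sum>i<N. (cmod (c i))\<^sup>2) \<le> Re (\<Sum>i<N. \<Sum>j<N. cnj (c i) * S i j z * c j)" .
  qed
  then obtain c where c: "\<And>i. i < N \<Longrightarrow> c i \<in> R"
    and sol: "\<And>z i. z \<in> Z \<Longrightarrow> i < N \<Longrightarrow> (\<Sum>j<N. S i j z * c j z) = b' i z" by blast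
  \<comment> \<open>Back substitution for the last unknown.\<close>
  define d where "d i = (if i = N then (\<lambda>z. p z * (b N z + (-1) * (\<Sum>j<N. A N j z * c j z))) else c i)" for i
  have R_sum: "(\<lambda>z. \<Sum>j<n. f j z) \<in> R" if "\<And>j. j < n \<Longrightarrow> f j \<in> R" for f and n :: nat
    using that by (induction n) (auto intro: R_const R_add)
  show ?case
  proof (intro exI[of _ d] conjI ballI allI impI)
    show "d i \<in> R" if "i < Suc N" for i
    proof (cases "i = N")
      case True
      have "(\<lambda>z. p z * (b N z + (-1) * (\<Sum>j<N. A N j z * c j z))) \<in> R"
        by (intro R_add R_mult R_const R_sum pR c Suc.prems(1,2)) auto
      then show ?thesis by (simp add: d_def True)
    qed (use that c in \<open>auto simp: d_def\<close>)
    fix z i assume z: "z \<in> Z" and i: "i < Suc N"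
    define s where "s = (\<Sum>j<N. A N j z * c j z)"
    have eq: "(\<Sum>j<Suc N. A i j z * d j z) = (\<Sum>j<N. A i j z * c j z) + A i N z * (p z * (b N z - s))"
      by (simp add: d_def s_def)
    show "(\<Sum>j<Suc N. A i j z * d j z) = b i z"
    proof (cases "i = N")
      case True
      then show ?thesis unfolding eq using ANN[OF z]
        by (simp add: s_def p_def mult.assoc[symmetric])
    next
      case False
      have "(\<Sum>j<N. A i j z * c j z) = (\<Sum>j<N. S i j z * c j z) + A i N z * (p z * s)"
        unfolding s_def S_def by (simp add: sum_distrib_left sum_subtractf algebra_simps sum_negf)
      also have "(\<Sum>j<N. S i j z * c j z) = b i z - A i N z * (p z * b N z)"
        using sol[OF z, of i] False i by (simp add: b'_def)
      finally show ?thesis unfolding eq by (simp add: algebra_simps)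
    qed
  qed
qed

section \<open>Tensorized Legendre functionals of holomorphic functions\<close>

definition vec_upd :: "'a^'d \<Rightarrow> 'd \<Rightarrow> 'a \<Rightarrow> 'a^'d" where
  "vec_upd z j t = (\<chi> i. if i = j then t else z $ i)"

lemma vec_upd_nth [simp]: "vec_upd z j t $ i = (if i = j then t else z $ i)"
  by (simp add: vec_upd_def)

definition filled_polyellipse :: "real^'d \<Rightarrow> (complex^'d) set" where
  "filled_polyellipse \<rho> = {z. \<forall>j. z $ j \<in> filled_ellipse (\<rho> $ j)}"

text \<open>Joint continuity up to the boundary and holomorphy in each variable separately: this
  suffices to apply Cauchy's formula and the maximum principle one variable at a time, and it is
  preserved by sums, products and inverses, as elimination demands.\<close>

definition ellipse_holomorphic :: "real^'d \<Rightarrow> (complex^'d \<Rightarrow> complex) set" where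
  "ellipse_holomorphic \<rho> = {F. continuous_on (filled_polyellipse \<rho>) F \<and>
     (\<forall>z\<in>filled_polyellipse \<rho>. \<forall>j. (\<lambda>t. F (vec_upd z j t)) holomorphic_on interior (filled_ellipse (\<rho> $ j)))}"

definition vec_of_real :: "real^'d \<Rightarrow> complex^'d" where
  "vec_of_real y = (\<chi> j. complex_of_real (y $ j))"

lemma vec_upd_in_filled_polyellipse:
  "z \<in> filled_polyellipse \<rho> \<Longrightarrow> t \<in> filled_ellipse (\<rho> $ j) \<Longrightarrow> vec_upd z j t \<in> filled_polyellipse \<rho>"
  by (auto simp: filled_polyellipse_def)

lemma continuous_on_vec_upd: "continuous_on S (\<lambda>t. vec_upd (z :: 'a::topological_space^'d) j t)"
  unfolding vec_upd_def
proof (intro continuous_on_vec_lambda)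
  show "continuous_on S (\<lambda>t. if i = j then t else z $ i)" for i
    by (cases "i = j") (auto intro: continuous_intros)
qed

lemma closed_filled_polyellipse: "closed (filled_polyellipse \<rho>)"
proof -
  have "filled_polyellipse \<rho> = (\<Inter>j. (\<lambda>z. z $ j) -` filled_ellipse (\<rho> $ j))"
    by (auto simp: filled_polyellipse_def)
  moreover have "closed ((\<lambda>z. z $ j) -` filled_ellipse (\<rho> $ j))" for j
    by (intro closed_vimage closed_filled_ellipse continuous_intros)
  ultimately show ?thesis by auto
qed

lemma vec_of_real_in_filled_polyellipse:
  assumes "\<And>j. 1 < \<rho> $ j" "y \<in> Gam"
  shows "vec_of_real y \<in> filled_polyellipse \<rho>"
  unfolding filled_polyellipse_def mem_Collect_eq
proof
  fix j
  have "complex_of_real (y $ j) \<in> interior (filled_ellipse (\<rho> $ j))"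
    using assms(2) by (intro interval_in_interior_filled_ellipse assms(1)) (simp add: Gam_def)
  then show "vec_of_real y $ j \<in> filled_ellipse (\<rho> $ j)"
    using interior_subset by (auto simp: vec_of_real_def)
qed

lemma ellipse_holomorphic_slice:
  assumes F: "F \<in> ellipse_holomorphic \<rho>" and z: "z \<in> filled_polyellipse \<rho>"
  shows "continuous_on (filled_ellipse (\<rho> $ j)) (\<lambda>t. F (vec_upd z j t))"
    and "(\<lambda>t. F (vec_upd z j t)) holomorphic_on interior (filled_ellipse (\<rho> $ j))"
proof -
  show "continuous_on (filled_ellipse (\<rho> $ j)) (\<lambda>t. F (vec_upd z j t))"
    by (rule continuous_on_compose2[OF _ continuous_on_vec_upd, of "filled_polyellipse \<rho>"])
       (use F z in \<open>auto simp: ellipse_holomorphic_def intro: vec_upd_in_filled_polyellipse\<close>)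
qed (use F z in \<open>auto simp: ellipse_holomorphic_def\<close>)

text \<open>The density, in the parameter of the ellipse, that represents the normalized Legendre
  functional; it includes Cauchy's 1/(2 pi i) and the derivative of the curve.\<close>

definition legendre_cauchy_kernel :: "nat \<Rightarrow> real \<Rightarrow> real \<Rightarrow> complex" where
  "legendre_cauchy_kernel k \<rho> t = (of_real (real k + 1/2) / (2 * pi * \<i>))
     * (legendre_Q_kernel k (bernstein_curve \<rho> t) * bernstein_deriv \<rho> t)"

lemma continuous_on_legendre_cauchy_kernel:
  assumes \<rho>: "1 < \<rho>"
  shows "continuous_on S (legendre_cauchy_kernel k \<rho>)"
proof -
  have "continuous_on S (\<lambda>t. legendre_Q_kernel k (bernstein_curve \<rho> t))"
    unfolding legendre_Q_kernel_def box_real[symmetric]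
  proof (rule integral_continuous_on_param)
    have "bernstein_curve \<rho> x - of_real t \<noteq> 0" if "t \<in> {-1..1}" for x t
      using joukowski_not_in_interval[OF _ that, of "of_real \<rho> * cis x"] \<rho>
      by (simp add: bernstein_curve_def norm_mult)
    then show "continuous_on (S \<times> cbox (-1) 1) (\<lambda>(x, t). complex_of_real (legendre k t) / (bernstein_curve \<rho> x - of_real t))"
      unfolding split_beta by (intro continuous_intros) auto
  qed
  then show ?thesis
    unfolding legendre_cauchy_kernel_def by (intro continuous_intros)
qed

text \<open>Cauchy's formula is inserted for F(s); after the exchange of integrals the inner one
  over s is the second-kind function at a point of the ellipse.\<close>

lemma legendre_functional_eq_kernel:
  assumes \<rho>: "1 < \<rho>"
    and cont: "continuous_on (filled_ellipse \<rho>) F"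
    and hol: "F holomorphic_on interior (filled_ellipse \<rho>)"
  shows "integral {-1..1} (\<lambda>s. of_real ((real k + 1/2) * legendre k s) * F (of_real s))
    = integral {0..2*pi} (\<lambda>t. legendre_cauchy_kernel k \<rho> t * F (bernstein_curve \<rho> t))"
proof -
  define c :: complex where "c = of_real (real k + 1/2) / (2 * pi * \<i>)"
  define h where "h s t = F (bernstein_curve \<rho> t) / (bernstein_curve \<rho> t - of_real s) * bernstein_deriv \<rho> t * of_real (legendre k s)"
    for s t :: real
  have inE: "bernstein_curve \<rho> t \<in> filled_ellipse \<rho>" for t
    using bernstein_curve_in_ellipse[OF \<rho>] bernstein_ellipse_subset[OF \<rho>] by blast
  have nz: "bernstein_curve \<rho> x - of_real t \<noteq> 0" if "t \<in> {-1..1}" for x t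
    using joukowski_not_in_interval[OF _ that, of "of_real \<rho> * cis x"] \<rho>
    by (simp add: bernstein_curve_def norm_mult)
  have "integral {-1..1} (\<lambda>s. of_real ((real k + 1/2) * legendre k s) * F (of_real s))
      = integral {-1..1} (\<lambda>s. c * integral {0..2*pi} (h s))"
  proof (rule integral_cong)
    fix s :: real assume s: "s \<in> {-1..1}"
    have "(h s has_integral (2 * pi * \<i> * F (of_real s)) * of_real (legendre k s)) {0..2*pi}"
      unfolding h_def[abs_def] by (intro has_integral_mult_left bernstein_cauchy_formula[OF \<rho> s cont hol])
    then have "c * integral {0..2*pi} (h s) = (c * (2 * pi * \<i>)) * (F (of_real s) * of_real (legendre k s))"
      by (simp add: integral_unique mult_ac)
    also have "c * (2 * pi * \<i>) = of_real (real k + 1/2)"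
      by (simp add: c_def)
    finally show "of_real ((real k + 1/2) * legendre k s) * F (of_real s) = c * integral {0..2*pi} (h s)"
      by simp
  qed
  also have "\<dots> = c * integral {-1..1} (\<lambda>s. integral {0..2*pi} (h s))"
    by (rule integral_mult_right)
  also have "integral {-1..1} (\<lambda>s. integral {0..2*pi} (h s)) = integral {0..2*pi} (\<lambda>t. integral {-1..1} (\<lambda>s. h s t))"
    unfolding box_real[symmetric]
  proof (rule integral_swap_continuous)
    have "continuous_on (cbox (-1, 0) (1, 2 * pi)) (\<lambda>x. F (bernstein_curve \<rho> (snd x)))"
      by (rule continuous_on_compose2[OF cont]) (auto intro!: continuous_intros inE)
    then show "continuous_on (cbox (-1, 0) (1, 2 * pi)) (\<lambda>(s, t). h s t)"
      unfolding h_def split_beta by (intro continuous_intros) (use nz in auto)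
  qed
  also have "\<dots> = integral {0..2*pi} (\<lambda>t. F (bernstein_curve \<rho> t) * bernstein_deriv \<rho> t * legendre_Q_kernel k (bernstein_curve \<rho> t))"
  proof (rule integral_cong)
    fix t
    have "(\<lambda>s. h s t) = (\<lambda>s. F (bernstein_curve \<rho> t) * bernstein_deriv \<rho> t * (of_real (legendre k s) / (bernstein_curve \<rho> t - of_real s)))"
      by (simp add: h_def)
    then show "integral {-1..1} (\<lambda>s. h s t) = F (bernstein_curve \<rho> t) * bernstein_deriv \<rho> t * legendre_Q_kernel k (bernstein_curve \<rho> t)"
      unfolding legendre_Q_kernel_def by (simp only: integral_mult_right)
  qed
  also have "c * \<dots> = integral {0..2*pi} (\<lambda>t. legendre_cauchy_kernel k \<rho> t * F (bernstein_curve \<rho> t))"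
    unfolding integral_mult_right[symmetric] legendre_cauchy_kernel_def c_def by (simp add: mult_ac)
  finally show ?thesis .
qed

text \<open>The factor 2 in the kernel bound cancels the 2 in Cauchy's 1/(2 pi), which leaves arc
  length over pi.\<close>

lemma integral_legendre_cauchy_kernel_le:
  assumes \<rho>: "1 < \<rho>"
  shows "integral {0..2*pi} (\<lambda>t. cmod (legendre_cauchy_kernel k \<rho> t)) \<le> bernstein_length \<rho> / pi * legendre_const k \<rho>"
proof -
  have "cmod (legendre_cauchy_kernel k \<rho> t) \<le> (legendre_const k \<rho> / pi) * cmod (bernstein_deriv \<rho> t)" for t
  proof -
    have "cmod (legendre_cauchy_kernel k \<rho> t) = ((real k + 1/2) * cmod (legendre_Q_kernel k (bernstein_curve \<rho> t))) * (cmod (bernstein_deriv \<rho> t) / (2 * pi))"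
      by (simp add: legendre_cauchy_kernel_def norm_mult norm_divide del: of_real_add)
    also have "\<dots> \<le> (2 * legendre_const k \<rho>) * (cmod (bernstein_deriv \<rho> t) / (2 * pi))"
      using legendre_Q_kernel_bound[of "of_real \<rho> * cis t" \<rho> k] \<rho>
      by (intro mult_right_mono) (auto simp: bernstein_curve_def norm_mult)
    finally show ?thesis by simp
  qed
  then have "integral {0..2*pi} (\<lambda>t. cmod (legendre_cauchy_kernel k \<rho> t))
      \<le> integral {0..2*pi} (\<lambda>t. (legendre_const k \<rho> / pi) * cmod (bernstein_deriv \<rho> t))"
    by (intro integral_le integrable_continuous_interval continuous_intros continuous_on_legendre_cauchy_kernel \<rho>) auto
  also have "\<dots> = bernstein_length \<rho> / pi * legendre_const k \<rho>"
    unfolding integral_mult_right bernstein_length_alt by simp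
  finally show ?thesis .
qed

lemma integrable_lborel_indicator_mult:
  fixes f :: "real \<Rightarrow> complex"
  assumes "continuous_on {a..b} f"
  shows "integrable lborel (\<lambda>x. indicator {a..b} x * f x)"
    and "integral\<^sup>L lborel (\<lambda>x. indicator {a..b} x * f x) = integral {a..b} f"
proof -
  have eq: "(\<lambda>x. indicator {a..b} x * f x) = (\<lambda>x. indicator {a..b} x *\<^sub>R f x)"
    by (auto simp: indicator_def)
  have s: "set_integrable lborel {a..b} f"
    by (rule borel_integrable_atLeastAtMost'[OF assms])
  then show "integrable lborel (\<lambda>x. indicator {a..b} x * f x)"
    unfolding eq set_integrable_def .
  show "integral\<^sup>L lborel (\<lambda>x. indicator {a..b} x * f x) = integral {a..b} f"
    using set_borel_integral_eq_integral(2)[OF s] unfolding eq set_lebesgue_integral_def .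
qed

text \<open>Variables are exchanged one at a time: for a set S of indices, the coordinates in S run
  over ellipses with the Cauchy density and the others over [-1, 1] with the Legendre weight. The
  integral does not depend on S. For S empty it is the functional; for S = UNIV, F is bounded by B
  and the densities factor.\<close>

lemma tensor_legendre_functional_bound:
  fixes F :: "complex^'d \<Rightarrow> complex" and k :: "'d \<Rightarrow> nat"
  assumes \<rho>: "\<And>j. 1 < \<rho> $ j"
    and F: "F \<in> ellipse_holomorphic \<rho>"
    and bound: "\<And>z. z \<in> filled_polyellipse \<rho> \<Longrightarrow> cmod (F z) \<le> B"
  shows "cmod ((\<Prod>j\<in>UNIV. of_real (real (k j) + 1/2)) *
      integral\<^sup>L (lebesgue_on Gam) (\<lambda>y. F (vec_of_real y) * of_real (legendre_tensor k y)))
    \<le> B * (\<Prod>j\<in>UNIV. bernstein_length (\<rho> $ j) / pi * legendre_const (k j) (\<rho> $ j))"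
proof -
  define Z where "Z = filled_polyellipse \<rho>"
  \<comment> \<open>Extension by zero to a Borel function on the whole space, so that every integral
    can be taken over the full product of real lines; the weights below carry the indicators of the
    actual ranges.\<close>
  define F' where "F' z = indicator Z z *\<^sub>R F z" for z
  have F'm [measurable]: "F' \<in> borel_measurable borel"
    unfolding F'_def Z_def
    by (rule borel_measurable_continuous_on_indicator)
       (use F closed_filled_polyellipse borel_closed in \<open>auto simp: ellipse_holomorphic_def\<close>)
  have "vec_of_real (0 :: real^'d) \<in> Z"
    unfolding Z_def by (rule vec_of_real_in_filled_polyellipse[OF \<rho>]) (simp add: Gam_def)
  then have B0: "B \<ge> 0" using bound norm_ge_zero order_trans unfolding Z_def by blast
  have F'b: "cmod (F' z) \<le> B" for z
    using bound[of z] B0 by (auto simp: F'_def Z_def indicator_def)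
  define pt where "pt S j t = (if j \<in> S then bernstein_curve (\<rho> $ j) t else of_real t)" for S j t
  define w :: "'d set \<Rightarrow> 'd \<Rightarrow> real \<Rightarrow> complex" where
    "w S j t = (if j \<in> S then indicator {0..2*pi} t * legendre_cauchy_kernel (k j) (\<rho> $ j) t
                else indicator {-1..1} t * of_real ((real (k j) + 1/2) * legendre (k j) t))" for S j t
  have wint: "integrable lborel (w S j)" for S j
  proof (cases "j \<in> S")
    case True
    then show ?thesis
      unfolding w_def by (simp add: integrable_lborel_indicator_mult(1)[OF continuous_on_legendre_cauchy_kernel[OF \<rho>]])
  next
    case False
    have "continuous_on {-1..1} (\<lambda>t. complex_of_real ((real (k j) + 1/2) * legendre (k j) t))"
      by (intro continuous_intros)
    from integrable_lborel_indicator_mult(1)[OF this] show ?thesis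
      unfolding w_def using False by simp
  qed
  \<comment> \<open>Lets nonvanishing of the weights stand in for membership in the domain of
    F.\<close>
  have win: "pt S j t \<in> filled_ellipse (\<rho> $ j)" if "w S j t \<noteq> 0" for S j t
    using that interval_in_interior_filled_ellipse[OF \<rho>, of t j] interior_subset[of "filled_ellipse (\<rho> $ j)"]
      bernstein_curve_in_ellipse[OF \<rho>, of j t] bernstein_ellipse_subset[OF \<rho>, of j]
    by (auto simp: w_def pt_def indicator_def split: if_splits)
  \<comment> \<open>The product measure is indexed by basis vectors rather than by coordinates, to
    match the description of \<open>lborel\<close> as an image of such a product.\<close>
  define e :: "'d \<Rightarrow> real^'d" where "e j = axis j 1" for j
  have inj: "inj e" unfolding e_def by (auto simp: inj_def axis_eq_axis)
  have Bas: "Basis = range e" by (auto simp: Basis_vec_def e_def)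
  define P where "P = Pi\<^sub>M (Basis :: (real^'d) set) (\<lambda>_. lborel :: real measure)"
  interpret product_sigma_finite "\<lambda>_ :: real^'d. lborel :: real measure"
    by standard
  have meas_comp [measurable]: "(\<lambda>x. x (e j)) \<in> borel_measurable P" for j
    unfolding P_def using measurable_component_singleton[of "e j" Basis "\<lambda>_. lborel"] by (simp add: Bas)
  define W where "W S x = (\<Prod>j\<in>UNIV. w S j (x (e j)))" for S x
  define G where "G S x = W S x * F' (\<chi> j. pt S j (x (e j)))" for S x
  have wm [measurable]: "w S j \<in> borel_measurable borel" for S j
    using borel_measurable_integrable[OF wint] by simp
  have ptm [measurable]: "pt S j \<in> borel_measurable borel" for S j
  proof -
    have "continuous_on UNIV (pt S j)" unfolding pt_def by (cases "j \<in> S") (auto intro!: continuous_intros)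
    then show ?thesis by (rule borel_measurable_continuous_onI)
  qed
  have intB: "integrable P (\<lambda>x. \<Prod>b\<in>Basis. w S (inv e b) (x b))" for S
    unfolding P_def by (intro product_integrable_prod wint) auto
  have prodB: "(\<Prod>b\<in>Basis. f (inv e b) b) = (\<Prod>j\<in>UNIV. f j (e j))" for f :: "'d \<Rightarrow> real^'d \<Rightarrow> complex"
    unfolding Bas using inj by (simp add: prod.reindex inv_f_f)
  have prodB': "(\<Prod>b\<in>Basis. f (inv e b) b) = (\<Prod>j\<in>UNIV. f j (e j))" for f :: "'d \<Rightarrow> real^'d \<Rightarrow> real"
    unfolding Bas using inj by (simp add: prod.reindex inv_f_f)
  have "(\<lambda>x. \<Prod>b\<in>Basis. w S (inv e b) (x b)) = W S" for S
    by (rule ext) (simp only: W_def prodB[of "\<lambda>j b. w S j (x b)" for x])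
  with intB have Wint: "integrable P (W S)" for S by simp
  have vm: "(\<lambda>x. \<chi> j. pt S j (x (e j))) \<in> borel_measurable P" for S
  proof -
    have "(\<lambda>x. pt S j (x (e j)) \<bullet> c) \<in> borel_measurable P" for j c by measurable
    then show ?thesis
      unfolding borel_measurable_euclidean_space[where 'c = "complex^'d"]
      by (auto simp: Basis_vec_def inner_axis)
  qed
  have Gint: "integrable P (G S)" for S
  proof (rule Bochner_Integration.integrable_bound[OF integrable_mult_right[OF integrable_norm[OF Wint[of S]], of B]])
    show "G S \<in> borel_measurable P"
      unfolding G_def using borel_measurable_integrable[OF Wint] vm F'm by (intro borel_measurable_times measurable_compose[OF vm F'm]) auto
    show "AE x in P. norm (G S x) \<le> norm (B * norm (W S x))"
      using F'b B0 by (auto simp: G_def norm_mult mult.commute[of B] intro!: AE_I2 mult_left_mono)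
  qed
  \<comment> \<open>One coordinate is split off by Fubini. The other factors are the same for S and
    \<open>insert j S\<close>, so the one-variable identity
    \<open>legendre_functional_eq_kernel\<close> applies to the inner integral.\<close>
  have step: "integral\<^sup>L P (G (insert j S)) = integral\<^sup>L P (G S)" if j: "j \<notin> S" for j S
  proof -
    define I where "I = (Basis :: (real^'d) set) - {e j}"
    have I: "finite I" "e j \<notin> I" "Basis = insert (e j) I" by (auto simp: I_def Bas)
    have split: "integral\<^sup>L P (G T) = (\<integral>x. (\<integral>y. G T (x(e j := y)) \<partial>lborel) \<partial>Pi\<^sub>M I (\<lambda>_. lborel))" for T
      unfolding P_def I(3) by (rule product_integral_insert[OF I(1,2)]) (use Gint[of T] in \<open>simp add: P_def I(3)\<close>)
    have "(\<integral>y. G (insert j S) (x(e j := y)) \<partial>lborel) = (\<integral>y. G S (x(e j := y)) \<partial>lborel)" for x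
    proof -
      have ej: "e i = e j \<longleftrightarrow> i = j" for i using inj by (auto simp: inj_def)
      define R where "R = (\<Prod>i\<in>UNIV - {j}. w S i (x (e i)))"
      define z where "z t = (\<chi> i. if i = j then t else pt S i (x (e i)))" for t
      have WT: "W T (x(e j := y)) = w T j y * R" if "T = S \<or> T = insert j S" for T y
      proof -
        have "W T (x(e j := y)) = w T j y * (\<Prod>i\<in>UNIV - {j}. w T i ((x(e j := y)) (e i)))"
          unfolding W_def by (subst prod.remove[of _ j]) auto
        also have "(\<Prod>i\<in>UNIV - {j}. w T i ((x(e j := y)) (e i))) = R"
          unfolding R_def using that by (intro prod.cong) (auto simp: ej w_def)
        finally show ?thesis .
      qed
      have zT: "(\<chi> i. pt T i ((x(e j := y)) (e i))) = z (pt T j y)" if "T = S \<or> T = insert j S" for T y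
        unfolding z_def vec_eq_iff using that by (auto simp: ej pt_def)
      have GT: "G T (x(e j := y)) = R * (w T j y * F' (z (pt T j y)))" if "T = S \<or> T = insert j S" for T y
        unfolding G_def WT[OF that] zT[OF that] by simp
      show ?thesis
      proof (cases "R = 0")
        case True
        then show ?thesis by (simp add: GT)
      next
        case False
        then have "w S i (x (e i)) \<noteq> 0" if "i \<noteq> j" for i
          using that by (auto simp: R_def)
        then have zZ: "z t \<in> Z" if "t \<in> filled_ellipse (\<rho> $ j)" for t
          using win[of S] that by (auto simp: z_def Z_def filled_polyellipse_def)
        define z0 where "z0 = z (of_real 0)"
        have z0: "z0 \<in> filled_polyellipse \<rho>"
          using zZ[of "of_real 0"] interval_in_interior_filled_ellipse[OF \<rho>, of 0 j] interior_subset[of "filled_ellipse (\<rho> $ j)"]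
          by (auto simp: z0_def Z_def)
        have zu: "z t = vec_upd z0 j t" for t
          by (simp add: z0_def z_def vec_upd_def vec_eq_iff)
        have F'z: "w T j y * F' (z (pt T j y)) = w T j y * F (z (pt T j y))" for T y
          using win[of T j y] zZ by (cases "w T j y = 0") (auto simp: F'_def indicator_def)
        have contF: "continuous_on (filled_ellipse (\<rho> $ j)) (\<lambda>t. F (z t))"
          and holF: "(\<lambda>t. F (z t)) holomorphic_on interior (filled_ellipse (\<rho> $ j))"
          unfolding zu by (rule ellipse_holomorphic_slice[OF F z0])+
        have "(\<integral>y. w S j y * F (z (pt S j y)) \<partial>lborel) =
            (\<integral>y. indicator {-1..1} y * (of_real ((real (k j) + 1/2) * legendre (k j) y) * F (z (of_real y))) \<partial>lborel)"
          using j by (simp add: w_def pt_def mult_ac)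
        also have "\<dots> = integral {-1..1} (\<lambda>y. of_real ((real (k j) + 1/2) * legendre (k j) y) * F (z (of_real y)))"
        proof (rule integrable_lborel_indicator_mult(2))
          have "continuous_on {-1..1} (\<lambda>y. F (z (complex_of_real y)))"
            by (rule continuous_on_compose2[OF contF])
               (use interval_in_interior_filled_ellipse[OF \<rho>] interior_subset in \<open>force intro!: continuous_intros\<close>)+
          then show "continuous_on {-1..1} (\<lambda>y. of_real ((real (k j) + 1/2) * legendre (k j) y) * F (z (of_real y)))"
            by (intro continuous_intros)
        qed
        also have "\<dots> = integral {0..2*pi} (\<lambda>t. legendre_cauchy_kernel (k j) (\<rho> $ j) t * F (z (bernstein_curve (\<rho> $ j) t)))"
          by (rule legendre_functional_eq_kernel[OF \<rho> contF holF])
        also have "\<dots> = (\<integral>t. indicator {0..2*pi} t * (legendre_cauchy_kernel (k j) (\<rho> $ j) t * F (z (bernstein_curve (\<rho> $ j) t))) \<partial>lborel)"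
        proof (rule integrable_lborel_indicator_mult(2)[symmetric])
          have "continuous_on {0..2*pi} (\<lambda>t. F (z (bernstein_curve (\<rho> $ j) t)))"
            by (rule continuous_on_compose2[OF contF])
               (use bernstein_curve_in_ellipse[OF \<rho>] bernstein_ellipse_subset[OF \<rho>] in \<open>force intro!: continuous_intros\<close>)+
          then show "continuous_on {0..2*pi} (\<lambda>t. legendre_cauchy_kernel (k j) (\<rho> $ j) t * F (z (bernstein_curve (\<rho> $ j) t)))"
            by (intro continuous_intros continuous_on_legendre_cauchy_kernel[OF \<rho>])
        qed
        also have "\<dots> = (\<integral>y. w (insert j S) j y * F (z (pt (insert j S) j y)) \<partial>lborel)"
          by (simp add: w_def pt_def mult_ac)
        finally show ?thesis by (simp add: GT F'z)
      qed
    qed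
    then show ?thesis unfolding split by simp
  qed
  have GS: "integral\<^sup>L P (G S) = integral\<^sup>L P (G {})" for S
    using finite[of S] by (induction S rule: finite_induct) (auto simp: step)
  have swap: "integral\<^sup>L P (G {}) = integral\<^sup>L P (G UNIV)" by (rule GS[symmetric])
  have "cmod (integral\<^sup>L P (G UNIV)) \<le> (\<integral>x. cmod (G UNIV x) \<partial>P)"
    by (rule integral_norm_bound)
  also have "\<dots> \<le> (\<integral>x. B * cmod (W UNIV x) \<partial>P)"
    using F'b by (intro integral_mono integrable_norm integrable_mult_right Gint Wint)
      (auto simp: G_def norm_mult mult.commute[of B] intro!: mult_left_mono)
  also have "\<dots> = B * (\<integral>x. (\<Prod>b\<in>Basis. cmod (w UNIV (inv e b) (x b))) \<partial>P)"
  proof -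
    have "cmod (W UNIV x) = (\<Prod>b\<in>Basis. cmod (w UNIV (inv e b) (x b)))" for x
      unfolding prodB'[of "\<lambda>j b. cmod (w UNIV j (x b))"] W_def by (rule prod_norm[symmetric])
    then show ?thesis by simp
  qed
  also have "(\<integral>x. (\<Prod>b\<in>Basis. cmod (w UNIV (inv e b) (x b))) \<partial>P) = (\<Prod>b\<in>Basis. \<integral>t. cmod (w UNIV (inv e b) t) \<partial>lborel)"
    unfolding P_def by (intro product_integral_prod integrable_norm wint) auto
  also have "\<dots> = (\<Prod>j\<in>UNIV. \<integral>t. cmod (w UNIV j t) \<partial>lborel)"
    by (rule prodB')
  also have "\<dots> = (\<Prod>j\<in>UNIV. integral {0..2*pi} (\<lambda>t. cmod (legendre_cauchy_kernel (k j) (\<rho> $ j) t)))"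
  proof (rule prod.cong[OF refl])
    fix j
    have "(\<lambda>t. cmod (w UNIV j t)) = (\<lambda>t. indicator {0..2*pi} t *\<^sub>R cmod (legendre_cauchy_kernel (k j) (\<rho> $ j) t))"
      by (auto simp: w_def norm_mult indicator_def)
    moreover have "set_integrable lborel {0..2*pi} (\<lambda>t. cmod (legendre_cauchy_kernel (k j) (\<rho> $ j) t))"
      by (intro borel_integrable_atLeastAtMost' continuous_intros continuous_on_legendre_cauchy_kernel \<rho>)
    ultimately show "(\<integral>t. cmod (w UNIV j t) \<partial>lborel) = integral {0..2*pi} (\<lambda>t. cmod (legendre_cauchy_kernel (k j) (\<rho> $ j) t))"
      using set_borel_integral_eq_integral(2) unfolding set_lebesgue_integral_def by fastforce
  qed
  also have "B * \<dots> \<le> B * (\<Prod>j\<in>UNIV. bernstein_length (\<rho> $ j) / pi * legendre_const (k j) (\<rho> $ j))"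
    using B0 integral_legendre_cauchy_kernel_le[OF \<rho>]
    by (intro mult_left_mono prod_mono conjI integral_nonneg integrable_continuous_interval continuous_intros
        continuous_on_legendre_cauchy_kernel \<rho>) auto
  finally have main: "cmod (integral\<^sup>L P (G {})) \<le> B * (\<Prod>j\<in>UNIV. bernstein_length (\<rho> $ j) / pi * legendre_const (k j) (\<rho> $ j))"
    unfolding swap .
  \<comment> \<open>Back to Lebesgue measure: \<open>H\<close> is the integrand for S empty as a
    function on the parameter space, and the weights make it vanish off \<open>Gam\<close>.\<close>
  define H where "H y = (\<Prod>j\<in>UNIV. w {} j (y $ j)) * F' (vec_of_real y)" for y :: "real^'d"
  have sumv: "(\<Sum>b\<in>Basis. x b *\<^sub>R b) $ j = x (e j)" for x :: "real^'d \<Rightarrow> real" and j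
  proof -
    have "(\<Sum>b\<in>Basis. x b *\<^sub>R b) $ j = (\<Sum>b\<in>Basis. x b *\<^sub>R b) \<bullet> e j"
      by (simp add: e_def inner_axis)
    also have "\<dots> = x (e j)" by (rule inner_sum_left_Basis) (simp add: Bas)
    finally show ?thesis .
  qed
  have Hm: "H \<in> borel_measurable borel"
  proof -
    have "continuous_on UNIV (vec_of_real :: real^'d \<Rightarrow> _)" unfolding vec_of_real_def by (intro continuous_intros)
    then have [measurable]: "(vec_of_real :: real^'d \<Rightarrow> _) \<in> borel_measurable borel" by (rule borel_measurable_continuous_onI)
    have [measurable]: "(\<lambda>y. y $ j) \<in> borel_measurable (borel :: (real^'d) measure)" for j
      by (intro borel_measurable_continuous_onI continuous_intros)
    show ?thesis unfolding H_def by measurable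
  qed
  have "integral\<^sup>L P (G {}) = (\<integral>x. H (\<Sum>b\<in>Basis. x b *\<^sub>R b) \<partial>P)"
    unfolding H_def G_def W_def sumv vec_of_real_def pt_def by simp
  also have "\<dots> = integral\<^sup>L lborel H"
  proof -
    have "(\<lambda>f. \<Sum>b\<in>Basis. f b *\<^sub>R b) \<in> measurable P (borel :: (real^'d) measure)"
      unfolding P_def
    proof (intro borel_measurable_sum borel_measurable_scaleR borel_measurable_const)
      show "(\<lambda>f. f b) \<in> borel_measurable (Pi\<^sub>M (Basis :: (real^'d) set) (\<lambda>_. lborel :: real measure))" if "b \<in> Basis" for b
        using measurable_component_singleton[OF that, of "\<lambda>_. lborel"] by simp
    qed
    then show ?thesis
      unfolding P_def by (subst (2) lborel_eq) (rule integral_distr[symmetric], use Hm in simp_all)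
  qed
  also have "\<dots> = integral\<^sup>L lebesgue H"
    by (rule integral_completion[symmetric]) (use Hm in simp)
  also have "\<dots> = integral\<^sup>L lebesgue (\<lambda>y. indicator Gam y *\<^sub>R
      ((\<Prod>j\<in>UNIV. of_real (real (k j) + 1/2)) * (F (vec_of_real y) * of_real (legendre_tensor k y))))"
  proof (rule Bochner_Integration.integral_cong[OF refl])
    fix y :: "real^'d"
    show "H y = indicator Gam y *\<^sub>R ((\<Prod>j\<in>UNIV. of_real (real (k j) + 1/2)) * (F (vec_of_real y) * of_real (legendre_tensor k y)))"
    proof (cases "y \<in> Gam")
      case True
      then have "F' (vec_of_real y) = F (vec_of_real y)"
        using vec_of_real_in_filled_polyellipse[OF \<rho>, of y] by (simp add: F'_def Z_def)
      moreover have "(\<Prod>j\<in>UNIV. w {} j (y $ j)) = (\<Prod>j\<in>UNIV. of_real (real (k j) + 1/2)) * of_real (legendre_tensor k y)"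
        using True by (simp add: w_def Gam_def legendre_tensor_def flip: prod.distrib)
      ultimately show ?thesis using True by (simp add: H_def)
    next
      case False
      then obtain j where "y $ j \<notin> {-1..1}" by (auto simp: Gam_def)
      then have "w {} j (y $ j) = 0" by (simp add: w_def)
      then have "H y = 0" unfolding H_def by (metis finite UNIV_I mult_zero_left prod_zero)
      then show ?thesis using False by simp
    qed
  qed
  also have "\<dots> = integral\<^sup>L (lebesgue_on Gam) (\<lambda>y. (\<Prod>j\<in>UNIV. of_real (real (k j) + 1/2)) * (F (vec_of_real y) * of_real (legendre_tensor k y)))"
  proof (rule integral_restrict_space[symmetric])
    have "Gam = cbox (\<chi> j. -1) (\<chi> j. 1 :: real^'d)" by (auto simp: Gam_def mem_box_cart)
    then have "(Gam :: (real^'d) set) \<in> sets lebesgue" using lmeasurable_cbox fmeasurableD by metis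
    then show "Gam \<inter> space (lebesgue :: (real^'d) measure) \<in> sets lebesgue" by simp
  qed
  also have "\<dots> = (\<Prod>j\<in>UNIV. of_real (real (k j) + 1/2)) *
      integral\<^sup>L (lebesgue_on Gam) (\<lambda>y. F (vec_of_real y) * of_real (legendre_tensor k y))"
    by (rule integral_mult_right_zero)
  finally show ?thesis using main by simp
qed

section \<open>Smooth bump functions and the fundamental lemma\<close>

lemma pderivative_eqI:
  "(f has_derivative f') (at x) \<Longrightarrow> pderivative i f x = f' (axis i 1)"
  unfolding pderivative_def by (metis frechet_derivative_at)

text \<open>Coinduction for smoothness: membership in some class of differentiable functions that is
  closed under partial derivatives is enough.\<close>

lemma smooth_funI:
  assumes "f \<in> S" and "\<And>g x. g \<in> S \<Longrightarrow> g differentiable (at x)" and "\<And>g i. g \<in> S \<Longrightarrow> pderivative i g \<in> S"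
  shows "smooth_fun f"
proof -
  have "foldr pderivative is f \<in> S" for "is"
    using assms(1) by (induction "is") (auto intro: assms(3))
  then show ?thesis unfolding smooth_fun_def using assms(2) by blast
qed

lemma smooth_fun_differentiable: "smooth_fun f \<Longrightarrow> f differentiable (at x)"
  unfolding smooth_fun_def by (metis foldr_Nil id_apply)

lemma smooth_fun_has_derivative:
  "smooth_fun f \<Longrightarrow> (f has_derivative frechet_derivative f (at x)) (at x)"
  using smooth_fun_differentiable frechet_derivative_works by blast

lemma smooth_fun_pderivative: "smooth_fun f \<Longrightarrow> smooth_fun (pderivative i f)"
  unfolding smooth_fun_def
proof (intro allI)
  fix "is" x assume "\<forall>is x. foldr pderivative is f differentiable (at x)"
  then have "foldr pderivative (is @ [i]) f differentiable (at x)" by blast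
  then show "foldr pderivative is (pderivative i f) differentiable (at x)" by simp
qed

lemma smooth_fun_continuous: "smooth_fun f \<Longrightarrow> continuous_on S f"
  by (meson differentiable_imp_continuous_within continuous_at_imp_continuous_on smooth_fun_differentiable)

lemma pderivative_add:
  "f differentiable (at x) \<Longrightarrow> g differentiable (at x) \<Longrightarrow>
    pderivative i (\<lambda>x. f x + g x) x = pderivative i f x + pderivative i g x"
  by (subst pderivative_eqI[OF has_derivative_add[OF frechet_derivative_works[THEN iffD1] frechet_derivative_works[THEN iffD1]]])
     (auto simp: pderivative_def)

lemma pderivative_mult:
  "f differentiable (at x) \<Longrightarrow> g differentiable (at x) \<Longrightarrow>
    pderivative i (\<lambda>x. f x * g x) x = pderivative i f x * g x + f x * pderivative i g x"
  by (subst pderivative_eqI[OF has_derivative_mult[OF frechet_derivative_works[THEN iffD1] frechet_derivative_works[THEN iffD1]]])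
     (auto simp: pderivative_def)

lemma pderivative_const: "pderivative i (\<lambda>x. c) = (\<lambda>x. 0)"
  by (rule ext, subst pderivative_eqI[OF has_derivative_const]) simp

lemma smooth_fun_const: "smooth_fun (\<lambda>x. c)"
  by (rule smooth_funI[where S = "range (\<lambda>c x. c)"]) (auto simp: pderivative_const)

text \<open>A single product is not stable under differentiation, but finite sums of products of
  smooth functions are, by Leibniz' rule; lists of pairs encode these sums.\<close>

lemma smooth_fun_mult:
  assumes "smooth_fun f" "smooth_fun g"
  shows "smooth_fun (\<lambda>x. f x * g x)"
proof (rule smooth_funI[where S = "{\<lambda>x. \<Sum>p\<leftarrow>ps. fst p x * snd p x | ps. \<forall>p\<in>set ps. smooth_fun (fst p) \<and> smooth_fun (snd p)}"])
  show "(\<lambda>x. f x * g x) \<in> {\<lambda>x. \<Sum>p\<leftarrow>ps. fst p x * snd p x | ps. \<forall>p\<in>set ps. smooth_fun (fst p) \<and> smooth_fun (snd p)}"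
    using assms by (intro CollectI exI[of _ "[(f, g)]"]) auto
next
  fix h x
  assume "h \<in> {\<lambda>x. \<Sum>p\<leftarrow>ps. fst p x * snd p x | ps. \<forall>p\<in>set ps. smooth_fun (fst p) \<and> smooth_fun (snd p)}"
  then obtain ps where h: "h = (\<lambda>x. \<Sum>p\<leftarrow>ps. fst p x * snd p x)" and ps: "\<forall>p\<in>set ps. smooth_fun (fst p) \<and> smooth_fun (snd p)"
    by auto
  show "h differentiable (at x)"
    unfolding h using ps by (induction ps) (auto intro!: differentiable_add differentiable_mult intro: smooth_fun_differentiable)
next
  fix h :: "real^'n \<Rightarrow> real" and i
  assume "h \<in> {\<lambda>x. \<Sum>p\<leftarrow>ps. fst p x * snd p x | ps. \<forall>p\<in>set ps. smooth_fun (fst p) \<and> smooth_fun (snd p)}"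
  then obtain ps where h: "h = (\<lambda>x. \<Sum>p\<leftarrow>ps. fst p x * snd p x)" and ps: "\<forall>p\<in>set ps. smooth_fun (fst p) \<and> smooth_fun (snd p)"
    by auto
  have diff: "(\<lambda>x. \<Sum>p\<leftarrow>ps. fst p x * snd p x) differentiable (at x)" if "\<forall>p\<in>set ps. smooth_fun (fst p) \<and> smooth_fun (snd p)"
    for ps and x :: "real^'n"
    using that by (induction ps) (auto intro!: differentiable_add differentiable_mult intro: smooth_fun_differentiable)
  have "\<exists>qs. pderivative i h = (\<lambda>x. \<Sum>p\<leftarrow>qs. fst p x * snd p x) \<and> (\<forall>p\<in>set qs. smooth_fun (fst p) \<and> smooth_fun (snd p))"
    unfolding h using ps
  proof (induction ps)
    case Nil
    then show ?case by (intro exI[of _ "[]"]) (simp add: pderivative_const)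
  next
    case (Cons p ps)
    then obtain qs where qs: "pderivative i (\<lambda>x. \<Sum>p\<leftarrow>ps. fst p x * snd p x) = (\<lambda>x. \<Sum>p\<leftarrow>qs. fst p x * snd p x)"
      "\<forall>p\<in>set qs. smooth_fun (fst p) \<and> smooth_fun (snd p)" by auto
    have "pderivative i (\<lambda>x. \<Sum>p\<leftarrow>p # ps. fst p x * snd p x) =
        (\<lambda>x. \<Sum>p\<leftarrow>(pderivative i (fst p), snd p) # (fst p, pderivative i (snd p)) # qs. fst p x * snd p x)"
      using Cons.prems diff[of ps] unfolding qs(1)[symmetric]
      by (auto simp: fun_eq_iff pderivative_add pderivative_mult smooth_fun_differentiable
          fun_cong[OF qs(1)] intro!: differentiable_mult)
    then show ?case using Cons.prems qs(2)
      by (intro exI[of _ "(pderivative i (fst p), snd p) # (fst p, pderivative i (snd p)) # qs"])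
         (auto intro: smooth_fun_pderivative)
  qed
  then show "pderivative i h \<in> {\<lambda>x. \<Sum>p\<leftarrow>ps. fst p x * snd p x | ps. \<forall>p\<in>set ps. smooth_fun (fst p) \<and> smooth_fun (snd p)}"
    by blast
qed

lemma smooth_fun_add:
  assumes "smooth_fun f" "smooth_fun g"
  shows "smooth_fun (\<lambda>x. f x + g x)"
proof (rule smooth_funI[where S = "{\<lambda>x. f x + g x | f g. smooth_fun f \<and> smooth_fun g}"])
  fix h i assume "h \<in> {\<lambda>x. f x + g x | f g. smooth_fun f \<and> smooth_fun g}"
  then obtain f g where h: "h = (\<lambda>x. f x + g x)" and fg: "smooth_fun f" "smooth_fun g" by auto
  have "pderivative i h = (\<lambda>x. pderivative i f x + pderivative i g x)"
    unfolding h by (rule ext) (simp add: fg pderivative_add smooth_fun_differentiable)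
  then show "pderivative i h \<in> {\<lambda>x. f x + g x | f g. smooth_fun f \<and> smooth_fun g}"
    using smooth_fun_pderivative fg by blast
qed (use assms in \<open>auto intro!: differentiable_add intro: smooth_fun_differentiable\<close>)

lemma smooth_fun_prod:
  "(\<And>i. i \<in> I \<Longrightarrow> smooth_fun (f i)) \<Longrightarrow> smooth_fun (\<lambda>x. \<Prod>i\<in>I. f i x)"
  by (induction I rule: infinite_finite_induct) (auto intro: smooth_fun_const smooth_fun_mult)

text \<open>Generalizes exp (-1/t) for t > 0: with a polynomial in 1/t as a factor the family is
  closed under differentiation.\<close>

definition flat_exp :: "real poly \<Rightarrow> real \<Rightarrow> real" where
  "flat_exp p t = (if 0 < t then poly p (1 / t) * exp (- (1 / t)) else 0)"

lemma tendsto_poly_div_exp_0: "((\<lambda>x. poly p x * exp (- x)) \<longlongrightarrow> (0::real)) at_top"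
proof -
  have "((\<lambda>x. \<Sum>i\<le>degree p. coeff p i * (x ^ i / exp x)) \<longlongrightarrow> (\<Sum>i\<le>degree p. coeff p i * (0::real))) at_top"
    by (intro tendsto_sum tendsto_mult_left tendsto_power_div_exp_0)
  then show ?thesis
    by (simp add: poly_altdef exp_minus divide_inverse sum_distrib_right mult.assoc)
qed

text \<open>With s = 1/t the new polynomial is s^2 (p(s) - p'(s)). At the origin the difference
  quotient from the right is s p(s) exp (-s) as s tends to infinity.\<close>

lemma flat_exp_has_derivative:
  "(flat_exp p has_real_derivative flat_exp ([:0, 0, 1:] * (p - pderiv p)) t) (at t)"
proof (cases t "0 :: real" rule: linorder_cases)
  case less
  have "((\<lambda>t. 0) has_real_derivative 0) (at t)" by simp
  moreover have "eventually (\<lambda>s. s < 0) (nhds t)"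
    using eventually_nhds_in_open[of "{..<0}" t] less by simp
  then have "eventually (\<lambda>s. flat_exp p s = 0) (nhds t)"
    by eventually_elim (simp add: flat_exp_def)
  ultimately have "(flat_exp p has_real_derivative 0) (at t)"
    by (subst DERIV_cong_ev[OF refl _ refl, where g = "\<lambda>s. 0"]) auto
  then show ?thesis using less by (simp add: flat_exp_def)
next
  case equal
  have "((\<lambda>h. flat_exp p h / h) \<longlongrightarrow> 0) (at 0)"
  proof (rule filterlim_split_at)
    show "((\<lambda>h. flat_exp p h / h) \<longlongrightarrow> 0) (at_left 0)"
      by (rule tendsto_eventually) (auto simp: eventually_at_filter flat_exp_def)
    have "((\<lambda>h. poly ([:0, 1:] * p) (inverse h) * exp (- inverse h)) \<longlongrightarrow> (0::real)) (at_right 0)"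
      by (rule filterlim_compose[OF tendsto_poly_div_exp_0 filterlim_inverse_at_top_right])
    moreover have "eventually (\<lambda>h::real. h > 0) (at_right 0)" by (simp add: eventually_at_right_less)
    then have "eventually (\<lambda>h. poly ([:0, 1:] * p) (inverse h) * exp (- inverse h) = flat_exp p h / h) (at_right 0)"
      by eventually_elim (simp add: flat_exp_def divide_inverse mult_ac)
    ultimately show "((\<lambda>h. flat_exp p h / h) \<longlongrightarrow> 0) (at_right 0)"
      by (rule Lim_transform_eventually)
  qed
  then show ?thesis using equal by (simp add: DERIV_def flat_exp_def)
next
  case greater
  have "((\<lambda>t. poly p (1 / t) * exp (- (1 / t))) has_real_derivative
      poly (pderiv p) (1 / t) * (- 1 / t\<^sup>2) * exp (- (1 / t)) + poly p (1 / t) * (exp (- (1 / t)) * (1 / t\<^sup>2))) (at t)"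
    using greater by (auto intro!: derivative_eq_intros simp: power2_eq_square)
  moreover have "poly (pderiv p) (1 / t) * (- 1 / t\<^sup>2) * exp (- (1 / t)) + poly p (1 / t) * (exp (- (1 / t)) * (1 / t\<^sup>2))
      = flat_exp ([:0, 0, 1:] * (p - pderiv p)) t"
    using greater by (simp add: flat_exp_def power2_eq_square field_simps)
  ultimately have d: "((\<lambda>t. poly p (1 / t) * exp (- (1 / t))) has_real_derivative
      flat_exp ([:0, 0, 1:] * (p - pderiv p)) t) (at t)" by simp
  have "eventually (\<lambda>s. s > 0) (nhds t)"
    using eventually_nhds_in_open[of "{0<..}" t] greater by simp
  then have "eventually (\<lambda>s. flat_exp p s = poly p (1 / s) * exp (- (1 / s))) (nhds t)"
    by eventually_elim (simp add: flat_exp_def)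
  then show ?thesis using d by (subst DERIV_cong_ev[OF refl _ refl])
qed

lemma smooth_fun_flat_exp: "smooth_fun (\<lambda>x :: real^'n. flat_exp p (m * x $ i + b))"
proof (rule smooth_funI[where S = "{\<lambda>x. c * flat_exp p (m * x $ i + b) | c p. True}"])
  have d: "((\<lambda>x :: real^'n. c * flat_exp p (m * x $ i + b)) has_derivative
      (\<lambda>h. c * (m * h $ i * flat_exp ([:0, 0, 1:] * (p - pderiv p)) (m * x $ i + b)))) (at x)" for c p x
  proof -
    have "((\<lambda>x :: real^'n. m * x $ i + b) has_derivative (\<lambda>h. m * h $ i)) (at x)"
      by (auto intro!: derivative_eq_intros bounded_linear.has_derivative[OF bounded_linear_vec_nth])
    moreover have "(flat_exp p has_derivative (\<lambda>h. h * flat_exp ([:0, 0, 1:] * (p - pderiv p)) (m * x $ i + b))) (at (m * x $ i + b))"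
      using flat_exp_has_derivative[of p "m * x $ i + b"] by (simp add: has_field_derivative_def mult_commute_abs)
    ultimately have "((\<lambda>x :: real^'n. flat_exp p (m * x $ i + b)) has_derivative
        (\<lambda>h. m * h $ i * flat_exp ([:0, 0, 1:] * (p - pderiv p)) (m * x $ i + b))) (at x)"
      by (rule has_derivative_compose)
    then show ?thesis by (rule has_derivative_mult_right)
  qed
  show "(\<lambda>x :: real^'n. flat_exp p (m * x $ i + b)) \<in> {\<lambda>x. c * flat_exp p (m * x $ i + b) | c p. True}"
    by (intro CollectI exI[of _ 1] exI[of _ p]) auto
  show "g differentiable (at x)" if "g \<in> {\<lambda>x :: real^'n. c * flat_exp p (m * x $ i + b) | c p. True}" for g x
    using that d unfolding differentiable_def by blast
  show "pderivative j g \<in> {\<lambda>x. c * flat_exp p (m * x $ i + b) | c p. True}"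
    if g: "g \<in> {\<lambda>x :: real^'n. c * flat_exp p (m * x $ i + b) | c p. True}" for g j
  proof -
    obtain c p where g: "g = (\<lambda>x. c * flat_exp p (m * x $ i + b))" using g by auto
    have "pderivative j g = (\<lambda>x. (c * (m * axis j 1 $ i)) * flat_exp ([:0, 0, 1:] * (p - pderiv p)) (m * x $ i + b))"
      unfolding g by (rule ext, subst pderivative_eqI[OF d]) simp
    then show ?thesis by blast
  qed
qed

text \<open>Per coordinate, exp (-1 / ((m + 1) (x_i - a_i))) and its mirror image at b_i: the
  nonzero set is the open box for every m, and on it the values tend to 1.\<close>

definition box_bump :: "real^'n \<Rightarrow> real^'n \<Rightarrow> nat \<Rightarrow> real^'n \<Rightarrow> real" where
  "box_bump a b m x = (\<Prod>i\<in>UNIV. flat_exp 1 (real (Suc m) * x $ i + (- real (Suc m) * a $ i))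
     * flat_exp 1 ((- real (Suc m)) * x $ i + real (Suc m) * b $ i))"

lemma flat_exp_1: "flat_exp 1 t = (if 0 < t then exp (- (1 / t)) else 0)"
  by (simp add: flat_exp_def)

lemma flat_exp_scaled:
  "flat_exp 1 (real (Suc m) * x + (- real (Suc m) * a)) = flat_exp 1 (real (Suc m) * (x - a))"
  "flat_exp 1 ((- real (Suc m)) * x + real (Suc m) * b) = flat_exp 1 (real (Suc m) * (b - x))"
  by (simp_all add: algebra_simps)

lemma box_bump_nonzero_iff: "box_bump a b m x \<noteq> 0 \<longleftrightarrow> x \<in> box a b"
  unfolding box_bump_def flat_exp_scaled by (auto simp: flat_exp_1 mem_box_cart zero_less_mult_iff)

lemma box_bump_bounds: "0 \<le> box_bump a b m x" "box_bump a b m x \<le> 1"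
proof -
  have f: "0 \<le> flat_exp 1 t \<and> flat_exp 1 t \<le> 1" for t by (auto simp: flat_exp_1)
  show "0 \<le> box_bump a b m x" unfolding box_bump_def using f by (intro prod_nonneg) auto
  show "box_bump a b m x \<le> 1" unfolding box_bump_def using f by (intro prod_le_1) (auto intro: mult_le_one)
qed

lemma box_bump_tendsto: "(\<lambda>m. box_bump a b m x) \<longlonglongrightarrow> indicator (box a b) x"
proof (cases "x \<in> box a b")
  case True
  have f: "(\<lambda>m. flat_exp 1 (real (Suc m) * t)) \<longlonglongrightarrow> 1" if "t > 0" for t :: real
  proof -
    have "(\<lambda>m. exp (- ((1 / t) * (1 / real (Suc m))))) \<longlonglongrightarrow> exp (- ((1 / t) * 0))"
      by (intro tendsto_intros LIMSEQ_Suc[OF lim_1_over_n])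
    then show ?thesis using that by (simp add: flat_exp_1 zero_less_mult_iff mult.commute)
  qed
  have "(\<lambda>m. box_bump a b m x) \<longlonglongrightarrow> (\<Prod>i\<in>(UNIV :: 'a set). 1 * 1)"
    unfolding box_bump_def flat_exp_scaled
    by (intro tendsto_prod tendsto_mult f) (use True in \<open>auto simp: mem_box_cart\<close>)
  then show ?thesis using True by simp
next
  case False
  then have "box_bump a b m x = 0" for m using box_bump_nonzero_iff by blast
  then show ?thesis using False by simp
qed

lemma box_bump_test_funs:
  assumes "cbox a b \<subseteq> D"
  shows "box_bump a b m \<in> test_funs D"
proof -
  have "smooth_fun (box_bump a b m)"
    unfolding box_bump_def by (intro smooth_fun_prod smooth_fun_mult smooth_fun_flat_exp)
  moreover have "closure {x. box_bump a b m x \<noteq> 0} \<subseteq> cbox a b"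
    unfolding box_bump_nonzero_iff Collect_mem_eq by (intro closure_minimal box_subset_cbox closed_cbox)
  ultimately show ?thesis
    unfolding test_funs_def using assms
    by (auto simp: box_bump_nonzero_iff bounded_box dest: subsetD)
qed

text \<open>The positive and negative parts of H are densities of two measures that agree on open
  boxes, an intersection-stable generator; so the two parts agree almost everywhere, which forces
  both to be 0.\<close>

lemma AE_zero_if_box_integrals_zero:
  fixes H :: "'a::euclidean_space \<Rightarrow> real"
  assumes H: "integrable lborel H"
    and zero: "\<And>a b. (\<integral>x. indicator (box a b) x * H x \<partial>lborel) = 0"
  shows "AE x in lborel. H x = 0"
proof -
  have [measurable]: "H \<in> borel_measurable borel" using H by auto
  define p where "p x = ennreal (H x)" for x
  define n where "n x = ennreal (- H x)" for x
  have pm [measurable]: "p \<in> borel_measurable borel" unfolding p_def by measurable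
  have nm [measurable]: "n \<in> borel_measurable borel" unfolding n_def by measurable
  have box: "(\<integral>\<^sup>+x. p x * indicator (box a b) x \<partial>lborel) = (\<integral>\<^sup>+x. n x * indicator (box a b) x \<partial>lborel)"
    and fin: "(\<integral>\<^sup>+x. p x * indicator (box a b) x \<partial>lborel) \<noteq> \<infinity>" for a b
  proof -
    define K where "K x = indicator (box a b) x * H x" for x
    have K: "integrable lborel K" unfolding K_def using integrable_mult_indicator[OF _ H, of "box a b"] by simp
    have eq: "p x * indicator (box a b) x = ennreal (K x)" "n x * indicator (box a b) x = ennreal (- K x)" for x
      by (auto simp: p_def n_def K_def indicator_def)
    have f: "(\<integral>\<^sup>+x. ennreal (K x) \<partial>lborel) \<noteq> \<infinity>" "(\<integral>\<^sup>+x. ennreal (- K x) \<partial>lborel) \<noteq> \<infinity>"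
      using K unfolding real_integrable_def by auto
    have "0 = integral\<^sup>L lborel K" using zero[of a b] by (simp add: K_def[abs_def])
    also have "\<dots> = enn2real (\<integral>\<^sup>+x. ennreal (K x) \<partial>lborel) - enn2real (\<integral>\<^sup>+x. ennreal (- K x) \<partial>lborel)"
      by (rule real_lebesgue_integral_def[OF K])
    finally have "enn2real (\<integral>\<^sup>+x. ennreal (K x) \<partial>lborel) = enn2real (\<integral>\<^sup>+x. ennreal (- K x) \<partial>lborel)" by simp
    then have "(\<integral>\<^sup>+x. ennreal (K x) \<partial>lborel) = (\<integral>\<^sup>+x. ennreal (- K x) \<partial>lborel)"
      using f by (metis ennreal_enn2real_if infinity_ennreal_def)
    then show "(\<integral>\<^sup>+x. p x * indicator (box a b) x \<partial>lborel) = (\<integral>\<^sup>+x. n x * indicator (box a b) x \<partial>lborel)"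
      "(\<integral>\<^sup>+x. p x * indicator (box a b) x \<partial>lborel) \<noteq> \<infinity>"
      using f by (simp_all add: eq)
  qed
  have "density lborel p = density lborel n"
  proof (rule measure_eqI_generator_eq[where \<Omega> = UNIV and E = "range (\<lambda>(a, b). box a b)" and A = "\<lambda>i. box (- (real i *\<^sub>R One)) (real i *\<^sub>R One)"])
    show "Int_stable (range (\<lambda>(a, b). box a b :: 'a set))"
      by (auto simp: Int_stable_def box_Int_box)
    show "emeasure (density lborel p) X = emeasure (density lborel n) X" if "X \<in> range (\<lambda>(a, b). box a b)" for X
      using that box by (auto simp: emeasure_density)
    show "emeasure (density lborel p) (box (- (real i *\<^sub>R One)) (real i *\<^sub>R One)) \<noteq> \<infinity>" for i
      using fin by (auto simp: emeasure_density)
    show "(\<Union>i. box (- (real i *\<^sub>R One)) (real i *\<^sub>R One)) = (UNIV :: 'a set)"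
      by (rule UN_box_eq_UNIV)
  qed (auto simp: borel_eq_box)
  then have ae: "AE x in lborel. p x = n x"
    by (intro sigma_finite_measure.density_unique[OF sigma_finite_lborel]) auto
  have r0: "r = 0" if "ennreal r = ennreal (- r)" for r
    using that by (cases r "0 :: real" rule: linorder_cases) (auto simp: ennreal_neg ennreal_eq_0_iff)
  from ae show ?thesis
    by eventually_elim (simp add: p_def n_def r0)
qed

text \<open>Bump functions tend boundedly to indicators of boxes, so h has integral zero over every
  box whose closed version lies in D. Localizing to one such box makes the uniqueness lemma for
  boxes applicable, and countably many of them cover D.\<close>

lemma fundamental_lemma:
  fixes h :: "real^'n \<Rightarrow> real"
  assumes D: "open D" and h: "integrable (lebesgue_on D) h"
    and zero: "\<And>\<phi>. \<phi> \<in> test_funs D \<Longrightarrow> integral\<^sup>L (lebesgue_on D) (\<lambda>x. h x * \<phi> x) = 0"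
  shows "AE x in lebesgue_on D. h x = 0"
proof -
  have Dm: "D \<inter> space (lebesgue :: (real^'n) measure) \<in> sets lebesgue" using D by auto
  define H where "H x = indicator D x * h x" for x
  have Hint: "integrable lebesgue H"
    using h unfolding integrable_restrict_space[OF Dm] H_def by simp
  have [simp]: "box a b \<in> sets lebesgue" for a b :: "real^'n"
    using lmeasurable_box by blast
  have boxz: "(\<integral>x. indicator (box a b) x * H x \<partial>lebesgue) = 0" if ab: "cbox a b \<subseteq> D" for a b
  proof -
    have "(\<lambda>m. \<integral>x. box_bump a b m x * H x \<partial>lebesgue) \<longlonglongrightarrow> (\<integral>x. indicator (box a b) x * H x \<partial>lebesgue)"
    proof (rule integral_dominated_convergence[where w = "\<lambda>x. \<bar>H x\<bar>"])
      show "(\<lambda>x. indicator (box a b) x * H x) \<in> borel_measurable lebesgue"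
        using Hint by (intro borel_measurable_times borel_measurable_indicator) auto
      have "box_bump a b m \<in> borel_measurable borel" for m
        using box_bump_test_funs[OF ab, of m] by (auto simp: test_funs_def intro: borel_measurable_continuous_onI smooth_fun_continuous)
      then show "(\<lambda>x. box_bump a b m x * H x) \<in> borel_measurable lebesgue" for m
        using borel_measurable_times[OF measurable_completion borel_measurable_integrable[OF Hint], of "box_bump a b m"] by simp
      show "AE x in lebesgue. (\<lambda>m. box_bump a b m x * H x) \<longlonglongrightarrow> indicator (box a b) x * H x"
        by (intro AE_I2 tendsto_mult_right box_bump_tendsto)
      show "AE x in lebesgue. norm (box_bump a b m x * H x) \<le> \<bar>H x\<bar>" for m
        using box_bump_bounds[of a b m] by (auto simp: abs_mult intro!: AE_I2 mult_left_le_one_le)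
    qed (use Hint in auto)
    moreover have "(\<integral>x. box_bump a b m x * H x \<partial>lebesgue) = 0" for m
      using zero[OF box_bump_test_funs[OF ab, of m]]
      unfolding integral_restrict_space[OF Dm] by (simp add: H_def mult_ac)
    ultimately show ?thesis by (simp add: LIMSEQ_const_iff)
  qed
  \<comment> \<open>Cut down to one box, the function has zero integral over every box: a nonempty
    intersection of two open boxes is a box whose closure is still inside D.\<close>
  have loc: "AE x in lebesgue. x \<in> box c d \<longrightarrow> h x = 0" if cd: "cbox c d \<subseteq> D" for c d
  proof -
    define K where "K x = indicator (box c d) x * H x" for x
    have K: "integrable lebesgue K"
      unfolding K_def using integrable_mult_indicator[OF _ Hint, of "box c d"] by simp
    \<comment> \<open>A Borel representative, since the uniqueness argument takes place on
      \<open>lborel\<close>.\<close>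
    then obtain K' where K'm: "K' \<in> borel_measurable lborel" and ae: "AE x in lborel. K x = K' x"
      using completion_ex_borel_measurable_real[of K lborel] by auto
    have ae': "AE x in lebesgue. K x = K' x" using ae by (rule AE_completion)
    have K'int: "integrable lebesgue K'"
      by (rule integrable_cong_AE_imp[OF K measurable_completion[OF K'm] ae'])
    then have K'l: "integrable lborel K'" using K'm by (simp add: integrable_completion)
    have "(\<integral>x. indicator (box a b) x * K' x \<partial>lborel) = 0" for a b
    proof -
      have "(\<integral>x. indicator (box a b) x * K' x \<partial>lborel) = (\<integral>x. indicator (box a b) x * K' x \<partial>lebesgue)"
        by (rule integral_completion[symmetric]) (use K'm in measurable)
      also have "\<dots> = (\<integral>x. indicator (box a b) x * K x \<partial>lebesgue)"
        using ae' K K'int by (intro integral_cong_AE borel_measurable_times borel_measurable_indicator) auto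
      also have "\<dots> = (\<integral>x. indicator (box a b \<inter> box c d) x * H x \<partial>lebesgue)"
        unfolding K_def indicator_inter_arith by (simp add: mult_ac)
      also have "\<dots> = 0"
      proof (cases "box a b \<inter> box c d = {}")
        case False
        obtain a' b' where ab': "box a b \<inter> box c d = box a' b'" unfolding box_Int_box by blast
        have "cbox a' b' = closure (box a' b')" using False ab' by (simp add: closure_box)
        also have "\<dots> \<subseteq> cbox c d" unfolding ab'[symmetric] by (intro closure_minimal) (auto intro: subsetD[OF box_subset_cbox])
        finally show ?thesis using cd boxz[of a' b'] unfolding ab' by auto
      qed simp
      finally show ?thesis .
    qed
    then have "AE x in lborel. K' x = 0" by (rule AE_zero_if_box_integrals_zero[OF K'l])
    then have "AE x in lebesgue. K' x = 0" by (rule AE_completion)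
    with ae' show ?thesis
      by eventually_elim (use cd box_subset_cbox[of c d] in \<open>auto simp: K_def H_def indicator_def split: if_splits\<close>)
  qed
  obtain \<D> where \<D>: "countable \<D>" "\<D> \<subseteq> Pow D" "\<And>X. X \<in> \<D> \<Longrightarrow> \<exists>a b. X = cbox a b" "\<Union>\<D> = D"
    by (rule open_countable_Union_open_cbox[OF D]) blast
  have "AE x in lebesgue. x \<in> X \<longrightarrow> h x = 0" if X: "X \<in> \<D>" for X
  proof -
    obtain a b where ab: "X = cbox a b" using \<D>(3)[OF X] by blast
    \<comment> \<open>The cover consists of closed boxes while vanishing is known on open ones; the
      faces are null sets.\<close>
    have "negligible (cbox a b - box a b)" by (rule negligible_frontier_interval)
    then have "AE x in lebesgue. x \<notin> cbox a b - box a b"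
      by (metis AE_not_in negligible_iff_null_sets)
    moreover have "AE x in lebesgue. x \<in> box a b \<longrightarrow> h x = 0"
      using loc[of a b] X \<D>(2) ab by blast
    ultimately show ?thesis unfolding ab by eventually_elim auto
  qed
  then have "AE x in lebesgue. \<forall>X\<in>\<D>. x \<in> X \<longrightarrow> h x = 0"
    by (subst AE_ball_countable[OF \<D>(1)]) blast
  then have "AE x in lebesgue. x \<in> D \<longrightarrow> h x = 0"
    by eventually_elim (use \<D>(4) in blast)
  then show ?thesis using D by (subst AE_restrict_space_iff) auto
qed

text \<open>The partial derivative is the dominated limit of difference quotients, and each quotient
  integrates to zero by translation invariance.\<close>

lemma integral_pderivative_eq_0:
  fixes \<psi> :: "real^'n \<Rightarrow> real"
  assumes diff: "\<And>x. \<psi> differentiable (at x)"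
    and cont: "continuous_on UNIV (pderivative i \<psi>)"
    and supp: "\<And>x. norm x > R \<Longrightarrow> \<psi> x = 0"
  shows "integral\<^sup>L lborel (pderivative i \<psi>) = 0"
proof -
  define g where "g = pderivative i \<psi>"
  define e :: "real^'n" where "e = axis i 1"
  have ne: "norm e = 1" by (simp add: e_def)
  have line: "((\<lambda>s. \<psi> (x + s *\<^sub>R e)) has_real_derivative g (x + s *\<^sub>R e)) (at s)" for x s
  proof -
    have l: "((\<lambda>s. x + s *\<^sub>R e) has_derivative (\<lambda>h. h *\<^sub>R e)) (at s)"
      by (auto intro!: derivative_eq_intros)
    have d: "(\<psi> has_derivative frechet_derivative \<psi> (at (x + s *\<^sub>R e))) (at (x + s *\<^sub>R e))"
      using diff frechet_derivative_works by blast
    have "((\<lambda>s. \<psi> (x + s *\<^sub>R e)) has_derivative (\<lambda>h. frechet_derivative \<psi> (at (x + s *\<^sub>R e)) (h *\<^sub>R e))) (at s)"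
      by (rule has_derivative_compose[OF l d])
    moreover have "(\<lambda>h. frechet_derivative \<psi> (at (x + s *\<^sub>R e)) (h *\<^sub>R e)) = (*) (g (x + s *\<^sub>R e))"
      using linear_frechet_derivative[OF diff] by (auto simp: g_def pderivative_def e_def linear_cmul)
    ultimately show ?thesis by (simp add: has_field_derivative_def)
  qed
  \<comment> \<open>Leaves room for the shifts, which have length at most 1, so that outside the
    ball both values in a quotient vanish.\<close>
  define R' where "R' = \<bar>R\<bar> + 2"
  have g0: "g x = 0" if "norm x > R" for x
  proof -
    have "eventually (\<lambda>s. norm (x + s *\<^sub>R e) > R) (nhds 0)"
    proof (rule order_tendstoD)
      have "((\<lambda>s. norm (x + s *\<^sub>R e)) \<longlongrightarrow> norm (x + 0 *\<^sub>R e)) (nhds 0)"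
        by (intro tendsto_intros filterlim_ident)
      then show "((\<lambda>s. norm (x + s *\<^sub>R e)) \<longlongrightarrow> norm x) (nhds 0)" by simp
    qed (use that in simp)
    then have "eventually (\<lambda>s. \<psi> (x + s *\<^sub>R e) = 0) (nhds 0)"
      by eventually_elim (rule supp)
    then have "((\<lambda>s. \<psi> (x + s *\<^sub>R e)) has_real_derivative 0) (at 0)"
      by (subst DERIV_cong_ev[OF refl _ refl, where g = "\<lambda>_. 0"]) auto
    with line[of x 0] show ?thesis using DERIV_unique by fastforce
  qed
  have "compact (g ` cball 0 R')"
    by (rule compact_continuous_image[OF continuous_on_subset[OF cont[folded g_def]]]) auto
  then obtain M where M: "\<forall>x\<in>cball 0 R'. \<bar>g x\<bar> \<le> M"
    by (auto dest!: compact_imp_bounded simp: bounded_iff)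
  have gM: "\<bar>g x\<bar> \<le> \<bar>M\<bar>" for x
  proof (cases "norm x \<le> R'")
    case True
    then have "\<bar>g x\<bar> \<le> M" using M by simp
    then show ?thesis by simp
  next
    case False
    then have "norm x > R" by (simp add: R'_def)
    then show ?thesis by (simp add: g0)
  qed
  define h where "h n = 1 / real (Suc n)" for n
  have h: "0 < h n" "h n \<le> 1" for n by (auto simp: h_def)
  have h0: "h \<longlonglongrightarrow> 0" unfolding h_def by (rule LIMSEQ_Suc[OF lim_1_over_n])
  define q where "q n x = (\<psi> (x + h n *\<^sub>R e) - \<psi> x) / h n" for n x
  have \<psi>c: "continuous_on UNIV \<psi>"
    using diff by (meson differentiable_imp_continuous_within continuous_at_imp_continuous_on)
  have \<psi>m [measurable]: "\<psi> \<in> borel_measurable borel" by (rule borel_measurable_continuous_onI[OF \<psi>c])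
  have \<psi>int: "integrable lborel \<psi>"
  proof -
    have "integrable lborel (\<lambda>x. indicator (cball 0 \<bar>R\<bar>) x *\<^sub>R \<psi> x)"
      by (intro borel_integrable_compact continuous_on_subset[OF \<psi>c]) auto
    moreover have "(\<lambda>x. indicator (cball 0 \<bar>R\<bar>) x *\<^sub>R \<psi> x) = \<psi>"
      using supp by (fastforce simp: indicator_def)
    ultimately show ?thesis by simp
  qed
  have qb: "\<bar>q n x\<bar> \<le> indicator (cball 0 R') x * \<bar>M\<bar>" for n x
  proof (cases "x \<in> cball 0 R'")
    case True
    have "\<exists>z>0. z < h n \<and> \<psi> (x + h n *\<^sub>R e) - \<psi> (x + 0 *\<^sub>R e) = (h n - 0) * g (x + z *\<^sub>R e)"
      by (rule MVT2[OF h(1)]) (rule line)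
    then obtain z where "q n x = g (x + z *\<^sub>R e)" using h(1)[of n] by (auto simp: q_def)
    then show ?thesis using gM True by simp
  next
    case False
    then have "norm x > R + 1" by (auto simp: R'_def)
    moreover have "norm (x + h n *\<^sub>R e) \<ge> norm x - h n"
      using norm_diff_ineq[of x "h n *\<^sub>R e"] h(1)[of n] by (simp add: ne)
    ultimately have "\<psi> x = 0" "\<psi> (x + h n *\<^sub>R e) = 0"
      using h(2)[of n] by (auto intro!: supp)
    then show ?thesis by (simp add: q_def)
  qed
  have "(\<lambda>n. integral\<^sup>L lborel (q n)) \<longlonglongrightarrow> integral\<^sup>L lborel g"
  proof (rule integral_dominated_convergence[where w = "\<lambda>x. indicator (cball 0 R') x * \<bar>M\<bar>"])
    show "g \<in> borel_measurable lborel"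
      using borel_measurable_continuous_onI[OF cont] by (simp add: g_def)
    show "q n \<in> borel_measurable lborel" for n unfolding q_def by measurable
    show "integrable lborel (\<lambda>x::real^'n. indicator (cball 0 R') x * \<bar>M\<bar>)"
      by (intro integrable_mult_left integrable_real_indicator) (auto simp: emeasure_bounded_finite[OF bounded_cball, unfolded infinity_ennreal_def])
    show "AE x in lborel. norm (q n x) \<le> indicator (cball 0 R') x * \<bar>M\<bar>" for n
      using qb by auto
    show "AE x in lborel. (\<lambda>n. q n x) \<longlonglongrightarrow> g x"
    proof (rule AE_I2)
      fix x
      have "((\<lambda>t. (\<psi> (x + t *\<^sub>R e) - \<psi> x) / t) \<longlongrightarrow> g x) (at 0)"
        using line[of x 0] by (simp add: DERIV_def)
      moreover have "filterlim h (at 0) sequentially"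
        using h0 h(1) by (auto simp: filterlim_at intro!: always_eventually less_imp_neq[symmetric])
      ultimately show "(\<lambda>n. q n x) \<longlonglongrightarrow> g x"
        unfolding q_def by (rule filterlim_compose)
    qed
  qed
  moreover have "integral\<^sup>L lborel (q n) = 0" for n
  proof -
    have d: "distr lborel borel ((+) (h n *\<^sub>R e)) = lborel" by (rule lborel_distr_plus)
    have "integrable lborel (\<lambda>x. \<psi> (h n *\<^sub>R e + x))" "integral\<^sup>L lborel (\<lambda>x. \<psi> (h n *\<^sub>R e + x)) = integral\<^sup>L lborel \<psi>"
      using integrable_distr_eq[of "(+) (h n *\<^sub>R e)" lborel borel \<psi>] integral_distr[of "(+) (h n *\<^sub>R e)" lborel borel \<psi>] \<psi>int
      unfolding d by auto
    then show ?thesis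
      unfolding q_def using \<psi>int by (simp add: add.commute)
  qed
  ultimately show ?thesis by (simp add: LIMSEQ_const_iff g_def)
qed

section \<open>Square integrable functions\<close>

text \<open>Over an arbitrary measure, because the same estimates serve \<open>lebesgue_on D\<close>
  in the space variable and \<open>lborel\<close> in the parameter.\<close>

definition sq_integrable :: "'a measure \<Rightarrow> ('a \<Rightarrow> 'b::euclidean_space) set" where
  "sq_integrable M = {f \<in> borel_measurable M. integrable M (\<lambda>x. (norm (f x))\<^sup>2)}"

definition sq_norm :: "'a measure \<Rightarrow> ('a \<Rightarrow> 'b::euclidean_space) \<Rightarrow> real" where
  "sq_norm M f = sqrt (integral\<^sup>L M (\<lambda>x. (norm (f x))\<^sup>2))"

lemma sq_norm_nonneg [simp]: "0 \<le> sq_norm M f"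
  by (simp add: sq_norm_def)

lemma sq_norm_power2: "(sq_norm M f)\<^sup>2 = integral\<^sup>L M (\<lambda>x. (norm (f x))\<^sup>2)"
  by (simp add: sq_norm_def)

lemma sq_integrable_measurable: "f \<in> sq_integrable M \<Longrightarrow> f \<in> borel_measurable M"
  by (simp add: sq_integrable_def)

lemma sq_integrable_inner:
  assumes f: "f \<in> sq_integrable M" and g: "g \<in> sq_integrable M"
  shows "integrable M (\<lambda>x. f x \<bullet> g x)"
proof (rule Bochner_Integration.integrable_bound)
  show "integrable M (\<lambda>x. (norm (f x))\<^sup>2 + (norm (g x))\<^sup>2)"
    using f g by (intro Bochner_Integration.integrable_add) (auto simp: sq_integrable_def)
  show "(\<lambda>x. f x \<bullet> g x) \<in> borel_measurable M"
    using f g by (intro borel_measurable_inner sq_integrable_measurable)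
  show "AE x in M. norm (f x \<bullet> g x) \<le> norm ((norm (f x))\<^sup>2 + (norm (g x))\<^sup>2)"
  proof (rule AE_I2)
    fix x
    have "\<bar>f x \<bullet> g x\<bar> \<le> norm (f x) * norm (g x)" by (rule Cauchy_Schwarz_ineq2)
    also have "\<dots> \<le> (norm (f x))\<^sup>2 + (norm (g x))\<^sup>2"
      using sum_squares_bound[of "norm (f x)" "norm (g x)"] mult_nonneg_nonneg[OF norm_ge_zero[of "f x"] norm_ge_zero[of "g x"]]
      by linarith
    finally show "norm (f x \<bullet> g x) \<le> norm ((norm (f x))\<^sup>2 + (norm (g x))\<^sup>2)" by simp
  qed
qed

lemma sq_integrable_scaleR:
  "f \<in> sq_integrable M \<Longrightarrow> (\<lambda>x. c *\<^sub>R f x) \<in> sq_integrable M"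
  by (auto simp: sq_integrable_def power_mult_distrib)

lemma sq_norm_scaleR: "sq_norm M (\<lambda>x. c *\<^sub>R f x) = \<bar>c\<bar> * sq_norm M f"
  by (simp add: sq_norm_def power_mult_distrib real_sqrt_mult)

lemma sq_norm_add_power2:
  assumes f: "f \<in> sq_integrable M" and g: "g \<in> sq_integrable M"
  shows "integrable M (\<lambda>x. (norm (f x + g x))\<^sup>2)"
    and "(sq_norm M (\<lambda>x. f x + g x))\<^sup>2 = (sq_norm M f)\<^sup>2 + 2 * integral\<^sup>L M (\<lambda>x. f x \<bullet> g x) + (sq_norm M g)\<^sup>2"
proof -
  have eq: "(norm (f x + g x))\<^sup>2 = (norm (f x))\<^sup>2 + 2 * (f x \<bullet> g x) + (norm (g x))\<^sup>2" for x
    by (simp add: power2_norm_eq_inner inner_add_left inner_add_right inner_commute)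
  have i: "integrable M (\<lambda>x. (norm (f x))\<^sup>2)" "integrable M (\<lambda>x. (norm (g x))\<^sup>2)"
    using f g by (auto simp: sq_integrable_def)
  show "integrable M (\<lambda>x. (norm (f x + g x))\<^sup>2)"
    unfolding eq using i sq_integrable_inner[OF f g] by auto
  show "(sq_norm M (\<lambda>x. f x + g x))\<^sup>2 = (sq_norm M f)\<^sup>2 + 2 * integral\<^sup>L M (\<lambda>x. f x \<bullet> g x) + (sq_norm M g)\<^sup>2"
    unfolding sq_norm_power2 eq using i sq_integrable_inner[OF f g] by simp
qed

lemma sq_integrable_add:
  assumes f: "f \<in> sq_integrable M" and g: "g \<in> sq_integrable M"
  shows "(\<lambda>x. f x + g x) \<in> sq_integrable M"
  using sq_norm_add_power2(1)[OF assms] assms by (auto simp: sq_integrable_def)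

lemma sq_integrable_diff:
  assumes f: "f \<in> sq_integrable M" and g: "g \<in> sq_integrable M"
  shows "(\<lambda>x. f x - g x) \<in> sq_integrable M"
  using sq_integrable_add[OF f sq_integrable_scaleR[OF g, of "-1"]] by simp

text \<open>Discriminant argument: the squared norm of f + t g is a nonnegative quadratic polynomial
  in t.\<close>

lemma cauchy_schwarz_integral:
  assumes f: "f \<in> sq_integrable M" and g: "g \<in> sq_integrable M"
  shows "\<bar>integral\<^sup>L M (\<lambda>x. f x \<bullet> g x)\<bar> \<le> sq_norm M f * sq_norm M g"
proof -
  define a where "a = (sq_norm M f)\<^sup>2"
  define b where "b = integral\<^sup>L M (\<lambda>x. f x \<bullet> g x)"
  define c where "c = (sq_norm M g)\<^sup>2"
  have pos: "0 \<le> a + 2 * t * b + t\<^sup>2 * c" for t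
  proof -
    have "0 \<le> (sq_norm M (\<lambda>x. f x + t *\<^sub>R g x))\<^sup>2" by simp
    also have "\<dots> = a + 2 * t * b + t\<^sup>2 * c"
      by (simp add: sq_norm_add_power2(2)[OF f sq_integrable_scaleR[OF g]] sq_norm_scaleR a_def b_def c_def power_mult_distrib)
    finally show ?thesis .
  qed
  have c0: "c \<ge> 0" by (simp add: c_def)
  have "b\<^sup>2 \<le> a * c"
  proof (cases "c = 0")
    case True
    \<comment> \<open>Without a quadratic term a nonzero slope is impossible: at t = -(a + 1) / (2b)
      the value would be -1.\<close>
    have "b = 0"
    proof (rule ccontr)
      assume "b \<noteq> 0"
      moreover from this have "2 * (- (a + 1) / (2 * b)) * b = - (a + 1)" by simp
      ultimately show False using pos[of "- (a + 1) / (2 * b)"] unfolding True mult_zero_right by linarith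
    qed
    then show ?thesis using True by simp
  next
    case False
    then have "0 \<le> a - b\<^sup>2 / c"
      using pos[of "- b / c"] by (simp add: power2_eq_square field_simps)
    then show ?thesis using False c0 by (simp add: field_simps)
  qed
  also have "\<dots> = (sq_norm M f * sq_norm M g)\<^sup>2" by (simp add: a_def c_def power_mult_distrib)
  finally have "\<bar>b\<bar> \<le> \<bar>sq_norm M f * sq_norm M g\<bar>" by (simp only: abs_le_square_iff)
  then show ?thesis by (simp add: b_def abs_mult)
qed

lemma sq_norm_triangle:
  assumes f: "f \<in> sq_integrable M" and g: "g \<in> sq_integrable M"
  shows "sq_norm M (\<lambda>x. f x + g x) \<le> sq_norm M f + sq_norm M g"
proof -
  have "(sq_norm M (\<lambda>x. f x + g x))\<^sup>2 \<le> (sq_norm M f + sq_norm M g)\<^sup>2"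
    unfolding sq_norm_add_power2(2)[OF f g] using cauchy_schwarz_integral[OF f g]
    by (simp add: power2_sum)
  then show ?thesis by (rule power2_le_imp_le) simp
qed

lemma sq_norm_cong_AE:
  assumes "f \<in> borel_measurable M" "g \<in> borel_measurable M" "AE x in M. f x = g x"
  shows "sq_norm M f = sq_norm M g"
proof -
  have "integral\<^sup>L M (\<lambda>x. (norm (f x))\<^sup>2) = integral\<^sup>L M (\<lambda>x. (norm (g x))\<^sup>2)"
    using assms by (intro integral_cong_AE) auto
  then show ?thesis by (simp add: sq_norm_def)
qed

lemma sq_integrable_cong_AE:
  assumes "f \<in> sq_integrable M" "g \<in> borel_measurable M" "AE x in M. f x = g x"
  shows "g \<in> sq_integrable M"
proof -
  have "integrable M (\<lambda>x. (norm (g x))\<^sup>2)"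
    by (rule integrable_cong_AE_imp[of _ "\<lambda>x. (norm (f x))\<^sup>2"]) (use assms in \<open>auto simp: sq_integrable_def\<close>)
  then show ?thesis using assms by (simp add: sq_integrable_def)
qed

lemma nn_integral_sq_norm:
  assumes "f \<in> sq_integrable M"
  shows "(\<integral>\<^sup>+x. ennreal ((norm (f x))\<^sup>2) \<partial>M) = ennreal ((sq_norm M f)\<^sup>2)"
  unfolding sq_norm_power2 by (rule nn_integral_eq_integral) (use assms in \<open>auto simp: sq_integrable_def\<close>)

lemma sq_norm_le_if_nn_integral_le:
  assumes "f \<in> borel_measurable M" "(\<integral>\<^sup>+x. ennreal ((norm (f x))\<^sup>2) \<partial>M) \<le> ennreal (c\<^sup>2)" "c \<ge> 0"
  shows "f \<in> sq_integrable M" "sq_norm M f \<le> c"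
proof -
  have "(\<integral>\<^sup>+x. ennreal (norm ((norm (f x))\<^sup>2)) \<partial>M) < \<infinity>"
    using assms(2) by (simp add: le_less_trans[OF _ ennreal_less_top])
  then show i: "f \<in> sq_integrable M"
    using assms(1) by (auto simp: sq_integrable_def integrable_iff_bounded)
  have "ennreal ((sq_norm M f)\<^sup>2) \<le> ennreal (c\<^sup>2)"
    using assms(2) nn_integral_sq_norm[OF i] by simp
  then have "(sq_norm M f)\<^sup>2 \<le> c\<^sup>2" by (simp add: ennreal_le_iff)
  then show "sq_norm M f \<le> c" using assms(3) by (rule power2_le_imp_le)
qed

lemma sq_integrable_sum:
  assumes "\<And>i. i \<in> I \<Longrightarrow> f i \<in> sq_integrable M"
  shows "(\<lambda>x. \<Sum>i\<in>I. f i x) \<in> sq_integrable M"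
  using assms
proof (induction I rule: infinite_finite_induct)
  case (insert i I)
  then show ?case by (simp add: sq_integrable_add)
qed (auto simp: sq_integrable_def)

lemma sq_norm_sum_le:
  assumes "\<And>i. i \<in> I \<Longrightarrow> f i \<in> sq_integrable M"
  shows "sq_norm M (\<lambda>x. \<Sum>i\<in>I. f i x) \<le> (\<Sum>i\<in>I. sq_norm M (f i))"
  using assms
proof (induction I rule: infinite_finite_induct)
  case (insert i I)
  then have "sq_norm M (\<lambda>x. f i x + (\<Sum>i\<in>I. f i x)) \<le> sq_norm M (f i) + sq_norm M (\<lambda>x. \<Sum>i\<in>I. f i x)"
    by (intro sq_norm_triangle sq_integrable_sum) auto
  also have "\<dots> \<le> sq_norm M (f i) + (\<Sum>i\<in>I. sq_norm M (f i))" using insert by auto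
  finally show ?case using insert by simp
qed (auto simp: sq_norm_def)

lemma sq_integrable_norm: "f \<in> sq_integrable M \<Longrightarrow> (\<lambda>x. norm (f x)) \<in> sq_integrable M"
  by (auto simp: sq_integrable_def)

lemma sq_norm_norm: "sq_norm M (\<lambda>x. norm (f x)) = sq_norm M f"
  by (simp add: sq_norm_def)

text \<open>Riesz-Fischer for a sequence with geometric increments: by monotone convergence the
  series of the pointwise norms of the increments is square integrable, so the sequence converges
  almost everywhere, and Fatou's lemma controls the distance to the limit.\<close>

lemma sq_integrable_complete:
  fixes F :: "nat \<Rightarrow> 'a \<Rightarrow> 'b::euclidean_space"
  assumes F: "\<And>n. F n \<in> sq_integrable M"
    and fast: "\<And>n. sq_norm M (\<lambda>x. F (Suc n) x - F n x) \<le> C * (1/2) ^ n"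
  obtains G where "G \<in> sq_integrable M" "(\<lambda>n. sq_norm M (\<lambda>x. F n x - G x)) \<longlonglongrightarrow> 0"
proof -
  have C: "C \<ge> 0" using order_trans[OF sq_norm_nonneg fast[of 0]] by simp
  define d where "d n x = F (Suc n) x - F n x" for n x
  have d: "d n \<in> sq_integrable M" for n unfolding d_def by (intro sq_integrable_diff F)
  have tele: "F (n + m) x - F n x = (\<Sum>i<m. d (n + i) x)" for n m x
  proof (induction m)
    case (Suc m)
    then show ?case by (simp add: Suc.IH[symmetric]) (simp add: d_def)
  qed simp
  have geo: "(\<Sum>i<m. C * (1/2) ^ (n + i)) \<le> 2 * C * (1/2) ^ n" for n m
  proof -
    have "(\<Sum>i<m. C * (1/2) ^ (n + i)) = C * (1/2) ^ n * (\<Sum>i<m. (1/2) ^ i)"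
      by (simp add: power_add sum_distrib_left mult_ac)
    also have "\<dots> \<le> C * (1/2) ^ n * 2"
    proof (rule mult_left_mono)
      have "(\<Sum>i<m. (1/2 :: real) ^ i) = 2 - 2 * (1/2) ^ m" by (induction m) auto
      then show "(\<Sum>i<m. (1/2 :: real) ^ i) \<le> 2" by simp
    qed (use C in simp)
    finally show ?thesis by (simp add: mult_ac)
  qed
  define S where "S N x = (\<Sum>i<N. norm (d i x))" for N x
  have Sint: "S N \<in> sq_integrable M" for N
    unfolding S_def by (intro sq_integrable_sum sq_integrable_norm d)
  have Sb: "sq_norm M (S N) \<le> 2 * C" for N
  proof -
    have "sq_norm M (S N) \<le> (\<Sum>i<N. sq_norm M (\<lambda>x. norm (d i x)))"
      unfolding S_def by (intro sq_norm_sum_le sq_integrable_norm d)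
    also have "\<dots> \<le> (\<Sum>i<N. C * (1/2) ^ (0 + i))"
      unfolding sq_norm_norm using fast by (intro sum_mono) (simp add: d_def[abs_def])
    also have "\<dots> \<le> 2 * C" using geo[where n = 0 and m = N] by simp
    finally show ?thesis .
  qed
  have "(\<integral>\<^sup>+x. (SUP N. ennreal ((S N x)\<^sup>2)) \<partial>M) = (SUP N. \<integral>\<^sup>+x. ennreal ((S N x)\<^sup>2) \<partial>M)"
  proof (rule nn_integral_monotone_convergence_SUP)
    show "incseq (\<lambda>N x. ennreal ((S N x)\<^sup>2))"
      unfolding incseq_def le_fun_def
      by (auto simp: S_def intro!: ennreal_leI power_mono sum_mono2 sum_nonneg)
    show "(\<lambda>x. ennreal ((S N x)\<^sup>2)) \<in> borel_measurable M" for N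
      using sq_integrable_measurable[OF Sint[of N]] by measurable
  qed
  also have "\<dots> \<le> ennreal ((2 * C)\<^sup>2)"
  proof (rule SUP_least)
    fix N
    have "(\<integral>\<^sup>+x. ennreal ((S N x)\<^sup>2) \<partial>M) = (\<integral>\<^sup>+x. ennreal ((norm (S N x))\<^sup>2) \<partial>M)" by simp
    also have "\<dots> \<le> ennreal ((2 * C)\<^sup>2)"
      unfolding nn_integral_sq_norm[OF Sint] by (intro ennreal_leI power_mono Sb) simp
    finally show "(\<integral>\<^sup>+x. ennreal ((S N x)\<^sup>2) \<partial>M) \<le> ennreal ((2 * C)\<^sup>2)" .
  qed
  finally have fin: "(\<integral>\<^sup>+x. (SUP N. ennreal ((S N x)\<^sup>2)) \<partial>M) \<noteq> \<infinity>"
    by (auto simp: top_unique)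
  have "AE x in M. (SUP N. ennreal ((S N x)\<^sup>2)) \<noteq> \<infinity>"
  proof (rule nn_integral_PInf_AE[OF _ fin])
    have [measurable]: "S N \<in> borel_measurable M" for N using Sint by (rule sq_integrable_measurable)
    show "(\<lambda>x. SUP N. ennreal ((S N x)\<^sup>2)) \<in> borel_measurable M" by measurable
  qed
  then have conv: "AE x in M. convergent (\<lambda>n. F n x)"
  proof eventually_elim
    fix x assume "(SUP N. ennreal ((S N x)\<^sup>2)) \<noteq> \<infinity>"
    then obtain B where B: "(SUP N. ennreal ((S N x)\<^sup>2)) = ennreal B" "B \<ge> 0"
      by (cases "SUP N. ennreal ((S N x)\<^sup>2)") auto
    have "S N x \<le> sqrt B" for N
    proof -
      have "ennreal ((S N x)\<^sup>2) \<le> ennreal B" unfolding B(1)[symmetric] by (rule SUP_upper) simp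
      then have "(S N x)\<^sup>2 \<le> B" using B(2) by (simp add: ennreal_le_iff)
      then show ?thesis by (simp add: real_le_rsqrt)
    qed
    then have "summable (\<lambda>i. norm (d i x))"
      by (intro summableI_nonneg_bounded[where x = "sqrt B"]) (auto simp: S_def)
    then have "summable (\<lambda>i. d i x)" by (rule summable_norm_cancel)
    then have "convergent (\<lambda>m. F 0 x + (\<Sum>i<m. d i x))"
      by (intro convergent_add convergent_const) (simp add: summable_iff_convergent)
    moreover have "F 0 x + (\<Sum>i<m. d i x) = F m x" for m by (simp add: tele[of 0 m x, simplified, symmetric])
    ultimately show "convergent (\<lambda>n. F n x)" by simp
  qed
  have Fm [measurable]: "F n \<in> borel_measurable M" for n using F by (rule sq_integrable_measurable)
  define G where "G x = lim (\<lambda>n. F n x)" for x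
  have Gm [measurable]: "G \<in> borel_measurable M"
    unfolding G_def by (rule borel_measurable_lim_metric) simp
  have tail: "(\<lambda>x. F n x - G x) \<in> sq_integrable M \<and> sq_norm M (\<lambda>x. F n x - G x) \<le> 2 * C * (1/2) ^ n" for n
  proof -
    have "(\<integral>\<^sup>+x. ennreal ((norm (F n x - G x))\<^sup>2) \<partial>M) = (\<integral>\<^sup>+x. liminf (\<lambda>m. ennreal ((norm (F n x - F (n + m) x))\<^sup>2)) \<partial>M)"
    proof (rule nn_integral_cong_AE)
      show "AE x in M. ennreal ((norm (F n x - G x))\<^sup>2) = liminf (\<lambda>m. ennreal ((norm (F n x - F (n + m) x))\<^sup>2))"
        using conv
      proof eventually_elim
        fix x assume "convergent (\<lambda>n. F n x)"
        then have "(\<lambda>m. F m x) \<longlonglongrightarrow> G x" unfolding G_def by (simp add: convergent_LIMSEQ_iff)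
        then have "(\<lambda>m. F (n + m) x) \<longlonglongrightarrow> G x"
          by (subst add.commute) (rule LIMSEQ_ignore_initial_segment)
        then have "(\<lambda>m. ennreal ((norm (F n x - F (n + m) x))\<^sup>2)) \<longlonglongrightarrow> ennreal ((norm (F n x - G x))\<^sup>2)"
          by (intro tendsto_ennrealI tendsto_intros)
        then show "ennreal ((norm (F n x - G x))\<^sup>2) = liminf (\<lambda>m. ennreal ((norm (F n x - F (n + m) x))\<^sup>2))"
          by (metis lim_imp_Liminf sequentially_bot)
      qed
    qed
    also have "\<dots> \<le> liminf (\<lambda>m. \<integral>\<^sup>+x. ennreal ((norm (F n x - F (n + m) x))\<^sup>2) \<partial>M)"
      by (rule nn_integral_liminf) measurable
    also have "\<dots> \<le> ennreal ((2 * C * (1/2) ^ n)\<^sup>2)"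
    proof (rule Liminf_le, simp, rule always_eventually, rule allI)
      fix m
      have i: "(\<lambda>x. F n x - F (n + m) x) \<in> sq_integrable M" by (intro sq_integrable_diff F)
      have "sq_norm M (\<lambda>x. F n x - F (n + m) x) = sq_norm M (\<lambda>x. F (n + m) x - F n x)"
        by (simp add: sq_norm_def norm_minus_commute)
      also have "\<dots> \<le> (\<Sum>i<m. sq_norm M (d (n + i)))"
        unfolding tele by (intro sq_norm_sum_le d)
      also have "\<dots> \<le> (\<Sum>i<m. C * (1/2) ^ (n + i))"
        by (intro sum_mono) (use fast in \<open>simp add: d_def[abs_def]\<close>)
      also have "\<dots> \<le> 2 * C * (1/2) ^ n" by (rule geo)
      finally have "sq_norm M (\<lambda>x. F n x - F (n + m) x) \<le> 2 * C * (1/2) ^ n" .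
      then show "(\<integral>\<^sup>+x. ennreal ((norm (F n x - F (n + m) x))\<^sup>2) \<partial>M) \<le> ennreal ((2 * C * (1/2) ^ n)\<^sup>2)"
        unfolding nn_integral_sq_norm[OF i] by (intro ennreal_leI power_mono) auto
    qed
    finally have le: "(\<integral>\<^sup>+x. ennreal ((norm (F n x - G x))\<^sup>2) \<partial>M) \<le> ennreal ((2 * C * (1/2) ^ n)\<^sup>2)" .
    have "(\<lambda>x. F n x - G x) \<in> borel_measurable M" by measurable
    from sq_norm_le_if_nn_integral_le[OF this le] C show ?thesis by auto
  qed
  have "G \<in> sq_integrable M"
    using sq_integrable_diff[OF F[of 0] tail[of 0, THEN conjunct1]] by simp
  moreover have "(\<lambda>n. sq_norm M (\<lambda>x. F n x - G x)) \<longlonglongrightarrow> 0"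
  proof (rule tendsto_sandwich[OF _ _ tendsto_const])
    have "(\<lambda>n. 2 * C * (1/2 :: real) ^ n) \<longlonglongrightarrow> 2 * C * 0"
      by (intro tendsto_intros LIMSEQ_power_zero) simp
    then show "(\<lambda>n. 2 * C * (1/2 :: real) ^ n) \<longlonglongrightarrow> 0" by simp
  qed (use tail in auto)
  ultimately show ?thesis by (rule that)
qed

section \<open>The space $H^1_0(D)$\<close>

lemma L2_eq_sq_integrable: "L2 D = sq_integrable (lebesgue_on D)"
  by (simp add: L2_def sq_integrable_def)

lemma L2_norm_eq_sq_norm: "L2_norm D = sq_norm (lebesgue_on D)"
  by (simp add: fun_eq_iff L2_norm_def sq_norm_def)

lemma L2_norm_nonneg [simp]: "0 \<le> L2_norm D v"
  by (simp add: L2_norm_eq_sq_norm)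

section \<open>Test functions and integration by parts\<close>

lemma integrable_lebesgue_on_continuous:
  fixes f :: "real^'n \<Rightarrow> 'b::euclidean_space"
  assumes D: "open D" and cont: "continuous_on UNIV f" and supp: "\<And>x. R < norm x \<Longrightarrow> f x = 0"
  shows "integrable (lebesgue_on D) f"
proof -
  have "integrable lborel (\<lambda>x. indicator (cball 0 R) x *\<^sub>R f x)"
    by (intro borel_integrable_compact continuous_on_subset[OF cont]) auto
  moreover have "(\<lambda>x. indicator (cball 0 R) x *\<^sub>R f x) = f"
    using supp by (fastforce simp: indicator_def)
  ultimately have "integrable lebesgue f"
    using borel_measurable_continuous_onI[OF cont] by (simp add: integrable_completion)
  then have "integrable lebesgue (\<lambda>x. indicator D x *\<^sub>R f x)"
    using D by (intro integrable_mult_indicator) auto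
  then show ?thesis using D by (subst integrable_restrict_space) auto
qed

lemma integral_lebesgue_on_eq_lborel:
  fixes f :: "real^'n \<Rightarrow> real"
  assumes D: "open D" and cont: "continuous_on UNIV f" and supp: "\<And>x. x \<notin> D \<Longrightarrow> f x = 0"
  shows "integral\<^sup>L (lebesgue_on D) f = integral\<^sup>L lborel f"
proof -
  have "integral\<^sup>L (lebesgue_on D) f = integral\<^sup>L lebesgue (\<lambda>x. indicator D x *\<^sub>R f x)"
    using D by (subst integral_restrict_space) auto
  also have "(\<lambda>x. indicator D x *\<^sub>R f x) = f"
    using supp by (fastforce simp: indicator_def)
  also have "integral\<^sup>L lebesgue f = integral\<^sup>L lborel f"
    by (rule integral_completion) (use borel_measurable_continuous_onI[OF cont] in simp)
  finally show ?thesis .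
qed

lemma test_funs_smooth: "\<phi> \<in> test_funs D \<Longrightarrow> smooth_fun \<phi>"
  by (simp add: test_funs_def)

lemma test_funs_continuous: "\<phi> \<in> test_funs D \<Longrightarrow> continuous_on S \<phi>"
  by (simp add: test_funs_smooth smooth_fun_continuous)

lemma test_funs_outside: "\<phi> \<in> test_funs D \<Longrightarrow> x \<notin> D \<Longrightarrow> \<phi> x = 0"
  unfolding test_funs_def using closure_subset[of "{x. \<phi> x \<noteq> 0}"] by blast

lemma test_funs_bounded_support:
  assumes "\<phi> \<in> test_funs D"
  obtains R where "\<And>x. R < norm x \<Longrightarrow> \<phi> x = 0"
proof -
  have "bounded {x. \<phi> x \<noteq> 0}"
    using assms bounded_subset[OF compact_imp_bounded closure_subset] by (simp add: test_funs_def)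
  then obtain R where "\<forall>x\<in>{x. \<phi> x \<noteq> 0}. norm x \<le> R" by (auto simp: bounded_iff)
  then show ?thesis by (intro that[of R]) (metis mem_Collect_eq not_le)
qed

text \<open>Off its support the function is locally zero, so differentiation does not enlarge the
  support.\<close>

lemma test_funs_pderivative:
  assumes \<phi>: "\<phi> \<in> test_funs D"
  shows "pderivative i \<phi> \<in> test_funs D"
proof -
  define K where "K = closure {x. \<phi> x \<noteq> 0}"
  have K: "compact K" "K \<subseteq> D" using \<phi> by (auto simp: test_funs_def K_def)
  have zero: "pderivative i \<phi> x = 0" if x: "x \<notin> K" for x
  proof -
    have "open (- K)" by (simp add: K_def open_Compl)
    then have "(\<phi> has_derivative (\<lambda>h. 0)) (at x)"
    proof (rule has_derivative_transform_within_open[OF has_derivative_const[of 0]])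
      show "0 = \<phi> y" if "y \<in> - K" for y
        using that closure_subset[of "{x. \<phi> x \<noteq> 0}"] by (auto simp: K_def)
    qed (use x in simp)
    then show ?thesis by (rule pderivative_eqI[of _ "\<lambda>h. 0"])
  qed
  then have "closure {x. pderivative i \<phi> x \<noteq> 0} \<subseteq> K"
    by (intro closure_minimal) (auto simp: K_def)
  moreover from this have "compact (closure {x. pderivative i \<phi> x \<noteq> 0})"
    using K(1) by (meson closed_closure compact_Int_closed compact_eq_bounded_closed bounded_subset)
  ultimately show ?thesis
    using K \<phi> by (auto simp: test_funs_def smooth_fun_pderivative)
qed

lemma test_funs_lincomb:
  assumes "\<phi> \<in> test_funs D" "\<psi> \<in> test_funs D"
  shows "(\<lambda>x. a * \<phi> x + b * \<psi> x) \<in> test_funs D"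
proof -
  let ?S = "\<lambda>f. closure {x. f x \<noteq> (0::real)}"
  have sub: "?S (\<lambda>x. a * \<phi> x + b * \<psi> x) \<subseteq> ?S \<phi> \<union> ?S \<psi>"
    unfolding closure_Un[symmetric] by (rule closure_mono) auto
  moreover have "compact (?S \<phi> \<union> ?S \<psi>)" using assms by (auto simp: test_funs_def)
  then have "compact (?S (\<lambda>x. a * \<phi> x + b * \<psi> x))"
    using sub by (meson closed_closure compact_eq_bounded_closed bounded_subset)
  moreover have "smooth_fun (\<lambda>x. a * \<phi> x + b * \<psi> x)"
    by (intro smooth_fun_add smooth_fun_mult smooth_fun_const test_funs_smooth[OF assms(1)] test_funs_smooth[OF assms(2)])
  ultimately show ?thesis using assms by (auto simp: test_funs_def)
qed

lemma test_funs_zero: "(\<lambda>x. 0) \<in> test_funs D"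
  by (simp add: test_funs_def smooth_fun_const)

lemma test_funs_sum:
  "(\<And>i. i \<in> I \<Longrightarrow> \<phi> i \<in> test_funs D) \<Longrightarrow> (\<lambda>x. \<Sum>i\<in>I. c i * \<phi> i x) \<in> test_funs D"
proof (induction I rule: infinite_finite_induct)
  case (insert i I)
  then show ?case using test_funs_lincomb[of "\<phi> i" D "\<lambda>x. \<Sum>i\<in>I. c i * \<phi> i x" "c i" 1] by simp
qed (auto simp: test_funs_zero)

lemma test_funs_L2:
  assumes D: "open D" and \<phi>: "\<phi> \<in> test_funs D"
  shows "\<phi> \<in> L2 D"
proof -
  obtain R where R: "\<And>x. R < norm x \<Longrightarrow> \<phi> x = 0" using test_funs_bounded_support[OF \<phi>] by blast
  have "integrable (lebesgue_on D) \<phi>" "integrable (lebesgue_on D) (\<lambda>x. (norm (\<phi> x))\<^sup>2)"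
    by (rule integrable_lebesgue_on_continuous[OF D, where R = R], use R in \<open>auto intro!: continuous_intros test_funs_continuous[OF \<phi>]\<close>)+
  then show ?thesis by (auto simp: L2_def)
qed

text \<open>The product f \<phi> is compactly supported even if f is not, so its partial derivative
  has integral zero; integrals over D and over the whole space agree because \<phi> vanishes off
  D.\<close>

lemma integration_by_parts_test_fun:
  assumes D: "open D" and f: "smooth_fun f" and \<phi>: "\<phi> \<in> test_funs D"
  shows "integral\<^sup>L (lebesgue_on D) (\<lambda>x. f x * pderivative i \<phi> x) = - integral\<^sup>L (lebesgue_on D) (\<lambda>x. pderivative i f x * \<phi> x)"
proof -
  obtain R where R: "\<And>x. R < norm x \<Longrightarrow> \<phi> x = 0" using test_funs_bounded_support[OF \<phi>] by blast
  obtain R' where R': "\<And>x. R' < norm x \<Longrightarrow> pderivative i \<phi> x = 0"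
    using test_funs_bounded_support[OF test_funs_pderivative[OF \<phi>]] by blast
  have pd: "pderivative i (\<lambda>x. f x * \<phi> x) = (\<lambda>x. pderivative i f x * \<phi> x + f x * pderivative i \<phi> x)"
    by (rule ext) (simp add: pderivative_mult smooth_fun_differentiable f test_funs_smooth[OF \<phi>])
  have c: "continuous_on UNIV (\<lambda>x. pderivative i f x * \<phi> x)" "continuous_on UNIV (\<lambda>x. f x * pderivative i \<phi> x)"
    by (intro continuous_intros smooth_fun_continuous smooth_fun_pderivative f test_funs_smooth[OF \<phi>])+
  have i: "integrable (lebesgue_on D) (\<lambda>x. pderivative i f x * \<phi> x)" "integrable (lebesgue_on D) (\<lambda>x. f x * pderivative i \<phi> x)"
    by (rule integrable_lebesgue_on_continuous[OF D c(1), where R = R], simp add: R)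
       (rule integrable_lebesgue_on_continuous[OF D c(2), where R = R'], simp add: R')
  have "integral\<^sup>L (lebesgue_on D) (\<lambda>x. pderivative i f x * \<phi> x + f x * pderivative i \<phi> x)
      = integral\<^sup>L lborel (\<lambda>x. pderivative i f x * \<phi> x + f x * pderivative i \<phi> x)"
    by (rule integral_lebesgue_on_eq_lborel[OF D continuous_on_add[OF c]])
       (simp add: test_funs_outside[OF \<phi>] test_funs_outside[OF test_funs_pderivative[OF \<phi>]])
  also have "\<dots> = integral\<^sup>L lborel (pderivative i (\<lambda>x. f x * \<phi> x))"
    unfolding pd ..
  also have "\<dots> = 0"
  proof (rule integral_pderivative_eq_0)
    show "(\<lambda>x. f x * \<phi> x) differentiable at x" for x
      by (intro differentiable_mult smooth_fun_differentiable f test_funs_smooth[OF \<phi>])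
    show "continuous_on UNIV (pderivative i (\<lambda>x. f x * \<phi> x))" unfolding pd by (intro continuous_on_add c)
    show "f x * \<phi> x = 0" if "R < norm x" for x using R[OF that] by simp
  qed
  finally show ?thesis using i by simp
qed

section \<open>Weak gradients\<close>

lemma L2_component:
  fixes g :: "'a::euclidean_space \<Rightarrow> real^'n"
  assumes g: "g \<in> L2 D"
  shows "(\<lambda>x. g x $ i) \<in> L2 D"
proof -
  from g have m: "(\<lambda>x. g x $ i) \<in> borel_measurable (lebesgue_on D)"
    using borel_measurable_inner[of g "lebesgue_on D" "\<lambda>_. axis i 1"] by (simp add: L2_def inner_axis)
  have "integrable (lebesgue_on D) (\<lambda>x. (norm (g x $ i))\<^sup>2)"
  proof (rule Bochner_Integration.integrable_bound)
    show "integrable (lebesgue_on D) (\<lambda>x. (norm (g x))\<^sup>2)" using g by (simp add: L2_def)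
    show "(\<lambda>x. (norm (g x $ i))\<^sup>2) \<in> borel_measurable (lebesgue_on D)" using m by measurable
    show "AE x in lebesgue_on D. norm ((norm (g x $ i))\<^sup>2) \<le> norm ((norm (g x))\<^sup>2)"
    proof (rule AE_I2)
      show "norm ((norm (g x $ i))\<^sup>2) \<le> norm ((norm (g x))\<^sup>2)" for x
        using power_mono[OF component_le_norm_cart[of "g x" i] abs_ge_zero, of 2] by simp
    qed
  qed
  with m show ?thesis by (simp add: L2_def)
qed

lemma L2_vec:
  fixes g :: "'a::euclidean_space \<Rightarrow> real^'n"
  assumes g: "\<And>i. (\<lambda>x. g x $ i) \<in> L2 D"
  shows "g \<in> L2 D"
proof -
  have gm: "(\<lambda>x. g x $ i) \<in> borel_measurable (lebesgue_on D)" "integrable (lebesgue_on D) (\<lambda>x. (norm (g x $ i))\<^sup>2)" for i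
    using g[of i] by (auto simp: L2_def)
  have m: "g \<in> borel_measurable (lebesgue_on D)"
    unfolding borel_measurable_euclidean_space[of g] using gm(1) by (auto simp: Basis_vec_def inner_axis)
  have "(norm (g x))\<^sup>2 = (\<Sum>i\<in>UNIV. (norm (g x $ i))\<^sup>2)" for x
    by (simp only: power2_norm_eq_inner inner_vec_def)
  then have "integrable (lebesgue_on D) (\<lambda>x. (norm (g x))\<^sup>2)"
    using gm(2) by simp
  with m show ?thesis by (simp add: L2_def)
qed

lemma L2_times_integrable:
  fixes f g :: "'a::euclidean_space \<Rightarrow> real"
  shows "f \<in> L2 D \<Longrightarrow> g \<in> L2 D \<Longrightarrow> integrable (lebesgue_on D) (\<lambda>x. f x * g x)"
  using sq_integrable_inner[of f "lebesgue_on D" g] by (simp add: L2_eq_sq_integrable)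

lemma L2_lincomb:
  fixes f g :: "'a::euclidean_space \<Rightarrow> 'b::euclidean_space"
  shows "f \<in> L2 D \<Longrightarrow> g \<in> L2 D \<Longrightarrow> (\<lambda>x. a *\<^sub>R f x + b *\<^sub>R g x) \<in> L2 D"
  unfolding L2_eq_sq_integrable by (intro sq_integrable_add sq_integrable_scaleR)

text \<open>The classical gradient. For a test function \<open>weak_grad\<close> is some chosen
  representative, which agrees with this one almost everywhere on D
  (\<open>weak_grad_test_fun\<close>).\<close>

definition grad :: "(real^'n \<Rightarrow> real) \<Rightarrow> real^'n \<Rightarrow> real^'n" where
  "grad \<phi> x = (\<chi> i. pderivative i \<phi> x)"

lemma grad_test_fun_L2: "open D \<Longrightarrow> \<phi> \<in> test_funs D \<Longrightarrow> grad \<phi> \<in> L2 D"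
  by (rule L2_vec) (simp add: grad_def test_funs_L2 test_funs_pderivative)

lemma grad_is_weak_grad: "open D \<Longrightarrow> \<phi> \<in> test_funs D \<Longrightarrow> is_weak_grad D \<phi> (grad \<phi>)"
  unfolding is_weak_grad_def by (auto simp: grad_def integration_by_parts_test_fun test_funs_smooth)

lemma test_funs_H1: "open D \<Longrightarrow> \<phi> \<in> test_funs D \<Longrightarrow> \<phi> \<in> H1 D"
  unfolding H1_def using test_funs_L2 grad_test_fun_L2 grad_is_weak_grad by blast

lemma H1_L2: "v \<in> H1 D \<Longrightarrow> v \<in> L2 D"
  by (simp add: H1_def)

lemma weak_grad:
  assumes "v \<in> H1 D"
  shows weak_grad_L2: "weak_grad D v \<in> L2 D" and is_weak_grad_weak_grad: "is_weak_grad D v (weak_grad D v)"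
proof -
  have "\<exists>g. g \<in> L2 D \<and> is_weak_grad D v g" using assms by (auto simp: H1_def)
  then have "weak_grad D v \<in> L2 D \<and> is_weak_grad D v (weak_grad D v)"
    unfolding weak_grad_def by (rule someI_ex)
  then show "weak_grad D v \<in> L2 D" "is_weak_grad D v (weak_grad D v)" by auto
qed

text \<open>A bounded set has finite measure, so the constant 1 is square integrable and can serve
  as the second factor.\<close>

lemma L2_integrable:
  fixes h :: "real^'n \<Rightarrow> real"
  assumes D: "open D" "bounded D" and h: "h \<in> L2 D"
  shows "integrable (lebesgue_on D) h"
proof -
  have "emeasure (lebesgue_on D) (space (lebesgue_on D)) \<noteq> \<infinity>"
  proof -
    have "D \<in> lmeasurable" using D by (simp add: bounded_set_imp_lmeasurable)
    then have "emeasure lebesgue D \<noteq> \<infinity>" unfolding infinity_ennreal_def by (rule fmeasurableD2)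
    then show ?thesis using D by (simp add: emeasure_restrict_space space_restrict_space)
  qed
  then have "(\<lambda>x. 1 :: real) \<in> L2 D"
    unfolding L2_def by (auto simp: integrable_iff_bounded less_top)
  from L2_times_integrable[OF h this] show ?thesis by simp
qed

text \<open>Componentwise, the difference of the two gradients is orthogonal to all test functions.
  This is what makes the chosen representative \<open>weak_grad\<close> usable in
  computations.\<close>

lemma is_weak_grad_unique:
  fixes v :: "real^'n \<Rightarrow> real"
  assumes D: "open D" "bounded D" and g: "g \<in> L2 D" "g' \<in> L2 D"
    and wg: "is_weak_grad D v g" "is_weak_grad D v g'"
  shows "AE x in lebesgue_on D. g x = g' x"
proof -
  have "AE x in lebesgue_on D. g x $ i - g' x $ i = 0" for i
  proof (rule fundamental_lemma[OF D(1)])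
    show "integrable (lebesgue_on D) (\<lambda>x. g x $ i - g' x $ i)"
      by (intro Bochner_Integration.integrable_diff L2_integrable D L2_component g)
    fix \<phi> assume \<phi>: "\<phi> \<in> test_funs D"
    have "integral\<^sup>L (lebesgue_on D) (\<lambda>x. g x $ i * \<phi> x) = integral\<^sup>L (lebesgue_on D) (\<lambda>x. g' x $ i * \<phi> x)"
      using wg(1)[unfolded is_weak_grad_def, rule_format, OF \<phi>, of i]
        wg(2)[unfolded is_weak_grad_def, rule_format, OF \<phi>, of i] by simp
    moreover have "integrable (lebesgue_on D) (\<lambda>x. g x $ i * \<phi> x)" "integrable (lebesgue_on D) (\<lambda>x. g' x $ i * \<phi> x)"
      by (intro L2_times_integrable L2_component g test_funs_L2[OF D(1) \<phi>])+
    ultimately show "integral\<^sup>L (lebesgue_on D) (\<lambda>x. (g x $ i - g' x $ i) * \<phi> x) = 0"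
      by (simp add: left_diff_distrib)
  qed
  then have "AE x in lebesgue_on D. \<forall>i. g x $ i - g' x $ i = 0"
    by (intro AE_finite_allI[of UNIV, simplified]) auto
  then show ?thesis by eventually_elim (simp add: vec_eq_iff)
qed

lemma is_weak_grad_lincomb:
  assumes D: "open D" and L: "v \<in> L2 D" "w \<in> L2 D" "g \<in> L2 D" "h \<in> L2 D"
    and wg: "is_weak_grad D v g" "is_weak_grad D w h"
  shows "is_weak_grad D (\<lambda>x. a * v x + b * w x) (\<lambda>x. a *\<^sub>R g x + b *\<^sub>R h x)"
  unfolding is_weak_grad_def
proof (intro ballI allI)
  fix \<phi> i assume \<phi>: "\<phi> \<in> test_funs D"
  note int = L2_times_integrable[OF L(1) test_funs_L2[OF D test_funs_pderivative[OF \<phi>]]]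
    L2_times_integrable[OF L(2) test_funs_L2[OF D test_funs_pderivative[OF \<phi>]]]
    L2_times_integrable[OF L2_component[OF L(3)] test_funs_L2[OF D \<phi>]]
    L2_times_integrable[OF L2_component[OF L(4)] test_funs_L2[OF D \<phi>]]
  have "integral\<^sup>L (lebesgue_on D) (\<lambda>x. (a * v x + b * w x) * pderivative i \<phi> x)
      = a * integral\<^sup>L (lebesgue_on D) (\<lambda>x. v x * pderivative i \<phi> x) + b * integral\<^sup>L (lebesgue_on D) (\<lambda>x. w x * pderivative i \<phi> x)"
    using int by (simp add: distrib_right mult.assoc)
  also have "\<dots> = - (a * integral\<^sup>L (lebesgue_on D) (\<lambda>x. g x $ i * \<phi> x) + b * integral\<^sup>L (lebesgue_on D) (\<lambda>x. h x $ i * \<phi> x))"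
    using wg \<phi> unfolding is_weak_grad_def by simp
  also have "\<dots> = - integral\<^sup>L (lebesgue_on D) (\<lambda>x. (a *\<^sub>R g x + b *\<^sub>R h x) $ i * \<phi> x)"
    using int by (simp add: distrib_right mult.assoc)
  finally show "integral\<^sup>L (lebesgue_on D) (\<lambda>x. (a * v x + b * w x) * pderivative i \<phi> x)
      = - integral\<^sup>L (lebesgue_on D) (\<lambda>x. (a *\<^sub>R g x + b *\<^sub>R h x) $ i * \<phi> x)" .
qed

lemma H1_lincomb:
  assumes D: "open D" and v: "v \<in> H1 D" and w: "w \<in> H1 D"
  shows "(\<lambda>x. a * v x + b * w x) \<in> H1 D"
proof -
  have "is_weak_grad D (\<lambda>x. a * v x + b * w x) (\<lambda>x. a *\<^sub>R weak_grad D v x + b *\<^sub>R weak_grad D w x)"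
    by (intro is_weak_grad_lincomb D H1_L2 weak_grad v w)
  moreover have "(\<lambda>x. a *\<^sub>R weak_grad D v x + b *\<^sub>R weak_grad D w x) \<in> L2 D"
    by (intro L2_lincomb weak_grad v w)
  moreover have "(\<lambda>x. a * v x + b * w x) \<in> L2 D"
    using L2_lincomb[OF H1_L2[OF v] H1_L2[OF w], of a b] by simp
  ultimately show ?thesis by (auto simp: H1_def)
qed

text \<open>Linearity is an almost everywhere statement, since the two sides involve separate
  choices of representatives; uniqueness of weak gradients reconciles them.\<close>

lemma weak_grad_lincomb:
  assumes D: "open D" "bounded D" and v: "v \<in> H1 D" and w: "w \<in> H1 D"
  shows "AE x in lebesgue_on D. weak_grad D (\<lambda>x. a * v x + b * w x) x = a *\<^sub>R weak_grad D v x + b *\<^sub>R weak_grad D w x"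
proof (rule is_weak_grad_unique[OF D])
  have "(\<lambda>x. a * v x + b * w x) \<in> H1 D" by (intro H1_lincomb D v w)
  then show "weak_grad D (\<lambda>x. a * v x + b * w x) \<in> L2 D"
    "is_weak_grad D (\<lambda>x. a * v x + b * w x) (weak_grad D (\<lambda>x. a * v x + b * w x))"
    by (rule weak_grad)+
  show "is_weak_grad D (\<lambda>x. a * v x + b * w x) (\<lambda>x. a *\<^sub>R weak_grad D v x + b *\<^sub>R weak_grad D w x)"
    by (intro is_weak_grad_lincomb D H1_L2 weak_grad v w)
qed (intro L2_lincomb weak_grad v w)

section \<open>The energy inner product\<close>

definition V_inner :: "(real^'n) set \<Rightarrow> (real^'n \<Rightarrow> real) \<Rightarrow> (real^'n \<Rightarrow> real) \<Rightarrow> real" where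
  "V_inner D v w = integral\<^sup>L (lebesgue_on D) (\<lambda>x. weak_grad D v x \<bullet> weak_grad D w x)"

lemma V_norm_nonneg [simp]: "0 \<le> V_norm D v"
  by (simp add: V_norm_def L2_norm_eq_sq_norm)

lemma V_norm_power2: "(V_norm D v)\<^sup>2 = V_inner D v v"
  by (simp add: V_norm_def L2_norm_eq_sq_norm sq_norm_power2 V_inner_def power2_norm_eq_inner)

lemma V_inner_cauchy_schwarz:
  "v \<in> H1 D \<Longrightarrow> w \<in> H1 D \<Longrightarrow> \<bar>V_inner D v w\<bar> \<le> V_norm D v * V_norm D w"
  unfolding V_inner_def V_norm_def L2_norm_eq_sq_norm
  by (intro cauchy_schwarz_integral) (simp_all flip: L2_eq_sq_integrable add: weak_grad_L2)

lemma weak_grad_measurable: "v \<in> H1 D \<Longrightarrow> weak_grad D v \<in> borel_measurable (lebesgue_on D)"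
  using weak_grad_L2 by (auto simp: L2_def)

lemma V_inner_commute: "V_inner D v w = V_inner D w v"
  by (simp add: V_inner_def inner_commute)

lemma weak_grad_inner_integrable:
  "v \<in> H1 D \<Longrightarrow> w \<in> H1 D \<Longrightarrow> integrable (lebesgue_on D) (\<lambda>x. weak_grad D v x \<bullet> weak_grad D w x)"
  by (intro sq_integrable_inner) (simp_all flip: L2_eq_sq_integrable add: weak_grad_L2)

lemma V_inner_lincomb:
  assumes D: "open D" "bounded D" and v: "v \<in> H1 D" and w: "w \<in> H1 D" and g: "g \<in> H1 D"
  shows "V_inner D (\<lambda>x. a * v x + b * w x) g = a * V_inner D v g + b * V_inner D w g"
proof -
  have [measurable]: "weak_grad D v \<in> borel_measurable (lebesgue_on D)" "weak_grad D w \<in> borel_measurable (lebesgue_on D)"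
    "weak_grad D g \<in> borel_measurable (lebesgue_on D)" "weak_grad D (\<lambda>x. a * v x + b * w x) \<in> borel_measurable (lebesgue_on D)"
    by (intro weak_grad_measurable v w g H1_lincomb D)+
  have "V_inner D (\<lambda>x. a * v x + b * w x) g =
      integral\<^sup>L (lebesgue_on D) (\<lambda>x. a * (weak_grad D v x \<bullet> weak_grad D g x) + b * (weak_grad D w x \<bullet> weak_grad D g x))"
    unfolding V_inner_def
  proof (rule integral_cong_AE)
    show "AE x in lebesgue_on D. weak_grad D (\<lambda>x. a * v x + b * w x) x \<bullet> weak_grad D g x =
        a * (weak_grad D v x \<bullet> weak_grad D g x) + b * (weak_grad D w x \<bullet> weak_grad D g x)"
      using weak_grad_lincomb[OF D v w, of a b] by eventually_elim (simp add: inner_add_left)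
  qed measurable
  also have "\<dots> = a * V_inner D v g + b * V_inner D w g"
    using weak_grad_inner_integrable[OF v g] weak_grad_inner_integrable[OF w g] by (simp add: V_inner_def)
  finally show ?thesis .
qed

lemma V_inner_lincomb_right:
  assumes D: "open D" "bounded D" and v: "v \<in> H1 D" and w: "w \<in> H1 D" and g: "g \<in> H1 D"
  shows "V_inner D g (\<lambda>x. a * v x + b * w x) = a * V_inner D g v + b * V_inner D g w"
  using V_inner_lincomb[OF assms, of a b] by (simp add: V_inner_commute)

lemma V_norm_lincomb_le:
  assumes D: "open D" "bounded D" and v: "v \<in> H1 D" and w: "w \<in> H1 D"
  shows "V_norm D (\<lambda>x. a * v x + b * w x) \<le> \<bar>a\<bar> * V_norm D v + \<bar>b\<bar> * V_norm D w"
proof -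
  have s: "sq_norm (lebesgue_on D) (weak_grad D (\<lambda>x. a * v x + b * w x)) =
      sq_norm (lebesgue_on D) (\<lambda>x. a *\<^sub>R weak_grad D v x + b *\<^sub>R weak_grad D w x)"
    by (intro sq_norm_cong_AE weak_grad_lincomb D v w weak_grad_measurable H1_lincomb
        borel_measurable_add borel_measurable_scaleR borel_measurable_const)
  show ?thesis
    unfolding V_norm_def L2_norm_eq_sq_norm s sq_norm_scaleR[symmetric]
    by (intro sq_norm_triangle sq_integrable_scaleR) (simp_all flip: L2_eq_sq_integrable add: weak_grad_L2 v w)
qed

lemma V_norm_scale:
  assumes D: "open D" "bounded D" and v: "v \<in> H1 D"
  shows "V_norm D (\<lambda>x. a * v x) = \<bar>a\<bar> * V_norm D v"
proof -
  have "(V_norm D (\<lambda>x. a * v x))\<^sup>2 = (\<bar>a\<bar> * V_norm D v)\<^sup>2"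
    using V_inner_lincomb[OF D v v, of "\<lambda>x. a * v x + 0 * v x" a 0] V_inner_lincomb_right[OF D v v v, of a 0]
      H1_lincomb[OF D(1) v v, of a 0]
    by (simp add: V_norm_power2 power_mult_distrib) (simp add: power2_eq_square)
  then show ?thesis by (simp add: power2_eq_iff_nonneg)
qed

lemma L2_norm_lincomb_le:
  assumes v: "v \<in> L2 D" and w: "w \<in> L2 D"
  shows "L2_norm D (\<lambda>x. a * v x + b * w x) \<le> \<bar>a\<bar> * L2_norm D v + \<bar>b\<bar> * L2_norm D (w :: 'a::euclidean_space \<Rightarrow> real)"
  using sq_norm_triangle[OF sq_integrable_scaleR[of v "lebesgue_on D" a] sq_integrable_scaleR[of w "lebesgue_on D" b]] v w
    sq_norm_scaleR[of "lebesgue_on D" a v] sq_norm_scaleR[of "lebesgue_on D" b w]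
  by (simp add: L2_norm_eq_sq_norm L2_eq_sq_integrable)

section \<open>The closure of the test functions\<close>

lemma H1_norm_bounds:
  "L2_norm D v \<le> H1_norm D v" "V_norm D v \<le> H1_norm D v" "H1_norm D v \<le> L2_norm D v + V_norm D v"
proof -
  have nn: "0 \<le> L2_norm D v" by (simp add: L2_norm_eq_sq_norm)
  show "L2_norm D v \<le> H1_norm D v" "V_norm D v \<le> H1_norm D v"
    unfolding H1_norm_def V_norm_def by (auto intro!: real_le_rsqrt)
  show "H1_norm D v \<le> L2_norm D v + V_norm D v"
    unfolding H1_norm_def V_norm_def[symmetric] by (rule sqrt_sum_squares_le_sum[OF nn V_norm_nonneg])
qed

lemma H10_H1: "v \<in> H10 D \<Longrightarrow> v \<in> H1 D"
  by (simp add: H10_def)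

lemma H10I:
  assumes v: "v \<in> H1 D" and \<phi>: "\<And>m. \<phi> m \<in> test_funs D"
    and L: "(\<lambda>m. L2_norm D (\<lambda>x. v x - \<phi> m x)) \<longlonglongrightarrow> 0" and V: "(\<lambda>m. V_norm D (\<lambda>x. v x - \<phi> m x)) \<longlonglongrightarrow> 0"
  shows "v \<in> H10 D"
proof -
  have "(\<lambda>m. H1_norm D (\<lambda>x. v x - \<phi> m x)) \<longlonglongrightarrow> 0"
  proof (rule tendsto_sandwich[OF _ _ tendsto_const])
    show "(\<lambda>m. L2_norm D (\<lambda>x. v x - \<phi> m x) + V_norm D (\<lambda>x. v x - \<phi> m x)) \<longlonglongrightarrow> 0"
      using tendsto_add[OF L V] by simp
    show "\<forall>\<^sub>F m in sequentially. H1_norm D (\<lambda>x. v x - \<phi> m x) \<le> L2_norm D (\<lambda>x. v x - \<phi> m x) + V_norm D (\<lambda>x. v x - \<phi> m x)"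
      by (simp add: H1_norm_bounds)
    show "\<forall>\<^sub>F m in sequentially. 0 \<le> H1_norm D (\<lambda>x. v x - \<phi> m x)"
      by (simp add: H1_norm_def)
  qed
  then show ?thesis using v \<phi> by (auto simp: H10_def)
qed

lemma H10E:
  assumes "v \<in> H10 D"
  obtains \<phi> where "\<And>m. \<phi> m \<in> test_funs D" "(\<lambda>m. L2_norm D (\<lambda>x. v x - \<phi> m x)) \<longlonglongrightarrow> 0"
    "(\<lambda>m. V_norm D (\<lambda>x. v x - \<phi> m x)) \<longlonglongrightarrow> 0"
proof -
  obtain \<phi> where \<phi>: "\<And>m. \<phi> m \<in> test_funs D" and lim: "(\<lambda>m. H1_norm D (\<lambda>x. v x - \<phi> m x)) \<longlonglongrightarrow> 0"
    using assms by (auto simp: H10_def)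
  have "(\<lambda>m. L2_norm D (\<lambda>x. v x - \<phi> m x)) \<longlonglongrightarrow> 0"
    by (rule tendsto_sandwich[OF _ _ tendsto_const lim]) (auto simp: H1_norm_bounds)
  moreover have "(\<lambda>m. V_norm D (\<lambda>x. v x - \<phi> m x)) \<longlonglongrightarrow> 0"
    by (rule tendsto_sandwich[OF _ _ tendsto_const lim]) (auto simp: H1_norm_bounds)
  ultimately show ?thesis using \<phi> that by blast
qed

lemma test_funs_H10:
  assumes D: "open D" "bounded D" and \<phi>: "\<phi> \<in> test_funs D"
  shows "\<phi> \<in> H10 D"
proof (rule H10I[where \<phi> = "\<lambda>_. \<phi>"])
  show "(\<lambda>m. L2_norm D (\<lambda>x. \<phi> x - \<phi> x)) \<longlonglongrightarrow> 0" by (simp add: L2_norm_def)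
  have "V_norm D (\<lambda>x. 0 * \<phi> x) = \<bar>0\<bar> * V_norm D \<phi>"
    by (rule V_norm_scale[OF D test_funs_H1[OF D(1) \<phi>]])
  then show "(\<lambda>m. V_norm D (\<lambda>x. \<phi> x - \<phi> x)) \<longlonglongrightarrow> 0" by simp
qed (use D \<phi> test_funs_H1 in auto)

lemma H10_lincomb:
  assumes D: "open D" "bounded D" and v: "v \<in> H10 D" and w: "w \<in> H10 D"
  shows "(\<lambda>x. a * v x + b * w x) \<in> H10 D"
proof -
  obtain \<phi> where \<phi>: "\<And>m. \<phi> m \<in> test_funs D" "(\<lambda>m. L2_norm D (\<lambda>x. v x - \<phi> m x)) \<longlonglongrightarrow> 0"
    "(\<lambda>m. V_norm D (\<lambda>x. v x - \<phi> m x)) \<longlonglongrightarrow> 0" using H10E[OF v] by blast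
  obtain \<psi> where \<psi>: "\<And>m. \<psi> m \<in> test_funs D" "(\<lambda>m. L2_norm D (\<lambda>x. w x - \<psi> m x)) \<longlonglongrightarrow> 0"
    "(\<lambda>m. V_norm D (\<lambda>x. w x - \<psi> m x)) \<longlonglongrightarrow> 0" using H10E[OF w] by blast
  have H: "(\<lambda>x. v x - \<phi> m x) \<in> H1 D" "(\<lambda>x. w x - \<psi> m x) \<in> H1 D" for m
    using H1_lincomb[OF D(1) H10_H1[OF v] test_funs_H1[OF D(1) \<phi>(1)], of 1 "-1" m]
      H1_lincomb[OF D(1) H10_H1[OF w] test_funs_H1[OF D(1) \<psi>(1)], of 1 "-1" m] by simp_all
  have eq: "(\<lambda>x. (a * v x + b * w x) - (a * \<phi> m x + b * \<psi> m x)) = (\<lambda>x. a * (v x - \<phi> m x) + b * (w x - \<psi> m x))" for m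
    by (simp add: algebra_simps)
  have z: "(\<lambda>m. \<bar>a\<bar> * f m + \<bar>b\<bar> * g m) \<longlonglongrightarrow> 0" if "f \<longlonglongrightarrow> 0" "g \<longlonglongrightarrow> 0" for f g :: "nat \<Rightarrow> real"
    using tendsto_add[OF tendsto_mult_left[OF that(1), of "\<bar>a\<bar>"] tendsto_mult_left[OF that(2), of "\<bar>b\<bar>"]] by simp
  show ?thesis
  proof (rule H10I[where \<phi> = "\<lambda>m x. a * \<phi> m x + b * \<psi> m x"])
    show "(\<lambda>x. a * v x + b * w x) \<in> H1 D" by (intro H1_lincomb D H10_H1 v w)
    show "(\<lambda>x. a * \<phi> m x + b * \<psi> m x) \<in> test_funs D" for m by (intro test_funs_lincomb \<phi> \<psi>)
    show "(\<lambda>m. L2_norm D (\<lambda>x. (a * v x + b * w x) - (a * \<phi> m x + b * \<psi> m x))) \<longlonglongrightarrow> 0"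
      unfolding eq
      by (rule tendsto_sandwich[OF _ _ tendsto_const z[OF \<phi>(2) \<psi>(2)]])
         (use L2_norm_lincomb_le[OF H1_L2[OF H(1)] H1_L2[OF H(2)]] in auto)
    show "(\<lambda>m. V_norm D (\<lambda>x. (a * v x + b * w x) - (a * \<phi> m x + b * \<psi> m x))) \<longlonglongrightarrow> 0"
      unfolding eq
      by (rule tendsto_sandwich[OF _ _ tendsto_const z[OF \<phi>(3) \<psi>(3)]])
         (use V_norm_lincomb_le[OF D H] in auto)
  qed
qed

lemma H10_scale: "open D \<Longrightarrow> bounded D \<Longrightarrow> v \<in> H10 D \<Longrightarrow> (\<lambda>x. a * v x) \<in> H10 D"
  using H10_lincomb[of D v v a 0] by simp

lemma V_inner_sum:
  assumes D: "open D" "bounded D" and \<phi>: "\<And>i. i < N \<Longrightarrow> \<phi> i \<in> test_funs D" and g: "g \<in> H1 D"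
  shows "V_inner D (\<lambda>x. \<Sum>i<N. c i * \<phi> i x) g = (\<Sum>i<(N::nat). c i * V_inner D (\<phi> i) g)"
  using \<phi>
proof (induction N)
  case 0
  then show ?case
    using V_inner_lincomb[OF D g g g, of 0 0] by simp
next
  case (Suc N)
  have "V_inner D (\<lambda>x. 1 * (\<Sum>i<N. c i * \<phi> i x) + c N * \<phi> N x) g
      = 1 * V_inner D (\<lambda>x. \<Sum>i<N. c i * \<phi> i x) g + c N * V_inner D (\<phi> N) g"
    using Suc.prems by (intro V_inner_lincomb D test_funs_H1[OF D(1)] test_funs_sum g) auto
  with Suc show ?case by simp
qed

section \<open>Poincare's inequality\<close>

lemma test_funs_smooth_mult:
  assumes f: "smooth_fun f" and \<phi>: "\<phi> \<in> test_funs D"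
  shows "(\<lambda>x. f x * \<phi> x) \<in> test_funs D"
proof -
  have sub: "closure {x. f x * \<phi> x \<noteq> 0} \<subseteq> closure {x. \<phi> x \<noteq> 0}"
    by (rule closure_mono) auto
  moreover have "compact (closure {x. f x * \<phi> x \<noteq> 0})"
    using sub \<phi> by (auto simp: test_funs_def compact_eq_bounded_closed intro: bounded_subset)
  ultimately show ?thesis
    using \<phi> smooth_fun_mult[OF f test_funs_smooth[OF \<phi>]] by (auto simp: test_funs_def)
qed

lemma coordinate_has_derivative:
  "((\<lambda>x :: real^'n. c * x $ i + d) has_derivative (\<lambda>h. c * h $ i)) (at x)"
  by (auto intro!: derivative_eq_intros bounded_linear.has_derivative[OF bounded_linear_vec_nth])

lemma smooth_fun_coordinate: "smooth_fun (\<lambda>x :: real^'n. x $ i)"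
proof (rule smooth_funI[where S = "{\<lambda>x. c * x $ i + d | c d. True}"])
  show "(\<lambda>x :: real^'n. x $ i) \<in> {\<lambda>x. c * x $ i + d | c d. True}"
    by (intro CollectI exI[of _ 1] exI[of _ 0]) simp
  show "g differentiable at x" if "g \<in> {\<lambda>x :: real^'n. c * x $ i + d | c d. True}" for g x
    using that coordinate_has_derivative unfolding differentiable_def by blast
  show "pderivative j g \<in> {\<lambda>x. c * x $ i + d | c d. True}" if gS: "g \<in> {\<lambda>x :: real^'n. c * x $ i + d | c d. True}" for g j
  proof -
    obtain c d where g: "g = (\<lambda>x. c * x $ i + d)" using gS by auto
    have "pderivative j g = (\<lambda>x. 0 * x $ i + c * axis j 1 $ i)"
      unfolding g by (rule ext, subst pderivative_eqI[OF coordinate_has_derivative]) simp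
    then show ?thesis by blast
  qed
qed

lemma weak_grad_test_fun:
  assumes D: "open D" "bounded D" and \<phi>: "\<phi> \<in> test_funs D"
  shows "AE x in lebesgue_on D. weak_grad D \<phi> x = grad \<phi> x"
  using D \<phi> by (intro is_weak_grad_unique[OF D, of _ _ \<phi>] weak_grad test_funs_H1 grad_test_fun_L2 grad_is_weak_grad)

text \<open>Integrating x_i \<phi> against the i-th derivative of \<phi> by parts shows that the
  squared L2 norm of \<phi> is -2 times the integral of \<phi> x_i times that derivative;
  Cauchy-Schwarz and |x_i| <= R yield the constant 2R.\<close>

lemma poincare_test_fun:
  fixes D :: "(real^'n) set"
  assumes D: "open D" "bounded D" and R: "\<And>x. x \<in> D \<Longrightarrow> norm x \<le> R" "0 \<le> R" and \<phi>: "\<phi> \<in> test_funs D"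
  shows "L2_norm D \<phi> \<le> 2 * R * V_norm D \<phi>"
proof -
  \<comment> \<open>Any one coordinate direction serves.\<close>
  obtain i :: 'n where True by blast
  define M where "M = lebesgue_on D"
  define \<psi> where "\<psi> x = x $ i * pderivative i \<phi> x" for x
  have \<psi>: "\<psi> \<in> test_funs D"
    unfolding \<psi>_def by (intro test_funs_smooth_mult smooth_fun_coordinate test_funs_pderivative \<phi>)
  have L: "\<phi> \<in> L2 D" "\<psi> \<in> L2 D" "grad \<phi> \<in> L2 D"
    by (intro test_funs_L2 grad_test_fun_L2 D \<phi> \<psi>)+
  have pd: "pderivative i (\<lambda>x. x $ i * \<phi> x) x = \<phi> x + x $ i * pderivative i \<phi> x" for x
  proof -
    have "pderivative i (\<lambda>x :: real^'n. x $ i) x = 1"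
      using pderivative_eqI[OF coordinate_has_derivative[of 1 i 0 x], of i] by simp
    then show ?thesis
      by (simp add: pderivative_mult smooth_fun_differentiable[OF smooth_fun_coordinate] smooth_fun_differentiable[OF test_funs_smooth[OF \<phi>]])
  qed
  have "integral\<^sup>L M (\<lambda>x. (x $ i * \<phi> x) * pderivative i \<phi> x) = - integral\<^sup>L M (\<lambda>x. pderivative i (\<lambda>x. x $ i * \<phi> x) x * \<phi> x)"
    unfolding M_def by (intro integration_by_parts_test_fun D \<phi> smooth_fun_mult smooth_fun_coordinate test_funs_smooth[OF \<phi>])
  moreover have "(\<lambda>x. (x $ i * \<phi> x) * pderivative i \<phi> x) = (\<lambda>x. \<phi> x * \<psi> x)"
    by (simp add: \<psi>_def fun_eq_iff)
  moreover have "(\<lambda>x. pderivative i (\<lambda>x. x $ i * \<phi> x) x * \<phi> x) = (\<lambda>x. (norm (\<phi> x))\<^sup>2 + \<phi> x * \<psi> x)"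
    unfolding pd by (simp add: \<psi>_def fun_eq_iff power2_eq_square algebra_simps)
  ultimately have "integral\<^sup>L M (\<lambda>x. \<phi> x * \<psi> x) = - integral\<^sup>L M (\<lambda>x. (norm (\<phi> x))\<^sup>2 + \<phi> x * \<psi> x)" by simp
  also have "\<dots> = - (integral\<^sup>L M (\<lambda>x. (norm (\<phi> x))\<^sup>2) + integral\<^sup>L M (\<lambda>x. \<phi> x * \<psi> x))"
    using L L2_times_integrable[OF L(1,2)] by (subst Bochner_Integration.integral_add) (auto simp: L2_def M_def)
  finally have "(sq_norm M \<phi>)\<^sup>2 = - 2 * integral\<^sup>L M (\<lambda>x. \<phi> x * \<psi> x)"
    unfolding sq_norm_power2 by simp
  also have "\<dots> \<le> 2 * (sq_norm M \<phi> * sq_norm M \<psi>)"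
    using cauchy_schwarz_integral[of \<phi> M \<psi>] L unfolding L2_eq_sq_integrable M_def by (simp add: abs_le_iff)
  finally have le: "(sq_norm M \<phi>)\<^sup>2 \<le> 2 * (sq_norm M \<phi> * sq_norm M \<psi>)" .
  have "sq_norm M \<psi> \<le> R * sq_norm M (grad \<phi>)"
  proof (rule power2_le_imp_le)
    have "(sq_norm M \<psi>)\<^sup>2 \<le> integral\<^sup>L M (\<lambda>x. R\<^sup>2 * (norm (grad \<phi> x))\<^sup>2)"
      unfolding sq_norm_power2
    proof (rule integral_mono)
      fix x assume "x \<in> space M"
      then have x: "x \<in> D" using D by (simp add: M_def space_restrict_space)
      have "\<bar>x $ i\<bar> \<le> R" using component_le_norm_cart[of x i] R(1)[OF x] by linarith
      moreover have "\<bar>pderivative i \<phi> x\<bar> \<le> norm (grad \<phi> x)"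
        using component_le_norm_cart[of "grad \<phi> x" i] by (simp add: grad_def)
      ultimately have "\<bar>\<psi> x\<bar> \<le> R * norm (grad \<phi> x)"
        unfolding \<psi>_def abs_mult by (intro mult_mono) auto
      then have "\<bar>\<psi> x\<bar>\<^sup>2 \<le> (R * norm (grad \<phi> x))\<^sup>2" by (rule power_mono) simp
      then show "(norm (\<psi> x))\<^sup>2 \<le> R\<^sup>2 * (norm (grad \<phi> x))\<^sup>2" by (simp add: power_mult_distrib)
    qed (use L in \<open>auto simp: L2_def M_def\<close>)
    also have "\<dots> = (R * sq_norm M (grad \<phi>))\<^sup>2" by (simp add: power_mult_distrib sq_norm_power2)
    finally show "(sq_norm M \<psi>)\<^sup>2 \<le> (R * sq_norm M (grad \<phi>))\<^sup>2" .
  qed (use R in simp)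
  from mult_left_mono[OF this sq_norm_nonneg[of M \<phi>]] le
  have "(sq_norm M \<phi>)\<^sup>2 \<le> 2 * (sq_norm M \<phi> * (R * sq_norm M (grad \<phi>)))" by linarith
  then have "sq_norm M \<phi> * sq_norm M \<phi> \<le> sq_norm M \<phi> * (2 * R * sq_norm M (grad \<phi>))"
    by (simp add: power2_eq_square mult_ac)
  then have "sq_norm M \<phi> \<le> 2 * R * sq_norm M (grad \<phi>)"
    using R(2) sq_norm_nonneg[of M \<phi>] by (cases "sq_norm M \<phi> = 0") (auto simp: mult_le_cancel_left)
  moreover have "sq_norm M (grad \<phi>) = V_norm D \<phi>"
    unfolding V_norm_def L2_norm_eq_sq_norm M_def
    using weak_grad_test_fun[OF D \<phi>] L(3) weak_grad_measurable[OF test_funs_H1[OF D(1) \<phi>]]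
    by (intro sq_norm_cong_AE) (auto simp: L2_def elim: eventually_mono)
  ultimately show ?thesis by (simp add: L2_norm_eq_sq_norm M_def)
qed

text \<open>Passage to the limit along approximating test functions, with the constant 2R depending
  on D alone.\<close>

lemma poincare:
  fixes D :: "(real^'n) set"
  assumes D: "open D" "bounded D"
  obtains C where "C \<ge> 0" "\<And>v. v \<in> H10 D \<Longrightarrow> L2_norm D v \<le> C * V_norm D v"
proof -
  obtain R where R: "\<And>x. x \<in> D \<Longrightarrow> norm x \<le> R" "0 < R"
    using D(2) by (metis bounded_pos)
  have "L2_norm D v \<le> 2 * R * V_norm D v" if v: "v \<in> H10 D" for v
  proof -
    obtain \<phi> where \<phi>: "\<And>m. \<phi> m \<in> test_funs D" "(\<lambda>m. L2_norm D (\<lambda>x. v x - \<phi> m x)) \<longlonglongrightarrow> 0"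
      "(\<lambda>m. V_norm D (\<lambda>x. v x - \<phi> m x)) \<longlonglongrightarrow> 0" using H10E[OF v] by blast
    have v1: "v \<in> H1 D" by (rule H10_H1[OF v])
    have p1: "\<phi> m \<in> H1 D" for m by (rule test_funs_H1[OF D(1) \<phi>(1)])
    have d1: "(\<lambda>x. v x - \<phi> m x) \<in> H1 D" for m
      using H1_lincomb[OF D(1) v1 p1, of 1 "-1" m] by simp
    have "L2_norm D v \<le> L2_norm D (\<lambda>x. v x - \<phi> m x) + 2 * R * (V_norm D v + V_norm D (\<lambda>x. v x - \<phi> m x))" for m
    proof -
      have "L2_norm D v \<le> L2_norm D (\<lambda>x. v x - \<phi> m x) + L2_norm D (\<phi> m)"
        using L2_norm_lincomb_le[OF H1_L2[OF d1] H1_L2[OF p1], of 1 m 1 m] by simp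
      also have "L2_norm D (\<phi> m) \<le> 2 * R * V_norm D (\<phi> m)"
        by (rule poincare_test_fun[OF D _ _ \<phi>(1)]) (use R in auto)
      also have "V_norm D (\<phi> m) \<le> V_norm D v + V_norm D (\<lambda>x. v x - \<phi> m x)"
        using V_norm_lincomb_le[OF D v1 d1, of 1 "-1" m] by simp
      finally show ?thesis using R(2) by (simp add: mult_left_mono)
    qed
    moreover have "(\<lambda>m. L2_norm D (\<lambda>x. v x - \<phi> m x) + 2 * R * (V_norm D v + V_norm D (\<lambda>x. v x - \<phi> m x)))
        \<longlonglongrightarrow> 0 + 2 * R * (V_norm D v + 0)"
      by (intro tendsto_intros \<phi>)
    ultimately have "L2_norm D v \<le> 0 + 2 * R * (V_norm D v + 0)"
      by (intro LIMSEQ_le_const) auto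
    then show ?thesis by simp
  qed
  then show ?thesis using R(2) by (intro that[of "2 * R"]) auto
qed

section \<open>Holomorphic coefficient forms\<close>

text \<open>Induction on the set of coordinates still allowed inside their ellipses: the maximum
  principle for the real part of -h in one coordinate pushes that coordinate to the ellipse
  itself.\<close>

lemma filled_polyellipse_min_principle:
  fixes \<rho> :: "real^'d"
  assumes \<rho>: "\<And>j. 1 < \<rho> $ j" and h: "h \<in> ellipse_holomorphic \<rho>"
    and bound: "\<And>z. z \<in> bernstein_polyellipse \<rho> \<Longrightarrow> c \<le> Re (h z)"
    and z: "z \<in> filled_polyellipse \<rho>"
  shows "c \<le> Re (h z)"
proof -
  have "c \<le> Re (h z)"
    if "z \<in> filled_polyellipse \<rho>" "\<And>j. j \<notin> S \<Longrightarrow> z $ j \<in> bernstein_ellipse (\<rho> $ j)" for S z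
    using finite[of S] that
  proof (induction S arbitrary: z rule: finite_induct)
    case empty
    then show ?case by (intro bound) (auto simp: bernstein_polyellipse_def)
  next
    case (insert j S)
    have zj: "z $ j \<in> filled_ellipse (\<rho> $ j)" using insert.prems by (auto simp: filled_polyellipse_def)
    have "Re (- h (vec_upd z j (z $ j))) \<le> - c"
    proof (rule maximum_real_frontier[where S = "filled_ellipse (\<rho> $ j)" and f = "\<lambda>t. - h (vec_upd z j t)"])
      show "(\<lambda>t. - h (vec_upd z j t)) holomorphic_on interior (filled_ellipse (\<rho> $ j))"
        by (intro holomorphic_intros ellipse_holomorphic_slice[OF h insert.prems(1)])
      show "continuous_on (closure (filled_ellipse (\<rho> $ j))) (\<lambda>t. - h (vec_upd z j t))"
        using ellipse_holomorphic_slice(1)[OF h insert.prems(1), of j]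
        by (auto simp: closure_closed[OF closed_filled_ellipse] intro: continuous_intros)
      fix t assume "t \<in> frontier (filled_ellipse (\<rho> $ j))"
      then have t: "t \<in> bernstein_ellipse (\<rho> $ j)" using frontier_filled_ellipse[OF \<rho>] by blast
      have "c \<le> Re (h (vec_upd z j t))"
      proof (rule insert.IH)
        show "vec_upd z j t \<in> filled_polyellipse \<rho>"
          using t bernstein_ellipse_subset[OF \<rho>] by (intro vec_upd_in_filled_polyellipse insert.prems) auto
        show "vec_upd z j t $ i \<in> bernstein_ellipse (\<rho> $ i)" if "i \<notin> S" for i
          using that t insert.prems(2)[of i] by auto
      qed
      then show "Re (- h (vec_upd z j t)) \<le> - c" by simp
    qed (use zj bounded_filled_ellipse in auto)
    moreover have "vec_upd z j (z $ j) = z" by (simp add: vec_eq_iff)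
    ultimately show ?case by simp
  qed
  from this[of z UNIV] z show ?thesis by simp
qed

section \<open>The ring of admissible functions of the parameter\<close>

lemma ellipse_holomorphic_const: "(\<lambda>z. c) \<in> ellipse_holomorphic \<rho>"
  by (simp add: ellipse_holomorphic_def)

lemma ellipse_holomorphic_add:
  "f \<in> ellipse_holomorphic \<rho> \<Longrightarrow> g \<in> ellipse_holomorphic \<rho> \<Longrightarrow> (\<lambda>z. f z + g z) \<in> ellipse_holomorphic \<rho>"
  by (auto simp: ellipse_holomorphic_def intro!: continuous_intros holomorphic_intros)

lemma ellipse_holomorphic_mult:
  "f \<in> ellipse_holomorphic \<rho> \<Longrightarrow> g \<in> ellipse_holomorphic \<rho> \<Longrightarrow> (\<lambda>z. f z * g z) \<in> ellipse_holomorphic \<rho>"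
  by (auto simp: ellipse_holomorphic_def intro!: continuous_intros holomorphic_intros)

lemma ellipse_holomorphic_sum:
  "(\<And>i. i \<in> I \<Longrightarrow> f i \<in> ellipse_holomorphic \<rho>) \<Longrightarrow> (\<lambda>z. \<Sum>i\<in>I. f i z) \<in> ellipse_holomorphic \<rho>"
  by (induction I rule: infinite_finite_induct) (auto intro: ellipse_holomorphic_const ellipse_holomorphic_add)

lemma ellipse_holomorphic_inverse:
  assumes f: "f \<in> ellipse_holomorphic \<rho>" and nz: "\<And>z. z \<in> filled_polyellipse \<rho> \<Longrightarrow> f z \<noteq> 0"
  shows "(\<lambda>z. inverse (f z)) \<in> ellipse_holomorphic \<rho>"
  unfolding ellipse_holomorphic_def mem_Collect_eq
proof (intro conjI ballI allI)
  show "continuous_on (filled_polyellipse \<rho>) (\<lambda>z. inverse (f z))"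
    using f nz by (auto simp: ellipse_holomorphic_def intro!: continuous_intros)
  fix z j assume z: "z \<in> filled_polyellipse \<rho>"
  show "(\<lambda>t. inverse (f (vec_upd z j t))) holomorphic_on interior (filled_ellipse (\<rho> $ j))"
  proof (rule holomorphic_on_inverse[OF ellipse_holomorphic_slice(2)[OF f z]])
    show "f (vec_upd z j t) \<noteq> 0" if "t \<in> interior (filled_ellipse (\<rho> $ j))" for t
      using that interior_subset by (intro nz vec_upd_in_filled_polyellipse z) auto
  qed
qed

text \<open>The infimum is itself an essential bound: the bounds Inf + 1/(n + 1) have countably many
  exceptional null sets.\<close>

lemma Linf_norm_nonneg: "g \<in> Linf D \<Longrightarrow> 0 \<le> Linf_norm D g"
  and AE_le_Linf_norm: "g \<in> Linf D \<Longrightarrow> AE x in lebesgue_on D. norm (g x) \<le> Linf_norm D g"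
proof -
  assume g: "g \<in> Linf D"
  define S where "S = {C. 0 \<le> C \<and> (AE x in lebesgue_on D. norm (g x) \<le> C)}"
  obtain C where "AE x in lebesgue_on D. norm (g x) \<le> C" using g by (auto simp: Linf_def)
  then have "AE x in lebesgue_on D. norm (g x) \<le> \<bar>C\<bar>" by eventually_elim linarith
  then have "\<bar>C\<bar> \<in> S" by (simp add: S_def)
  then have ne: "S \<noteq> {}" by blast
  have bb: "bdd_below S" by (auto simp: S_def bdd_below_def)
  have eq: "Linf_norm D g = Inf S" by (simp add: Linf_norm_def S_def)
  show "0 \<le> Linf_norm D g" unfolding eq using ne by (intro cInf_greatest) (auto simp: S_def)
  have "AE x in lebesgue_on D. norm (g x) \<le> Inf S + 1 / real (Suc n)" for n
  proof -
    have "Inf S < Inf S + 1 / real (Suc n)" by simp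
    then obtain C where "C \<in> S" "C < Inf S + 1 / real (Suc n)" using cInf_lessD[OF ne] by blast
    then have "AE x in lebesgue_on D. norm (g x) \<le> C" "C \<le> Inf S + 1 / real (Suc n)" by (auto simp: S_def)
    then show ?thesis by (auto elim!: eventually_mono)
  qed
  then have "AE x in lebesgue_on D. \<forall>n. norm (g x) \<le> Inf S + 1 / real (Suc n)" by (simp add: AE_all_countable)
  then show "AE x in lebesgue_on D. norm (g x) \<le> Linf_norm D g"
    unfolding eq
  proof eventually_elim
    fix x assume *: "\<forall>n. norm (g x) \<le> Inf S + 1 / real (Suc n)"
    have "(\<lambda>n. Inf S + 1 / real (Suc n)) \<longlonglongrightarrow> Inf S + 0"
      by (intro tendsto_intros LIMSEQ_Suc[OF lim_1_over_n])
    then show "norm (g x) \<le> Inf S" using * by (intro LIMSEQ_le_const[of _ "Inf S"]) auto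
  qed
qed

lemma Linf_add: "g \<in> Linf D \<Longrightarrow> h \<in> Linf D \<Longrightarrow> (\<lambda>x. g x + h x) \<in> Linf D"
proof -
  assume g: "g \<in> Linf D" and h: "h \<in> Linf D"
  have "AE x in lebesgue_on D. norm (g x + h x) \<le> Linf_norm D g + Linf_norm D h"
    using AE_le_Linf_norm[OF g] AE_le_Linf_norm[OF h] by eventually_elim (rule norm_triangle_mono)
  then show ?thesis using g h by (auto simp: Linf_def)
qed

lemma Linf_scale: "g \<in> Linf D \<Longrightarrow> (\<lambda>x. g x * c) \<in> Linf D"
proof -
  assume g: "g \<in> Linf D"
  have "AE x in lebesgue_on D. norm (g x * c) \<le> Linf_norm D g * norm c"
    using AE_le_Linf_norm[OF g] by eventually_elim (simp add: norm_mult mult_right_mono)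
  then show ?thesis using g by (auto simp: Linf_def)
qed

lemma Linf_diff: "g \<in> Linf D \<Longrightarrow> h \<in> Linf D \<Longrightarrow> (\<lambda>x. g x - h x) \<in> Linf D"
  using Linf_add[OF _ Linf_scale[of h D "-1"], of g] by simp

lemma Linf_sum: "(\<And>j. j \<in> J \<Longrightarrow> g j \<in> Linf D) \<Longrightarrow> (\<lambda>x. \<Sum>j\<in>J. g j x) \<in> Linf D"
proof (induction J rule: infinite_finite_induct)
  case (insert j J)
  then show ?case by (simp add: Linf_add)
qed (auto simp: Linf_def intro!: exI[of _ 0])

lemma Linf_times_integrable:
  assumes g: "g \<in> Linf D" and p: "integrable (lebesgue_on D) (p :: _ \<Rightarrow> real)"
  shows "integrable (lebesgue_on D) (\<lambda>x. g x * of_real (p x))"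
proof (rule Bochner_Integration.integrable_bound)
  show "integrable (lebesgue_on D) (\<lambda>x. Linf_norm D g * norm (p x))"
    using p by (intro integrable_mult_right integrable_norm)
  show "(\<lambda>x. g x * of_real (p x)) \<in> borel_measurable (lebesgue_on D)"
    using g p by (intro borel_measurable_times) (auto simp: Linf_def)
  show "AE x in lebesgue_on D. norm (g x * of_real (p x)) \<le> norm (Linf_norm D g * norm (p x))"
    using AE_le_Linf_norm[OF g] by eventually_elim (auto simp: norm_mult abs_mult intro!: mult_mono)
qed

lemma norm_integral_Linf_le:
  assumes g: "g \<in> Linf D" and p: "integrable (lebesgue_on D) (p :: _ \<Rightarrow> real)"
  shows "cmod (integral\<^sup>L (lebesgue_on D) (\<lambda>x. g x * of_real (p x))) \<le> Linf_norm D g * integral\<^sup>L (lebesgue_on D) (\<lambda>x. \<bar>p x\<bar>)"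
proof -
  have "cmod (integral\<^sup>L (lebesgue_on D) (\<lambda>x. g x * of_real (p x))) \<le> integral\<^sup>L (lebesgue_on D) (\<lambda>x. cmod (g x * of_real (p x)))"
    by (rule integral_norm_bound)
  also have "\<dots> \<le> integral\<^sup>L (lebesgue_on D) (\<lambda>x. Linf_norm D g * \<bar>p x\<bar>)"
  proof (rule integral_mono_AE)
    show "AE x in lebesgue_on D. cmod (g x * of_real (p x)) \<le> Linf_norm D g * \<bar>p x\<bar>"
      using AE_le_Linf_norm[OF g] by eventually_elim (auto simp: norm_mult intro!: mult_right_mono)
  qed (use p Linf_times_integrable[OF g p] in auto)
  finally show ?thesis by simp
qed

text \<open>Pairing of the coefficient with an integrable weight. It turns the L-infinity-valued map
  into scalar functions of z, which become the Galerkin matrix entries when \<open>p\<close> is an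
  inner product of gradients.\<close>

definition Linf_form :: "(real^'n) set \<Rightarrow> (real^'n \<Rightarrow> complex^'d \<Rightarrow> complex) \<Rightarrow> (real^'n \<Rightarrow> real) \<Rightarrow> complex^'d \<Rightarrow> complex" where
  "Linf_form D b p z = integral\<^sup>L (lebesgue_on D) (\<lambda>x. b x z * of_real (p x))"

text \<open>Integration against p is a bounded linear functional on L-infinity, with norm at most
  the L1 norm of p, so the remainder estimate passes to the scalar function.\<close>

lemma Linf_form_has_derivative:
  fixes b :: "real^'n \<Rightarrow> complex^'d \<Rightarrow> complex"
  assumes b: "Linf_holomorphic D b" and p: "integrable (lebesgue_on D) p"
  shows "\<exists>L. (Linf_form D b p has_derivative (\<lambda>h. \<Sum>j\<in>UNIV. L j * h $ j)) (at z)"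
proof -
  have bL: "(\<lambda>x. b x w) \<in> Linf D" for w using b by (simp add: Linf_holomorphic_def)
  obtain A where A: "\<And>j. A j \<in> Linf D"
    and lim: "((\<lambda>w. Linf_norm D (\<lambda>x. b x w - b x z - (\<Sum>j\<in>UNIV. A j x * (w $ j - z $ j))) / norm (w - z)) \<longlongrightarrow> 0) (at z)"
    using b unfolding Linf_holomorphic_def by blast
  define r where "r w x = b x w - b x z - (\<Sum>j\<in>UNIV. A j x * (w $ j - z $ j))" for w x
  have rL: "r w \<in> Linf D" for w
    unfolding r_def by (intro Linf_diff Linf_sum Linf_scale A bL)
  define L where "L j = integral\<^sup>L (lebesgue_on D) (\<lambda>x. A j x * of_real (p x))" for j
  define P where "P = integral\<^sup>L (lebesgue_on D) (\<lambda>x. \<bar>p x\<bar>)"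
  have eq: "Linf_form D b p w - Linf_form D b p z - (\<Sum>j\<in>UNIV. L j * (w - z) $ j)
      = integral\<^sup>L (lebesgue_on D) (\<lambda>x. r w x * of_real (p x))" for w
  proof -
    have "integral\<^sup>L (lebesgue_on D) (\<lambda>x. r w x * of_real (p x)) =
       integral\<^sup>L (lebesgue_on D) (\<lambda>x. b x w * of_real (p x) - b x z * of_real (p x) - (\<Sum>j\<in>UNIV. (A j x * of_real (p x)) * (w $ j - z $ j)))"
      by (rule Bochner_Integration.integral_cong[OF refl])
         (simp only: r_def left_diff_distrib sum_distrib_right, simp only: mult_ac)
    also have "\<dots> = Linf_form D b p w - Linf_form D b p z - (\<Sum>j\<in>UNIV. L j * (w $ j - z $ j))"
      using Linf_times_integrable[OF bL p] Linf_times_integrable[OF A p]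
      by (simp add: Linf_form_def L_def)
    finally show ?thesis by simp
  qed
  have "((\<lambda>w. norm (Linf_form D b p w - Linf_form D b p z - (\<Sum>j\<in>UNIV. L j * (w - z) $ j)) / norm (w - z)) \<longlongrightarrow> 0) (at z)"
  proof (rule tendsto_sandwich[OF _ _ tendsto_const])
    show "((\<lambda>w. (Linf_norm D (r w) / norm (w - z)) * P) \<longlongrightarrow> 0) (at z)"
      using tendsto_mult_right[OF lim, of P] by (simp add: r_def[abs_def])
    show "\<forall>\<^sub>F w in at z. norm (Linf_form D b p w - Linf_form D b p z - (\<Sum>j\<in>UNIV. L j * (w - z) $ j)) / norm (w - z)
        \<le> (Linf_norm D (r w) / norm (w - z)) * P"
      unfolding eq using norm_integral_Linf_le[OF rL p]
      by (intro always_eventually allI) (simp add: P_def divide_right_mono)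
  qed simp
  moreover have "bounded_linear (\<lambda>h :: complex^'d. \<Sum>j\<in>UNIV. L j * h $ j)"
    by (intro bounded_linear_sum bounded_linear_const_mult bounded_linear_vec_nth)
  ultimately have "(Linf_form D b p has_derivative (\<lambda>h. \<Sum>j\<in>UNIV. L j * h $ j)) (at z)"
    by (simp add: has_derivative_iff_norm)
  then show ?thesis by blast
qed

text \<open>The derivative has the form h -> sum of L_j h_j with complex L_j, so along one
  coordinate it is multiplication by L_j, which is complex differentiability.\<close>

lemma Linf_form_ellipse_holomorphic:
  fixes b :: "real^'n \<Rightarrow> complex^'b \<Rightarrow> complex"
  assumes b: "Linf_holomorphic D b" and p: "integrable (lebesgue_on D) p"
  shows "Linf_form D b p \<in> ellipse_holomorphic \<rho>"
proof -
  have "continuous_on S (Linf_form D b p)" for S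
    using Linf_form_has_derivative[OF b p]
    by (meson has_derivative_continuous continuous_at_imp_continuous_on)
  moreover have "(\<lambda>t. Linf_form D b p (vec_upd z j t)) holomorphic_on S" for z j S
  proof -
    have "\<exists>L. ((\<lambda>t. Linf_form D b p (vec_upd z j t)) has_field_derivative L) (at t)" for t
    proof -
      obtain L where L: "(Linf_form D b p has_derivative (\<lambda>h. \<Sum>j\<in>UNIV. L j * h $ j)) (at (vec_upd z j t))"
        using Linf_form_has_derivative[OF b p] by blast
      have "((\<lambda>t. vec_upd z j t) has_derivative (\<lambda>k. axis j k)) (at t)"
      proof -
        have "linear (axis j :: complex \<Rightarrow> complex^'b)"
          by (rule linearI) (auto simp: vec_eq_iff axis_def)
        then have "bounded_linear (axis j :: complex \<Rightarrow> complex^'b)" by (simp add: linear_conv_bounded_linear)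
        then have "((\<lambda>t. vec_upd z j 0 + axis j t) has_derivative (\<lambda>k. 0 + axis j k)) (at t)"
          by (rule has_derivative_add[OF has_derivative_const bounded_linear_imp_has_derivative])
        moreover have "(\<lambda>t. vec_upd z j 0 + axis j t) = vec_upd z j"
          by (auto simp: fun_eq_iff vec_eq_iff axis_def)
        ultimately show ?thesis by simp
      qed
      from has_derivative_compose[OF this L]
      have "((\<lambda>t. Linf_form D b p (vec_upd z j t)) has_derivative (\<lambda>k. L j * k)) (at t)"
        by (simp add: axis_def if_distrib if_distribR cong: if_cong)
      then show ?thesis unfolding has_field_derivative_def by blast
    qed
    then show ?thesis unfolding holomorphic_on_def field_differentiable_def
      by (meson has_field_derivative_at_within)
  qed
  ultimately show ?thesis by (simp add: ellipse_holomorphic_def)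
qed

text \<open>Differentiability gives a linear bound near z: \<open>K\<close> adds the norms of the
  components of the derivative and 1 for the remainder, which is at most |w - z| there. The almost
  everywhere form is the one that \<open>weak_solution_stability\<close> takes as
  hypothesis.\<close>

lemma Linf_holomorphic_continuous:
  fixes b :: "real^'n \<Rightarrow> complex^'d \<Rightarrow> complex"
  assumes b: "Linf_holomorphic D b" and e: "0 < e"
  obtains r where "0 < r" "\<And>w. norm (w - z) < r \<Longrightarrow> AE x in lebesgue_on D. cmod (b x w - b x z) \<le> e"
proof -
  have bL: "(\<lambda>x. b x w) \<in> Linf D" for w using b by (simp add: Linf_holomorphic_def)
  obtain A where A: "\<And>j. A j \<in> Linf D"
    and lim: "((\<lambda>w. Linf_norm D (\<lambda>x. b x w - b x z - (\<Sum>j\<in>UNIV. A j x * (w $ j - z $ j))) / norm (w - z)) \<longlongrightarrow> 0) (at z)"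
    using b unfolding Linf_holomorphic_def by blast
  define r where "r w x = b x w - b x z - (\<Sum>j\<in>UNIV. A j x * (w $ j - z $ j))" for w x
  have rL: "r w \<in> Linf D" for w
    unfolding r_def by (intro Linf_diff Linf_sum Linf_scale A bL)
  define K where "K = 1 + (\<Sum>j\<in>UNIV. Linf_norm D (A j))"
  have K: "K \<ge> 1" unfolding K_def using Linf_norm_nonneg[OF A] by (simp add: sum_nonneg)
  have "eventually (\<lambda>w. Linf_norm D (r w) / norm (w - z) < 1) (at z)"
    using order_tendstoD(2)[OF lim, of 1] by (simp add: r_def[abs_def])
  then obtain s where s: "s > 0" "\<And>w. w \<noteq> z \<Longrightarrow> dist w z < s \<Longrightarrow> Linf_norm D (r w) / norm (w - z) < 1"
    unfolding eventually_at by blast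
  show ?thesis
  proof (rule that[of "min s (e / K)"])
    show "0 < min s (e / K)" using s e K by simp
    fix w assume w: "norm (w - z) < min s (e / K)"
    have le: "Linf_norm D (r w) \<le> norm (w - z)" if "w \<noteq> z"
      using s(2)[OF that] w that by (simp add: dist_norm field_simps)
    show "AE x in lebesgue_on D. cmod (b x w - b x z) \<le> e"
    proof (cases "w = z")
      case False
      have "AE x in lebesgue_on D. \<forall>j\<in>UNIV. cmod (A j x) \<le> Linf_norm D (A j)"
        by (intro AE_finite_allI) (auto intro: AE_le_Linf_norm A)
      with AE_le_Linf_norm[OF rL[of w]] show ?thesis
      proof eventually_elim
        fix x assume rx: "cmod (r w x) \<le> Linf_norm D (r w)" and Ax: "\<forall>j\<in>UNIV. cmod (A j x) \<le> Linf_norm D (A j)"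
        have "b x w - b x z = r w x + (\<Sum>j\<in>UNIV. A j x * (w $ j - z $ j))" by (simp add: r_def)
        also have "cmod \<dots> \<le> norm (w - z) + (\<Sum>j\<in>UNIV. Linf_norm D (A j) * norm (w - z))"
        proof (rule norm_triangle_mono)
          show "cmod (r w x) \<le> norm (w - z)" using rx le[OF False] by linarith
          show "cmod (\<Sum>j\<in>UNIV. A j x * (w $ j - z $ j)) \<le> (\<Sum>j\<in>UNIV. Linf_norm D (A j) * norm (w - z))"
          proof (rule sum_norm_le)
            fix j :: 'd
            have "cmod (w $ j - z $ j) \<le> norm (w - z)" using Finite_Cartesian_Product.norm_nth_le[of "w - z" j] by simp
            then show "cmod (A j x * (w $ j - z $ j)) \<le> Linf_norm D (A j) * norm (w - z)"
              unfolding norm_mult using Ax by (intro mult_mono) (auto intro: Linf_norm_nonneg A)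
          qed
        qed
        also have "\<dots> = K * norm (w - z)" by (simp add: K_def sum_distrib_right distrib_right)
        also have "\<dots> \<le> K * (e / K)" using w K by (intro mult_left_mono) auto
        also have "\<dots> = e" using K by simp
        finally show "cmod (b x w - b x z) \<le> e" .
      qed
    qed (use e in simp)
  qed
qed

section \<open>Energy forms with a bounded real coefficient\<close>

definition V_form :: "(real^'n) set \<Rightarrow> (real^'n \<Rightarrow> real) \<Rightarrow> (real^'n \<Rightarrow> real) \<Rightarrow> (real^'n \<Rightarrow> real) \<Rightarrow> real" where
  "V_form D \<alpha> v w = integral\<^sup>L (lebesgue_on D) (\<lambda>x. \<alpha> x * (weak_grad D v x \<bullet> weak_grad D w x))"

lemma bounded_times_integrable:
  fixes \<alpha> p :: "'a \<Rightarrow> real"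
  assumes "\<alpha> \<in> borel_measurable M" "AE x in M. \<bar>\<alpha> x\<bar> \<le> K" "integrable M p"
  shows "integrable M (\<lambda>x. \<alpha> x * p x)"
proof (rule Bochner_Integration.integrable_bound)
  show "integrable M (\<lambda>x. K * \<bar>p x\<bar>)" using assms by auto
  show "AE x in M. norm (\<alpha> x * p x) \<le> norm (K * \<bar>p x\<bar>)"
    using assms(2) by eventually_elim (auto simp: abs_mult intro!: mult_right_mono)
qed (use assms in auto)

lemma V_form_lincomb:
  assumes D: "open D" "bounded D" and \<alpha>: "\<alpha> \<in> borel_measurable (lebesgue_on D)" "AE x in lebesgue_on D. \<bar>\<alpha> x\<bar> \<le> K"
    and v: "v \<in> H1 D" and w: "w \<in> H1 D" and g: "g \<in> H1 D"
  shows "V_form D \<alpha> (\<lambda>x. a * v x + b * w x) g = a * V_form D \<alpha> v g + b * V_form D \<alpha> w g"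
proof -
  have [measurable]: "weak_grad D v \<in> borel_measurable (lebesgue_on D)" "weak_grad D w \<in> borel_measurable (lebesgue_on D)"
    "weak_grad D g \<in> borel_measurable (lebesgue_on D)" "weak_grad D (\<lambda>x. a * v x + b * w x) \<in> borel_measurable (lebesgue_on D)"
    "\<alpha> \<in> borel_measurable (lebesgue_on D)"
    by (intro weak_grad_measurable v w g H1_lincomb D \<alpha>)+
  have "V_form D \<alpha> (\<lambda>x. a * v x + b * w x) g =
      integral\<^sup>L (lebesgue_on D) (\<lambda>x. a * (\<alpha> x * (weak_grad D v x \<bullet> weak_grad D g x)) + b * (\<alpha> x * (weak_grad D w x \<bullet> weak_grad D g x)))"
    unfolding V_form_def
  proof (rule integral_cong_AE)
    show "AE x in lebesgue_on D. \<alpha> x * (weak_grad D (\<lambda>x. a * v x + b * w x) x \<bullet> weak_grad D g x) =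
        a * (\<alpha> x * (weak_grad D v x \<bullet> weak_grad D g x)) + b * (\<alpha> x * (weak_grad D w x \<bullet> weak_grad D g x))"
      using weak_grad_lincomb[OF D v w, of a b] by eventually_elim (simp add: inner_add_left algebra_simps)
  qed measurable
  also have "\<dots> = a * V_form D \<alpha> v g + b * V_form D \<alpha> w g"
    using bounded_times_integrable[OF \<alpha> weak_grad_inner_integrable[OF v g]]
      bounded_times_integrable[OF \<alpha> weak_grad_inner_integrable[OF w g]] by (simp add: V_form_def)
  finally show ?thesis .
qed

lemma V_form_commute: "V_form D \<alpha> v w = V_form D \<alpha> w v"
  by (simp add: V_form_def inner_commute)

text \<open>Cauchy-Schwarz for the vector fields \<alpha> grad v and grad w.\<close>

lemma V_form_bound:
  assumes \<alpha>: "\<alpha> \<in> borel_measurable (lebesgue_on D)" "AE x in lebesgue_on D. \<bar>\<alpha> x\<bar> \<le> K" and K: "0 \<le> K"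
    and v: "v \<in> H1 D" and w: "w \<in> H1 D"
  shows "\<bar>V_form D \<alpha> v w\<bar> \<le> K * V_norm D v * V_norm D w"
proof -
  define M where "M = lebesgue_on D"
  define g where "g x = \<alpha> x *\<^sub>R weak_grad D v x" for x
  have vL: "weak_grad D v \<in> sq_integrable M" "weak_grad D w \<in> sq_integrable M"
    using weak_grad_L2 v w by (auto simp: M_def L2_eq_sq_integrable)
  have gm: "g \<in> borel_measurable M"
    unfolding g_def M_def by (intro borel_measurable_scaleR weak_grad_measurable v \<alpha>)
  have ae: "AE x in M. (norm (g x))\<^sup>2 \<le> K\<^sup>2 * (norm (weak_grad D v x))\<^sup>2"
    using \<alpha>(2) unfolding M_def
  proof eventually_elim
    fix x assume "\<bar>\<alpha> x\<bar> \<le> K"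
    then have "norm (g x) \<le> K * norm (weak_grad D v x)" by (simp add: g_def mult_right_mono)
    from power_mono[OF this norm_ge_zero, of 2]
    show "(norm (g x))\<^sup>2 \<le> K\<^sup>2 * (norm (weak_grad D v x))\<^sup>2" by (simp add: power_mult_distrib)
  qed
  have gi: "integrable M (\<lambda>x. (norm (g x))\<^sup>2)"
  proof (rule Bochner_Integration.integrable_bound)
    show "integrable M (\<lambda>x. K\<^sup>2 * (norm (weak_grad D v x))\<^sup>2)" using vL(1) by (auto simp: sq_integrable_def)
    show "AE x in M. norm ((norm (g x))\<^sup>2) \<le> norm (K\<^sup>2 * (norm (weak_grad D v x))\<^sup>2)"
      using ae by eventually_elim simp
  qed (use gm in measurable)
  then have gL: "g \<in> sq_integrable M" using gm by (simp add: sq_integrable_def)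
  have "(sq_norm M g)\<^sup>2 \<le> (K * V_norm D v)\<^sup>2"
  proof -
    have "(sq_norm M g)\<^sup>2 \<le> integral\<^sup>L M (\<lambda>x. K\<^sup>2 * (norm (weak_grad D v x))\<^sup>2)"
      unfolding sq_norm_power2 by (rule integral_mono_AE[OF gi _ ae]) (use vL in \<open>auto simp: sq_integrable_def\<close>)
    also have "\<dots> = (K * V_norm D v)\<^sup>2"
      by (simp add: power_mult_distrib V_norm_def L2_norm_eq_sq_norm sq_norm_power2 M_def)
    finally show ?thesis .
  qed
  then have g: "sq_norm M g \<le> K * V_norm D v" by (rule power2_le_imp_le) (use K in simp)
  have "V_form D \<alpha> v w = integral\<^sup>L M (\<lambda>x. g x \<bullet> weak_grad D w x)"
    by (simp add: V_form_def g_def M_def)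
  also have "\<bar>\<dots>\<bar> \<le> sq_norm M g * sq_norm M (weak_grad D w)"
    by (rule cauchy_schwarz_integral[OF gL vL(2)])
  also have "\<dots> \<le> (K * V_norm D v) * V_norm D w"
    using g by (simp add: V_norm_def L2_norm_eq_sq_norm M_def mult_right_mono)
  finally show ?thesis .
qed

lemma V_form_coercive:
  assumes \<alpha>: "\<alpha> \<in> borel_measurable (lebesgue_on D)" "AE x in lebesgue_on D. \<bar>\<alpha> x\<bar> \<le> K"
    and lower: "AE x in lebesgue_on D. c \<le> \<alpha> x" and v: "v \<in> H1 D"
  shows "c * (V_norm D v)\<^sup>2 \<le> V_form D \<alpha> v v"
proof -
  have i: "integrable (lebesgue_on D) (\<lambda>x. weak_grad D v x \<bullet> weak_grad D v x)"
    by (rule weak_grad_inner_integrable[OF v v])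
  have "c * (V_norm D v)\<^sup>2 = integral\<^sup>L (lebesgue_on D) (\<lambda>x. c * (weak_grad D v x \<bullet> weak_grad D v x))"
    by (simp add: V_norm_power2 V_inner_def)
  also have "\<dots> \<le> V_form D \<alpha> v v"
    unfolding V_form_def
  proof (rule integral_mono_AE)
    show "AE x in lebesgue_on D. c * (weak_grad D v x \<bullet> weak_grad D v x) \<le> \<alpha> x * (weak_grad D v x \<bullet> weak_grad D v x)"
      using lower by eventually_elim (simp add: mult_right_mono)
    show "integrable (lebesgue_on D) (\<lambda>x. \<alpha> x * (weak_grad D v x \<bullet> weak_grad D v x))"
      by (rule bounded_times_integrable[OF \<alpha> i])
  qed (use i in simp)
  finally show ?thesis .
qed

section \<open>Bounded functionals on the energy space\<close>

lemma V_dual_bdd_above: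
  assumes f: "f \<in> V_dual D"
  shows "bdd_above ((\<lambda>v. \<bar>f v\<bar>) ` {v \<in> H10 D. V_norm D v \<le> 1})"
proof -
  obtain C where C: "\<And>v. v \<in> H10 D \<Longrightarrow> \<bar>f v\<bar> \<le> C * V_norm D v"
    using f unfolding V_dual_def by blast
  show ?thesis
  proof (rule bdd_aboveI2)
    fix v assume v: "v \<in> {v \<in> H10 D. V_norm D v \<le> 1}"
    have "\<bar>f v\<bar> \<le> C * V_norm D v" using C v by blast
    also have "\<dots> \<le> \<bar>C\<bar> * V_norm D v" by (intro mult_right_mono) auto
    also have "\<dots> \<le> \<bar>C\<bar> * 1" using v by (intro mult_left_mono) auto
    finally show "\<bar>f v\<bar> \<le> \<bar>C\<bar>" by simp
  qed
qed

text \<open>Scaling to the unit ball, except at energy norm 0, where boundedness of f forces f v =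
  0.\<close>

lemma V_dual_le:
  assumes D: "open D" "bounded D" and f: "f \<in> V_dual D" and v: "v \<in> H10 D"
  shows "\<bar>f v\<bar> \<le> V_dual_norm D f * V_norm D v"
proof -
  obtain C where C: "\<And>v. v \<in> H10 D \<Longrightarrow> \<bar>f v\<bar> \<le> C * V_norm D v" and lin: "\<And>c v. v \<in> H10 D \<Longrightarrow> f (\<lambda>x. c * v x) = c * f v"
    using f unfolding V_dual_def by blast
  show ?thesis
  proof (cases "V_norm D v = 0")
    case True
    then show ?thesis using C[OF v] by simp
  next
    case False
    then have pos: "V_norm D v > 0" using V_norm_nonneg[of D v] by linarith
    define w where "w = (\<lambda>x. (1 / V_norm D v) * v x)"
    have "w \<in> H10 D" unfolding w_def by (rule H10_scale[OF D v])
    moreover have "V_norm D w \<le> 1"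
      unfolding w_def V_norm_scale[OF D H10_H1[OF v]] using pos by simp
    ultimately have "\<bar>f w\<bar> \<le> V_dual_norm D f"
      unfolding V_dual_norm_def using V_dual_bdd_above[OF f] by (intro cSUP_upper) auto
    moreover have "f w = (1 / V_norm D v) * f v" unfolding w_def by (rule lin[OF v])
    ultimately show ?thesis using pos by (simp add: abs_mult field_simps)
  qed
qed

lemma V_dual_norm_nonneg:
  assumes D: "open D" "bounded D" and f: "f \<in> V_dual D"
  shows "0 \<le> V_dual_norm D f"
proof -
  have z: "(\<lambda>x. 0) \<in> H10 D" by (rule test_funs_H10[OF D test_funs_zero])
  have "V_norm D (\<lambda>x. 0) = 0" using V_norm_scale[OF D H10_H1[OF z], of 0] by simp
  then have "\<bar>f (\<lambda>x. 0)\<bar> \<le> V_dual_norm D f"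
    unfolding V_dual_norm_def using z V_dual_bdd_above[OF f] by (intro cSUP_upper) auto
  then show ?thesis by linarith
qed

section \<open>Regularized Galerkin approximation\<close>

lemma weak_solution_form:
  "weak_solution D \<alpha> f w \<Longrightarrow> v \<in> H10 D \<Longrightarrow> V_form D \<alpha> w v = f v"
  by (simp add: weak_solution_def V_form_def)

lemma weak_solution_H1: "weak_solution D \<alpha> f w \<Longrightarrow> w \<in> H1 D"
  by (simp add: weak_solution_def H10_H1)

text \<open>The solution is tested with itself; one factor of its norm cancels unless that norm is
  0.\<close>

lemma weak_solution_bound:
  assumes D: "open D" "bounded D" and f: "f \<in> V_dual D"
    and \<alpha>: "\<alpha> \<in> borel_measurable (lebesgue_on D)" "AE x in lebesgue_on D. \<bar>\<alpha> x\<bar> \<le> K"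
    and lower: "AE x in lebesgue_on D. c \<le> \<alpha> x" and w: "weak_solution D \<alpha> f w"
  shows "c * V_norm D w \<le> V_dual_norm D f"
proof -
  have w10: "w \<in> H10 D" using w by (simp add: weak_solution_def)
  have "c * (V_norm D w)\<^sup>2 \<le> V_form D \<alpha> w w"
    by (rule V_form_coercive[OF \<alpha> lower weak_solution_H1[OF w]])
  also have "\<dots> = f w" by (rule weak_solution_form[OF w w10])
  also have "\<dots> \<le> V_dual_norm D f * V_norm D w" using V_dual_le[OF D f w10] by linarith
  finally have le: "V_norm D w * (c * V_norm D w) \<le> V_norm D w * V_dual_norm D f"
    by (simp add: power2_eq_square mult_ac)
  show ?thesis
  proof (cases "V_norm D w = 0")
    case True
    then show ?thesis using V_dual_norm_nonneg[OF D f] by simp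
  next
    case False
    then have "V_norm D w > 0" using V_norm_nonneg[of D w] by linarith
    then show ?thesis using le mult_le_cancel_left_pos by blast
  qed
qed

text \<open>With e = v - w, the energy of e under \<alpha> equals the form with coefficient \<beta>
  - \<alpha> at w and e, because both solutions give the same value f e. One factor 1/c comes from
  coercivity, the other from the bound on w.\<close>

lemma weak_solution_stability:
  assumes D: "open D" "bounded D" and f: "f \<in> V_dual D" and c: "0 < c" and s: "0 \<le> s"
    and \<alpha>: "\<alpha> \<in> borel_measurable (lebesgue_on D)" "AE x in lebesgue_on D. \<bar>\<alpha> x\<bar> \<le> K"
    and \<beta>: "\<beta> \<in> borel_measurable (lebesgue_on D)" "AE x in lebesgue_on D. \<bar>\<beta> x\<bar> \<le> K"
    and lower: "AE x in lebesgue_on D. c \<le> \<alpha> x" "AE x in lebesgue_on D. c \<le> \<beta> x"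
    and v: "weak_solution D \<alpha> f v" and w: "weak_solution D \<beta> f w"
    and close: "AE x in lebesgue_on D. \<bar>\<beta> x - \<alpha> x\<bar> \<le> s"
  shows "V_norm D (\<lambda>x. v x - w x) \<le> s * V_dual_norm D f / c\<^sup>2"
proof -
  define e where "e = (\<lambda>x. 1 * v x + (-1) * w x)"
  have v10: "v \<in> H10 D" and w10: "w \<in> H10 D" using v w by (auto simp: weak_solution_def)
  have e10: "e \<in> H10 D" unfolding e_def by (rule H10_lincomb[OF D v10 w10])
  note e1 = H10_H1[OF e10] and v1 = H10_H1[OF v10] and w1 = H10_H1[OF w10]
  have "V_form D \<alpha> e e = V_form D \<alpha> v e - V_form D \<alpha> w e"
    using V_form_lincomb[OF D \<alpha> v1 w1 e1, of 1 "-1"] unfolding e_def by simp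
  also have "V_form D \<alpha> v e = V_form D \<beta> w e"
    using weak_solution_form[OF v e10] weak_solution_form[OF w e10] by simp
  also have "V_form D \<beta> w e - V_form D \<alpha> w e = V_form D (\<lambda>x. \<beta> x - \<alpha> x) w e"
    using bounded_times_integrable[OF \<alpha> weak_grad_inner_integrable[OF w1 e1]]
      bounded_times_integrable[OF \<beta> weak_grad_inner_integrable[OF w1 e1]]
    by (simp add: V_form_def left_diff_distrib)
  also have "\<dots> \<le> s * V_norm D w * V_norm D e"
    using V_form_bound[OF _ close s w1 e1] \<alpha> \<beta> by fastforce
  finally have "c * (V_norm D e)\<^sup>2 \<le> s * V_norm D w * V_norm D e"
    using V_form_coercive[OF \<alpha> lower(1) e1] by linarith
  then have le: "V_norm D e * (c * V_norm D e) \<le> V_norm D e * (s * V_norm D w)"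
    by (simp add: power2_eq_square mult_ac)
  have "c * V_norm D e \<le> s * V_norm D w"
  proof (cases "V_norm D e = 0")
    case True
    then show ?thesis using s by simp
  next
    case False
    then have "V_norm D e > 0" using V_norm_nonneg[of D e] by linarith
    then show ?thesis using le mult_le_cancel_left_pos by blast
  qed
  also have "\<dots> \<le> s * (V_dual_norm D f / c)"
    using weak_solution_bound[OF D f \<beta> lower(2) w] c s by (intro mult_left_mono) (auto simp: field_simps)
  finally have "V_norm D e \<le> s * V_dual_norm D f / c\<^sup>2"
    using c by (simp add: field_simps power2_eq_square)
  then show ?thesis by (simp add: e_def)
qed

lemma V_dual_sum:
  assumes D: "open D" "bounded D" and f: "f \<in> V_dual D" and \<phi>: "\<And>i. i < N \<Longrightarrow> \<phi> i \<in> test_funs D"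
  shows "f (\<lambda>x. \<Sum>i<N. r i * \<phi> i x) = (\<Sum>i<(N::nat). r i * f (\<phi> i))"
  using \<phi>
proof (induction N)
  case 0
  have "\<forall>c. \<forall>v\<in>H10 D. f (\<lambda>x. c * v x) = c * f v"
    using f by (simp add: V_dual_def)
  from this[rule_format, OF test_funs_H10[OF D test_funs_zero], of 0] show ?case by simp
next
  case (Suc N)
  have H: "(\<lambda>x. \<Sum>i<N. r i * \<phi> i x) \<in> H10 D" "\<phi> N \<in> H10 D"
    using Suc.prems by (auto intro!: test_funs_H10[OF D] test_funs_sum)
  have add: "\<forall>v\<in>H10 D. \<forall>w\<in>H10 D. f (\<lambda>x. v x + w x) = f v + f w"
    and scale: "\<forall>c. \<forall>v\<in>H10 D. f (\<lambda>x. c * v x) = c * f v"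
    using f by (simp_all add: V_dual_def)
  have "f (\<lambda>x. (\<Sum>i<N. r i * \<phi> i x) + r N * \<phi> N x) = f (\<lambda>x. \<Sum>i<N. r i * \<phi> i x) + f (\<lambda>x. r N * \<phi> N x)"
    by (rule add[rule_format, OF H(1) H10_scale[OF D H(2)]])
  moreover have "f (\<lambda>x. r N * \<phi> N x) = r N * f (\<phi> N)"
    by (rule scale[rule_format, OF H(2)])
  ultimately show ?case using Suc by simp
qed

lemma grad_sum:
  assumes "\<And>i. i < N \<Longrightarrow> \<phi> i \<in> test_funs D"
  shows "grad (\<lambda>x. \<Sum>i<N. r i * \<phi> i x) x = (\<Sum>i<(N::nat). r i *\<^sub>R grad (\<phi> i) x)"
proof -
  have "pderivative j (\<lambda>x. \<Sum>i<N. r i * \<phi> i x) x = (\<Sum>i<N. r i * pderivative j (\<phi> i) x)" for j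
  proof (rule pderivative_eqI[THEN trans])
    show "((\<lambda>x. \<Sum>i<N. r i * \<phi> i x) has_derivative (\<lambda>h. \<Sum>i<N. r i * frechet_derivative (\<phi> i) (at x) h)) (at x)"
      by (intro has_derivative_sum has_derivative_mult_right smooth_fun_has_derivative test_funs_smooth[of _ D] assms) auto
  qed (simp add: pderivative_def)
  then show ?thesis by (simp add: grad_def vec_eq_iff)
qed

text \<open>Symmetry of the real Gram matrix cancels the imaginary part. This makes the weight in
  the complex Galerkin form real and nonnegative, so that a lower bound on the real part of the
  coefficient carries over.\<close>

lemma gram_form_real:
  fixes G :: "nat \<Rightarrow> 'a::real_inner"
  shows "(\<Sum>i<N. \<Sum>j<N. cnj (c i) * c j * of_real (G i \<bullet> G j))
    = of_real ((norm (\<Sum>i<N. Re (c i) *\<^sub>R G i))\<^sup>2 + (norm (\<Sum>i<N. Im (c i) *\<^sub>R G i))\<^sup>2)"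
proof (rule complex_eqI)
  have n: "(norm (\<Sum>i<N. r i *\<^sub>R G i))\<^sup>2 = (\<Sum>i<N. \<Sum>j<N. r i * r j * (G i \<bullet> G j))" for r
    unfolding power2_norm_eq_inner inner_sum_left inner_sum_right by (subst sum.swap) (simp add: mult_ac)
  show "Re (\<Sum>i<N. \<Sum>j<N. cnj (c i) * c j * of_real (G i \<bullet> G j)) =
    Re (of_real ((norm (\<Sum>i<N. Re (c i) *\<^sub>R G i))\<^sup>2 + (norm (\<Sum>i<N. Im (c i) *\<^sub>R G i))\<^sup>2))"
    unfolding n by (simp add: sum.distrib[symmetric] distrib_right)
  have "(\<Sum>i<N. \<Sum>j<N. Re (c i) * Im (c j) * (G i \<bullet> G j)) = (\<Sum>i<N. \<Sum>j<N. Im (c i) * Re (c j) * (G i \<bullet> G j))"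
    by (subst sum.swap) (simp add: inner_commute mult_ac)
  then show "Im (\<Sum>i<N. \<Sum>j<N. cnj (c i) * c j * of_real (G i \<bullet> G j)) =
    Im (of_real ((norm (\<Sum>i<N. Re (c i) *\<^sub>R G i))\<^sup>2 + (norm (\<Sum>i<N. Im (c i) *\<^sub>R G i))\<^sup>2))"
    by (simp add: sum_subtractf left_diff_distrib)
qed

lemma V_inner_test_funs:
  assumes D: "open D" "bounded D" and \<phi>: "\<phi> \<in> test_funs D" "\<psi> \<in> test_funs D"
  shows "V_inner D \<phi> \<psi> = integral\<^sup>L (lebesgue_on D) (\<lambda>x. grad \<phi> x \<bullet> grad \<psi> x)"
    and "integrable (lebesgue_on D) (\<lambda>x. grad \<phi> x \<bullet> grad \<psi> x)"
proof -
  have L: "grad \<phi> \<in> L2 D" "grad \<psi> \<in> L2 D" using D \<phi> by (auto intro: grad_test_fun_L2)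
  then show "integrable (lebesgue_on D) (\<lambda>x. grad \<phi> x \<bullet> grad \<psi> x)"
    unfolding L2_eq_sq_integrable by (rule sq_integrable_inner)
  show "V_inner D \<phi> \<psi> = integral\<^sup>L (lebesgue_on D) (\<lambda>x. grad \<phi> x \<bullet> grad \<psi> x)"
    unfolding V_inner_def
  proof (rule integral_cong_AE)
    show "AE x in lebesgue_on D. weak_grad D \<phi> x \<bullet> weak_grad D \<psi> x = grad \<phi> x \<bullet> grad \<psi> x"
      using weak_grad_test_fun[OF D \<phi>(1)] weak_grad_test_fun[OF D \<phi>(2)] by eventually_elim simp
  qed (use L D \<phi> in \<open>auto simp: L2_def intro!: borel_measurable_inner weak_grad_measurable test_funs_H1\<close>)
qed

lemma V_form_test_funs:
  assumes D: "open D" "bounded D" and \<alpha>: "\<alpha> \<in> borel_measurable (lebesgue_on D)"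
    and \<phi>: "\<phi> \<in> test_funs D" "\<psi> \<in> test_funs D"
  shows "V_form D \<alpha> \<phi> \<psi> = integral\<^sup>L (lebesgue_on D) (\<lambda>x. \<alpha> x * (grad \<phi> x \<bullet> grad \<psi> x))"
proof -
  have L: "grad \<phi> \<in> L2 D" "grad \<psi> \<in> L2 D" using D \<phi> by (auto intro: grad_test_fun_L2)
  show ?thesis
    unfolding V_form_def
  proof (rule integral_cong_AE)
    show "AE x in lebesgue_on D. \<alpha> x * (weak_grad D \<phi> x \<bullet> weak_grad D \<psi> x) = \<alpha> x * (grad \<phi> x \<bullet> grad \<psi> x)"
      using weak_grad_test_fun[OF D \<phi>(1)] weak_grad_test_fun[OF D \<phi>(2)] by eventually_elim simp
  qed (use L D \<phi> \<alpha> in \<open>auto simp: L2_def intro!: borel_measurable_times borel_measurable_inner weak_grad_measurable test_funs_H1\<close>)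
qed

text \<open>With the weight \<open>p\<close> fixed, the form is a scalar holomorphic function of z,
  to which the minimum principle applies; the pointwise bound on the coefficient is used on the
  ellipses only.\<close>

lemma Linf_form_coercive:
  fixes ac :: "real^'n \<Rightarrow> complex^'d \<Rightarrow> complex"
  assumes D: "open D" and ac: "Linf_holomorphic D ac" and \<rho>: "\<And>j. 1 < \<rho> $ j"
    and coercive: "\<And>x z. x \<in> D \<Longrightarrow> z \<in> bernstein_polyellipse \<rho> \<Longrightarrow> \<delta> \<le> Re (ac x z)"
    and p: "integrable (lebesgue_on D) p" "\<And>x. 0 \<le> p x" and z: "z \<in> filled_polyellipse \<rho>"
  shows "\<delta> * integral\<^sup>L (lebesgue_on D) p \<le> Re (Linf_form D ac p z)"
proof (rule filled_polyellipse_min_principle[OF \<rho> Linf_form_ellipse_holomorphic[OF ac p(1)] _ z])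
  fix z assume z: "z \<in> bernstein_polyellipse \<rho>"
  have acL: "(\<lambda>x. ac x z) \<in> Linf D" using ac by (simp add: Linf_holomorphic_def)
  have i: "integrable (lebesgue_on D) (\<lambda>x. ac x z * of_real (p x))" by (rule Linf_times_integrable[OF acL p(1)])
  have "\<delta> * integral\<^sup>L (lebesgue_on D) p = integral\<^sup>L (lebesgue_on D) (\<lambda>x. \<delta> * p x)" by simp
  also have "\<dots> \<le> integral\<^sup>L (lebesgue_on D) (\<lambda>x. Re (ac x z * of_real (p x)))"
  proof (rule integral_mono)
    fix x assume "x \<in> space (lebesgue_on D)"
    then have "x \<in> D" by (simp add: space_restrict_space)
    then show "\<delta> * p x \<le> Re (ac x z * of_real (p x))"
      using coercive[OF _ z] p(2)[of x] by (simp add: mult_right_mono)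
  qed (use p integrable_Re[OF i] in simp_all)
  also have "\<dots> = Re (Linf_form D ac p z)"
    unfolding Linf_form_def by (rule integral_Re[OF i])
  finally show "\<delta> * integral\<^sup>L (lebesgue_on D) p \<le> Re (Linf_form D ac p z)" .
qed

text \<open>The regularization \<open>\<epsilon>\<close> makes the Galerkin matrix coercive even if the chosen test functions are
  linearly dependent.\<close>

lemma regularized_galerkin_system:
  fixes ac :: "real^'n \<Rightarrow> complex^'d \<Rightarrow> complex" and \<phi> :: "nat \<Rightarrow> real^'n \<Rightarrow> real"
  assumes D: "open D" "bounded D" and f: "f \<in> V_dual D" and ac: "Linf_holomorphic D ac" and \<rho>: "\<And>j. 1 < \<rho> $ j"
    and coercive: "\<And>x z. x \<in> D \<Longrightarrow> z \<in> bernstein_polyellipse \<rho> \<Longrightarrow> \<delta> \<le> Re (ac x z)" and \<delta>: "0 < \<delta>"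
    and \<phi>: "\<And>i. i < N \<Longrightarrow> \<phi> i \<in> test_funs D" and \<epsilon>: "0 < \<epsilon>"
  shows "\<exists>c. (\<forall>i<N. c i \<in> ellipse_holomorphic \<rho>) \<and>
    (\<forall>z\<in>filled_polyellipse \<rho>. \<forall>i<N.
      (\<Sum>j<N. Linf_form D ac (\<lambda>x. grad (\<phi> i) x \<bullet> grad (\<phi> j) x) z * c j z) + of_real \<epsilon> * c i z = of_real (f (\<phi> i))) \<and>
    (\<forall>z\<in>filled_polyellipse \<rho>. \<forall>g\<in>H1 D.
      cmod (\<Sum>i<N. c i z * of_real (V_inner D (\<phi> i) g)) \<le> V_dual_norm D f / \<delta> * V_norm D g)"
proof -
  define S where "S i j z = Linf_form D ac (\<lambda>x. grad (\<phi> i) x \<bullet> grad (\<phi> j) x) z" for i j z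
  define A where "A i j z = S i j z + (if i = j then of_real \<epsilon> else 0)" for i j z
  \<comment> \<open>Real and imaginary part of the Galerkin function with coefficient vector c;
    \<open>E c\<close> is its energy.\<close>
  define wr where "wr c = (\<lambda>x. \<Sum>i<N. Re (c i) * \<phi> i x)" for c :: "nat \<Rightarrow> complex"
  define wi where "wi c = (\<lambda>x. \<Sum>i<N. Im (c i) * \<phi> i x)" for c :: "nat \<Rightarrow> complex"
  have w: "wr c \<in> test_funs D" "wi c \<in> test_funs D" for c
    unfolding wr_def wi_def by (intro test_funs_sum \<phi>; simp)+
  define E where "E c = (V_norm D (wr c))\<^sup>2 + (V_norm D (wi c))\<^sup>2" for c
  have Gi: "integrable (lebesgue_on D) (\<lambda>x. grad (\<phi> i) x \<bullet> grad (\<phi> j) x)" if "i < N" "j < N" for i j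
    using that by (intro V_inner_test_funs(2) D \<phi>)
  have acL: "(\<lambda>x. ac x z) \<in> Linf D" for z using ac by (simp add: Linf_holomorphic_def)
  have form: "\<delta> * E c + \<epsilon> * (\<Sum>i<N. (cmod (c i))\<^sup>2) \<le> Re (\<Sum>i<N. \<Sum>j<N. cnj (c i) * A i j z * c j)"
    if z: "z \<in> filled_polyellipse \<rho>" for c z
  proof -
    \<comment> \<open>By bilinearity the unregularized form at c is the pairing of the coefficient
      with this single nonnegative weight.\<close>
    define p where "p x = (norm (grad (wr c) x))\<^sup>2 + (norm (grad (wi c) x))\<^sup>2" for x
    have pi: "integrable (lebesgue_on D) p" and pE: "integral\<^sup>L (lebesgue_on D) p = E c"
      using V_inner_test_funs[OF D w(1) w(1), of c c] V_inner_test_funs[OF D w(2) w(2), of c c]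
      by (simp_all add: p_def[abs_def] E_def power2_norm_eq_inner V_norm_power2)
    have p: "of_real (p x) = (\<Sum>i<N. \<Sum>j<N. cnj (c i) * c j * of_real (grad (\<phi> i) x \<bullet> grad (\<phi> j) x))" for x
      unfolding gram_form_real p_def wr_def wi_def using grad_sum[OF \<phi>] by simp
    have "(\<Sum>i<N. \<Sum>j<N. cnj (c i) * S i j z * c j) =
        integral\<^sup>L (lebesgue_on D) (\<lambda>x. \<Sum>i<N. \<Sum>j<N. (cnj (c i) * c j) * (ac x z * of_real (grad (\<phi> i) x \<bullet> grad (\<phi> j) x)))"
    proof -
      have int: "integrable (lebesgue_on D) (\<lambda>x. (cnj (c i) * c j) * (ac x z * of_real (grad (\<phi> i) x \<bullet> grad (\<phi> j) x)))"
        if "i < N" "j < N" for i j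
        by (intro integrable_mult_right Linf_times_integrable[OF acL Gi[OF that]])
      have "(\<Sum>i<N. \<Sum>j<N. cnj (c i) * S i j z * c j) = (\<Sum>i<N. \<Sum>j<N. (cnj (c i) * c j) * S i j z)"
        by (simp add: mult_ac)
      also have "\<dots> = (\<Sum>i<N. \<Sum>j<N. integral\<^sup>L (lebesgue_on D) (\<lambda>x. (cnj (c i) * c j) * (ac x z * of_real (grad (\<phi> i) x \<bullet> grad (\<phi> j) x))))"
        by (simp only: S_def Linf_form_def integral_mult_right_zero)
      also have "\<dots> = (\<Sum>i<N. integral\<^sup>L (lebesgue_on D) (\<lambda>x. \<Sum>j<N. (cnj (c i) * c j) * (ac x z * of_real (grad (\<phi> i) x \<bullet> grad (\<phi> j) x))))"
        by (intro sum.cong refl Bochner_Integration.integral_sum[symmetric] int) auto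
      also have "\<dots> = integral\<^sup>L (lebesgue_on D) (\<lambda>x. \<Sum>i<N. \<Sum>j<N. (cnj (c i) * c j) * (ac x z * of_real (grad (\<phi> i) x \<bullet> grad (\<phi> j) x)))"
        by (intro Bochner_Integration.integral_sum[symmetric] Bochner_Integration.integrable_sum int) auto
      finally show ?thesis .
    qed
    also have "\<dots> = Linf_form D ac p z"
      unfolding Linf_form_def p sum_distrib_left by (simp add: mult_ac)
    finally have Sp: "(\<Sum>i<N. \<Sum>j<N. cnj (c i) * S i j z * c j) = Linf_form D ac p z" .
    have "(\<Sum>i<N. \<Sum>j<N. cnj (c i) * A i j z * c j) =
        (\<Sum>i<N. \<Sum>j<N. cnj (c i) * S i j z * c j) + (\<Sum>i<N. \<Sum>j<N. (if i = j then of_real \<epsilon> * (cnj (c i) * c i) else 0))"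
      unfolding A_def sum.distrib[symmetric] by (intro sum.cong refl) (simp add: algebra_simps)
    also have "(\<Sum>i<N. \<Sum>j<N. (if i = j then of_real \<epsilon> * (cnj (c i) * c i) else 0)) = of_real (\<epsilon> * (\<Sum>i<N. (cmod (c i))\<^sup>2))"
      by (simp add: sum_distrib_left mult.commute[of "cnj _"] flip: complex_norm_square)
    finally have "Re (\<Sum>i<N. \<Sum>j<N. cnj (c i) * A i j z * c j) = Re (Linf_form D ac p z) + \<epsilon> * (\<Sum>i<N. (cmod (c i))\<^sup>2)"
      unfolding Sp by simp
    moreover have "\<delta> * E c \<le> Re (Linf_form D ac p z)"
      unfolding pE[symmetric] by (rule Linf_form_coercive[OF D(1) ac \<rho> coercive pi _ z]) (simp_all add: p_def)
    ultimately show ?thesis by simp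
  qed
  have E0: "0 \<le> E c" for c by (simp add: E_def)
  have "\<exists>c. (\<forall>i<N. c i \<in> ellipse_holomorphic \<rho>) \<and>
      (\<forall>z\<in>filled_polyellipse \<rho>. \<forall>i<N. (\<Sum>j<N. A i j z * c j z) = of_real (f (\<phi> i)))"
  proof (rule coercive_system_solution[where \<epsilon> = \<epsilon>])
    show "A i j \<in> ellipse_holomorphic \<rho>" if "i < N" "j < N" for i j
      unfolding A_def S_def using Linf_form_ellipse_holomorphic[OF ac Gi[OF that], of \<rho>]
      by (intro ellipse_holomorphic_add ellipse_holomorphic_const) auto
    fix z :: "complex^'d" and c :: "nat \<Rightarrow> complex" assume z: "z \<in> filled_polyellipse \<rho>"
    show "\<epsilon> * (\<Sum>i<N. (cmod (c i))\<^sup>2) \<le> Re (\<Sum>i<N. \<Sum>j<N. cnj (c i) * A i j z * c j)"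
      using form[OF z, of c] mult_nonneg_nonneg[OF less_imp_le[OF \<delta>] E0[of c]] by linarith
  qed (use \<epsilon> in \<open>auto intro: ellipse_holomorphic_add ellipse_holomorphic_mult ellipse_holomorphic_const ellipse_holomorphic_inverse\<close>)
  then obtain c where c: "\<And>i. i < N \<Longrightarrow> c i \<in> ellipse_holomorphic \<rho>"
    and sol: "\<And>z i. z \<in> filled_polyellipse \<rho> \<Longrightarrow> i < N \<Longrightarrow> (\<Sum>j<N. A i j z * c j z) = of_real (f (\<phi> i))" by blast
  show ?thesis
  proof (intro exI[of _ c] conjI allI ballI impI)
    show "c i \<in> ellipse_holomorphic \<rho>" if "i < N" for i by (rule c[OF that])
  next
    fix z i assume z: "z \<in> filled_polyellipse \<rho>" and i: "i < N"
    have "(\<Sum>j<N. A i j z * c j z) = (\<Sum>j<N. S i j z * c j z) + (\<Sum>j<N. if i = j then of_real \<epsilon> * c i z else 0)"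
      unfolding A_def sum.distrib[symmetric] by (intro sum.cong refl) (simp add: algebra_simps)
    then show "(\<Sum>j<N. Linf_form D ac (\<lambda>x. grad (\<phi> i) x \<bullet> grad (\<phi> j) x) z * c j z) + of_real \<epsilon> * c i z = of_real (f (\<phi> i))"
      using sol[OF z i] i by (simp add: S_def)
  next
    fix z g assume z: "z \<in> filled_polyellipse \<rho>" and g: "g \<in> H1 D"
    \<comment> \<open>The system is tested with the conjugate of its solution; as the right-hand
      sides are real, the real part of the result is \<open>f (wr d)\<close>.\<close>
    define d where "d i = c i z" for i
    have "(\<Sum>i<N. \<Sum>j<N. cnj (d i) * A i j z * d j) = (\<Sum>i<N. cnj (d i) * (\<Sum>j<N. A i j z * d j))"
      by (simp add: sum_distrib_left mult.assoc)
    also have "\<dots> = (\<Sum>i<N. cnj (d i) * of_real (f (\<phi> i)))"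
      using sol[OF z] by (simp add: d_def)
    finally have "Re (\<Sum>i<N. \<Sum>j<N. cnj (d i) * A i j z * d j) = (\<Sum>i<N. Re (d i) * f (\<phi> i))" by simp
    also have "\<dots> = f (wr d)" unfolding wr_def by (rule V_dual_sum[OF D f \<phi>, symmetric])
    also have "\<dots> \<le> V_dual_norm D f * V_norm D (wr d)"
      using V_dual_le[OF D f test_funs_H10[OF D w(1)], of d] by linarith
    also have "\<dots> \<le> V_dual_norm D f * sqrt (E d)"
      by (intro mult_left_mono V_dual_norm_nonneg[OF D f]) (simp add: E_def real_le_rsqrt)
    \<comment> \<open>The regularization term is nonnegative and is dropped, so the bound does not
      depend on \<epsilon>.\<close>
    finally have "\<delta> * E d \<le> V_dual_norm D f * sqrt (E d)"
      using form[OF z, of d] mult_nonneg_nonneg[OF less_imp_le[OF \<epsilon>] sum_nonneg[of "{..<N}" "\<lambda>i. (cmod (d i))\<^sup>2"]] by simp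
    then have le: "sqrt (E d) * (\<delta> * sqrt (E d)) \<le> sqrt (E d) * V_dual_norm D f"
      using E0[of d] by (simp add: mult_ac)
    have Ed: "sqrt (E d) \<le> V_dual_norm D f / \<delta>"
    proof (cases "sqrt (E d) = 0")
      case True
      then show ?thesis using V_dual_norm_nonneg[OF D f] \<delta> by simp
    next
      case False
      then have "sqrt (E d) > 0" using E0[of d] by simp
      then have "\<delta> * sqrt (E d) \<le> V_dual_norm D f" using le mult_le_cancel_left_pos by blast
      then show ?thesis using \<delta> by (simp add: field_simps)
    qed
    have H: "wr d \<in> H1 D" "wi d \<in> H1 D" by (intro test_funs_H1 D w)+
    have "(\<Sum>i<N. c i z * of_real (V_inner D (\<phi> i) g)) = Complex (V_inner D (wr d) g) (V_inner D (wi d) g)"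
      unfolding wr_def wi_def using V_inner_sum[OF D \<phi> g]
      by (simp add: complex_eq_iff d_def)
    then have "cmod (\<Sum>i<N. c i z * of_real (V_inner D (\<phi> i) g)) = sqrt ((V_inner D (wr d) g)\<^sup>2 + (V_inner D (wi d) g)\<^sup>2)"
      by (simp add: cmod_def)
    also have "\<dots> \<le> sqrt ((V_norm D (wr d) * V_norm D g)\<^sup>2 + (V_norm D (wi d) * V_norm D g)\<^sup>2)"
      using power_mono[OF V_inner_cauchy_schwarz[OF H(1) g] abs_ge_zero, of 2] power_mono[OF V_inner_cauchy_schwarz[OF H(2) g] abs_ge_zero, of 2]
      by (intro real_sqrt_le_mono add_mono) simp_all
    also have "\<dots> = sqrt (E d * (V_norm D g)\<^sup>2)" by (simp add: E_def power_mult_distrib distrib_right)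
    also have "\<dots> = sqrt (E d) * V_norm D g" by (simp add: real_sqrt_mult)
    also have "\<dots> \<le> V_dual_norm D f / \<delta> * V_norm D g" by (rule mult_right_mono[OF Ed]) simp
    finally show "cmod (\<Sum>i<N. c i z * of_real (V_inner D (\<phi> i) g)) \<le> V_dual_norm D f / \<delta> * V_norm D g" .
  qed
qed

lemma V_form_sum:
  assumes D: "open D" "bounded D" and \<alpha>: "\<alpha> \<in> borel_measurable (lebesgue_on D)" "AE x in lebesgue_on D. \<bar>\<alpha> x\<bar> \<le> K"
    and \<phi>: "\<And>i. i < N \<Longrightarrow> \<phi> i \<in> test_funs D" and g: "g \<in> H1 D"
  shows "V_form D \<alpha> (\<lambda>x. \<Sum>i<N. r i * \<phi> i x) g = (\<Sum>i<(N::nat). r i * V_form D \<alpha> (\<phi> i) g)"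
  using \<phi>
proof (induction N)
  case 0
  then show ?case using V_form_lincomb[OF D \<alpha> g g g, of 0 0] by simp
next
  case (Suc N)
  have "V_form D \<alpha> (\<lambda>x. 1 * (\<Sum>i<N. r i * \<phi> i x) + r N * \<phi> N x) g
      = 1 * V_form D \<alpha> (\<lambda>x. \<Sum>i<N. r i * \<phi> i x) g + r N * V_form D \<alpha> (\<phi> N) g"
    using Suc.prems by (intro V_form_lincomb[OF D \<alpha>] test_funs_H1[OF D(1)] test_funs_sum g) auto
  with Suc show ?case by simp
qed

text \<open>Cea's argument; the regularization contributes \<open>\<epsilon> (r\<^sub>k - \<Sum> r\<^sub>i\<^sup>2) \<le> \<epsilon> / 4\<close> to the energy of the error.\<close>

lemma regularized_galerkin_error:
  fixes \<phi> :: "nat \<Rightarrow> real^'n \<Rightarrow> real"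
  assumes D: "open D" "bounded D" and \<alpha>: "\<alpha> \<in> borel_measurable (lebesgue_on D)" "AE x in lebesgue_on D. \<bar>\<alpha> x\<bar> \<le> K * c"
    and lower: "AE x in lebesgue_on D. c \<le> \<alpha> x" and c: "0 < c" and K: "0 \<le> K"
    and v: "weak_solution D \<alpha> f v" and \<phi>: "\<And>i. i < N \<Longrightarrow> \<phi> i \<in> test_funs D"
    and sol: "\<And>i. i < N \<Longrightarrow> (\<Sum>j<N. V_form D \<alpha> (\<phi> i) (\<phi> j) * r j) + \<epsilon> * r i = f (\<phi> i)"
    and k: "k < N" and near: "V_norm D (\<lambda>x. v x - \<phi> k x) \<le> \<eta>" and \<eta>: "0 < \<eta>" and \<epsilon>: "\<epsilon> = 4 * c * \<eta>\<^sup>2"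
  shows "V_norm D (\<lambda>x. v x - (\<Sum>i<N. r i * \<phi> i x)) \<le> (K + 2) * \<eta>"
proof -
  \<comment> \<open>Coordinates of the competitor \<open>\<phi> k\<close>; \<open>s\<close> and
    \<open>q\<close> are the coordinates and the function of the difference between the Galerkin
    function and this competitor.\<close>
  define e where "e i = (if i = k then 1 else 0 :: real)" for i
  define w where "w = (\<lambda>x. \<Sum>i<N. r i * \<phi> i x)"
  define s where "s i = r i - e i" for i
  define q where "q = (\<lambda>x. \<Sum>i<N. s i * \<phi> i x)"
  have v10: "v \<in> H10 D" using v by (simp add: weak_solution_def)
  have v1: "v \<in> H1 D" by (rule H10_H1[OF v10])
  have p1: "\<phi> i \<in> H1 D" if "i < N" for i by (rule test_funs_H1[OF D(1) \<phi>[OF that]])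
  have w1: "w \<in> H1 D" and q1: "q \<in> H1 D"
    unfolding w_def q_def by (intro test_funs_H1[OF D(1)] test_funs_sum \<phi>; simp)+
  have qw: "q = (\<lambda>x. 1 * w x + (-1) * \<phi> k x)"
  proof -
    have "(\<Sum>i<N. e i * \<phi> i x) = (\<Sum>i<N. if i = k then \<phi> i x else 0)" for x
      by (intro sum.cong) (auto simp: e_def)
    then show ?thesis
      unfolding q_def w_def s_def using k by (simp add: left_diff_distrib sum_subtractf)
  qed
  define g where "g = (\<lambda>x. 1 * v x + (-1) * \<phi> k x)"
  have g1: "g \<in> H1 D" unfolding g_def by (rule H1_lincomb[OF D(1) v1 p1[OF k]])
  have gn: "V_norm D g \<le> \<eta>" using near by (simp add: g_def)
  \<comment> \<open>Galerkin orthogonality fails only by the regularization term.\<close>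
  have res: "V_form D \<alpha> w (\<phi> i) - V_form D \<alpha> v (\<phi> i) = - \<epsilon> * r i" if i: "i < N" for i
  proof -
    have "V_form D \<alpha> w (\<phi> i) = (\<Sum>j<N. r j * V_form D \<alpha> (\<phi> j) (\<phi> i))"
      unfolding w_def by (rule V_form_sum[OF D \<alpha> \<phi> p1[OF i]])
    also have "\<dots> = (\<Sum>j<N. V_form D \<alpha> (\<phi> i) (\<phi> j) * r j)"
      by (intro sum.cong refl) (simp add: V_form_commute mult.commute)
    also have "\<dots> = f (\<phi> i) - \<epsilon> * r i" using sol[OF i] by simp
    also have "f (\<phi> i) = V_form D \<alpha> v (\<phi> i)"
      by (rule weak_solution_form[OF v test_funs_H10[OF D \<phi>[OF i]], symmetric])
    finally show ?thesis by simp
  qed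
  have Vq: "V_form D \<alpha> q h = V_form D \<alpha> w h - V_form D \<alpha> (\<phi> k) h" if "h \<in> H1 D" for h
    using V_form_lincomb[OF D \<alpha> w1 p1[OF k] that, of 1 "-1"] unfolding qw by simp
  have Vg: "V_form D \<alpha> g h = V_form D \<alpha> v h - V_form D \<alpha> (\<phi> k) h" if "h \<in> H1 D" for h
    using V_form_lincomb[OF D \<alpha> v1 p1[OF k] that, of 1 "-1"] unfolding g_def by simp
  have sumq: "V_form D \<alpha> h q = (\<Sum>i<N. s i * V_form D \<alpha> h (\<phi> i))" if "h \<in> H1 D" for h
    unfolding q_def using V_form_sum[OF D \<alpha> \<phi> that, where r = s] by (simp add: V_form_commute)
  have "V_form D \<alpha> w q - V_form D \<alpha> v q = (\<Sum>i<N. s i * (V_form D \<alpha> w (\<phi> i) - V_form D \<alpha> v (\<phi> i)))"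
    unfolding sumq[OF w1] sumq[OF v1] by (simp add: right_diff_distrib sum_subtractf)
  also have "\<dots> = (\<Sum>i<N. \<epsilon> * (e i * r i - (r i)\<^sup>2))"
    by (intro sum.cong refl) (simp add: res s_def power2_eq_square algebra_simps)
  also have "\<dots> \<le> (\<Sum>i<N. \<epsilon> * (e i / 4))"
  proof (intro sum_mono mult_left_mono)
    fix i
    have "0 \<le> (r i - 1/2)\<^sup>2" "0 \<le> (r i)\<^sup>2" by auto
    then show "e i * r i - (r i)\<^sup>2 \<le> e i / 4" by (auto simp: e_def power2_eq_square algebra_simps)
  qed (use \<epsilon> c in simp)
  also have "\<dots> = (\<Sum>i<N. if i = k then \<epsilon> / 4 else 0)"
    by (intro sum.cong) (auto simp: e_def)
  also have "\<dots> = \<epsilon> / 4" using k by simp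
  also have "\<dots> = c * \<eta>\<^sup>2" by (simp add: \<epsilon>)
  finally have 1: "V_form D \<alpha> w q - V_form D \<alpha> v q \<le> c * \<eta>\<^sup>2" .
  have "V_form D \<alpha> g q \<le> (K * c) * V_norm D g * V_norm D q"
    using V_form_bound[OF \<alpha> _ g1 q1] K c by simp
  also have "\<dots> \<le> (K * c) * \<eta> * V_norm D q"
    using K c gn by (intro mult_right_mono mult_left_mono) auto
  finally have 2: "V_form D \<alpha> g q \<le> (K * c) * \<eta> * V_norm D q" .
  have "c * (V_norm D q)\<^sup>2 \<le> V_form D \<alpha> q q" by (rule V_form_coercive[OF \<alpha> lower q1])
  also have "\<dots> = (V_form D \<alpha> w q - V_form D \<alpha> v q) + V_form D \<alpha> g q"
    unfolding Vq[OF q1] Vg[OF q1] by simp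
  also have "\<dots> \<le> c * \<eta>\<^sup>2 + (K * c) * \<eta> * V_norm D q" using 1 2 by linarith
  also have "\<dots> = c * (\<eta>\<^sup>2 + K * \<eta> * V_norm D q)" by (simp add: algebra_simps)
  finally have X: "(V_norm D q)\<^sup>2 \<le> \<eta>\<^sup>2 + K * \<eta> * V_norm D q" using c by simp
  \<comment> \<open>Otherwise the norm X of q would satisfy (K + 1) \<eta> X <= X^2 <= \<eta>^2 + K
    \<eta> X, hence X <= \<eta>, against X > (K + 1) \<eta>.\<close>
  have "V_norm D q \<le> (K + 1) * \<eta>"
  proof (rule ccontr)
    assume "\<not> V_norm D q \<le> (K + 1) * \<eta>"
    then have gt: "(K + 1) * \<eta> < V_norm D q" by simp
    have "\<eta> \<le> (K + 1) * \<eta>" using K \<eta> by simp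
    with gt have "\<eta> < V_norm D q" by linarith
    then have "\<eta> * \<eta> < \<eta> * V_norm D q" using \<eta> by simp
    moreover have "(K + 1) * \<eta> * V_norm D q \<le> V_norm D q * V_norm D q"
      using gt by (intro mult_right_mono) auto
    ultimately show False using X by (simp add: power2_eq_square algebra_simps)
  qed
  moreover have "V_norm D (\<lambda>x. 1 * g x + (-1) * q x) \<le> \<bar>1\<bar> * V_norm D g + \<bar>-1\<bar> * V_norm D q"
    by (rule V_norm_lincomb_le[OF D g1 q1])
  moreover have "(\<lambda>x. 1 * g x + (-1) * q x) = (\<lambda>x. v x - w x)"
    by (simp add: g_def qw)
  ultimately have "V_norm D (\<lambda>x. v x - w x) \<le> (K + 2) * \<eta>"
    using gn by (simp add: algebra_simps)
  then show ?thesis by (simp add: w_def)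
qed

lemma norm_vec_of_real_diff: "norm (vec_of_real y - vec_of_real y') = norm (y - y')"
proof -
  have "norm ((vec_of_real y - vec_of_real y') $ i) = norm ((y - y') $ i)" for i
    by (simp add: vec_of_real_def flip: of_real_diff)
  then show ?thesis by (simp add: norm_vec_def)
qed

lemma compact_Gam: "compact Gam"
proof -
  have "Gam = cbox (\<chi> j. -1) (\<chi> j. 1 :: real^'d)" by (auto simp: Gam_def mem_box_cart)
  then show ?thesis by (metis compact_cbox)
qed

text \<open>Continuity of the solution in y and compactness of the parameter box give finitely many
  test functions such that every solution is close to one of them. These are the trial functions,
  and Cea's estimate against the nearest one bounds the Galerkin error uniformly in y.\<close>

lemma galerkin_approximation:
  fixes D :: "(real^'n) set" and a :: "real^'n \<Rightarrow> real^'d \<Rightarrow> real" and ac :: "real^'n \<Rightarrow> complex^'d \<Rightarrow> complex"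
    and u :: "real^'n \<Rightarrow> real^'d \<Rightarrow> real"
  assumes D: "open D" "bounded D" and f: "f \<in> V_dual D" and amin: "0 < amin" "amin < amax"
    and a_bounds: "\<And>x y. x \<in> D \<Longrightarrow> y \<in> Gam \<Longrightarrow> amin \<le> a x y \<and> a x y \<le> amax"
    and ac_continues: "\<And>x y. x \<in> D \<Longrightarrow> y \<in> Gam \<Longrightarrow> ac x (vec_of_real y) = complex_of_real (a x y)"
    and ac: "Linf_holomorphic D ac" and \<delta>: "0 < \<delta>" and \<rho>: "\<And>j. 1 < \<rho> $ j"
    and coercive: "\<And>x z. x \<in> D \<Longrightarrow> z \<in> bernstein_polyellipse \<rho> \<Longrightarrow> \<delta> \<le> Re (ac x z)"
    and u: "\<And>y. y \<in> Gam \<Longrightarrow> weak_solution D (\<lambda>x. a x y) f (\<lambda>x. u x y)" and \<eta>: "0 < \<eta>"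
  shows "\<exists>N \<phi> c. (\<forall>i<N. \<phi> i \<in> test_funs D \<and> c i \<in> ellipse_holomorphic \<rho>) \<and>
    (\<forall>z\<in>filled_polyellipse \<rho>. \<forall>g\<in>H1 D.
      cmod (\<Sum>i<(N::nat). c i z * of_real (V_inner D (\<phi> i) g)) \<le> V_dual_norm D f / \<delta> * V_norm D g) \<and>
    (\<forall>y\<in>Gam. V_norm D (\<lambda>x. u x y - (\<Sum>i<N. Re (c i (vec_of_real y)) * \<phi> i x)) \<le> \<eta>)"
proof -
  define K where "K = amax / amin"
  have K: "K \<ge> 0" "K * amin = amax" using amin by (auto simp: K_def)
  \<comment> \<open>Compensates the factor K + 2 lost in the error estimate.\<close>
  define \<eta>' where "\<eta>' = \<eta> / (K + 2)"
  have \<eta>': "0 < \<eta>'" "(K + 2) * \<eta>' = \<eta>" using \<eta> K by (auto simp: \<eta>'_def)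
  have spD: "space (lebesgue_on D) = D" by (simp add: space_restrict_space)
  have acL: "(\<lambda>x. ac x z) \<in> Linf D" for z using ac by (simp add: Linf_holomorphic_def)
  have am: "(\<lambda>x. a x y) \<in> borel_measurable (lebesgue_on D)" if y: "y \<in> Gam" for y
  proof -
    have "(\<lambda>x. Re (ac x (vec_of_real y))) \<in> borel_measurable (lebesgue_on D)"
      using acL[of "vec_of_real y"] by (auto simp: Linf_def)
    moreover have "Re (ac x (vec_of_real y)) = a x y" if "x \<in> space (lebesgue_on D)" for x
      using ac_continues[of x y] that y spD by simp
    ultimately show ?thesis by (subst measurable_cong[symmetric]) auto
  qed
  have ab: "AE x in lebesgue_on D. \<bar>a x y\<bar> \<le> K * amin" and al: "AE x in lebesgue_on D. amin \<le> a x y" if y: "y \<in> Gam" for y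
  proof -
    have "amin \<le> a x y \<and> \<bar>a x y\<bar> \<le> K * amin" if "x \<in> space (lebesgue_on D)" for x
      using a_bounds[OF _ y, of x] that amin spD unfolding K(2) by simp
    then show "AE x in lebesgue_on D. \<bar>a x y\<bar> \<le> K * amin" "AE x in lebesgue_on D. amin \<le> a x y"
      by (auto intro!: AE_I2)
  qed
  \<comment> \<open>Density of test functions at the fixed y and stability in a neighbourhood of y;
    each of the two errors gets half of \<open>\<eta>'\<close>.\<close>
  have local: "\<exists>\<phi> r. \<phi> \<in> test_funs D \<and> 0 < r \<and> (\<forall>y'\<in>Gam. dist y y' < r \<longrightarrow> V_norm D (\<lambda>x. u x y' - \<phi> x) \<le> \<eta>')"
    if y: "y \<in> Gam" for y
  proof -
    have u10: "(\<lambda>x. u x y) \<in> H10 D" using u[OF y] by (simp add: weak_solution_def)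
    obtain \<phi> where \<phi>: "\<And>m. \<phi> m \<in> test_funs D" "(\<lambda>m. V_norm D (\<lambda>x. u x y - \<phi> m x)) \<longlonglongrightarrow> 0"
      using H10E[OF u10] by blast
    have ev: "eventually (\<lambda>m. V_norm D (\<lambda>x. u x y - \<phi> m x) < \<eta>' / 2) sequentially"
      by (rule order_tendstoD(2)[OF \<phi>(2)]) (use \<eta>' in simp)
    obtain m where m: "V_norm D (\<lambda>x. u x y - \<phi> m x) < \<eta>' / 2"
      using eventually_happens'[OF sequentially_bot ev] by blast
    \<comment> \<open>Tolerance in the coefficient for which stability yields half of
      \<open>\<eta>'\<close>; the summand 1 keeps the denominator positive when f has norm
      0.\<close>
    define s where "s = \<eta>' / 2 * amin\<^sup>2 / (V_dual_norm D f + 1)"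
    have f0: "0 \<le> V_dual_norm D f" by (rule V_dual_norm_nonneg[OF D f])
    then have s: "0 < s" using \<eta>' amin by (auto simp: s_def)
    have sb: "s * V_dual_norm D f / amin\<^sup>2 \<le> \<eta>' / 2"
    proof -
      have "s * V_dual_norm D f \<le> s * (V_dual_norm D f + 1)" using s by (intro mult_left_mono) auto
      also have "\<dots> = \<eta>' / 2 * amin\<^sup>2"
      proof -
        have cancel: "A / t * t = A" if "t \<noteq> 0" for A t :: real using that by simp
        show ?thesis unfolding s_def by (rule cancel) (use f0 in linarith)
      qed
      finally show ?thesis using amin by (simp add: field_simps)
    qed
    obtain r where r: "0 < r" "\<And>w. norm (w - vec_of_real y) < r \<Longrightarrow> AE x in lebesgue_on D. cmod (ac x w - ac x (vec_of_real y)) \<le> s"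
      using Linf_holomorphic_continuous[OF ac s] by blast
    show ?thesis
    proof (intro exI[of _ "\<phi> m"] exI[of _ r] conjI ballI impI)
      fix y' assume y': "y' \<in> Gam" and d: "dist y y' < r"
      have close: "AE x in lebesgue_on D. \<bar>a x y' - a x y\<bar> \<le> s"
      proof -
        have "norm (vec_of_real y' - vec_of_real y) < r"
          using d by (simp add: norm_vec_of_real_diff dist_norm norm_minus_commute)
        from r(2)[OF this] AE_space[of "lebesgue_on D"] show ?thesis
        proof eventually_elim
          fix x assume c: "cmod (ac x (vec_of_real y') - ac x (vec_of_real y)) \<le> s" and "x \<in> space (lebesgue_on D)"
          then have "x \<in> D" using spD by simp
          then show "\<bar>a x y' - a x y\<bar> \<le> s"
            using c y y' by (simp add: ac_continues flip: of_real_diff)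
        qed
      qed
      have "V_norm D (\<lambda>x. u x y - u x y') \<le> s * V_dual_norm D f / amin\<^sup>2"
        by (rule weak_solution_stability[OF D f amin(1) less_imp_le[OF s] am[OF y] ab[OF y] am[OF y'] ab[OF y'] al[OF y] al[OF y'] u[OF y] u[OF y'] close])
      then have 1: "V_norm D (\<lambda>x. u x y - u x y') \<le> \<eta>' / 2" using sb by linarith
      have H: "(\<lambda>x. u x y) \<in> H1 D" "(\<lambda>x. u x y') \<in> H1 D" "\<phi> m \<in> H1 D"
        by (intro weak_solution_H1[OF u] y y' test_funs_H1 D \<phi>)+
      have H': "(\<lambda>x. 1 * u x y + (-1) * u x y') \<in> H1 D" "(\<lambda>x. 1 * u x y + (-1) * \<phi> m x) \<in> H1 D"
        by (intro H1_lincomb D H)+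
      have "V_norm D (\<lambda>x. (-1) * (1 * u x y + (-1) * u x y') + 1 * (1 * u x y + (-1) * \<phi> m x)) \<le>
          \<bar>-1\<bar> * V_norm D (\<lambda>x. 1 * u x y + (-1) * u x y') + \<bar>1\<bar> * V_norm D (\<lambda>x. 1 * u x y + (-1) * \<phi> m x)"
        by (rule V_norm_lincomb_le[OF D H'])
      also have "\<dots> \<le> \<eta>'" using 1 m by simp
      finally show "V_norm D (\<lambda>x. u x y' - \<phi> m x) \<le> \<eta>'" by simp
    qed (use r \<phi> in auto)
  qed
  then have "\<forall>y\<in>Gam. \<exists>p. fst p \<in> test_funs D \<and> 0 < snd p \<and>
      (\<forall>y'\<in>Gam. dist y y' < snd p \<longrightarrow> V_norm D (\<lambda>x. u x y' - fst p x) \<le> \<eta>')"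
    by simp
  then obtain F where F: "\<forall>y\<in>Gam. fst (F y) \<in> test_funs D \<and> 0 < snd (F y) \<and>
      (\<forall>y'\<in>Gam. dist y y' < snd (F y) \<longrightarrow> V_norm D (\<lambda>x. u x y' - fst (F y) x) \<le> \<eta>')"
    unfolding bchoice_iff by blast
  define \<Phi> where "\<Phi> y = fst (F y)" for y
  define R where "R y = snd (F y)" for y
  have \<Phi>: "\<Phi> y \<in> test_funs D" "0 < R y"
    "\<And>y'. y' \<in> Gam \<Longrightarrow> dist y y' < R y \<Longrightarrow> V_norm D (\<lambda>x. u x y' - \<Phi> y x) \<le> \<eta>'" if "y \<in> Gam" for y
    using F that by (simp_all add: \<Phi>_def R_def)
  obtain Y where Y: "Y \<subseteq> Gam" "finite Y" "Gam \<subseteq> (\<Union>y\<in>Y. ball y (R y))"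
    by (rule compactE_image[OF compact_Gam, of Gam "\<lambda>y. ball y (R y)"]) (use \<Phi>(2) in force)+
  obtain h where h: "bij_betw h {0..<card Y} Y" using ex_bij_betw_nat_finite[OF Y(2)] by blast
  define N where "N = card Y"
  define \<phi> where "\<phi> i = \<Phi> (h i)" for i
  have hY: "h i \<in> Gam" if "i < N" for i
    using that h Y(1) by (auto simp: N_def bij_betw_def)
  have \<phi>: "\<phi> i \<in> test_funs D" if "i < N" for i
    unfolding \<phi>_def by (intro \<Phi> hY that)
  have near: "\<exists>k<N. V_norm D (\<lambda>x. u x y - \<phi> k x) \<le> \<eta>'" if y: "y \<in> Gam" for y
  proof -
    obtain y0 where y0: "y0 \<in> Y" "dist y0 y < R y0" using Y(3) y by auto
    from y0(1) have "y0 \<in> h ` {0..<N}" using h by (simp add: N_def bij_betw_def)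
    then obtain k where k: "k < N" "h k = y0" by auto
    then show ?thesis using \<Phi>(3)[OF _ y y0(2)] y0 Y(1) by (auto simp: \<phi>_def)
  qed
  \<comment> \<open>The size for which the energy contribution \<epsilon>/4 in the error estimate is
    amin times the squared accuracy.\<close>
  define \<epsilon> where "\<epsilon> = 4 * amin * \<eta>'\<^sup>2"
  have \<epsilon>: "0 < \<epsilon>" using amin \<eta>' by (simp add: \<epsilon>_def)
  have "\<exists>c. (\<forall>i<N. c i \<in> ellipse_holomorphic \<rho>) \<and>
    (\<forall>z\<in>filled_polyellipse \<rho>. \<forall>i<N.
      (\<Sum>j<N. Linf_form D ac (\<lambda>x. grad (\<phi> i) x \<bullet> grad (\<phi> j) x) z * c j z) + of_real \<epsilon> * c i z = of_real (f (\<phi> i))) \<and>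
    (\<forall>z\<in>filled_polyellipse \<rho>. \<forall>g\<in>H1 D.
      cmod (\<Sum>i<N. c i z * of_real (V_inner D (\<phi> i) g)) \<le> V_dual_norm D f / \<delta> * V_norm D g)"
    by (rule regularized_galerkin_system[OF D f ac \<rho> coercive \<delta> \<phi> \<epsilon>])
  then obtain c where c: "\<And>i. i < N \<Longrightarrow> c i \<in> ellipse_holomorphic \<rho>"
    and sys: "\<And>z i. z \<in> filled_polyellipse \<rho> \<Longrightarrow> i < N \<Longrightarrow>
      (\<Sum>j<N. Linf_form D ac (\<lambda>x. grad (\<phi> i) x \<bullet> grad (\<phi> j) x) z * c j z) + of_real \<epsilon> * c i z = of_real (f (\<phi> i))"
    and bound: "\<And>z g. z \<in> filled_polyellipse \<rho> \<Longrightarrow> g \<in> H1 D \<Longrightarrow>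
      cmod (\<Sum>i<N. c i z * of_real (V_inner D (\<phi> i) g)) \<le> V_dual_norm D f / \<delta> * V_norm D g"
    by blast
  have err: "V_norm D (\<lambda>x. u x y - (\<Sum>i<N. Re (c i (vec_of_real y)) * \<phi> i x)) \<le> \<eta>" if y: "y \<in> Gam" for y
  proof -
    define z where "z = vec_of_real y"
    have z: "z \<in> filled_polyellipse \<rho>" unfolding z_def by (rule vec_of_real_in_filled_polyellipse[OF \<rho> y])
    have Lf: "Linf_form D ac (\<lambda>x. grad (\<phi> i) x \<bullet> grad (\<phi> j) x) z = of_real (V_form D (\<lambda>x. a x y) (\<phi> i) (\<phi> j))"
      if "i < N" "j < N" for i j
    proof -
      have "Linf_form D ac (\<lambda>x. grad (\<phi> i) x \<bullet> grad (\<phi> j) x) z =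
          integral\<^sup>L (lebesgue_on D) (\<lambda>x. complex_of_real (a x y * (grad (\<phi> i) x \<bullet> grad (\<phi> j) x)))"
        unfolding Linf_form_def z_def
        by (rule Bochner_Integration.integral_cong[OF refl]) (simp add: spD ac_continues y)
      also have "\<dots> = of_real (V_form D (\<lambda>x. a x y) (\<phi> i) (\<phi> j))"
        unfolding V_form_test_funs[OF D am[OF y] \<phi>[OF that(1)] \<phi>[OF that(2)]] by (rule integral_complex_of_real)
      finally show ?thesis .
    qed
    obtain k where k: "k < N" "V_norm D (\<lambda>x. u x y - \<phi> k x) \<le> \<eta>'" using near[OF y] by blast
    have "V_norm D (\<lambda>x. u x y - (\<Sum>i<N. Re (c i z) * \<phi> i x)) \<le> (K + 2) * \<eta>'"
    proof (rule regularized_galerkin_error[where \<phi> = \<phi> and r = "\<lambda>i. Re (c i z)" and k = k,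
          OF D am[OF y] ab[OF y] al[OF y] amin(1) K(1) u[OF y] _ _ k(1) k(2) \<eta>'(1) \<epsilon>_def])
      show "\<phi> i \<in> test_funs D" if "i < N" for i by (rule \<phi>[OF that])
      fix i assume i: "i < N"
      \<comment> \<open>At a real parameter the Galerkin matrix is real, so the real parts of the
        complex coefficients solve the real system.\<close>
      have "Re ((\<Sum>j<N. Linf_form D ac (\<lambda>x. grad (\<phi> i) x \<bullet> grad (\<phi> j) x) z * c j z) + of_real \<epsilon> * c i z) = f (\<phi> i)"
        unfolding sys[OF z i] by simp
      moreover have "(\<Sum>j<N. Linf_form D ac (\<lambda>x. grad (\<phi> i) x \<bullet> grad (\<phi> j) x) z * c j z)
          = (\<Sum>j<N. of_real (V_form D (\<lambda>x. a x y) (\<phi> i) (\<phi> j)) * c j z)"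
        by (intro sum.cong refl) (simp add: Lf i)
      ultimately show "(\<Sum>j<N. V_form D (\<lambda>x. a x y) (\<phi> i) (\<phi> j) * Re (c j z)) + \<epsilon> * Re (c i z) = f (\<phi> i)"
        by simp
    qed
    then show ?thesis unfolding \<eta>'(2) z_def .
  qed
  show ?thesis
    using \<phi> c bound err by (intro exI[of _ N] exI[of _ \<phi>] exI[of _ c]) auto
qed

section \<open>Integration over the parameter\<close>

text \<open>Lebesgue measure is complete, so modification on a null set preserves
  measurability.\<close>

lemma borel_measurable_lebesgue_AE:
  fixes f g :: "'a::euclidean_space \<Rightarrow> 'b::topological_space"
  assumes g: "g \<in> borel_measurable lebesgue" and ae: "AE x in lebesgue. f x = g x"
  shows "f \<in> borel_measurable lebesgue"
proof (rule measurableI)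
  fix A :: "'b set" assume A: "A \<in> sets borel"
  have "g -` A \<inter> space lebesgue \<in> sets lebesgue" using g A by (rule measurable_sets)
  then show "f -` A \<inter> space lebesgue \<in> sets lebesgue"
  proof (rule completion.in_sets_AE[rotated])
    show "AE x in lebesgue. (x \<in> g -` A \<inter> space lebesgue) = (x \<in> f -` A \<inter> space lebesgue)"
      using ae by eventually_elim auto
  qed auto
qed simp

text \<open>Cauchy-Schwarz in y bounds the squared difference at x by the squared norm of P times
  the integral of |u - w|^2 over y; integrating in x and exchanging the integrals brings in the
  hypothesis for each y and the measure of \<Gamma>. The exchange takes a product-measurable
  integrand, hence the Borel version \<open>u'\<close> of u.\<close>

lemma parameter_integral_L2:
  fixes u w :: "real^'n \<Rightarrow> real^'d \<Rightarrow> real"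
  assumes D: "open D"
    and um: "(\<lambda>(x, y). u x y) \<in> borel_measurable (lebesgue_on (D \<times> \<Gamma>))"
    and \<Gamma>: "compact \<Gamma>" and P: "continuous_on UNIV P"
    and wm: "(\<lambda>z. w (fst z) (snd z)) \<in> borel_measurable borel"
    and wb: "\<And>x. \<exists>B. \<forall>y\<in>\<Gamma>. \<bar>w x y\<bar> \<le> B"
    and close: "\<And>y. y \<in> \<Gamma> \<Longrightarrow> (\<lambda>x. u x y - w x y) \<in> L2 D" "\<And>y. y \<in> \<Gamma> \<Longrightarrow> L2_norm D (\<lambda>x. u x y - w x y) \<le> \<eta>"
    and \<eta>: "0 \<le> \<eta>"
  defines "d \<equiv> \<lambda>x. integral\<^sup>L (lebesgue_on \<Gamma>) (\<lambda>y. u x y * P y) - integral\<^sup>L (lebesgue_on \<Gamma>) (\<lambda>y. w x y * P y)"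
    and "C \<equiv> sq_norm lborel (\<lambda>y. indicator \<Gamma> y * P y) * sqrt (measure lborel \<Gamma>)"
  shows "d \<in> L2 D" "L2_norm D d \<le> C * \<eta>"
proof -
  have \<Gamma>c: "closed \<Gamma>" using \<Gamma> by (rule compact_imp_closed)
  have [measurable]: "D \<in> sets borel" "\<Gamma> \<in> sets borel" using D \<Gamma>c by auto
  have [measurable]: "P \<in> borel_measurable borel" by (rule borel_measurable_continuous_onI[OF P])
  have \<Gamma>m: "\<Gamma> \<inter> space (lebesgue :: (real^'d) measure) \<in> sets lebesgue" using \<Gamma>c by auto
  have \<Gamma>fin: "emeasure lborel \<Gamma> \<noteq> \<infinity>" using emeasure_compact_finite[OF \<Gamma>] by simp
  have Dm: "D \<inter> space (lebesgue :: (real^'n) measure) \<in> sets lebesgue" using D by auto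
  define H where "H z = indicator (D \<times> \<Gamma>) z * u (fst z) (snd z)" for z
  have "(D \<times> \<Gamma>) \<in> sets (borel :: ((real^'n) \<times> (real^'d)) measure)"
    unfolding borel_prod[symmetric] by simp
  then have "(D \<times> \<Gamma>) \<inter> space lebesgue \<in> sets lebesgue" by auto
  then have "H \<in> borel_measurable lebesgue"
    using um unfolding H_def[abs_def] by (simp add: borel_measurable_restrict_space_iff split_beta')
  then obtain u' where u'm: "u' \<in> borel_measurable lborel" and ae: "AE z in lborel. H z = u' z"
    using completion_ex_borel_measurable_real[of H lborel] by blast
  have [measurable]: "u' \<in> borel_measurable (borel \<Otimes>\<^sub>M borel)" using u'm by (simp add: borel_prod)
  have [measurable]: "(\<lambda>z. w (fst z) (snd z)) \<in> borel_measurable (borel \<Otimes>\<^sub>M borel)" using wm by (simp add: borel_prod)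
  obtain N where N: "N \<in> sets lborel" "emeasure lborel N = 0" "{z \<in> space lborel. H z \<noteq> u' z} \<subseteq> N"
    using ae by (auto elim!: AE_E)
  have [measurable]: "N \<in> sets (borel \<Otimes>\<^sub>M borel)" using N(1) unfolding borel_prod sets_lborel .
  have aeN: "AE z in lborel \<Otimes>\<^sub>M lborel. z \<notin> N"
    unfolding lborel_prod using N by (intro AE_not_in) (auto simp: null_sets_def)
  have HN: "H z = u' z" if "z \<notin> N" for z using N(3) that by auto
  have aeNxy: "AE x in lborel. AE y in lborel. (x, y) \<notin> N"
    using lborel_pair.AE_pair[OF aeN] .
  \<comment> \<open>Null sections in both directions are used: at fixed y for the estimate from the
    hypothesis, at fixed x for the identification of the parameter integral.\<close>
  have "AE y in lborel. AE x in lborel. (x, y) \<notin> N"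
  proof (subst lborel_pair.AE_commute[symmetric])
    have "- N \<in> sets (borel \<Otimes>\<^sub>M borel)"
      using N(1) unfolding borel_prod sets_lborel by (rule borel_comp)
    moreover have "{z \<in> space (lborel \<Otimes>\<^sub>M lborel). (fst z, snd z) \<notin> N} = - N"
      by (auto simp: space_pair_measure)
    ultimately show "{z \<in> space (lborel \<Otimes>\<^sub>M lborel). (fst z, snd z) \<notin> N} \<in> sets (lborel \<Otimes>\<^sub>M lborel)"
      by simp
  qed (rule aeNxy)
  then have aeyx: "AE y in lborel. AE x in lborel. H (x, y) = u' (x, y)"
    by (rule eventually_mono) (auto elim!: eventually_mono intro: HN)
  have aexy: "AE x in lborel. AE y in lborel. H (x, y) = u' (x, y)"
    using aeNxy by (rule eventually_mono) (auto elim!: eventually_mono intro: HN)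
  \<comment> \<open>The difference formed with the Borel version and truncated to the product of D
    and \<Gamma>, hence measurable on the whole product space.\<close>
  define T where "T x y = indicator D x * indicator \<Gamma> y * (u' (x, y) - w x y)" for x y
  have Tm [measurable]: "(\<lambda>(x, y). T x y) \<in> borel_measurable (borel \<Otimes>\<^sub>M borel)"
    unfolding T_def split_beta' by measurable
  define p where "p y = indicator \<Gamma> y * P y" for y
  have pm [measurable]: "p \<in> borel_measurable borel" unfolding p_def by measurable
  have pL: "p \<in> sq_integrable lborel"
  proof -
    have "integrable lborel (\<lambda>y. indicator \<Gamma> y *\<^sub>R (P y)\<^sup>2)"
      by (intro borel_integrable_compact \<Gamma> continuous_intros continuous_on_subset[OF P]) auto
    moreover have "(\<lambda>y. indicator \<Gamma> y *\<^sub>R (P y)\<^sup>2) = (\<lambda>y. (norm (p y))\<^sup>2)"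
      by (auto simp: p_def indicator_def)
    ultimately show ?thesis using pm by (simp add: sq_integrable_def)
  qed
  define c where "c = sq_norm lborel p"
  define E where "E x = (\<integral>\<^sup>+y. ennreal ((T x y)\<^sup>2) \<partial>lborel)" for x
  have Em [measurable]: "E \<in> borel_measurable borel"
  proof -
    have "(\<lambda>x. \<integral>\<^sup>+y. ennreal ((T x y)\<^sup>2) \<partial>lborel) \<in> borel_measurable (lborel :: (real^'n) measure)"
      by (rule sigma_finite_measure.borel_measurable_nn_integral[OF sigma_finite_lborel]) measurable
    then show ?thesis by (simp add: E_def[abs_def])
  qed
  \<comment> \<open>At fixed y the integral is at most the squared L2 distance of the hypothesis,
    after passage from \<open>lborel\<close> to the completed measure on D.\<close>
  have slice: "(\<integral>\<^sup>+x. ennreal ((T x y)\<^sup>2) \<partial>lborel) \<le> indicator \<Gamma> y * ennreal (\<eta>\<^sup>2)"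
    if y: "AE x in lborel. H (x, y) = u' (x, y)" for y
  proof (cases "y \<in> \<Gamma>")
    case True
    define e where "e x = u x y - w x y" for x
    have eL: "e \<in> sq_integrable (lebesgue_on D)" "sq_norm (lebesgue_on D) e \<le> \<eta>"
      using close[OF True] by (simp_all add: e_def[abs_def] L2_eq_sq_integrable L2_norm_eq_sq_norm)
    have "(\<integral>\<^sup>+x. ennreal ((T x y)\<^sup>2) \<partial>lborel) = (\<integral>\<^sup>+x. ennreal ((T x y)\<^sup>2) \<partial>lebesgue)"
      by (simp add: nn_integral_completion)
    also have "\<dots> = (\<integral>\<^sup>+x. ennreal ((norm (e x))\<^sup>2) * indicator D x \<partial>lebesgue)"
    proof (rule nn_integral_cong_AE)
      show "AE x in lebesgue. ennreal ((T x y)\<^sup>2) = ennreal ((norm (e x))\<^sup>2) * indicator D x"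
        using AE_completion[OF y] by eventually_elim (auto simp: T_def H_def e_def True indicator_def)
    qed
    also have "\<dots> = (\<integral>\<^sup>+x. ennreal ((norm (e x))\<^sup>2) \<partial>lebesgue_on D)"
      by (rule nn_integral_restrict_space[OF Dm, symmetric])
    also have "\<dots> \<le> ennreal (\<eta>\<^sup>2)"
      unfolding nn_integral_sq_norm[OF eL(1)] by (intro ennreal_leI power_mono eL) simp
    finally show ?thesis using True by simp
  qed (simp add: T_def)
  have total: "(\<integral>\<^sup>+x. E x \<partial>lborel) \<le> ennreal (\<eta>\<^sup>2) * emeasure lborel \<Gamma>"
  proof -
    have "(\<integral>\<^sup>+x. E x \<partial>lborel) = (\<integral>\<^sup>+y. \<integral>\<^sup>+x. ennreal ((T x y)\<^sup>2) \<partial>lborel \<partial>lborel)"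
      unfolding E_def by (rule lborel_pair.Fubini'[symmetric]) measurable
    also have "\<dots> \<le> (\<integral>\<^sup>+y. indicator \<Gamma> y * ennreal (\<eta>\<^sup>2) \<partial>lborel)"
      using aeyx by (intro nn_integral_mono_AE) (auto elim!: eventually_mono intro: slice)
    also have "\<dots> = ennreal (\<eta>\<^sup>2) * emeasure lborel \<Gamma>"
      by (subst mult.commute) (simp add: nn_integral_cmult_indicator)
    finally show ?thesis .
  qed
  have "(\<integral>\<^sup>+x. E x \<partial>lborel) \<noteq> \<infinity>"
    using total \<Gamma>fin by (auto simp: ennreal_mult_eq_top_iff top_unique)
  then have Efin: "AE x in lborel. E x \<noteq> \<infinity>" by (intro nn_integral_PInf_AE) auto
  have TL: "T x \<in> sq_integrable lborel" "ennreal ((sq_norm lborel (T x))\<^sup>2) = E x" if "E x \<noteq> \<infinity>" for x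
  proof -
    have [measurable]: "T x \<in> borel_measurable borel"
    proof -
      have "(\<lambda>y. (\<lambda>(x, y). T x y) (x, y)) \<in> borel_measurable borel" by measurable
      then show ?thesis by simp
    qed
    show 1: "T x \<in> sq_integrable lborel"
      using that by (auto simp: sq_integrable_def integrable_iff_bounded E_def less_top)
    show "ennreal ((sq_norm lborel (T x))\<^sup>2) = E x"
      using nn_integral_sq_norm[OF 1] by (simp add: E_def)
  qed
  define h where "h x = (\<integral>y. T x y * p y \<partial>lborel)" for x
  have hm [measurable]: "h \<in> borel_measurable borel"
  proof -
    have "(\<lambda>x. \<integral>y. T x y * p y \<partial>lborel) \<in> borel_measurable (lborel :: (real^'n) measure)"
      by (rule sigma_finite_measure.borel_measurable_lebesgue_integral[OF sigma_finite_lborel]) measurable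
    then show ?thesis by (simp add: h_def[abs_def])
  qed
  \<comment> \<open>Squared Cauchy-Schwarz in the parameter; finiteness of \<open>E x\<close> makes
    the section square integrable.\<close>
  have hb: "ennreal ((h x)\<^sup>2) \<le> ennreal (c\<^sup>2) * E x" if "E x \<noteq> \<infinity>" for x
  proof -
    have "\<bar>h x\<bar> \<le> sq_norm lborel (T x) * c"
      using cauchy_schwarz_integral[OF TL(1)[OF that] pL] by (simp add: h_def c_def)
    from power_mono[OF this abs_ge_zero, of 2]
    have "(h x)\<^sup>2 \<le> c\<^sup>2 * (sq_norm lborel (T x))\<^sup>2" by (simp add: power_mult_distrib mult.commute)
    then have "ennreal ((h x)\<^sup>2) \<le> ennreal (c\<^sup>2 * (sq_norm lborel (T x))\<^sup>2)" by (rule ennreal_leI)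
    also have "\<dots> = ennreal (c\<^sup>2) * E x" using TL(2)[OF that] by (simp add: ennreal_mult)
    finally show ?thesis .
  qed
  have hnorm: "(\<integral>\<^sup>+x. ennreal ((norm (h x))\<^sup>2) \<partial>lebesgue_on D) \<le> ennreal ((C * \<eta>)\<^sup>2)"
  proof -
    have "(\<integral>\<^sup>+x. ennreal ((norm (h x))\<^sup>2) \<partial>lebesgue_on D) \<le> (\<integral>\<^sup>+x. ennreal ((norm (h x))\<^sup>2) \<partial>lebesgue)"
      unfolding nn_integral_restrict_space[OF Dm] by (intro nn_integral_mono) (auto simp: indicator_def)
    also have "\<dots> = (\<integral>\<^sup>+x. ennreal ((h x)\<^sup>2) \<partial>lborel)" by (simp add: nn_integral_completion)
    also have "\<dots> \<le> (\<integral>\<^sup>+x. ennreal (c\<^sup>2) * E x \<partial>lborel)"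
      using Efin by (intro nn_integral_mono_AE) (auto elim!: eventually_mono intro: hb)
    also have "\<dots> = ennreal (c\<^sup>2) * (\<integral>\<^sup>+x. E x \<partial>lborel)" by (rule nn_integral_cmult) simp
    also have "\<dots> \<le> ennreal (c\<^sup>2) * (ennreal (\<eta>\<^sup>2) * emeasure lborel \<Gamma>)" by (intro mult_left_mono total) simp
    also have "\<dots> = ennreal ((C * \<eta>)\<^sup>2)"
      using \<Gamma>fin by (simp add: C_def c_def p_def[abs_def] power_mult_distrib emeasure_eq_ennreal_measure ennreal_mult'[symmetric] mult_ac)
    finally show ?thesis .
  qed
  have C0: "C * \<eta> \<ge> 0" using \<eta> by (simp add: C_def)
  have "h \<in> borel_measurable (lebesgue_on D)" by (intro measurable_restrict_space1 measurable_completion) simp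
  from sq_norm_le_if_nn_integral_le[OF this hnorm C0]
  have hL: "h \<in> sq_integrable (lebesgue_on D)" "sq_norm (lebesgue_on D) h \<le> C * \<eta>" .
  \<comment> \<open>Identifies \<open>d\<close>, built from the given representative u, with the
    Borel function \<open>h\<close> at almost every x in D; boundedness of w at fixed x makes its
    part integrable, so the integral may be split.\<close>
  have dh: "d x = h x" if x: "x \<in> D" "AE y in lborel. H (x, y) = u' (x, y)" "E x \<noteq> \<infinity>" for x
  proof -
    obtain B where B: "\<forall>y\<in>\<Gamma>. \<bar>w x y\<bar> \<le> B" using wb by blast
    have [measurable]: "w x \<in> borel_measurable borel"
    proof -
      have "(\<lambda>y. (\<lambda>z. w (fst z) (snd z)) (x, y)) \<in> borel_measurable borel" by measurable
      then show ?thesis by simp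
    qed
    have [measurable]: "(\<lambda>y. u' (x, y)) \<in> borel_measurable borel" by measurable
    have pint: "integrable lborel p"
    proof -
      have "integrable lborel (\<lambda>y. indicator \<Gamma> y *\<^sub>R P y)"
        by (intro borel_integrable_compact \<Gamma> continuous_on_subset[OF P]) auto
      then show ?thesis by (simp add: p_def[abs_def])
    qed
    have wi: "integrable lborel (\<lambda>y. w x y * p y)"
    proof (rule Bochner_Integration.integrable_bound)
      show "integrable lborel (\<lambda>y. B * p y)" using pint by simp
      show "AE y in lborel. norm (w x y * p y) \<le> norm (B * p y)"
        using B by (auto simp: p_def indicator_def abs_mult intro!: AE_I2 mult_right_mono)
    qed measurable
    have Ti: "integrable lborel (\<lambda>y. T x y * p y)"
      using sq_integrable_inner[OF TL(1)[OF x(3)] pL] by simp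
    have "integral\<^sup>L (lebesgue_on \<Gamma>) (\<lambda>y. u x y * P y) = integral\<^sup>L lebesgue (\<lambda>y. indicator \<Gamma> y *\<^sub>R (u x y * P y))"
      by (rule integral_restrict_space[OF \<Gamma>m])
    also have "\<dots> = integral\<^sup>L lebesgue (\<lambda>y. u' (x, y) * p y)"
    proof -
      have ae: "AE y in lebesgue. indicator \<Gamma> y *\<^sub>R (u x y * P y) = u' (x, y) * p y"
        using AE_completion[OF x(2)] by eventually_elim (use x(1) in \<open>auto simp: H_def p_def indicator_def\<close>)
      have m: "(\<lambda>y. u' (x, y) * p y) \<in> borel_measurable lebesgue" by (rule measurable_completion) measurable
      show ?thesis by (rule integral_cong_AE[OF borel_measurable_lebesgue_AE[OF m ae] m ae])
    qed
    also have "\<dots> = integral\<^sup>L lborel (\<lambda>y. u' (x, y) * p y)"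
      by (rule integral_completion) measurable
    also have "(\<lambda>y. u' (x, y) * p y) = (\<lambda>y. T x y * p y + w x y * p y)"
      using x(1) by (auto simp: T_def p_def indicator_def algebra_simps)
    also have "integral\<^sup>L lborel (\<lambda>y. T x y * p y + w x y * p y) = h x + integral\<^sup>L lborel (\<lambda>y. w x y * p y)"
      unfolding h_def by (rule Bochner_Integration.integral_add[OF Ti wi])
    also have "integral\<^sup>L lborel (\<lambda>y. w x y * p y) = integral\<^sup>L lebesgue (\<lambda>y. w x y * p y)"
      by (rule integral_completion[symmetric]) measurable
    also have "\<dots> = integral\<^sup>L (lebesgue_on \<Gamma>) (\<lambda>y. w x y * P y)"
      unfolding integral_restrict_space[OF \<Gamma>m] by (simp add: p_def mult_ac)
    finally show ?thesis by (simp add: d_def)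
  qed
  have aed: "AE x in lebesgue. x \<in> D \<longrightarrow> d x = h x"
    using AE_completion[OF aexy] AE_completion[OF Efin] by eventually_elim (use dh in blast)
  then have aeD: "AE x in lebesgue_on D. d x = h x" using Dm by (simp add: AE_restrict_space_iff)
  have dm: "d \<in> borel_measurable (lebesgue_on D)"
  proof -
    have m: "(\<lambda>x. indicator D x *\<^sub>R h x) \<in> borel_measurable lebesgue" by (rule measurable_completion) measurable
    have "(\<lambda>x. indicator D x *\<^sub>R d x) \<in> borel_measurable lebesgue"
      by (rule borel_measurable_lebesgue_AE[OF m], rule eventually_mono[OF aed]) (auto simp: indicator_def)
    then show ?thesis using Dm by (simp add: borel_measurable_restrict_space_iff)
  qed
  show "d \<in> L2 D"
    unfolding L2_eq_sq_integrable using aeD by (intro sq_integrable_cong_AE[OF hL(1) dm]) (auto elim: eventually_mono)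
  have "sq_norm (lebesgue_on D) d = sq_norm (lebesgue_on D) h"
    by (rule sq_norm_cong_AE[OF dm sq_integrable_measurable[OF hL(1)] aeD])
  then show "L2_norm D d \<le> C * \<eta>" using hL(2) by (simp add: L2_norm_eq_sq_norm)
qed

section \<open>Legendre coefficients\<close>

lemma continuous_on_legendre_tensor: "continuous_on S (legendre_tensor k)"
  unfolding legendre_tensor_def by (intro continuous_intros)

text \<open>The products are sorted by variable; one with k_j = 0 contributes \<open>D_bar\<close>
  and no square root.\<close>

lemma C_hat_eq:
  "C_hat D f \<delta> \<rho> k * rho_pow \<rho> k * (\<Prod>j\<in>{j. k j \<noteq> 0}. sqrt (real (k j)))
    = V_dual_norm D f / \<delta> * (\<Prod>j\<in>UNIV. bernstein_length (\<rho> $ j) / pi * legendre_const (k j) (\<rho> $ j))"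
proof -
  define A where "A j = bernstein_length (\<rho> $ j) / pi" for j
  define r where "r j = (\<rho> $ j) powi (- int (k j))" for j
  have U: "UNIV = {j. k j = 0} \<union> {j. k j \<noteq> 0}" by auto
  have "(\<Prod>j\<in>UNIV. legendre_const (k j) (\<rho> $ j)) =
      (\<Prod>j\<in>UNIV. if k j = 0 then D_bar (\<rho> $ j) else D_half (\<rho> $ j) * sqrt (real (k j))) * (\<Prod>j\<in>UNIV. r j)"
    by (simp add: legendre_const_def r_def prod.distrib)
  also have "(\<Prod>j\<in>UNIV. if k j = 0 then D_bar (\<rho> $ j) else D_half (\<rho> $ j) * sqrt (real (k j))) =
      (\<Prod>j\<in>{j. k j = 0}. D_bar (\<rho> $ j)) * (\<Prod>j\<in>{j. k j \<noteq> 0}. D_half (\<rho> $ j) * sqrt (real (k j)))"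
    by (subst prod.If_cases) (auto simp: Compl_eq)
  finally have "(\<Prod>j\<in>UNIV. A j * legendre_const (k j) (\<rho> $ j)) = (\<Prod>j\<in>UNIV. A j) *
      ((\<Prod>j\<in>{j. k j = 0}. D_bar (\<rho> $ j)) * ((\<Prod>j\<in>{j. k j \<noteq> 0}. D_half (\<rho> $ j)) * (\<Prod>j\<in>{j. k j \<noteq> 0}. sqrt (real (k j)))) * (\<Prod>j\<in>UNIV. r j))"
    by (simp add: prod.distrib)
  then show ?thesis
    unfolding C_hat_def rho_pow_def A_def r_def by (simp add: mult_ac)
qed

text \<open>The orthonormal polynomials carry a factor sqrt (k_j + 1/2) and the first kind of
  coefficient a factor k_j + 1/2, so the ratio is the inverse square root.\<close>

lemma legendre_on_coeff_eq:
  "legendre_on_coeff u k x = (\<Prod>j\<in>UNIV. 1 / sqrt (real (k j) + 1/2)) * legendre_coeff u k x"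
proof -
  define q where "q j = sqrt (real (k j) + 1/2)" for j
  have q: "q j > 0" "q j * q j = real (k j) + 1/2" for j by (simp_all add: q_def)
  have "legendre_on_tensor k y = (\<Prod>j\<in>UNIV. q j) * legendre_tensor k y" for y
    by (simp add: legendre_on_tensor_def legendre_tensor_def legendre_on_def q_def add_divide_distrib flip: prod.distrib)
  then have "legendre_on_coeff u k x = (\<Prod>j\<in>UNIV. q j) * integral\<^sup>L (lebesgue_on Gam) (\<lambda>y. u x y * legendre_tensor k y)"
    unfolding legendre_on_coeff_def integral_mult_right_zero[symmetric] by (simp add: mult_ac)
  also have "(\<Prod>j\<in>UNIV. q j) = (\<Prod>j\<in>UNIV. 1 / q j * (q j * q j))"
    using q(1) by (intro prod.cong refl) (simp add: less_imp_neq[symmetric])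
  also have "\<dots> = (\<Prod>j\<in>UNIV. 1 / q j) * (\<Prod>j\<in>UNIV. real (k j) + 1/2)"
    unfolding q(2) by (rule prod.distrib)
  finally show ?thesis by (simp add: legendre_coeff_def q_def)
qed

text \<open>A variable contributes sqrt 2 if k_j = 0 and sqrt (k_j / (k_j + 1/2)) <= 1 otherwise;
  this is the source of the power of 2 in the second bound.\<close>

lemma normalization_factor_le:
  "(\<Prod>j\<in>(UNIV :: 'd::finite set). 1 / sqrt (real (k j) + 1/2)) * (\<Prod>j\<in>{j. k j \<noteq> 0}. sqrt (real (k j)))
    \<le> 2 powr (real (zero_count k) / 2)"
proof -
  have eq: "(\<Prod>j\<in>{j. k j \<noteq> 0}. sqrt (real (k j))) = (\<Prod>j\<in>UNIV. if k j = 0 then 1 else sqrt (real (k j)))"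
    by (subst prod.If_cases) (auto simp: Compl_eq)
  have "(\<Prod>j\<in>UNIV. 1 / sqrt (real (k j) + 1/2)) * (\<Prod>j\<in>{j. k j \<noteq> 0}. sqrt (real (k j)))
      = (\<Prod>j\<in>UNIV. 1 / sqrt (real (k j) + 1/2) * (if k j = 0 then 1 else sqrt (real (k j))))"
    unfolding eq prod.distrib ..
  also have "\<dots> \<le> (\<Prod>j\<in>UNIV. if k j = 0 then sqrt 2 else 1)"
    by (intro prod_mono) (auto simp: real_sqrt_divide)
  also have "\<dots> = sqrt 2 ^ zero_count k"
    by (subst prod.If_cases) (auto simp: zero_count_def)
  also have "\<dots> = 2 powr (real (zero_count k) / 2)"
    by (simp add: powr_half_sqrt[symmetric] powr_power)
  finally show ?thesis .
qed

text \<open>The weak gradient of the limit is the \<open>L\<^sup>2\<close> limit of the gradients, which exists by completeness.\<close>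

lemma H10_limit:
  fixes v :: "real^'n \<Rightarrow> real"
  assumes D: "open D" "bounded D" and v: "v \<in> L2 D" and U: "\<And>m. U m \<in> test_funs D"
    and lim: "(\<lambda>m. L2_norm D (\<lambda>x. v x - U m x)) \<longlonglongrightarrow> 0"
    and fast: "\<And>m. V_norm D (\<lambda>x. U (Suc m) x - U m x) \<le> C * (1/2) ^ m"
    and bound: "\<And>m. V_norm D (U m) \<le> B"
  shows "v \<in> H10 D" "V_norm D v \<le> B"
proof -
  define M where "M = lebesgue_on D"
  define F where "F m = weak_grad D (U m)" for m
  have U1: "U m \<in> H1 D" for m by (rule test_funs_H1[OF D(1) U])
  have F: "F m \<in> sq_integrable M" for m
    unfolding F_def M_def using weak_grad_L2[OF U1] by (simp add: L2_eq_sq_integrable)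
  have Ffast: "sq_norm M (\<lambda>x. F (Suc m) x - F m x) \<le> C * (1/2) ^ m" for m
  proof -
    have d1: "(\<lambda>x. 1 * U (Suc m) x + (-1) * U m x) \<in> H1 D" by (intro H1_lincomb D U1)
    have "sq_norm M (weak_grad D (\<lambda>x. 1 * U (Suc m) x + (-1) * U m x)) = sq_norm M (\<lambda>x. F (Suc m) x - F m x)"
    proof (rule sq_norm_cong_AE)
      show "AE x in M. weak_grad D (\<lambda>x. 1 * U (Suc m) x + (-1) * U m x) x = F (Suc m) x - F m x"
        using weak_grad_lincomb[OF D U1 U1, of 1 "Suc m" "-1" m] unfolding M_def F_def by simp
    qed (use weak_grad_measurable[OF d1] sq_integrable_measurable[OF F] in \<open>auto simp: M_def\<close>)
    moreover have "sq_norm M (weak_grad D (\<lambda>x. 1 * U (Suc m) x + (-1) * U m x)) = V_norm D (\<lambda>x. U (Suc m) x - U m x)"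
      by (simp add: V_norm_def L2_norm_eq_sq_norm M_def)
    ultimately show ?thesis using fast[of m] by simp
  qed
  obtain G where G: "G \<in> sq_integrable M" "(\<lambda>m. sq_norm M (\<lambda>x. F m x - G x)) \<longlonglongrightarrow> 0"
    by (rule sq_integrable_complete[of F M C, OF F Ffast]) blast
  have GL: "G \<in> L2 D" using G(1) by (simp add: L2_eq_sq_integrable M_def)
  have wg: "is_weak_grad D v G"
    unfolding is_weak_grad_def
  proof (intro ballI allI)
    fix \<psi> i assume \<psi>: "\<psi> \<in> test_funs D"
    have \<psi>L: "\<psi> \<in> L2 D" "pderivative i \<psi> \<in> L2 D" by (intro test_funs_L2 test_funs_pderivative D \<psi>)+
    have UL: "U m \<in> L2 D" for m by (rule H1_L2[OF U1])
    have 1: "(\<lambda>m. integral\<^sup>L M (\<lambda>x. U m x * pderivative i \<psi> x)) \<longlonglongrightarrow> integral\<^sup>L M (\<lambda>x. v x * pderivative i \<psi> x)"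
    proof (rule LIM_zero_cancel, rule Lim_null_comparison)
      have vU: "(\<lambda>x. v x - U m x) \<in> L2 D" for m using L2_lincomb[OF v UL, of 1 "-1"] by simp
      show "\<forall>\<^sub>F m in sequentially. norm (integral\<^sup>L M (\<lambda>x. U m x * pderivative i \<psi> x) - integral\<^sup>L M (\<lambda>x. v x * pderivative i \<psi> x))
          \<le> L2_norm D (\<lambda>x. v x - U m x) * L2_norm D (pderivative i \<psi>)"
      proof (rule always_eventually, rule allI)
        fix m
        have "integral\<^sup>L M (\<lambda>x. v x * pderivative i \<psi> x) - integral\<^sup>L M (\<lambda>x. U m x * pderivative i \<psi> x)
            = integral\<^sup>L M (\<lambda>x. (v x - U m x) \<bullet> pderivative i \<psi> x)"
          using L2_times_integrable[OF v \<psi>L(2)] L2_times_integrable[OF UL \<psi>L(2)] by (simp add: M_def left_diff_distrib)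
        then show "norm (integral\<^sup>L M (\<lambda>x. U m x * pderivative i \<psi> x) - integral\<^sup>L M (\<lambda>x. v x * pderivative i \<psi> x))
          \<le> L2_norm D (\<lambda>x. v x - U m x) * L2_norm D (pderivative i \<psi>)"
          using cauchy_schwarz_integral[of "\<lambda>x. v x - U m x" M "pderivative i \<psi>"] vU \<psi>L
          by (simp add: L2_eq_sq_integrable L2_norm_eq_sq_norm M_def abs_minus_commute)
      qed
      show "(\<lambda>m. L2_norm D (\<lambda>x. v x - U m x) * L2_norm D (pderivative i \<psi>)) \<longlonglongrightarrow> 0"
        using tendsto_mult_right[OF lim, of "L2_norm D (pderivative i \<psi>)"] by simp
    qed
    have 2: "(\<lambda>m. integral\<^sup>L M (\<lambda>x. F m x $ i * \<psi> x)) \<longlonglongrightarrow> integral\<^sup>L M (\<lambda>x. G x $ i * \<psi> x)"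
    proof (rule LIM_zero_cancel, rule Lim_null_comparison)
      \<comment> \<open>Writes one component of the gradient tested with \<psi> as an inner product
        of vector fields, so that Cauchy-Schwarz for vector fields applies.\<close>
      define \<Psi> where "\<Psi> x = \<psi> x *\<^sub>R (axis i 1 :: real^'n)" for x
      have \<Psi>: "\<Psi> \<in> sq_integrable M"
        using \<psi>L(1) unfolding \<Psi>_def L2_def M_def sq_integrable_def by (auto intro!: borel_measurable_scaleR)
      have dot: "g \<bullet> \<Psi> x = g $ i * \<psi> x" for g x by (simp add: \<Psi>_def inner_axis mult.commute)
      show "\<forall>\<^sub>F m in sequentially. norm (integral\<^sup>L M (\<lambda>x. F m x $ i * \<psi> x) - integral\<^sup>L M (\<lambda>x. G x $ i * \<psi> x))
          \<le> sq_norm M (\<lambda>x. F m x - G x) * sq_norm M \<Psi>"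
      proof (rule always_eventually, rule allI)
        fix m
        have "integral\<^sup>L M (\<lambda>x. F m x $ i * \<psi> x) - integral\<^sup>L M (\<lambda>x. G x $ i * \<psi> x)
            = integral\<^sup>L M (\<lambda>x. (F m x - G x) \<bullet> \<Psi> x)"
          using sq_integrable_inner[OF F \<Psi>] sq_integrable_inner[OF G(1) \<Psi>] by (simp add: inner_diff_left dot left_diff_distrib)
        then show "norm (integral\<^sup>L M (\<lambda>x. F m x $ i * \<psi> x) - integral\<^sup>L M (\<lambda>x. G x $ i * \<psi> x))
          \<le> sq_norm M (\<lambda>x. F m x - G x) * sq_norm M \<Psi>"
          using cauchy_schwarz_integral[OF sq_integrable_diff[OF F G(1)] \<Psi>] by simp
      qed
      show "(\<lambda>m. sq_norm M (\<lambda>x. F m x - G x) * sq_norm M \<Psi>) \<longlonglongrightarrow> 0"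
        using tendsto_mult_right[OF G(2), of "sq_norm M \<Psi>"] by simp
    qed
    have "integral\<^sup>L M (\<lambda>x. U m x * pderivative i \<psi> x) = - integral\<^sup>L M (\<lambda>x. F m x $ i * \<psi> x)" for m
      using is_weak_grad_weak_grad[OF U1, of m] \<psi> unfolding is_weak_grad_def F_def M_def by blast
    with 1 have "(\<lambda>m. - integral\<^sup>L M (\<lambda>x. F m x $ i * \<psi> x)) \<longlonglongrightarrow> integral\<^sup>L M (\<lambda>x. v x * pderivative i \<psi> x)" by simp
    from LIMSEQ_unique[OF this tendsto_minus[OF 2]]
    show "integral\<^sup>L (lebesgue_on D) (\<lambda>x. v x * pderivative i \<psi> x) = - integral\<^sup>L (lebesgue_on D) (\<lambda>x. G x $ i * \<psi> x)"
      by (simp add: M_def)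
  qed
  have v1: "v \<in> H1 D" using v GL wg by (auto simp: H1_def)
  have vG: "AE x in M. weak_grad D v x = G x"
    unfolding M_def by (rule is_weak_grad_unique[OF D weak_grad_L2[OF v1] GL is_weak_grad_weak_grad[OF v1] wg])
  have Vlim: "(\<lambda>m. V_norm D (\<lambda>x. v x - U m x)) \<longlonglongrightarrow> 0"
  proof -
    have "V_norm D (\<lambda>x. v x - U m x) = sq_norm M (\<lambda>x. F m x - G x)" for m
    proof -
      have d1: "(\<lambda>x. 1 * v x + (-1) * U m x) \<in> H1 D" by (intro H1_lincomb D U1 v1)
      have "sq_norm M (weak_grad D (\<lambda>x. 1 * v x + (-1) * U m x)) = sq_norm M (\<lambda>x. G x - F m x)"
      proof (rule sq_norm_cong_AE)
        show "AE x in M. weak_grad D (\<lambda>x. 1 * v x + (-1) * U m x) x = G x - F m x"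
          using weak_grad_lincomb[OF D v1 U1, of 1 "-1" m] vG unfolding M_def F_def by eventually_elim simp
      qed (use weak_grad_measurable[OF d1] sq_integrable_measurable[OF F] sq_integrable_measurable[OF G(1)] in \<open>auto simp: M_def\<close>)
      then show ?thesis by (simp add: V_norm_def L2_norm_eq_sq_norm M_def sq_norm_def norm_minus_commute)
    qed
    then show ?thesis using G(2) by simp
  qed
  show "v \<in> H10 D" by (rule H10I[OF v1 U lim Vlim])
  have "V_norm D v \<le> V_norm D (\<lambda>x. v x - U m x) + B" for m
  proof -
    have d1: "(\<lambda>x. 1 * v x + (-1) * U m x) \<in> H1 D" by (intro H1_lincomb D U1 v1)
    have "V_norm D v \<le> V_norm D (\<lambda>x. v x - U m x) + V_norm D (U m)"
      using V_norm_lincomb_le[OF D d1 U1, of 1 1 m] by simp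
    then show ?thesis using bound[of m] by linarith
  qed
  moreover have "(\<lambda>m. V_norm D (\<lambda>x. v x - U m x) + B) \<longlonglongrightarrow> 0 + B" by (intro tendsto_intros Vlim)
  ultimately have "V_norm D v \<le> 0 + B" by (intro LIMSEQ_le_const) auto
  then show "V_norm D v \<le> B" by simp
qed

text \<open>\<open>U m\<close> is the Legendre coefficient of the m-th approximant
  \<open>W m y\<close>, again a test function. Its inner product with g is the Legendre functional
  of a scalar holomorphic function, bounded on the filled ellipses by the dual norm of f over
  \<delta> times the norm of g. Taking g = \<open>U m\<close> bounds the norm; taking g to be the
  difference of consecutive \<open>U m\<close> and closeness to u gives a geometric rate.\<close>

lemma legendre_coeff_in_H10:
  fixes D :: "(real^'n) set" and a :: "real^'n \<Rightarrow> real^'d \<Rightarrow> real" and ac :: "real^'n \<Rightarrow> complex^'d \<Rightarrow> complex"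
    and u :: "real^'n \<Rightarrow> real^'d \<Rightarrow> real" and k :: "'d \<Rightarrow> nat"
  assumes D: "open D" "bounded D" and f: "f \<in> V_dual D" and amin: "0 < amin" "amin < amax"
    and a_bounds: "\<And>x y. x \<in> D \<Longrightarrow> y \<in> Gam \<Longrightarrow> amin \<le> a x y \<and> a x y \<le> amax"
    and ac_continues: "\<And>x y. x \<in> D \<Longrightarrow> y \<in> Gam \<Longrightarrow> ac x (vec_of_real y) = complex_of_real (a x y)"
    and ac: "Linf_holomorphic D ac" and \<delta>: "0 < \<delta>" and \<rho>: "\<And>j. 1 < \<rho> $ j"
    and coercive: "\<And>x z. x \<in> D \<Longrightarrow> z \<in> bernstein_polyellipse \<rho> \<Longrightarrow> \<delta> \<le> Re (ac x z)"
    and u: "parametric_solution D a f u"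
  defines "B \<equiv> V_dual_norm D f / \<delta> * (\<Prod>j\<in>UNIV. bernstein_length (\<rho> $ j) / pi * legendre_const (k j) (\<rho> $ j))"
  shows "legendre_coeff u k \<in> H10 D" "V_norm D (legendre_coeff u k) \<le> B"
proof -
  define MG where "MG = lebesgue_on (Gam :: (real^'d) set)"
  have um: "(\<lambda>(x, y). u x y) \<in> borel_measurable (lebesgue_on (D \<times> Gam))"
    and uw: "\<And>y. y \<in> Gam \<Longrightarrow> weak_solution D (\<lambda>x. a x y) f (\<lambda>x. u x y)"
    using u by (simp_all add: parametric_solution_def)
  \<comment> \<open>The accuracy 2^(-m) of the m-th approximant is what gives the coefficients the
    rate required by \<open>H10_limit\<close>.\<close>
  define Q where "Q m N \<phi> c \<longleftrightarrow> (\<forall>i<N. \<phi> i \<in> test_funs D \<and> c i \<in> ellipse_holomorphic \<rho>) \<and>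
    (\<forall>z\<in>filled_polyellipse \<rho>. \<forall>g\<in>H1 D.
      cmod (\<Sum>i<(N::nat). c i z * of_real (V_inner D (\<phi> i) g)) \<le> V_dual_norm D f / \<delta> * V_norm D g) \<and>
    (\<forall>y\<in>Gam. V_norm D (\<lambda>x. u x y - (\<Sum>i<N. Re (c i (vec_of_real y)) * \<phi> i x)) \<le> (1/2) ^ m)" for m :: nat and N \<phi> c
  have "\<exists>N \<phi> c. Q m N \<phi> c" for m
    unfolding Q_def by (rule galerkin_approximation[OF D f amin a_bounds ac_continues ac \<delta> \<rho> coercive uw]) simp_all
  then have "\<forall>m. \<exists>t. Q m (fst t) (fst (snd t)) (snd (snd t))" by simp
  then obtain t where t: "\<And>m. Q m (fst (t m)) (fst (snd (t m))) (snd (snd (t m)))"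
    unfolding choice_iff by blast
  define N where "N m = fst (t m)" for m
  define \<phi> where "\<phi> m = fst (snd (t m))" for m
  define c where "c m = snd (snd (t m))" for m
  have Q: "Q m (N m) (\<phi> m) (c m)" for m using t by (simp add: N_def \<phi>_def c_def)
  have \<phi>: "\<phi> m i \<in> test_funs D" and c: "c m i \<in> ellipse_holomorphic \<rho>" if "i < N m" for m i
    using Q[of m] that by (simp_all add: Q_def)
  have cb: "cmod (\<Sum>i<N m. c m i z * of_real (V_inner D (\<phi> m i) g)) \<le> V_dual_norm D f / \<delta> * V_norm D g"
    if "z \<in> filled_polyellipse \<rho>" "g \<in> H1 D" for m z g
    using Q[of m] that by (simp add: Q_def)
  have err: "V_norm D (\<lambda>x. u x y - (\<Sum>i<N m. Re (c m i (vec_of_real y)) * \<phi> m i x)) \<le> (1/2) ^ m" if "y \<in> Gam" for m y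
    using Q[of m] that by (simp add: Q_def)
  define P where "P = legendre_tensor k"
  define \<kappa> where "\<kappa> = (\<Prod>j\<in>UNIV. real (k j) + 1/2)"
  have \<kappa>: "0 < \<kappa>" unfolding \<kappa>_def by (intro prod_pos) simp
  define r where "r m i y = Re (c m i (vec_of_real y))" for m i y
  have Gm: "Gam \<inter> space (lebesgue :: (real^'d) measure) \<in> sets lebesgue"
    using borel_closed[OF compact_imp_closed[OF compact_Gam]] by auto
  have contG: "integrable MG h" if "continuous_on Gam h" for h :: "real^'d \<Rightarrow> 'b::euclidean_space"
  proof -
    have "integrable lborel (\<lambda>y. indicator Gam y *\<^sub>R h y)" by (rule borel_integrable_compact[OF compact_Gam that])
    then have "integrable lebesgue (\<lambda>y. indicator Gam y *\<^sub>R h y)"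
      by (simp add: integrable_completion borel_measurable_integrable)
    then show ?thesis unfolding MG_def integrable_restrict_space[OF Gm] .
  qed
  have vc: "continuous_on Gam (vec_of_real :: real^'d \<Rightarrow> _)" unfolding vec_of_real_def by (intro continuous_intros)
  have cc: "continuous_on Gam (\<lambda>y. c m i (vec_of_real y))" if "i < N m" for m i
    by (rule continuous_on_compose2[OF _ vc, of "filled_polyellipse \<rho>"])
       (use c[OF that] vec_of_real_in_filled_polyellipse[OF \<rho>] in \<open>auto simp: ellipse_holomorphic_def\<close>)
  have rc: "continuous_on Gam (r m i)" if "i < N m" for m i
    unfolding r_def by (intro continuous_intros cc that)
  have Pc: "continuous_on S P" for S unfolding P_def by (rule continuous_on_legendre_tensor)
  have rPi: "integrable MG (\<lambda>y. r m i y * P y)" if "i < N m" for m i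
    by (intro contG continuous_intros rc Pc that)
  define \<gamma> where "\<gamma> m i = \<kappa> * integral\<^sup>L MG (\<lambda>y. r m i y * P y)" for m i
  define U where "U m x = (\<Sum>i<N m. \<gamma> m i * \<phi> m i x)" for m x
  define W where "W m y x = (\<Sum>i<N m. r m i y * \<phi> m i x)" for m y x
  have U: "U m \<in> test_funs D" and W: "W m y \<in> test_funs D" for m y
    unfolding U_def W_def by (intro test_funs_sum \<phi>; simp)+
  have U1: "U m \<in> H1 D" and W1: "W m y \<in> H1 D" for m y by (intro test_funs_H1 D U W)+
  have Wb: "V_norm D (\<lambda>x. u x y - W m y x) \<le> (1/2) ^ m" if "y \<in> Gam" for m y
    using err[OF that] by (simp add: W_def r_def)
  have innerW: "V_inner D (W m y) g = (\<Sum>i<N m. r m i y * V_inner D (\<phi> m i) g)" if "g \<in> H1 D" for m y g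
    unfolding W_def by (rule V_inner_sum[OF D \<phi> that])
  have Wi: "integrable MG (\<lambda>y. V_inner D (W m y) g * P y)" if "g \<in> H1 D" for m g
    unfolding innerW[OF that] by (intro contG continuous_intros rc Pc) auto
  have innerU: "V_inner D (U m) g = \<kappa> * integral\<^sup>L MG (\<lambda>y. V_inner D (W m y) g * P y)" if g: "g \<in> H1 D" for m g
  proof -
    have "V_inner D (U m) g = (\<Sum>i<N m. \<gamma> m i * V_inner D (\<phi> m i) g)"
      unfolding U_def by (rule V_inner_sum[OF D \<phi> g])
    also have "\<dots> = \<kappa> * (\<Sum>i<N m. integral\<^sup>L MG (\<lambda>y. (r m i y * P y) * V_inner D (\<phi> m i) g))"
      unfolding \<gamma>_def integral_mult_left_zero by (simp add: sum_distrib_left mult_ac)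
    also have "(\<Sum>i<N m. integral\<^sup>L MG (\<lambda>y. (r m i y * P y) * V_inner D (\<phi> m i) g)) =
        integral\<^sup>L MG (\<lambda>y. \<Sum>i<N m. (r m i y * P y) * V_inner D (\<phi> m i) g)"
      by (intro Bochner_Integration.integral_sum[symmetric] integrable_mult_left rPi) auto
    also have "\<dots> = integral\<^sup>L MG (\<lambda>y. V_inner D (W m y) g * P y)"
      by (simp add: innerW[OF g] sum_distrib_left mult_ac)
    finally show ?thesis .
  qed
  have f0: "0 \<le> V_dual_norm D f / \<delta>" using V_dual_norm_nonneg[OF D f] \<delta> by simp
  have UB: "\<bar>V_inner D (U m) g\<bar> \<le> B * V_norm D g" if g: "g \<in> H1 D" for m g
  proof -
    define F where "F z = (\<Sum>i<N m. c m i z * of_real (V_inner D (\<phi> m i) g))" for z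
    have Fh: "F \<in> ellipse_holomorphic \<rho>"
      unfolding F_def by (intro ellipse_holomorphic_sum ellipse_holomorphic_mult ellipse_holomorphic_const c) auto
    have Fi: "integrable MG (\<lambda>y. F (vec_of_real y) * of_real (P y))"
      unfolding F_def by (intro contG continuous_intros cc Pc) auto
    have "V_inner D (U m) g = \<kappa> * integral\<^sup>L MG (\<lambda>y. Re (F (vec_of_real y) * of_real (P y)))"
      unfolding innerU[OF g] innerW[OF g] by (simp add: F_def r_def)
    also have "\<dots> = Re (of_real \<kappa> * integral\<^sup>L MG (\<lambda>y. F (vec_of_real y) * of_real (P y)))"
      using integral_Re[OF Fi] by simp
    finally have "\<bar>V_inner D (U m) g\<bar> \<le> cmod (of_real \<kappa> * integral\<^sup>L MG (\<lambda>y. F (vec_of_real y) * of_real (P y)))"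
      using abs_Re_le_cmod by metis
    also have "\<dots> \<le> (V_dual_norm D f / \<delta> * V_norm D g) * (\<Prod>j\<in>UNIV. bernstein_length (\<rho> $ j) / pi * legendre_const (k j) (\<rho> $ j))"
      using tensor_legendre_functional_bound[OF \<rho> Fh, of "V_dual_norm D f / \<delta> * V_norm D g" k] cb[OF _ g]
      unfolding F_def MG_def P_def \<kappa>_def by simp
    also have "\<dots> = B * V_norm D g" by (simp add: B_def mult_ac)
    finally show ?thesis .
  qed
  have VB: "V_norm D (U m) \<le> B" for m
  proof (cases "V_norm D (U m) = 0")
    case True
    \<comment> \<open>Nonnegativity of the product is read off from the functional bound, applied to
      the zero function with bound 1.\<close>
    have "0 \<le> (\<Prod>j\<in>UNIV. bernstein_length (\<rho> $ j) / pi * legendre_const (k j) (\<rho> $ j))"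
      using tensor_legendre_functional_bound[OF \<rho> ellipse_holomorphic_const[of 0], of 1 k] by simp
    then have "0 \<le> B" unfolding B_def by (rule mult_nonneg_nonneg[OF f0])
    then show ?thesis using True by simp
  next
    case False
    then have pos: "0 < V_norm D (U m)" using V_norm_nonneg[of D "U m"] by linarith
    have "V_norm D (U m) * V_norm D (U m) \<le> B * V_norm D (U m)"
      using UB[OF U1[of m], of m] by (simp add: V_norm_power2[symmetric] power2_eq_square)
    then show ?thesis using pos by simp
  qed
  define PN where "PN = \<kappa> * integral\<^sup>L MG (\<lambda>y. \<bar>P y\<bar>)"
  have Pi: "integrable MG (\<lambda>y. \<bar>P y\<bar>)" by (intro contG continuous_intros Pc)
  have PN0: "0 \<le> PN" unfolding PN_def using \<kappa> by simp
  have diff: "V_norm D (\<lambda>x. U (Suc m) x - U m x) \<le> (2 * PN) * (1/2) ^ m" for m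
  proof -
    define g where "g = (\<lambda>x. 1 * U (Suc m) x + (-1) * U m x)"
    have g1: "g \<in> H1 D" unfolding g_def by (intro H1_lincomb D U1)
    \<comment> \<open>Both approximants are compared with u itself, and 2^(-m) + 2^(-m-1) is at most
      2 * 2^(-m); hence the factor 2 in the rate.\<close>
    have WW: "\<bar>V_inner D (W (Suc m) y) g - V_inner D (W m y) g\<bar> \<le> 2 * (1/2) ^ m * V_norm D g" if y: "y \<in> Gam" for y
    proof -
      have uy: "(\<lambda>x. u x y) \<in> H1 D" by (rule weak_solution_H1[OF uw[OF y]])
      define e where "e n = (\<lambda>x. 1 * u x y + (-1) * W n y x)" for n
      have e1: "e n \<in> H1 D" for n unfolding e_def by (intro H1_lincomb D uy W1)
      have Ve: "V_inner D (e n) g = V_inner D (\<lambda>x. u x y) g - V_inner D (W n y) g" for n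
        unfolding e_def using V_inner_lincomb[OF D uy W1 g1, of 1 "-1"] by simp
      have ineq: "\<bar>V_inner D (e n) g\<bar> \<le> (1/2) ^ n * V_norm D g" for n
      proof -
        have "V_norm D (e n) \<le> (1/2) ^ n" using Wb[OF y, of n] by (simp add: e_def)
        from mult_right_mono[OF this V_norm_nonneg[of D g]] show ?thesis
          using V_inner_cauchy_schwarz[OF e1[of n] g1] by linarith
      qed
      have "(1/2 :: real) ^ Suc m * V_norm D g \<le> (1/2) ^ m * V_norm D g"
        by (intro mult_right_mono) auto
      then show ?thesis using ineq[of m] ineq[of "Suc m"] Ve[of m] Ve[of "Suc m"] by linarith
    qed
    have "V_inner D g g = V_inner D (U (Suc m)) g - V_inner D (U m) g"
      using V_inner_lincomb[OF D U1 U1 g1, of 1 "Suc m" "-1" m] by (simp add: g_def)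
    also have "\<dots> = \<kappa> * integral\<^sup>L MG (\<lambda>y. (V_inner D (W (Suc m) y) g - V_inner D (W m y) g) * P y)"
      unfolding innerU[OF g1] using Wi[OF g1] by (simp add: left_diff_distrib right_diff_distrib)
    also have "\<dots> \<le> \<kappa> * integral\<^sup>L MG (\<lambda>y. (2 * (1/2) ^ m * V_norm D g) * \<bar>P y\<bar>)"
    proof (intro mult_left_mono integral_mono)
      show "integrable MG (\<lambda>y. (V_inner D (W (Suc m) y) g - V_inner D (W m y) g) * P y)"
        using Wi[OF g1] by (simp add: left_diff_distrib)
      fix y assume "y \<in> space MG"
      then have y: "y \<in> Gam" by (simp add: MG_def space_restrict_space)
      have "(V_inner D (W (Suc m) y) g - V_inner D (W m y) g) * P y \<le> \<bar>V_inner D (W (Suc m) y) g - V_inner D (W m y) g\<bar> * \<bar>P y\<bar>"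
        by (metis abs_ge_self abs_mult)
      also have "\<dots> \<le> (2 * (1/2) ^ m * V_norm D g) * \<bar>P y\<bar>" by (rule mult_right_mono[OF WW[OF y]]) simp
      finally show "(V_inner D (W (Suc m) y) g - V_inner D (W m y) g) * P y \<le> (2 * (1/2) ^ m * V_norm D g) * \<bar>P y\<bar>" .
    qed (use Pi \<kappa> in auto)
    also have "\<dots> = ((2 * PN) * (1/2) ^ m) * V_norm D g" by (simp add: PN_def mult_ac)
    finally have sq: "V_norm D g * V_norm D g \<le> ((2 * PN) * (1/2) ^ m) * V_norm D g"
      by (simp add: V_norm_power2[symmetric] power2_eq_square)
    have "V_norm D g \<le> (2 * PN) * (1/2) ^ m"
    proof (cases "V_norm D g = 0")
      case True
      then show ?thesis using PN0 by simp
    next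
      case False
      then have "0 < V_norm D g" using V_norm_nonneg[of D g] by linarith
      then show ?thesis using sq by simp
    qed
    then show ?thesis by (simp add: g_def)
  qed
  \<comment> \<open>Poincare turns closeness in energy at each y into closeness in L2, the form in
    which parameter integrals can be compared.\<close>
  obtain CP where CP: "0 \<le> CP" "\<And>v. v \<in> H10 D \<Longrightarrow> L2_norm D v \<le> CP * V_norm D v" using poincare[OF D] by blast
  define CF where "CF = sq_norm lborel (\<lambda>y. indicator Gam y * P y) * sqrt (measure lborel (Gam :: (real^'d) set))"
  have L: "(\<lambda>x. legendre_coeff u k x - U m x) \<in> L2 D \<and> L2_norm D (\<lambda>x. legendre_coeff u k x - U m x) \<le> \<kappa> * (CF * (CP * (1/2) ^ m))" for m
  proof -
    \<comment> \<open>The approximant cut off outside the parameter box: continuity of the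
      coefficients is known on \<open>Gam\<close> only, and the cut-off makes them Borel on the
      whole space.\<close>
    define w where "w x y = (\<Sum>i<N m. (indicator Gam y *\<^sub>R r m i y) * \<phi> m i x)" for x y
    have wW: "w x y = W m y x" if "y \<in> Gam" for x y using that by (simp add: w_def W_def)
    define d where "d = (\<lambda>x. integral\<^sup>L (lebesgue_on Gam) (\<lambda>y. u x y * P y) - integral\<^sup>L (lebesgue_on Gam) (\<lambda>y. w x y * P y))"
    have wmeas: "(\<lambda>z. w (fst z) (snd z)) \<in> borel_measurable borel"
        unfolding w_def
      proof (intro borel_measurable_sum borel_measurable_times)
        fix i assume "i \<in> {..<N m}"
        then have i: "i < N m" by simp
        have "(\<lambda>y. indicator Gam y *\<^sub>R r m i y) \<in> borel_measurable borel"
          by (rule borel_measurable_continuous_on_indicator[OF _ rc[OF i]]) (rule borel_closed[OF compact_imp_closed[OF compact_Gam]])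
        moreover have "(snd :: (real^'n) \<times> (real^'d) \<Rightarrow> _) \<in> borel_measurable borel"
          by (intro borel_measurable_continuous_onI continuous_intros)
        ultimately show "(\<lambda>z :: (real^'n) \<times> (real^'d). indicator Gam (snd z) *\<^sub>R r m i (snd z)) \<in> borel_measurable borel"
          by (rule measurable_compose[rotated])
        have "continuous_on UNIV (\<lambda>z :: (real^'n) \<times> (real^'d). \<phi> m i (fst z))"
          by (rule continuous_on_compose2[OF test_funs_continuous[OF \<phi>[OF i], of UNIV]]) (auto intro: continuous_intros)
        then show "(\<lambda>z :: (real^'n) \<times> (real^'d). \<phi> m i (fst z)) \<in> borel_measurable borel"
          by (rule borel_measurable_continuous_onI)
      qed
    have wbd: "\<exists>B. \<forall>y\<in>Gam. \<bar>w x y\<bar> \<le> B" for x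
      proof -
        have "continuous_on Gam (\<lambda>y. W m y x)" unfolding W_def by (intro continuous_intros rc) auto
        then have "bounded ((\<lambda>y. W m y x) ` Gam)" by (intro compact_imp_bounded compact_continuous_image compact_Gam)
        then show ?thesis by (auto simp: bounded_iff wW)
      qed
    have wclose: "(\<lambda>x. u x y - w x y) \<in> L2 D" "L2_norm D (\<lambda>x. u x y - w x y) \<le> CP * (1/2) ^ m" if y: "y \<in> Gam" for y
    proof -
      have u10: "(\<lambda>x. u x y) \<in> H10 D" using uw[OF y] by (simp add: weak_solution_def)
      have d10: "(\<lambda>x. 1 * u x y + (-1) * W m y x) \<in> H10 D"
        by (intro H10_lincomb D u10 test_funs_H10 W)
      show "(\<lambda>x. u x y - w x y) \<in> L2 D"
        using H1_L2[OF H10_H1[OF d10]] by (simp add: wW[OF y])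
      have "L2_norm D (\<lambda>x. u x y - w x y) \<le> CP * V_norm D (\<lambda>x. u x y - W m y x)"
        using CP(2)[OF d10] by (simp add: wW[OF y])
      also have "\<dots> \<le> CP * (1/2) ^ m" by (rule mult_left_mono[OF Wb[OF y] CP(1)])
      finally show "L2_norm D (\<lambda>x. u x y - w x y) \<le> CP * (1/2) ^ m" .
    qed
    have "0 \<le> CP * (1/2) ^ m" using CP(1) by simp
    note pil = parameter_integral_L2[OF D(1) um compact_Gam Pc wmeas wbd wclose this]
    have dL: "d \<in> L2 D" "L2_norm D d \<le> CF * (CP * (1/2) ^ m)"
      unfolding d_def CF_def using pil by auto
    have eq: "legendre_coeff u k x - U m x = \<kappa> * d x" for x
    proof -
      have "integral\<^sup>L (lebesgue_on Gam) (\<lambda>y. w x y * P y) = integral\<^sup>L MG (\<lambda>y. \<Sum>i<N m. (r m i y * P y) * \<phi> m i x)"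
        unfolding MG_def
        by (rule Bochner_Integration.integral_cong[OF refl])
           (simp add: space_restrict_space wW W_def sum_distrib_left mult_ac)
      also have "\<dots> = (\<Sum>i<N m. integral\<^sup>L MG (\<lambda>y. (r m i y * P y) * \<phi> m i x))"
        by (intro Bochner_Integration.integral_sum integrable_mult_left rPi) auto
      also have "\<dots> = (\<Sum>i<N m. integral\<^sup>L MG (\<lambda>y. r m i y * P y) * \<phi> m i x)"
        by (simp only: integral_mult_left_zero)
      finally have Ix: "integral\<^sup>L (lebesgue_on Gam) (\<lambda>y. w x y * P y) = (\<Sum>i<N m. integral\<^sup>L MG (\<lambda>y. r m i y * P y) * \<phi> m i x)" .
      have "\<kappa> * integral\<^sup>L (lebesgue_on Gam) (\<lambda>y. w x y * P y) = U m x"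
        unfolding Ix U_def \<gamma>_def by (simp add: sum_distrib_left mult_ac)
      then show ?thesis
        by (simp add: d_def right_diff_distrib legendre_coeff_def \<kappa>_def P_def)
    qed
    have "(\<lambda>x. \<kappa> *\<^sub>R d x) \<in> L2 D" using sq_integrable_scaleR[of d "lebesgue_on D" \<kappa>] dL(1) by (simp add: L2_eq_sq_integrable)
    moreover have "L2_norm D (\<lambda>x. \<kappa> *\<^sub>R d x) = \<kappa> * L2_norm D d"
      unfolding L2_norm_eq_sq_norm sq_norm_scaleR using \<kappa> by simp
    ultimately show ?thesis
      using mult_left_mono[OF dL(2), of \<kappa>] \<kappa> unfolding eq by simp
  qed
  have vL: "legendre_coeff u k \<in> L2 D"
    using L2_lincomb[OF L[THEN conjunct1, of 0] H1_L2[OF U1[of 0]], of 1 1] by simp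
  have lim: "(\<lambda>m. L2_norm D (\<lambda>x. legendre_coeff u k x - U m x)) \<longlonglongrightarrow> 0"
  proof (rule tendsto_sandwich[OF _ _ tendsto_const])
    have "(\<lambda>m. \<kappa> * (CF * (CP * (1/2 :: real) ^ m))) \<longlonglongrightarrow> \<kappa> * (CF * (CP * 0))"
      by (intro tendsto_intros LIMSEQ_power_zero) simp
    then show "(\<lambda>m. \<kappa> * (CF * (CP * (1/2 :: real) ^ m))) \<longlonglongrightarrow> 0" by simp
  qed (use L in auto)
  show "legendre_coeff u k \<in> H10 D" "V_norm D (legendre_coeff u k) \<le> B"
    by (rule H10_limit[OF D vL U lim diff VB])+
qed

text \<open>Membership in \<open>H10 D\<close> accompanies each bound because \<open>V_norm\<close>
  is defined through a choice of weak gradient and has its meaning for functions that possess one.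
  The second kind of coefficient is a rescaling of the first, so its bound follows with the
  numerical factor of \<open>normalization_factor_le\<close>.\<close>

theorem proposition6p2:
  fixes D :: "(real^'n) set"
    and f :: "(real^'n \<Rightarrow> real) \<Rightarrow> real"
    and a :: "real^'n \<Rightarrow> real^'d \<Rightarrow> real"
    and ac :: "real^'n \<Rightarrow> complex^'d \<Rightarrow> complex"
    and u :: "real^'n \<Rightarrow> real^'d \<Rightarrow> real"
    and \<rho> :: "real^'d"
    and amin amax \<delta> :: real
  assumes dim: "CARD('n) \<in> {1, 2, 3}"
    and D: "bounded_lipschitz_domain D"
    and f: "f \<in> V_dual D"
    and aminmax: "0 < amin" "amin < amax"
    and a_bounds: "\<And>x y. x \<in> closure D \<Longrightarrow> y \<in> Gam \<Longrightarrow> amin \<le> a x y \<and> a x y \<le> amax"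
    and ac_continues: "\<And>x y. x \<in> closure D \<Longrightarrow> y \<in> Gam \<Longrightarrow>
      ac x (\<chi> j. complex_of_real (y $ j)) = complex_of_real (a x y)"
    and ac_holo: "Linf_holomorphic D ac"
    and delta: "0 < \<delta>" "\<delta> < amin"
    and rho: "\<And>j. 1 < \<rho> $ j"
    and ac_coercive: "\<And>x z. x \<in> closure D \<Longrightarrow> z \<in> bernstein_polyellipse \<rho> \<Longrightarrow> \<delta> \<le> Re (ac x z)"
    and u: "parametric_solution D a f u"
  shows "\<forall>k :: 'd \<Rightarrow> nat.
      legendre_coeff u k \<in> H10 D \<and>
      V_norm D (legendre_coeff u k)
        \<le> C_hat D f \<delta> \<rho> k * rho_pow \<rho> k * (\<Prod>j\<in>{j. k j \<noteq> 0}. sqrt (real (k j))) \<and>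
      legendre_on_coeff u k \<in> H10 D \<and>
      V_norm D (legendre_on_coeff u k)
        \<le> C_hat D f \<delta> \<rho> k * 2 powr (real (zero_count k) / 2) * rho_pow \<rho> k"
proof
  fix k :: "'d \<Rightarrow> nat"
  have D': "open D" "bounded D" using D by (simp_all add: bounded_lipschitz_domain_def)
  define S where "S = (\<Prod>j\<in>{j. k j \<noteq> 0}. sqrt (real (k j)))"
  define A where "A = C_hat D f \<delta> \<rho> k * rho_pow \<rho> k"
  define q where "q = (\<Prod>j\<in>UNIV. 1 / sqrt (real (k j) + 1/2))"
  have H: "legendre_coeff u k \<in> H10 D" and V: "V_norm D (legendre_coeff u k) \<le> A * S"
    unfolding A_def S_def C_hat_eq
    by (rule legendre_coeff_in_H10[OF D' f aminmax _ _ ac_holo delta(1) rho _ u];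
        use a_bounds ac_continues ac_coercive closure_subset[of D] in \<open>auto simp: vec_of_real_def\<close>)+
  have S: "0 < S" unfolding S_def by (intro prod_pos) auto
  have q: "0 \<le> q" unfolding q_def by (intro prod_nonneg) auto
  \<comment> \<open>Read off from the bound itself, since a norm is nonnegative and S is
    positive.\<close>
  have A: "0 \<le> A"
    using order_trans[OF V_norm_nonneg V] S by (simp add: zero_le_mult_iff)
  have eq: "legendre_on_coeff u k = (\<lambda>x. q * legendre_coeff u k x)"
    unfolding q_def by (rule ext) (rule legendre_on_coeff_eq)
  have "V_norm D (legendre_on_coeff u k) = q * V_norm D (legendre_coeff u k)"
    unfolding eq V_norm_scale[OF D' H10_H1[OF H]] using q by simp
  also have "\<dots> \<le> q * (A * S)" by (rule mult_left_mono[OF V q])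
  also have "\<dots> = A * (q * S)" by (simp add: mult_ac)
  also have "\<dots> \<le> A * 2 powr (real (zero_count k) / 2)"
    unfolding q_def S_def by (rule mult_left_mono[OF normalization_factor_le A])
  finally have "V_norm D (legendre_on_coeff u k) \<le> A * 2 powr (real (zero_count k) / 2)" .
  moreover have "legendre_on_coeff u k \<in> H10 D" unfolding eq by (rule H10_scale[OF D' H])
  ultimately show "legendre_coeff u k \<in> H10 D \<and>
      V_norm D (legendre_coeff u k)
        \<le> C_hat D f \<delta> \<rho> k * rho_pow \<rho> k * (\<Prod>j\<in>{j. k j \<noteq> 0}. sqrt (real (k j))) \<and>
      legendre_on_coeff u k \<in> H10 D \<and>
      V_norm D (legendre_on_coeff u k)
        \<le> C_hat D f \<delta> \<rho> k * 2 powr (real (zero_count k) / 2) * rho_pow \<rho> k"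
    using H V by (simp add: A_def S_def mult_ac)
qed

end
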